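(* Let $B$ be a unital $C^*$-algebra and let $A \subseteq B$ be a norm closed subalgebra with $1_B \in A$. Let $q$ be a closed projection in $B^{**}$, and set $B_0 = \{ b \in B : bq = qb \}$ and $A_0 = A \cap B_0$. The following are equivalent: (i) $q B_0 \subset A_0^{\perp\perp}$. (ii) $A_0^{\perp} \subset (q B_0)_\perp$ (or equivalently $A_0^\perp \subset (q B_0^{**})_\perp$). (iii) If $b \in B_0$ and $q b^* b q \leq q d$ for an invertible positive $d \in B$ which commutes with $q$, then there exists an element $a \in A$ with $aq = qa = bq$ and $a^* a \leq d$. (iv) $q$ is $A_0$-null, that is, if $\varphi \in A_0^\perp$ then $|\varphi|(q) = 0$. If these conditions all hold, then $q$ is a $p$-projection for $A$ (or equivalently $q \in A^{\perp\perp}$, or equivalently $q$ is $A$-closed), $q A_0$ is a $C^*$-algebra, and we also have (v) $q B_0 = q A_0$. (vi) If $b \in B_0$ and $\| bq \| \leq 1$ then there exists an element $a \in \mathrm{Ball}(A)$ with $aq = qa = bq$. Moreover, (vi) implies (v). If $q$ is a $p$-projection for $A$ then items (i)--(vi) are all equivalent.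
   Context: $B^{**}$ is the bidual of $B$, a von Neumann algebra containing $B$; products such as $qb$ and inequalities between elements of $B$ and $q$ are taken in $B^{**}$. Projections are orthogonal (self-adjoint) projections. A projection in $B^{**}$ is open if it is the weak* limit of an increasing net of positive elements of $B$; a projection $q\in B^{**}$ is closed if $1-q$ is open. For a subspace $X$ of a Banach space $Y$, $X^\perp \subset Y^*$ is its annihilator, and $X^{\perp\perp} = (X^\perp)^\perp \subset Y^{**}$ is the weak* closure of $X$ in $Y^{**}$, identified with $X^{**}$; in particular $B_0^{**}$ is identified with $B_0^{\perp\perp} \subset B^{**}$, and $A^{**}$ with $A^{\perp\perp}\subset B^{**}$. For a subset $Z \subset Y^{**}$, $Z_\perp = \{\varphi \in Y^* : z(\varphi) = 0 \text{ for all } z \in Z\}$. $B_0$ is a unital $C^*$-subalgebra of $B$ and $q \in B_0^{\perp\perp} = B_0^{**}$. In (ii) and (iv), $A_0^\perp$ denotes the annihilator of $A_0$ in $B_0^*$, and $(qB_0)_\perp$, $(qB_0^{**})_\perp$ are pre-annihilators in $B_0^*$. In (i), $A_0^{\perp\perp}$ is the weak* closure of $A_0$ in $B_0^{**} \subset B^{**}$. For $\varphi \in B_0^*$, $|\varphi|$ is the positive functional in the polar decomposition $\varphi = u|\varphi|$, i.e. the (unique) positive functional such that $\varphi(x) = |\varphi|(xu)$ and $|\varphi|(x) = \varphi(xu^* )$ for $x \in B_0^{**}$, where $u \in B_0^{**}$ is a partial isometry with $u^*u$ equal to the support projection of $|\varphi|$ (functionals being extended to normal functionals on $B_0^{**}$).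 A projection $p \in A^{**}$ is $A$-open if there is a net $(x_t)$ in $A \cap pA^{**}p$ with $x_t \to p$ weak*; a projection $q \in A^{**}$ is $A$-closed if $1-q$ is $A$-open. The $p$-projections for $A$ are the closed projections in $B^{**}$ that lie in $A^{\perp\perp}$. $\mathrm{Ball}(A)$ is the closed unit ball of $A$. *)

theory Defs
  imports "HOL-Analysis.Analysis"
begin

section \<open>Unital C*-algebras\<close>

class unital_cstar_algebra = real_normed_algebra_1 + banach +
  fixes scaleC :: "complex \<Rightarrow> 'a \<Rightarrow> 'a"  (infixr "*\<^sub>C" 75)
    and star :: "'a \<Rightarrow> 'a"
  assumes scaleC_add_right: "c *\<^sub>C (x + y) = c *\<^sub>C x + c *\<^sub>C y"
    and scaleC_add_left: "(c + d) *\<^sub>C x = c *\<^sub>C x + d *\<^sub>C x"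
    and scaleC_scaleC: "c *\<^sub>C d *\<^sub>C x = (c * d) *\<^sub>C x"
    and scaleR_scaleC: "scaleR r x = complex_of_real r *\<^sub>C x"
    and mult_scaleC_left: "(c *\<^sub>C x) * y = c *\<^sub>C (x * y)"
    and mult_scaleC_right: "x * (c *\<^sub>C y) = c *\<^sub>C (x * y)"
    and norm_scaleC: "norm (c *\<^sub>C x) = cmod c * norm x"
    and star_star: "star (star x) = x"
    and star_add: "star (x + y) = star x + star y"
    and star_scaleC: "star (c *\<^sub>C x) = cnj c *\<^sub>C star x"
    and star_mult: "star (x * y) = star y * star x"
    and cstar_identity: "norm (star x * x) = (norm x)\<^sup>2"

definition complex_subalgebra :: "'b::unital_cstar_algebra set \<Rightarrow> bool" where
  "complex_subalgebra A \<longleftrightarrow>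
     0 \<in> A \<and> (\<forall>x\<in>A. \<forall>y\<in>A. x + y \<in> A) \<and> (\<forall>c. \<forall>x\<in>A. c *\<^sub>C x \<in> A) \<and>
     (\<forall>x\<in>A. \<forall>y\<in>A. x * y \<in> A)"

definition cstar_positive :: "'b::unital_cstar_algebra \<Rightarrow> bool" where
  "cstar_positive x \<longleftrightarrow> (\<exists>y. x = star y * y)"

definition cstar_le :: "'b::unital_cstar_algebra \<Rightarrow> 'b \<Rightarrow> bool" where
  "cstar_le x y \<longleftrightarrow> cstar_positive (y - x)"

definition cstar_invertible :: "'b::unital_cstar_algebra \<Rightarrow> bool" where
  "cstar_invertible x \<longleftrightarrow> (\<exists>y. x * y = 1 \<and> y * x = 1)"


section \<open>Duals and biduals of subspaces\<close>

text \<open>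
  Everything is relative to a subspace \<open>S\<close> of the ambient algebra, so that the dual and bidual
  of the whole algebra (\<open>S = UNIV\<close>) and of a C*-subalgebra are instances of the same notions.
  Functionals are total functions that vanish outside of their domain, which makes the dual
  and the bidual vector spaces under the pointwise operations.
\<close>

type_synonym 'b functional = "'b \<Rightarrow> complex"
type_synonym 'b bifunctional = "'b functional \<Rightarrow> complex"

definition dual :: "'b::unital_cstar_algebra set \<Rightarrow> 'b functional set" where
  "dual S = {\<phi>. (\<forall>x\<in>S. \<forall>y\<in>S. \<phi> (x + y) = \<phi> x + \<phi> y) \<and>
                (\<forall>c. \<forall>x\<in>S. \<phi> (c *\<^sub>C x) = c * \<phi> x) \<and>
                (\<exists>K. \<forall>x\<in>S. cmod (\<phi> x) \<le> K * norm x) \<and>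
                (\<forall>x. x \<notin> S \<longrightarrow> \<phi> x = 0)}"

definition dual_norm :: "'b::unital_cstar_algebra set \<Rightarrow> 'b functional \<Rightarrow> real" where
  "dual_norm S \<phi> = Sup {cmod (\<phi> x) | x. x \<in> S \<and> norm x \<le> 1}"

definition bidual :: "'b::unital_cstar_algebra set \<Rightarrow> 'b bifunctional set" where
  "bidual S = {\<eta>. (\<forall>\<phi>\<in>dual S. \<forall>\<psi>\<in>dual S. \<eta> (\<lambda>x. \<phi> x + \<psi> x) = \<eta> \<phi> + \<eta> \<psi>) \<and>
                  (\<forall>c. \<forall>\<phi>\<in>dual S. \<eta> (\<lambda>x. c * \<phi> x) = c * \<eta> \<phi>) \<and>
                  (\<exists>K. \<forall>\<phi>\<in>dual S. cmod (\<eta> \<phi>) \<le> K * dual_norm S \<phi>) \<and>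
                  (\<forall>\<phi>. \<phi> \<notin> dual S \<longrightarrow> \<eta> \<phi> = 0)}"

definition bidual_norm :: "'b::unital_cstar_algebra set \<Rightarrow> 'b bifunctional \<Rightarrow> real" where
  "bidual_norm S \<eta> = Sup {cmod (\<eta> \<phi>) | \<phi>. \<phi> \<in> dual S \<and> dual_norm S \<phi> \<le> 1}"

definition canon :: "'b::unital_cstar_algebra set \<Rightarrow> 'b \<Rightarrow> 'b bifunctional" where
  "canon S b = (\<lambda>\<phi>. if \<phi> \<in> dual S then \<phi> b else 0)"

definition annihilator :: "'b::unital_cstar_algebra set \<Rightarrow> 'b set \<Rightarrow> 'b functional set" where
  "annihilator S X = {\<phi> \<in> dual S. \<forall>x\<in>X. \<phi> x = 0}"

definition biannihilator :: "'b::unital_cstar_algebra set \<Rightarrow> 'b set \<Rightarrow> 'b bifunctional set" where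
  "biannihilator S X = {\<eta> \<in> bidual S. \<forall>\<phi>\<in>annihilator S X. \<eta> \<phi> = 0}"

definition preannihilator ::
    "'b::unital_cstar_algebra set \<Rightarrow> 'b bifunctional set \<Rightarrow> 'b functional set" where
  "preannihilator S Z = {\<phi> \<in> dual S. \<forall>\<eta>\<in>Z. \<eta> \<phi> = 0}"

text \<open>
  For a subspace \<open>S\<close>, \<open>bidual_incl S\<close> is the second adjoint of the inclusion of \<open>S\<close> into the
  ambient algebra; it identifies the bidual of \<open>S\<close> with \<open>biannihilator UNIV S\<close>.
  \<open>bidual_pull S\<close> is the inverse identification.
\<close>

definition restrict_functional :: "'b set \<Rightarrow> 'b functional \<Rightarrow> 'b functional" where
  "restrict_functional S \<phi> = (\<lambda>x. if x \<in> S then \<phi> x else 0)"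

definition bidual_incl :: "'b::unital_cstar_algebra set \<Rightarrow> 'b bifunctional \<Rightarrow> 'b bifunctional" where
  "bidual_incl S \<eta> = (\<lambda>\<phi>. if \<phi> \<in> dual UNIV then \<eta> (restrict_functional S \<phi>) else 0)"

definition bidual_pull :: "'b::unital_cstar_algebra set \<Rightarrow> 'b bifunctional \<Rightarrow> 'b bifunctional" where
  "bidual_pull S = inv_into (bidual S) (bidual_incl S)"


section \<open>The bidual as a von Neumann algebra\<close>

text \<open>
  The product is the (first) Arens product
  \<open>(\<eta> \<theta>)(\<phi>) = \<eta>(\<theta> \<phi>)\<close>, where \<open>(\<theta> \<phi>)(a) = \<theta>(\<phi> a)\<close> and \<open>(\<phi> a)(x) = \<phi>(a x)\<close>;
  for C*-algebras it is the product of the enveloping von Neumann algebra.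
\<close>

definition arens :: "'b::unital_cstar_algebra set \<Rightarrow> 'b bifunctional \<Rightarrow> 'b bifunctional
    \<Rightarrow> 'b bifunctional" where
  "arens S \<eta> \<theta> = (\<lambda>\<phi>. if \<phi> \<in> dual S
      then \<eta> (\<lambda>a. if a \<in> S then \<theta> (\<lambda>x. if x \<in> S then \<phi> (a * x) else 0) else 0)
      else 0)"

definition bidual_star :: "'b::unital_cstar_algebra bifunctional \<Rightarrow> 'b bifunctional" where
  "bidual_star \<eta> = (\<lambda>\<phi>. cnj (\<eta> (\<lambda>x. cnj (\<phi> (star x)))))"

definition bidual_projection :: "'b::unital_cstar_algebra set \<Rightarrow> 'b bifunctional \<Rightarrow> bool" where
  "bidual_projection S p \<longleftrightarrow> p \<in> bidual S \<and> arens S p p = p \<and> bidual_star p = p"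

definition bidual_positive :: "'b::unital_cstar_algebra set \<Rightarrow> 'b bifunctional \<Rightarrow> bool" where
  "bidual_positive S \<eta> \<longleftrightarrow> (\<exists>\<theta>\<in>bidual S. \<eta> = arens S (bidual_star \<theta>) \<theta>)"

definition bidual_le ::
    "'b::unital_cstar_algebra set \<Rightarrow> 'b bifunctional \<Rightarrow> 'b bifunctional \<Rightarrow> bool" where
  "bidual_le S \<eta> \<theta> \<longleftrightarrow> bidual_positive S (\<lambda>\<phi>. \<theta> \<phi> - \<eta> \<phi>)"

text \<open>Norm-closed *-subalgebras of the bidual of the whole algebra, not necessarily containing
  its unit.\<close>

definition bidual_cstar_subalgebra :: "'b::unital_cstar_algebra bifunctional set \<Rightarrow> bool" where
  "bidual_cstar_subalgebra Z \<longleftrightarrow>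
     Z \<subseteq> bidual UNIV \<and> (\<lambda>_. 0) \<in> Z \<and>
     (\<forall>\<eta>\<in>Z. \<forall>\<theta>\<in>Z. (\<lambda>\<phi>. \<eta> \<phi> + \<theta> \<phi>) \<in> Z) \<and>
     (\<forall>c. \<forall>\<eta>\<in>Z. (\<lambda>\<phi>. c * \<eta> \<phi>) \<in> Z) \<and>
     (\<forall>\<eta>\<in>Z. \<forall>\<theta>\<in>Z. arens UNIV \<eta> \<theta> \<in> Z) \<and>
     (\<forall>\<eta>\<in>Z. bidual_star \<eta> \<in> Z) \<and>
     (\<forall>\<zeta> \<eta>. (\<forall>n::nat. \<zeta> n \<in> Z) \<and> \<eta> \<in> bidual UNIV \<and>
        (\<lambda>n. bidual_norm UNIV (\<lambda>\<phi>. \<zeta> n \<phi> - \<eta> \<phi>)) \<longlonglongrightarrow> 0 \<longrightarrow> \<eta> \<in> Z)"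


section \<open>Absolute values of functionals\<close>

definition positive_functional :: "'b::unital_cstar_algebra set \<Rightarrow> 'b functional \<Rightarrow> bool" where
  "positive_functional S \<psi> \<longleftrightarrow> \<psi> \<in> dual S \<and> (\<forall>x\<in>S. \<psi> (star x * x) \<in> \<real>\<^sub>\<ge>\<^sub>0)"

text \<open>
  The normal extension of \<open>\<psi> \<in> dual S\<close> to the bidual is evaluation \<open>\<eta> \<mapsto> \<eta> \<psi>\<close>. The support
  projection of a positive \<open>\<psi>\<close> is the smallest projection on which it takes its full mass.
\<close>

definition support_projection ::
    "'b::unital_cstar_algebra set \<Rightarrow> 'b functional \<Rightarrow> 'b bifunctional \<Rightarrow> bool" where
  "support_projection S \<psi> s \<longleftrightarrow>
     bidual_projection S s \<and> s \<psi> = canon S 1 \<psi> \<and>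
     (\<forall>e. bidual_projection S e \<and> e \<psi> = canon S 1 \<psi> \<longrightarrow> bidual_le S s e)"

definition is_abs_functional ::
    "'b::unital_cstar_algebra set \<Rightarrow> 'b functional \<Rightarrow> 'b functional \<Rightarrow> bool" where
  "is_abs_functional S \<phi> \<psi> \<longleftrightarrow> positive_functional S \<psi> \<and>
     (\<exists>u\<in>bidual S. arens S (arens S u (bidual_star u)) u = u \<and>
        support_projection S \<psi> (arens S (bidual_star u) u) \<and>
        (\<forall>x\<in>bidual S. x \<phi> = arens S x u \<psi> \<and> x \<psi> = arens S x (bidual_star u) \<phi>))"

definition abs_functional :: "'b::unital_cstar_algebra set \<Rightarrow> 'b functional \<Rightarrow> 'b functional" where
  "abs_functional S \<phi> = (THE \<psi>. is_abs_functional S \<phi> \<psi>)"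


section \<open>Nets, open and closed projections\<close>

definition directed_index :: "'i set \<Rightarrow> ('i \<Rightarrow> 'i \<Rightarrow> bool) \<Rightarrow> bool" where
  "directed_index I r \<longleftrightarrow> I \<noteq> {} \<and> reflp_on I r \<and> transp_on I r \<and>
     (\<forall>i\<in>I. \<forall>j\<in>I. \<exists>k\<in>I. r i k \<and> r j k)"

definition net_filter :: "'i set \<Rightarrow> ('i \<Rightarrow> 'i \<Rightarrow> bool) \<Rightarrow> 'i filter" where
  "net_filter I r = (INF i\<in>I. principal {j \<in> I. r i j})"

definition weakstar_limit :: "'i set \<Rightarrow> ('i \<Rightarrow> 'i \<Rightarrow> bool) \<Rightarrow> ('i \<Rightarrow> 'b::unital_cstar_algebra)
    \<Rightarrow> 'b bifunctional \<Rightarrow> bool" where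
  "weakstar_limit I r x p \<longleftrightarrow>
     (\<forall>\<phi>\<in>dual UNIV. ((\<lambda>i. \<phi> (x i)) \<longlongrightarrow> p \<phi>) (net_filter I r))"

text \<open>
  HOL cannot quantify over the type of indices of a net, so a type has to be fixed. For increasing
  nets subsets of the algebra suffice: a weak* convergent increasing net can be replaced by its
  range, indexed by itself. For arbitrary nets pairs of a (finite) set of functionals and a natural
  number suffice, because they index a basis of weak* neighbourhoods of a point.
\<close>

definition open_projection :: "'b::unital_cstar_algebra bifunctional \<Rightarrow> bool" where
  "open_projection p \<longleftrightarrow> bidual_projection UNIV p \<and>
     (\<exists>(I :: 'b set) r (x :: 'b \<Rightarrow> 'b). directed_index I r \<and>
        (\<forall>i\<in>I. cstar_positive (x i)) \<and>
        (\<forall>i\<in>I. \<forall>j\<in>I. r i j \<longrightarrow> cstar_le (x i) (x j)) \<and>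
        weakstar_limit I r x p)"

definition closed_projection :: "'b::unital_cstar_algebra bifunctional \<Rightarrow> bool" where
  "closed_projection q \<longleftrightarrow> bidual_projection UNIV q \<and> open_projection (\<lambda>\<phi>. canon UNIV 1 \<phi> - q \<phi>)"

definition A_open :: "'b::unital_cstar_algebra set \<Rightarrow> 'b bifunctional \<Rightarrow> bool" where
  "A_open A p \<longleftrightarrow> bidual_projection UNIV p \<and> p \<in> biannihilator UNIV A \<and>
     (\<exists>(I :: ('b functional set \<times> nat) set) r x. directed_index I r \<and>
        (\<forall>i\<in>I. x i \<in> A \<and>
           (\<exists>\<eta>\<in>biannihilator UNIV A. canon UNIV (x i) = arens UNIV (arens UNIV p \<eta>) p)) \<and>
        weakstar_limit I r x p)"

definition A_closed :: "'b::unital_cstar_algebra set \<Rightarrow> 'b bifunctional \<Rightarrow> bool" where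
  "A_closed A q \<longleftrightarrow> bidual_projection UNIV q \<and> q \<in> biannihilator UNIV A \<and>
     A_open A (\<lambda>\<phi>. canon UNIV 1 \<phi> - q \<phi>)"

definition p_projection :: "'b::unital_cstar_algebra set \<Rightarrow> 'b bifunctional \<Rightarrow> bool" where
  "p_projection A q \<longleftrightarrow> closed_projection q \<and> q \<in> biannihilator UNIV A"


section \<open>The conditions\<close>

text \<open>\<open>\<iota> b\<close> is \<open>b\<close> viewed in the bidual of the whole algebra, and \<open>\<odot>\<close> is the product there.\<close>

abbreviation canon_UNIV :: "'b::unital_cstar_algebra \<Rightarrow> 'b bifunctional"  ("\<iota>") where
  "\<iota> \<equiv> canon UNIV"

abbreviation arens_UNIV :: "'b::unital_cstar_algebra bifunctional \<Rightarrow> 'b bifunctional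
    \<Rightarrow> 'b bifunctional"  (infixl "\<odot>" 70) where
  "\<eta> \<odot> \<theta> \<equiv> arens UNIV \<eta> \<theta>"

definition B0 :: "'b::unital_cstar_algebra bifunctional \<Rightarrow> 'b set" where
  "B0 q = {b. \<iota> b \<odot> q = q \<odot> \<iota> b}"

definition A0 :: "'b::unital_cstar_algebra set \<Rightarrow> 'b bifunctional \<Rightarrow> 'b set" where
  "A0 A q = A \<inter> B0 q"

text \<open>The closed projection \<open>q\<close>, which belongs to \<open>biannihilator UNIV (B0 q)\<close>, viewed as an
  element of the bidual of \<open>B0 q\<close>.\<close>

definition q0 :: "'b::unital_cstar_algebra bifunctional \<Rightarrow> 'b bifunctional" where
  "q0 q = bidual_pull (B0 q) q"

definition cond_i :: "'b::unital_cstar_algebra set \<Rightarrow> 'b bifunctional \<Rightarrow> bool" where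
  "cond_i A q \<longleftrightarrow>
     {q \<odot> \<iota> b | b. b \<in> B0 q} \<subseteq> bidual_incl (B0 q) ` biannihilator (B0 q) (A0 A q)"

definition cond_ii :: "'b::unital_cstar_algebra set \<Rightarrow> 'b bifunctional \<Rightarrow> bool" where
  "cond_ii A q \<longleftrightarrow> annihilator (B0 q) (A0 A q)
     \<subseteq> preannihilator (B0 q) {arens (B0 q) (q0 q) (canon (B0 q) b) | b. b \<in> B0 q}"

definition cond_ii' :: "'b::unital_cstar_algebra set \<Rightarrow> 'b bifunctional \<Rightarrow> bool" where
  "cond_ii' A q \<longleftrightarrow> annihilator (B0 q) (A0 A q)
     \<subseteq> preannihilator (B0 q) {arens (B0 q) (q0 q) \<eta> | \<eta>. \<eta> \<in> bidual (B0 q)}"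

definition cond_iii :: "'b::unital_cstar_algebra set \<Rightarrow> 'b bifunctional \<Rightarrow> bool" where
  "cond_iii A q \<longleftrightarrow>
     (\<forall>b d. b \<in> B0 q \<and> cstar_invertible d \<and> cstar_positive d \<and> \<iota> d \<odot> q = q \<odot> \<iota> d \<and>
        bidual_le UNIV (q \<odot> \<iota> (star b) \<odot> \<iota> b \<odot> q) (q \<odot> \<iota> d) \<longrightarrow>
        (\<exists>a\<in>A. \<iota> a \<odot> q = q \<odot> \<iota> a \<and> q \<odot> \<iota> a = \<iota> b \<odot> q \<and> cstar_le (star a * a) d))"

definition cond_iv :: "'b::unital_cstar_algebra set \<Rightarrow> 'b bifunctional \<Rightarrow> bool" where
  "cond_iv A q \<longleftrightarrow>
     (\<forall>\<phi>\<in>annihilator (B0 q) (A0 A q). q0 q (abs_functional (B0 q) \<phi>) = 0)"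

definition cond_v :: "'b::unital_cstar_algebra set \<Rightarrow> 'b bifunctional \<Rightarrow> bool" where
  "cond_v A q \<longleftrightarrow> {q \<odot> \<iota> b | b. b \<in> B0 q} = {q \<odot> \<iota> a | a. a \<in> A0 A q}"

definition cond_vi :: "'b::unital_cstar_algebra set \<Rightarrow> 'b bifunctional \<Rightarrow> bool" where
  "cond_vi A q \<longleftrightarrow>
     (\<forall>b\<in>B0 q. bidual_norm UNIV (\<iota> b \<odot> q) \<le> 1 \<longrightarrow>
        (\<exists>a\<in>A. norm a \<le> 1 \<and> \<iota> a \<odot> q = q \<odot> \<iota> a \<and> q \<odot> \<iota> a = \<iota> b \<odot> q))"

end

theory Submission
  imports Defs "HOL-Library.Function_Algebras"
begin

text \<open>
  All conditions are compared with a statement \<open>E\<close> about functionals on \<open>B\<close>: if \<open>\<phi>\<close> vanishes on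
  \<open>A\<^sub>0\<close>, then \<open>(q b)(\<phi>) = 0\<close> for \<open>b \<in> B\<^sub>0\<close>. Since \<open>q\<close> is closed, \<open>1 - q\<close> is the weak* limit of an
  approximate unit of \<open>J = {b. b q = q b = 0}\<close>; hence \<open>q\<close> belongs to the bidual of \<open>B\<^sub>0\<close>, and \<open>E\<close> is
  (i) and (ii), while the polar decomposition of functionals turns it into (iv).

  From \<open>E\<close>, an element \<open>c\<close> of \<open>B\<^sub>0\<close> with \<open>\<parallel>q c\<parallel> \<le> 1\<close> is interpolated as follows. If \<open>x\<close> almost
  interpolates it and has almost norm 1, then \<open>q c + (1 - q) x / (1 + \<delta>)\<close> is a contraction in the weak*
  closure of \<open>A\<^sub>0\<close> which is close to \<open>x\<close> and agrees with \<open>c\<close> modulo \<open>J\<close>. By Helly's theorem an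
  element of \<open>A\<^sub>0\<close> nearly has the same properties, and these elements converge rapidly.

  The same method shows that \<open>1 - q\<close> is in the weak* closure of \<open>A \<inter> J\<close> if \<open>q \<in> A\<^sup>\<bottom>\<^sup>\<bottom>\<close>. So \<open>q\<close> is
  \<open>A\<close>-closed, and \<open>q(\<phi>) = 0\<close> if \<open>\<phi>\<close> vanishes on \<open>A\<^sub>0\<close>, which yields \<open>E\<close> from (v).
\<close>

section \<open>C*-algebras\<close>

text \<open>The obstacle is the bidual: its order, adjoint and norm have to be controlled although
  it is given only by the Arens product. Everything is reduced to positive functionals. A functional
  that almost attains its norm at \<open>y\<close> is almost concentrated on
  \<open>star y * y\<close>; in the limit this yields a positive \<open>\<psi>\<close> over which
  \<open>\<phi>\<close> satisfies a Cauchy-Schwarz inequality, so that \<open>\<phi>\<close> has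
  nearly representing vectors in the seminorm of \<open>\<psi>\<close>. Polarisation then shows that
  positive functionals span the dual. Hence identities in the bidual may be tested on them, the two
  Arens products agree, and norm estimates follow from \<open>right_polar\<close> and
  \<open>left_polar\<close>. In the interpolation the factor 1 / (1 + \<delta>) restores an exact
  contraction, because Helly's theorem returns elements only up to a small loss in the norm. One
  element has to meet three demands at once, a small norm, closeness to \<open>x\<close>, and
  closeness to \<open>c\<close> modulo \<open>J\<close>; hence the version of Helly's theorem with
  three seminorms. Statement \<open>E\<close> is \<open>A0_interpolates\<close>.\<close>

lemma scaleC_one [simp]: "1 *\<^sub>C x = (x::'b::unital_cstar_algebra)"
  using scaleR_scaleC[of 1 x] by simp

lemma scaleC_zero [simp]: "0 *\<^sub>C x = (0::'b::unital_cstar_algebra)"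
  using scaleR_scaleC[of 0 x] by simp

lemma scaleC_zero_right [simp]: "c *\<^sub>C 0 = (0::'b::unital_cstar_algebra)"
  using scaleC_add_right[of c 0 "0::'b"] by simp

lemma scaleC_minus_one: "(-1) *\<^sub>C x = - (x::'b::unital_cstar_algebra)"
  using scaleR_scaleC[of "-1" x] by simp

lemma scaleC_minus_right [simp]: "c *\<^sub>C (- x) = - (c *\<^sub>C (x::'b::unital_cstar_algebra))"
  using scaleC_add_right[of c x "-x"] by (simp add: eq_neg_iff_add_eq_0 add.commute)

lemma scaleC_minus_left [simp]: "(- c) *\<^sub>C x = - (c *\<^sub>C (x::'b::unital_cstar_algebra))"
  using scaleC_add_left[of c "-c" x] by (simp add: eq_neg_iff_add_eq_0 add.commute)

lemma scaleC_diff_right: "c *\<^sub>C (x - y) = c *\<^sub>C x - c *\<^sub>C (y::'b::unital_cstar_algebra)"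
  using scaleC_add_right[of c x "-y"] by simp

lemma scaleC_scaleR: "c *\<^sub>C r *\<^sub>R x = r *\<^sub>R c *\<^sub>C (x::'b::unital_cstar_algebra)"
  by (simp add: scaleR_scaleC scaleC_scaleC mult.commute)

lemma star_zero [simp]: "star 0 = (0::'b::unital_cstar_algebra)"
  using star_add[of 0 "0::'b"] by simp

lemma star_minus [simp]: "star (- x) = - star (x::'b::unital_cstar_algebra)"
  using star_add[of x "-x"] by (simp add: eq_neg_iff_add_eq_0 add.commute)

lemma star_diff: "star (x - y) = star x - star (y::'b::unital_cstar_algebra)"
  using star_add[of x "-y"] by simp

lemma star_scaleR [simp]: "star (r *\<^sub>R x) = r *\<^sub>R star (x::'b::unital_cstar_algebra)"
  by (simp add: scaleR_scaleC star_scaleC)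

lemma star_one [simp]: "star 1 = (1::'b::unital_cstar_algebra)"
  using star_mult[of "star (1::'b)" 1] by (simp add: star_star)

lemma norm_star [simp]: "norm (star x) = norm (x::'b::unital_cstar_algebra)"
proof -
  have le: "norm y \<le> norm (star y)" for y :: 'b
  proof (cases "y = 0")
    case False
    have "(norm y)\<^sup>2 \<le> norm (star y) * norm y"
      using norm_mult_ineq[of "star y" y] by (simp add: cstar_identity)
    with False show ?thesis by (simp add: power2_eq_square)
  qed simp
  show ?thesis using le[of x] le[of "star x"] by (simp add: star_star)
qed

lemma cstar_identity': "norm (x * star x) = (norm (x::'b::unital_cstar_algebra))\<^sup>2"
  using cstar_identity[of "star x"] by (simp add: star_star)

lemma bounded_linear_star: "bounded_linear (star :: 'b::unital_cstar_algebra \<Rightarrow> 'b)"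
  by (rule bounded_linear_intro[of _ 1]) (auto simp: star_add)

lemma bounded_linear_scaleC: "bounded_linear (scaleC c :: 'b::unital_cstar_algebra \<Rightarrow> 'b)"
  by (rule bounded_linear_intro[of _ "cmod c"])
     (auto simp: scaleC_add_right norm_scaleC scaleR_scaleC scaleC_scaleC mult.commute)

lemmas tendsto_scaleC = bounded_linear.tendsto[OF bounded_linear_scaleC]

section \<open>Positive elements and their square roots\<close>

lemma norm_selfadjoint_square:
  fixes x :: "'b::unital_cstar_algebra"
  shows "star x = x \<Longrightarrow> norm (x * x) = (norm x)\<^sup>2"
  using cstar_identity[of x] by simp

text \<open>The fixed point iteration for the equation \<open>w = (x + w\<^sup>2) / 2\<close> yields \<open>w = 1 - sqrt (1 - x)\<close>; its
  increments are dominated by those of the same iteration for the number 1.\<close>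

lemma sqrt_iteration:
  fixes x :: "'b::unital_cstar_algebra"
  assumes x: "norm x \<le> 1"
  obtains w where "norm w \<le> 1" "2 *\<^sub>R w = x + w * w"
    "\<And>V. closed V \<Longrightarrow> 0 \<in> V \<Longrightarrow> (\<And>u. u \<in> V \<Longrightarrow> (1/2) *\<^sub>R (x + u * u) \<in> V) \<Longrightarrow> w \<in> V"
proof -
  define W where "W = rec_nat 0 (\<lambda>_ u. (1/2) *\<^sub>R (x + u * u))"
  define om where "om = rec_nat 0 (\<lambda>_ r. (1 + r * r) / 2 :: real)"
  have W0: "W 0 = 0" and WS: "W (Suc n) = (1/2) *\<^sub>R (x + W n * W n)" for n by (simp_all add: W_def)
  have om0: "om 0 = 0" and omS: "om (Suc n) = (1 + om n * om n) / 2" for n by (simp_all add: om_def)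
  have om01: "0 \<le> om n \<and> om n \<le> 1" for n
  proof (induction n)
    case (Suc n)
    then have "om n * om n \<le> 1" by (simp add: mult_le_one)
    with Suc show ?case by (simp add: omS field_simps)
  qed (simp add: om0)
  have inc: "om n \<le> om (Suc n)" for n
    using zero_le_square[of "om n - 1"] by (simp add: omS algebra_simps)
  have nW: "norm (W n) \<le> om n" for n
  proof (induction n)
    case (Suc n)
    have "norm (x + W n * W n) \<le> 1 + om n * om n"
      by (rule norm_triangle_le)
         (meson Suc add_mono mult_mono norm_ge_zero norm_mult_ineq om01 order_trans x)
    then show ?case by (simp add: WS omS)
  qed (simp add: W0 om0)
  have dW: "norm (W (Suc n) - W n) \<le> om (Suc n) - om n" for n
  proof (induction n)
    case 0 show ?case using x by (simp add: WS W0 omS om0)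
  next
    case (Suc n)
    have e2: "om (Suc (Suc n)) = (1 + om (Suc n) * om (Suc n)) / 2" by (rule omS)
    have b: "om n * om n = 2 * om (Suc n) - 1" by (simp add: omS field_simps)
    have e: "W (Suc (Suc n)) - W (Suc n)
        = (1/2) *\<^sub>R (W (Suc n) * (W (Suc n) - W n) + (W (Suc n) - W n) * W n)"
      by (subst (1 2) WS) (simp add: algebra_simps)
    have "norm (W (Suc n) * (W (Suc n) - W n)) \<le> om (Suc n) * (om (Suc n) - om n)"
      by (meson Suc mult_mono norm_ge_zero norm_mult_ineq om01 order_trans nW)
    moreover have "norm ((W (Suc n) - W n) * W n) \<le> (om (Suc n) - om n) * om n"
    proof (rule order_trans[OF norm_mult_ineq mult_mono[OF Suc nW]])
      show "0 \<le> om (Suc n) - om n" using inc[of n] by simp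
    qed simp
    ultimately have "norm (W (Suc (Suc n)) - W (Suc n))
        \<le> (1/2) * (om (Suc n) * (om (Suc n) - om n) + (om (Suc n) - om n) * om n)"
      unfolding e by (simp add: norm_triangle_le)
    also have "\<dots> = om (Suc (Suc n)) - om (Suc n)"
      using e2 b by (simp add: field_simps)
    finally show ?case .
  qed
  have dW2: "norm (W (n + k) - W n) \<le> om (n + k) - om n" for n k
  proof (induction k)
    case (Suc k)
    have "norm (W (Suc (n + k)) - W n) \<le> norm (W (Suc (n + k)) - W (n + k)) + norm (W (n + k) - W n)"
      by (metis diff_add_cancel add_diff_eq norm_triangle_ineq)
    with Suc dW[of "n + k"] show ?case by simp
  qed simp
  have "incseq om" by (rule incseq_SucI) (rule inc)
  then obtain L where "om \<longlonglongrightarrow> L" using incseq_convergent[of om 1] om01 by metis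
  then have "Cauchy om" by (rule LIMSEQ_imp_Cauchy)
  have "Cauchy W"
  proof (rule CauchyI')
    fix e :: real assume "0 < e"
    then obtain M where M: "\<And>m n. m \<ge> M \<Longrightarrow> n \<ge> M \<Longrightarrow> norm (om m - om n) < e"
      using CauchyD[OF \<open>Cauchy om\<close>] by blast
    have "norm (W m - W n) < e" if "m \<ge> M" "n > m" for m n
    proof -
      have "norm (W n - W m) \<le> om n - om m" using dW2[of m "n - m"] that by simp
      also have "\<dots> < e" using M[of n m] that by simp
      finally show ?thesis by (simp add: norm_minus_commute)
    qed
    then show "\<exists>M. \<forall>m\<ge>M. \<forall>n>m. dist (W m) (W n) < e" unfolding dist_norm by blast
  qed
  then obtain w where w: "W \<longlonglongrightarrow> w" using Cauchy_convergent convergent_def by blast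
  show thesis
  proof
    show "norm w \<le> 1"
      by (rule LIMSEQ_le_const2[OF tendsto_norm[OF w]]) (meson nW om01 order_trans)
    have "(\<lambda>n. W (Suc n)) \<longlonglongrightarrow> (1/2) *\<^sub>R (x + w * w)"
      unfolding WS by (intro tendsto_intros w)
    moreover have "(\<lambda>n. W (Suc n)) \<longlonglongrightarrow> w" using w by (rule LIMSEQ_Suc)
    ultimately have "w = (1/2) *\<^sub>R (x + w * w)" using LIMSEQ_unique by blast
    then show "2 *\<^sub>R w = x + w * w"
      by (metis divideR_right zero_neq_numeral inverse_eq_divide)
    fix V :: "'b set"
    assume V: "closed V" "0 \<in> V" "\<And>u. u \<in> V \<Longrightarrow> (1/2) *\<^sub>R (x + u * u) \<in> V"
    have "W n \<in> V" for n by (induction n) (use V in \<open>auto simp: W0 WS\<close>)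
    with V(1) w show "w \<in> V" using closed_sequentially by blast
  qed
qed

text \<open>For a self-adjoint \<open>h\<close> the bound says that the spectrum lies between 0 and
  2 t. Sums and square roots are accessible in this form, whereas it takes
  \<open>cpos_star_mult\<close> to see that every \<open>star x * x\<close> has it; only then do
  \<open>cpos\<close> and \<open>cstar_positive\<close> agree.\<close>

definition cpos :: "'b::unital_cstar_algebra \<Rightarrow> bool" where
  "cpos h \<longleftrightarrow> star h = h \<and> (\<exists>t. norm (t *\<^sub>R 1 - h) \<le> t)"

lemma cpos_selfadjoint: "cpos h \<Longrightarrow> star h = h"
  by (simp add: cpos_def)

lemma cpos_add: assumes "cpos a" "cpos b" shows "cpos (a + b)"
proof -
  obtain s t where "norm (s *\<^sub>R 1 - a) \<le> s" "norm (t *\<^sub>R 1 - b) \<le> t"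
    using assms by (auto simp: cpos_def)
  then have "norm ((s *\<^sub>R 1 - a) + (t *\<^sub>R 1 - b)) \<le> s + t" by (meson add_mono norm_triangle_le)
  then have "norm ((s + t) *\<^sub>R 1 - (a + b)) \<le> s + t" by (simp add: algebra_simps)
  with assms show ?thesis by (auto simp: cpos_def star_add)
qed

lemma cpos_scaleR: assumes "cpos a" "0 \<le> r" shows "cpos (r *\<^sub>R a)"
proof -
  obtain s where "norm (s *\<^sub>R 1 - a) \<le> s" using assms by (auto simp: cpos_def)
  then have "norm (r *\<^sub>R (s *\<^sub>R 1 - a)) \<le> r * s" using assms(2) by (simp add: mult_left_mono)
  then have "norm ((r * s) *\<^sub>R 1 - r *\<^sub>R a) \<le> r * s" by (simp add: algebra_simps)
  with assms show ?thesis by (auto simp: cpos_def)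
qed

lemma cpos_norm_bound:
  fixes b :: "'b::unital_cstar_algebra"
  assumes "star b = b" "norm b \<le> \<beta>" shows "cpos (\<beta> *\<^sub>R 1 - b)"
  unfolding cpos_def by (intro conjI exI[of _ \<beta>]) (use assms in \<open>auto simp: star_diff\<close>)

lemma cpos_one: "0 \<le> r \<Longrightarrow> cpos (r *\<^sub>R 1)"
  using cpos_norm_bound[of 0 r] by simp

text \<open>For \<open>x = 1 - h / t\<close> the solution of the fixed point equation satisfies
  \<open>(1 - w)\<^sup>2 = h / t\<close>. The clause on \<open>V\<close> replaces the statement that
  \<open>s\<close> is a norm limit of real polynomials in \<open>h\<close>; it is applied to
  commutants and to C*-subalgebras.\<close>

lemma cpos_sqrt:
  fixes h :: "'b::unital_cstar_algebra"
  assumes "cpos h"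
  obtains s where "cpos s" "s * s = h"
    "\<And>V. closed V \<Longrightarrow> 1 \<in> V \<Longrightarrow> h \<in> V \<Longrightarrow> (\<And>u v. u \<in> V \<Longrightarrow> v \<in> V \<Longrightarrow> u + v \<in> V) \<Longrightarrow>
       (\<And>r u. u \<in> V \<Longrightarrow> r *\<^sub>R u \<in> V) \<Longrightarrow> (\<And>u. u \<in> V \<Longrightarrow> u * u \<in> V) \<Longrightarrow> s \<in> V"
proof -
  obtain t where t: "norm (t *\<^sub>R 1 - h) \<le> t" and h: "star h = h" using assms by (auto simp: cpos_def)
  have t0: "0 \<le> t" using t norm_ge_zero order_trans by blast
  show thesis
  proof (cases "t = 0")
    case True
    then have h0: "h = 0" using t by simp
    have "0 \<in> V" if "1 \<in> V" "\<And>r u. u \<in> V \<Longrightarrow> r *\<^sub>R u \<in> V" for V :: "'b set"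
      using that(2)[OF that(1), of 0] by simp
    then show ?thesis using that[of 0] h0 assms by auto
  next
    case False
    with t0 have tp: "t > 0" by simp
    define x where "x = 1 - (1/t) *\<^sub>R h"
    have sx: "star x = x" by (simp add: x_def star_diff h)
    have "t *\<^sub>R 1 - h = t *\<^sub>R x" using tp by (simp add: x_def algebra_simps)
    then have "norm x \<le> 1" using t tp by simp
    then obtain w where w: "norm w \<le> 1" "2 *\<^sub>R w = x + w * w"
      "\<And>V. closed V \<Longrightarrow> 0 \<in> V \<Longrightarrow> (\<And>u. u \<in> V \<Longrightarrow> (1/2) *\<^sub>R (x + u * u) \<in> V) \<Longrightarrow> w \<in> V"
      using sqrt_iteration by blast
    have cs: "closed {v::'b. star v = v}"
      by (intro closed_Collect_eq continuous_on_id linear_continuous_on bounded_linear_star)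
    have "w \<in> {v. star v = v}" by (rule w(3)[OF cs]) (simp_all add: star_add star_mult sx)
    then have sw: "star w = w" by simp
    define s where "s = sqrt t *\<^sub>R (1 - w)"
    have ss: "s * s = h"
    proof -
      have "s * s = t *\<^sub>R (1 - 2 *\<^sub>R w + w * w)"
        using tp by (simp add: s_def algebra_simps scaleR_2)
      also have "\<dots> = t *\<^sub>R (1 - x)" unfolding w(2) by (simp add: algebra_simps)
      also have "\<dots> = h" using tp by (simp add: x_def)
      finally show ?thesis .
    qed
    have "cpos s" unfolding cpos_def
    proof (intro conjI exI[of _ "sqrt t"])
      show "star s = s" by (simp add: s_def star_diff sw)
      have "sqrt t *\<^sub>R 1 - s = sqrt t *\<^sub>R w" by (simp add: s_def algebra_simps)
      then show "norm (sqrt t *\<^sub>R 1 - s) \<le> sqrt t" using w(1) tp by simp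
    qed
    moreover have "s \<in> V" if V: "closed V" "1 \<in> V" "h \<in> V" "\<And>u v. u \<in> V \<Longrightarrow> v \<in> V \<Longrightarrow> u + v \<in> V"
       "\<And>r u. u \<in> V \<Longrightarrow> r *\<^sub>R u \<in> V" "\<And>u. u \<in> V \<Longrightarrow> u * u \<in> V" for V
    proof -
      have V0: "0 \<in> V" using V(5)[OF V(2), of 0] by simp
      have xV: "x \<in> V" using V(4)[OF V(2) V(5)[OF V(3), of "-1/t"]] by (simp add: x_def)
      have "w \<in> V" by (rule w(3)[OF V(1) V0]) (intro V xV)
      then have "1 + (-1) *\<^sub>R w \<in> V" by (intro V)
      then show ?thesis using V(5)[of "1 - w"] by (simp add: s_def)
    qed
    ultimately show ?thesis using that ss by blast
  qed
qed

lemma closed_commutant: "closed {v::'b::unital_cstar_algebra. y * v = v * y}"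
  by (intro closed_Collect_eq continuous_intros)

lemma cpos_sqrt_commute:
  fixes h :: "'b::unital_cstar_algebra"
  assumes "cpos h"
  obtains s where "cpos s" "s * s = h" "\<And>y. y * h = h * y \<Longrightarrow> y * s = s * y"
proof -
  obtain s where s: "cpos s" "s * s = h"
    "\<And>V. closed V \<Longrightarrow> 1 \<in> V \<Longrightarrow> h \<in> V \<Longrightarrow> (\<And>u v. u \<in> V \<Longrightarrow> v \<in> V \<Longrightarrow> u + v \<in> V) \<Longrightarrow>
       (\<And>r u. u \<in> V \<Longrightarrow> r *\<^sub>R u \<in> V) \<Longrightarrow> (\<And>u. u \<in> V \<Longrightarrow> u * u \<in> V) \<Longrightarrow> s \<in> V"
    using cpos_sqrt[OF assms] by blast
  have "s \<in> {v. y * v = v * y}" if "y * h = h * y" for y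
  proof (rule s(3)[OF closed_commutant])
    fix u assume "u \<in> {v. y * v = v * y}"
    then show "u * u \<in> {v. y * v = v * y}" by (metis (mono_tags) mem_Collect_eq mult.assoc)
  qed (use that in \<open>auto simp: algebra_simps\<close>)
  then show thesis using s that by blast
qed

text \<open>As \<open>s\<close> and \<open>r\<close> commute, \<open>u = s + \<i> r\<close>
  satisfies \<open>star u * u = 1\<close> and has norm 1, and \<open>s\<close> and \<open>r\<close>
  are its real and imaginary parts.\<close>

lemma norm_le_one_of_square_sum:
  fixes s r :: "'b::unital_cstar_algebra"
  assumes s: "star s = s" and r: "star r = r" and c: "s * r = r * s" and e: "s * s + r * r = 1"
  shows "norm s \<le> 1" "norm r \<le> 1"
proof -
  define u where "u = s + \<i> *\<^sub>C r"
  have su: "star u = s - \<i> *\<^sub>C r" by (simp add: u_def star_add star_scaleC s r)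
  have "star u * u = s * s + r * r"
    unfolding su unfolding u_def
    by (simp add: algebra_simps mult_scaleC_left mult_scaleC_right scaleC_scaleC scaleC_add_right scaleC_diff_right c)
  then have "(norm u)\<^sup>2 = 1" using cstar_identity[of u] e by simp
  then have nu: "norm u = 1" using power2_eq_1_iff[of "norm u"] norm_ge_zero[of u] by linarith
  have "2 *\<^sub>R s = u + star u" unfolding su by (simp add: u_def scaleR_2)
  then have "norm (2 *\<^sub>R s) \<le> norm u + norm (star u)" using norm_triangle_ineq[of u "star u"] by simp
  then show "norm s \<le> 1" by (simp add: nu)
  have "2 *\<^sub>R (\<i> *\<^sub>C r) = u - star u" unfolding su by (simp add: u_def scaleR_2)
  then have "norm (2 *\<^sub>R (\<i> *\<^sub>C r)) \<le> norm u + norm (star u)" using norm_triangle_ineq4[of u "star u"] by simp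
  then show "norm r \<le> 1" by (simp add: nu norm_scaleC)
qed

text \<open>Scale \<open>s\<close> to a contraction \<open>y\<close> and put
  \<open>r = sqrt (1 - y * y)\<close>. The squares of \<open>y\<close> and \<open>r\<close> add up
  to 1, hence \<open>norm (1 - y * y) = (norm r)\<^sup>2 \<le> 1\<close>, which is positivity of
  \<open>y * y\<close> with the constant \<open>t = 1\<close>.\<close>

lemma cpos_square:
  fixes s :: "'b::unital_cstar_algebra"
  assumes s: "star s = s"
  shows "cpos (s * s)"
proof -
  define c where "c = norm s + 1"
  have c: "c > 0" by (simp add: c_def add_nonneg_pos)
  define y where "y = (1/c) *\<^sub>R s"
  have sy: "star y = y" by (simp add: y_def s)
  have ny: "norm y \<le> 1" using c by (simp add: y_def c_def field_simps)
  have "norm (y * y) \<le> 1" using ny by (simp add: norm_selfadjoint_square sy power_le_one)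
  then have "cpos (1 - y * y)" using cpos_norm_bound[of "y * y" 1] by (simp add: star_mult sy)
  from cpos_sqrt_commute[OF this] obtain r where r: "cpos r" "r * r = 1 - y * y" "\<And>z. z * (1 - y * y) = (1 - y * y) * z \<Longrightarrow> z * r = r * z"
    by blast
  have "y * r = r * y" by (rule r(3)) (simp add: algebra_simps)
  then have "norm r \<le> 1"
    using norm_le_one_of_square_sum[of y r] sy cpos_selfadjoint[OF r(1)] r(2) by simp
  then have "norm (1 - y * y) \<le> 1"
    using norm_selfadjoint_square[OF cpos_selfadjoint[OF r(1)]] by (simp add: r(2) power_le_one)
  then have "cpos (y * y)" unfolding cpos_def by (intro conjI exI[of _ 1]) (auto simp: star_mult sy)
  then have "cpos (c\<^sup>2 *\<^sub>R (y * y))" by (rule cpos_scaleR) simp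
  then show ?thesis using c by (simp add: y_def power2_eq_square)
qed

text \<open>For \<beta> = 1 the square roots of \<open>a\<close> and \<open>1 - a\<close> commute
  and their squares add up to 1, so both are contractions. The proof scales to this case, and the
  detour through \<beta> + e covers \<beta> = 0.\<close>

lemma cpos_norm_le:
  fixes a :: "'b::unital_cstar_algebra"
  assumes a: "cpos a" and b: "cpos (\<beta> *\<^sub>R 1 - a)" and \<beta>: "0 \<le> \<beta>"
  shows "norm a \<le> \<beta>"
proof -
  have main: "norm a \<le> \<gamma>" if g: "cpos (\<gamma> *\<^sub>R 1 - a)" "0 < \<gamma>" for \<gamma>
  proof -
    define a' where "a' = (1/\<gamma>) *\<^sub>R a"
    have "cpos a'" using a that by (simp add: a'_def cpos_scaleR)
    from cpos_sqrt_commute[OF this] obtain s where s: "cpos s" "s * s = a'" by blast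
    have "cpos (1 - a')"
      using cpos_scaleR[OF g(1), of "1/\<gamma>"] g(2) by (simp add: a'_def algebra_simps)
    from cpos_sqrt_commute[OF this] obtain r where r: "cpos r" "r * r = 1 - a'"
       "\<And>z. z * (1 - a') = (1 - a') * z \<Longrightarrow> z * r = r * z"
      by blast
    have "s * r = r * s" by (rule r(3)) (simp add: s(2)[symmetric] algebra_simps)
    then have "norm s \<le> 1"
      using norm_le_one_of_square_sum(1)[of s r] s r(1,2) by (simp add: cpos_selfadjoint)
    then have "norm a' \<le> 1"
      using norm_selfadjoint_square[OF cpos_selfadjoint[OF s(1)]] by (simp add: s(2) power_le_one)
    with g(2) show ?thesis by (simp add: a'_def field_simps)
  qed
  show ?thesis
  proof (rule field_le_epsilon)
    fix e :: real assume e: "0 < e"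
    have "cpos ((\<beta> *\<^sub>R 1 - a) + e *\<^sub>R 1)" using b e by (intro cpos_add cpos_one) auto
    then have "cpos ((\<beta> + e) *\<^sub>R 1 - a)" by (simp add: algebra_simps)
    then show "norm a \<le> \<beta> + e" using main \<beta> e by (simp add: add_nonneg_pos)
  qed
qed

lemma cpos_norm_mono:
  fixes a :: "'b::unital_cstar_algebra"
  assumes "cpos a" "cpos (b - a)"
  shows "norm a \<le> norm b"
proof (rule cpos_norm_le[OF assms(1)])
  have "star b = b"
    using assms[THEN cpos_selfadjoint] by (simp add: star_diff)
  then have "cpos ((norm b *\<^sub>R 1 - b) + (b - a))" by (intro cpos_add assms cpos_norm_bound) auto
  then show "cpos (norm b *\<^sub>R 1 - a)" by simp
qed simp

text \<open>With \<open>k = - y* y\<close> and \<open>l = y y*\<close> one has \<open>y (1 - k) = (1 + l) y\<close>, where the left hand side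
  is a contraction if \<open>norm y = 1\<close>, while the right hand side is not.\<close>

lemma neg_star_mult_cpos_eq_0:
  fixes y :: "'b::unital_cstar_algebra"
  assumes k: "cpos (- (star y * y))"
  shows "y = 0"
proof (rule ccontr)
  assume "y \<noteq> 0"
  define z where "z = (1 / norm y) *\<^sub>R y"
  have nz: "norm z = 1" using \<open>y \<noteq> 0\<close> by (simp add: z_def)
  define k where "k = - (star z * z)"
  define l where "l = z * star z"
  have ck: "cpos k" using cpos_scaleR[OF k, of "1 / (norm y)\<^sup>2"]
    by (simp add: k_def z_def power2_eq_square)
  have nk: "norm k = 1" by (simp add: k_def cstar_identity nz)
  have nl: "norm l = 1" by (simp add: l_def cstar_identity' nz)
  define a where "a = (1/2) *\<^sub>R (z + star z)"
  define b where "b = (1/2) *\<^sub>R (\<i> *\<^sub>C (z - star z))"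
  have sa: "star a = a" by (simp add: a_def star_add star_star add.commute)
  have sb: "star b = b" by (simp add: b_def star_diff star_scaleC star_star flip: scaleC_minus_right)
  \<comment> \<open>Since z = a - \<i> b, the sum \<open>z * star z + star z * z\<close> is twice
    \<open>a * a + b * b\<close>. As \<open>k\<close> is positive, \<open>l\<close> is positive,
    too.\<close>
  have "l = 2 *\<^sub>R (a * a + b * b) + k"
  proof -
    have "4 *\<^sub>R (a * a) = (z + star z) * (z + star z)" by (simp add: a_def)
    moreover have "4 *\<^sub>R (b * b) = - ((z - star z) * (z - star z))"
      by (simp add: b_def mult_scaleC_left mult_scaleC_right scaleC_scaleC scaleC_scaleR scaleC_minus_one)
    ultimately have "4 *\<^sub>R (a * a + b * b) = 2 *\<^sub>R (z * star z + star z * z)"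
      by (simp only: scaleR_add_right) (simp add: algebra_simps scaleR_2)
    then have "2 *\<^sub>R (2 *\<^sub>R (a * a + b * b)) = 2 *\<^sub>R (z * star z + star z * z)" by simp
    then have "2 *\<^sub>R (a * a + b * b) = z * star z + star z * z" using scaleR_left_imp_eq[of 2] by (metis zero_neq_numeral)
    then show ?thesis by (simp add: l_def k_def)
  qed
  then have cl: "cpos l" using ck by (auto intro!: cpos_add cpos_scaleR cpos_square sa sb)
  from cpos_sqrt_commute[OF this] obtain s where s: "cpos s" "s * s = l" by blast
  have n1k: "norm (1 - k) \<le> 1"
    using cpos_norm_le[of "1 - k" 1] cpos_norm_bound[of k 1] ck nk cpos_selfadjoint[OF ck] by simp
  have e: "z * (1 - k) = (1 + l) * z" by (simp add: k_def l_def algebra_simps)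
  have "norm (z * (1 - k)) \<le> 1"
    using order_trans[OF norm_mult_ineq[of z "1 - k"]] nz n1k by simp
  then have n: "norm ((1 + l) * z) \<le> 1" by (simp add: e)
  have sl: "star l = l" using cl by (rule cpos_selfadjoint)
  have "((1 + l) * z) * star ((1 + l) * z) = (1 + l) * l * (1 + l)"
    by (simp add: star_mult star_add star_star sl l_def mult.assoc)
  then have "norm ((1 + l) * l * (1 + l)) \<le> 1"
    using cstar_identity'[of "(1 + l) * z"] n by (simp add: power_le_one)
  \<comment> \<open>The difference of the two elements is \<open>l + l\<^sup>3\<close>, where
    \<open>l\<^sup>3\<close> is the square of the self-adjoint \<open>l * s\<close>. Since
    \<open>l\<close> has norm 1, the left hand side is 2 and contradicts the bound 1 just
    obtained.\<close>
  moreover have "norm (2 *\<^sub>R (l * l)) \<le> norm ((1 + l) * l * (1 + l))"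
  proof (rule cpos_norm_mono)
    show "cpos (2 *\<^sub>R (l * l))" by (intro cpos_scaleR cpos_square sl) simp
    have c: "l * s = s * l" by (simp add: s(2)[symmetric] mult.assoc)
    have "star (l * s) = l * s" by (simp add: star_mult sl cpos_selfadjoint[OF s(1)] c)
    then have "cpos (l + (l * s) * (l * s))" by (intro cpos_add cl cpos_square)
    moreover have "(l * s) * (l * s) = l * l * l" by (metis c mult.assoc s(2))
    ultimately show "cpos ((1 + l) * l * (1 + l) - 2 *\<^sub>R (l * l))" by (simp add: algebra_simps scaleR_2)
  qed
  ultimately show False by (simp add: norm_selfadjoint_square sl nl)
qed

text \<open>With \<open>m = sqrt (h * h)\<close>, the absolute value of \<open>h\<close>, the
  element \<open>f = m - h\<close> is twice the negative part of \<open>h\<close>. Because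
  \<open>h * f = - (m * f)\<close>, the element \<open>star (x * f) * (x * f)\<close> is the
  negative of a square, so \<open>neg_star_mult_cpos_eq_0\<close> yields \<open>x * f = 0\<close>;
  then \<open>f * f = 0\<close>, and \<open>h = m\<close> is positive.\<close>

lemma cpos_star_mult:
  fixes x :: "'b::unital_cstar_algebra"
  shows "cpos (star x * x)"
proof -
  define h where "h = star x * x"
  have sh: "star h = h" by (simp add: h_def star_mult star_star)
  obtain m where m: "cpos m" "m * m = h * h" "\<And>y. y * (h * h) = (h * h) * y \<Longrightarrow> y * m = m * y"
    using cpos_sqrt_commute[OF cpos_square[OF sh]] by blast
  have hm: "h * m = m * h" by (rule m(3)) (simp add: mult.assoc)
  obtain r where r: "cpos r" "r * r = m" "\<And>y. y * m = m * y \<Longrightarrow> y * r = r * y"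
    using cpos_sqrt_commute[OF m(1)] by blast
  have hr: "h * r = r * h" by (rule r(3)[OF hm])
  have mr: "m * r = r * m" by (rule r(3)) simp
  define f where "f = m - h"
  have sf: "star f = f" by (simp add: f_def star_diff sh cpos_selfadjoint[OF m(1)])
  have fr: "f * r = r * f" by (simp add: f_def algebra_simps hr mr)
  have srf: "star (r * f) = r * f" by (simp add: star_mult sf cpos_selfadjoint[OF r(1)] fr)
  have "(m + h) * f = 0" by (simp add: f_def algebra_simps m(2) hm)
  then have "h * f = - (m * f)" by (simp add: algebra_simps add_eq_0_iff)
  moreover have "f * m = m * f" by (simp add: f_def algebra_simps hm)
  ultimately have fhf: "f * (h * f) = - ((r * f) * (r * f))"
    by (metis (no_types, lifting) fr mult.assoc mult_minus_right r(2))
  have yy: "star (x * f) * (x * f) = f * (h * f)" by (simp add: star_mult sf h_def mult.assoc)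
  then have "cpos (- (star (x * f) * (x * f)))" by (simp add: fhf cpos_square srf)
  then have xf: "x * f = 0" by (rule neg_star_mult_cpos_eq_0)
  then have "(r * f) * (r * f) = 0" using yy fhf by simp
  then have "r * f = 0" using norm_selfadjoint_square[OF srf] by simp
  then have "m * f = 0" by (metis mult.assoc mult_zero_right r(2))
  moreover have "h * f = 0" by (simp add: h_def mult.assoc xf)
  ultimately have "f * f = 0" by (simp add: f_def algebra_simps)
  then have "f = 0" using norm_selfadjoint_square[OF sf] by simp
  then have "h = m" by (simp add: f_def)
  with m(1) show ?thesis by (simp add: h_def)
qed

lemma cpos_mult_star: "cpos (x * star (x::'b::unital_cstar_algebra))"
  using cpos_star_mult[of "star x"] by (simp add: star_star)

lemma cstar_positive_iff_cpos: "cstar_positive x \<longleftrightarrow> cpos x"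
proof
  assume "cpos x"
  from cpos_sqrt_commute[OF this] obtain s where "cpos s" "s * s = x" by blast
  then show "cstar_positive x" unfolding cstar_positive_def using cpos_selfadjoint by metis
qed (auto simp: cstar_positive_def cpos_star_mult)

lemma norm_one_minus_le:
  fixes h :: "'b::unital_cstar_algebra"
  assumes "cpos h" "norm h \<le> 1"
  shows "norm (1 - h) \<le> 1"
  using cpos_norm_le[of "1 - h" 1] cpos_norm_bound[of h 1] assms cpos_selfadjoint[of h] by simp

lemma cstar_invertible_near_one:
  fixes x :: "'b::unital_cstar_algebra"
  assumes "norm (1 - x) < 1"
  shows "cstar_invertible x"
proof -
  define y where "y = 1 - x"
  have s: "summable (\<lambda>n. y ^ n)" using assms unfolding y_def[symmetric] by (rule complete_algebra_summable_geometric)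
  define z where "z = (\<Sum>n. y ^ n)"
  have "(\<Sum>n. y ^ Suc n) = z - 1" using suminf_split_head[OF s] by (simp add: z_def)
  moreover have "(\<Sum>n. y ^ Suc n) = y * z" using suminf_mult[OF s, of y] by (simp add: z_def)
  moreover have "(\<Sum>n. y ^ Suc n) = z * y" using suminf_mult2[OF s, of y] by (simp add: z_def power_Suc2 del: power_Suc)
  ultimately have "y * z = z - 1" "z * y = z - 1" by metis+
  then have "x * z = 1" "z * x = 1" by (simp_all add: y_def algebra_simps)
  then show ?thesis by (auto simp: cstar_invertible_def)
qed

section \<open>Maximal filters and the Hahn-Banach theorem\<close>

text \<open>Stated for an arbitrary predicate because it is applied upwards, to effects, as well as
  downwards, to filters and sublinear functionals.\<close>

lemma Zorn_upper_bounds: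
  assumes "A \<noteq> {}"
    and refl: "\<And>a. a \<in> A \<Longrightarrow> P a a"
    and trans: "\<And>a b c. a \<in> A \<Longrightarrow> b \<in> A \<Longrightarrow> c \<in> A \<Longrightarrow> P a b \<Longrightarrow> P b c \<Longrightarrow> P a c"
    and antisym: "\<And>a b. a \<in> A \<Longrightarrow> b \<in> A \<Longrightarrow> P a b \<Longrightarrow> P b a \<Longrightarrow> a = b"
    and chain: "\<And>C. C \<subseteq> A \<Longrightarrow> C \<noteq> {} \<Longrightarrow> (\<And>a b. a \<in> C \<Longrightarrow> b \<in> C \<Longrightarrow> P a b \<or> P b a) \<Longrightarrow>
      \<exists>u\<in>A. \<forall>a\<in>C. P a u"
  obtains m where "m \<in> A" "\<And>a. a \<in> A \<Longrightarrow> P m a \<Longrightarrow> a = m"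
proof -
  have po: "partial_order_on A (relation_of P A)"
    by (rule partial_order_on_relation_ofI) (use refl trans antisym in blast)+
  have "\<exists>u\<in>A. \<forall>a\<in>C. P a u" if "C \<in> Chains (relation_of P A)" for C
  proof (cases "C = {}")
    case True
    then show ?thesis using assms(1) by blast
  next
    case False
    with that show ?thesis
      by (intro chain) (auto simp: Chains_def relation_of_def)
  qed
  from predicate_Zorn[OF po this] that show thesis by blast
qed

text \<open>An ultrafilter refining \<open>F\<close>; finer filters are smaller, so Zorn's lemma is
  applied downwards. Limits along it take the place of weak* compactness.\<close>

lemma maximal_filter:
  fixes F :: "'a filter"
  assumes "F \<noteq> bot"
  obtains U where "U \<noteq> bot" "U \<le> F" "\<And>P. eventually P U \<or> eventually (\<lambda>x. \<not> P x) U"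
proof -
  let ?A = "{G. G \<le> F \<and> G \<noteq> bot}"
  obtain U where U: "U \<in> ?A" "\<And>G. G \<in> ?A \<Longrightarrow> G \<le> U \<Longrightarrow> G = U"
  proof (rule Zorn_upper_bounds[of ?A "\<lambda>a b. b \<le> a"])
    show "?A \<noteq> {}" using assms by blast
    fix C assume C: "C \<subseteq> ?A" "C \<noteq> {}" "\<And>a b. a \<in> C \<Longrightarrow> b \<in> C \<Longrightarrow> b \<le> a \<or> a \<le> b"
    have "eventually P (Inf C) \<longleftrightarrow> (\<exists>b\<in>C. eventually P b)" for P
      by (rule eventually_Inf_base) (use C in \<open>force+\<close>)
    then have "Inf C \<noteq> bot" using C(1) unfolding trivial_limit_def by blast
    moreover obtain G where G: "G \<in> C" using C(2) by blast
    then have "Inf C \<le> G" "G \<le> F" using C(1) by (auto intro: Inf_lower)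
    then have "Inf C \<le> F" by (rule order_trans)
    ultimately show "\<exists>u\<in>?A. \<forall>a\<in>C. u \<le> a" using Inf_lower by blast
  next
    fix a b c :: "'a filter" assume "b \<le> a" "c \<le> b" then show "c \<le> a" by (rule order_trans[rotated])
  next
    fix a b :: "'a filter" assume "b \<le> a" "a \<le> b" then show "a = b" by (rule antisym[rotated])
  next
    fix m assume "m \<in> ?A" "\<And>a. a \<in> ?A \<Longrightarrow> a \<le> m \<Longrightarrow> a = m"
    then show thesis by (rule that)
  qed simp
  have "eventually P U \<or> eventually (\<lambda>x. \<not> P x) U" for P
  proof (rule disjCI)
    assume n: "\<not> eventually (\<lambda>x. \<not> P x) U"
    \<comment> \<open>If \<open>P\<close> holds frequently, the trace of \<open>U\<close> on
      \<open>P\<close> is a proper filter, and minimality of \<open>U\<close> makes it equal to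
      \<open>U\<close>.\<close>
    let ?G = "inf U (principal {x. P x})"
    have "?G \<noteq> bot" using n by (simp add: trivial_limit_def eventually_inf_principal)
    then have "?G = U" using U by (intro U(2)) (auto intro: le_infI1)
    moreover have "eventually P ?G" by (simp add: eventually_inf_principal)
    ultimately show "eventually P U" by simp
  qed
  with U(1) that show thesis by blast
qed

lemma maximal_filter_compact_limit:
  fixes f :: "'a \<Rightarrow> 'c::topological_space"
  assumes U: "U \<noteq> bot" "\<And>P. eventually P U \<or> eventually (\<lambda>x. \<not> P x) U"
    and K: "compact K" "eventually (\<lambda>x. f x \<in> K) U"
  shows "\<exists>l\<in>K. (f \<longlongrightarrow> l) U"
proof -
  have "filtermap f U \<noteq> bot" using U(1) by (simp add: filtermap_bot_iff)
  moreover have "eventually (\<lambda>x. x \<in> K) (filtermap f U)" using K(2) by (simp add: eventually_filtermap)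
  ultimately obtain l where l: "l \<in> K" "inf (nhds l) (filtermap f U) \<noteq> bot"
    using K(1) unfolding compact_filter by blast
  have "eventually (\<lambda>x. f x \<in> S) U" if "open S" "l \<in> S" for S
  proof (rule ccontr)
    assume "\<not> eventually (\<lambda>x. f x \<in> S) U"
    then have "eventually (\<lambda>x. f x \<notin> S) U" using U(2) by blast
    then have "eventually (\<lambda>y. y \<notin> S) (filtermap f U)" by (simp add: eventually_filtermap)
    moreover have "eventually (\<lambda>y. y \<in> S) (nhds l)" using that by (rule eventually_nhds_in_open)
    ultimately have "eventually (\<lambda>_. False) (inf (nhds l) (filtermap f U))"
      unfolding eventually_inf by blast
    with l(2) show False by (simp add: trivial_limit_def)
  qed
  with l(1) show ?thesis by (auto simp: tendsto_def)
qed

section \<open>Sublinear functionals and linear functionals below them\<close>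

definition sublinear :: "('v::real_vector \<Rightarrow> real) \<Rightarrow> bool" where
  "sublinear p \<longleftrightarrow> (\<forall>x y. p (x + y) \<le> p x + p y) \<and> (\<forall>t x. 0 \<le> t \<longrightarrow> p (t *\<^sub>R x) = t * p x)"

lemma sublinear_add: "sublinear p \<Longrightarrow> p (x + y) \<le> p x + p y"
  and sublinear_scale: "sublinear p \<Longrightarrow> 0 \<le> t \<Longrightarrow> p (t *\<^sub>R x) = t * p x"
  by (auto simp: sublinear_def)

lemma sublinear_zero: "sublinear p \<Longrightarrow> p 0 = 0"
  using sublinear_scale[of p 0 0] by simp

lemma sublinear_neg: "sublinear p \<Longrightarrow> - p (- x) \<le> p x"
  using sublinear_add[of p x "-x"] sublinear_zero[of p] by simp

text \<open>The infimum of \<open>p (x - v) + f v\<close> over \<open>V\<close> is the greatest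
  sublinear functional that is below \<open>p\<close> everywhere and below \<open>f\<close> on
  \<open>V\<close>. Asking only for a cone covers rays and subspaces alike. The last clause bounds
  \<open>p'\<close> from below, which the separation in \<open>Helly_three_seminorms\<close>
  uses.\<close>

lemma sublinear_below_cone:
  assumes p: "sublinear p" and V: "0 \<in> V" "\<And>u v. u \<in> V \<Longrightarrow> v \<in> V \<Longrightarrow> u + v \<in> V"
      "\<And>t v. 0 \<le> t \<Longrightarrow> v \<in> V \<Longrightarrow> t *\<^sub>R v \<in> V"
    and f: "\<And>u v. u \<in> V \<Longrightarrow> v \<in> V \<Longrightarrow> f (u + v) = f u + f v"
      "\<And>t v. 0 \<le> t \<Longrightarrow> v \<in> V \<Longrightarrow> f (t *\<^sub>R v) = t * f v"
    and pf: "\<And>v. v \<in> V \<Longrightarrow> - p (- v) \<le> f v"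
  obtains p' where "sublinear p'" "\<And>x. p' x \<le> p x" "\<And>v. v \<in> V \<Longrightarrow> p' v \<le> f v"
    "\<And>x c. (\<And>v. v \<in> V \<Longrightarrow> c \<le> p (x - v) + f v) \<Longrightarrow> c \<le> p' x"
proof -
  define p' where "p' x = (INF v\<in>V. p (x - v) + f v)" for x
  have f0: "f 0 = 0" using f(2)[of 0 0] V(1) by simp
  have lower: "- p (- x) \<le> p (x - v) + f v" if "v \<in> V" for x v
    using sublinear_add[OF p, of "x - v" "-x"] pf[OF that] by simp
  have bdd: "bdd_below ((\<lambda>v. p (x - v) + f v) ` V)" for x
    using lower by (intro bdd_belowI2) auto
  have le: "p' x \<le> p (x - v) + f v" if "v \<in> V" for x v
    unfolding p'_def by (rule cINF_lower[OF bdd that])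
  have ge: "c \<le> p' x" if "\<And>v. v \<in> V \<Longrightarrow> c \<le> p (x - v) + f v" for c x
    unfolding p'_def using that V(1) by (intro cINF_greatest) auto
  have sc: "p' (t *\<^sub>R x) \<le> t * p' x" if "t > 0" for t x
  proof -
    have "p' (t *\<^sub>R x) / t \<le> p' x"
    proof (rule ge)
      fix v assume v: "v \<in> V"
      have "p' (t *\<^sub>R x) \<le> p (t *\<^sub>R x - t *\<^sub>R v) + f (t *\<^sub>R v)" using v that by (intro le V(3)) auto
      also have "p (t *\<^sub>R x - t *\<^sub>R v) = t * p (x - v)"
        using sublinear_scale[OF p, of t "x - v"] that by (simp add: scaleR_diff_right)
      also have "f (t *\<^sub>R v) = t * f v" using f(2) v that by simp
      finally show "p' (t *\<^sub>R x) / t \<le> p (x - v) + f v" using that by (simp add: field_simps)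
    qed
    then show ?thesis using that by (simp add: field_simps)
  qed
  have "sublinear p'" unfolding sublinear_def
  proof (intro conjI allI impI)
    fix x y
    have "p' (x + y) - p' y \<le> p' x"
    proof (rule ge)
      fix v assume v: "v \<in> V"
      have "p' (x + y) - (p (x - v) + f v) \<le> p' y"
      proof (rule ge)
        fix w assume w: "w \<in> V"
        have "p' (x + y) \<le> p ((x - v) + (y - w)) + f (v + w)"
          using le[OF V(2)[OF v w], of "x + y"] by (simp add: algebra_simps)
        also have "\<dots> \<le> p (x - v) + p (y - w) + (f v + f w)"
          using sublinear_add[OF p, of "x - v" "y - w"] f(1)[OF v w] by simp
        finally show "p' (x + y) - (p (x - v) + f v) \<le> p (y - w) + f w" by simp
      qed
      then show "p' (x + y) - p' y \<le> p (x - v) + f v" by simp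
    qed
    then show "p' (x + y) \<le> p' x + p' y" by simp
  next
    fix t :: real and x assume "0 \<le> t"
    show "p' (t *\<^sub>R x) = t * p' x"
    proof (cases "t = 0")
      case True
      have "0 \<le> p' 0" by (rule ge) (use lower[of _ 0] sublinear_zero[OF p] in auto)
      moreover have "p' 0 \<le> 0" using le[OF V(1), of 0] f0 sublinear_zero[OF p] by simp
      ultimately show ?thesis using True by simp
    next
      case False
      with \<open>0 \<le> t\<close> have t: "t > 0" by simp
      have "p' ((1/t) *\<^sub>R (t *\<^sub>R x)) \<le> (1/t) * p' (t *\<^sub>R x)" using t by (intro sc) simp
      then have "t * p' x \<le> p' (t *\<^sub>R x)" using t by (simp add: field_simps)
      with sc[OF t, of x] show ?thesis by simp
    qed
  qed
  moreover have "p' x \<le> p x" for x using le[OF V(1), of x] f0 by simp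
  moreover have "p' v \<le> f v" if "v \<in> V" for v using le[OF that, of v] sublinear_zero[OF p] by simp
  ultimately show thesis using that ge by blast
qed

text \<open>This serves two ends: a minimal sublinear functional cannot be lowered along a ray, so
  it is odd and therefore linear; and any linear functional below \<open>p'\<close> attains
  \<open>p\<close> at \<open>y\<close>.\<close>

lemma sublinear_below_ray:
  assumes p: "sublinear p"
  obtains p' where "sublinear p'" "\<And>x. p' x \<le> p x" "p' (- y) \<le> - p y"
proof -
  let ?V = "range (\<lambda>t::real. - (\<bar>t\<bar> *\<^sub>R y))"
  have add: "u + v \<in> ?V" if "u \<in> ?V" "v \<in> ?V" for u v
  proof -
    from that obtain s t where "u = - (\<bar>s\<bar> *\<^sub>R y)" "v = - (\<bar>t\<bar> *\<^sub>R y)" by auto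
    then have "u + v = - (\<bar>\<bar>s\<bar> + \<bar>t\<bar>\<bar> *\<^sub>R y)" by (simp add: algebra_simps)
    then show ?thesis by blast
  qed
  have sc: "r *\<^sub>R v \<in> ?V" if "0 \<le> r" "v \<in> ?V" for r v
  proof -
    from that obtain t where "v = - (\<bar>t\<bar> *\<^sub>R y)" by auto
    then have "r *\<^sub>R v = - (\<bar>r * t\<bar> *\<^sub>R y)" using that(1) by (simp add: abs_mult)
    then show ?thesis by blast
  qed
  have m: "p (\<bar>t\<bar> *\<^sub>R y) = \<bar>t\<bar> * p y" for t using sublinear_scale[OF p] by simp
  obtain p' where p': "sublinear p'" "\<And>x. p' x \<le> p x" "\<And>v. v \<in> ?V \<Longrightarrow> p' v \<le> - p (- v)"
  proof (rule sublinear_below_cone[OF p, of ?V "\<lambda>v. - p (- v)"])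
    show "0 \<in> ?V" by (rule image_eqI[of _ _ 0]) auto
    fix u v assume "u \<in> ?V" "v \<in> ?V"
    then obtain s t where st: "u = - (\<bar>s\<bar> *\<^sub>R y)" "v = - (\<bar>t\<bar> *\<^sub>R y)" by auto
    have "- (u + v) = (\<bar>s\<bar> + \<bar>t\<bar>) *\<^sub>R y" by (simp add: st algebra_simps)
    then show "- p (- (u + v)) = - p (- u) + - p (- v)"
      using sublinear_scale[OF p, of "\<bar>s\<bar> + \<bar>t\<bar>" y] by (simp add: st m algebra_simps)
  next
    fix r :: real and v assume "0 \<le> r"
    then show "- p (- (r *\<^sub>R v)) = r * - p (- v)" using sublinear_scale[OF p, of r "-v"] by simp
  qed (use add sc in auto)
  have "p' (- y) \<le> - p y" using p'(3)[of "- y"] image_eqI[of "-y" "\<lambda>t. - (\<bar>t\<bar> *\<^sub>R y)" 1 UNIV] by simp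
  with p' that show thesis by blast
qed

lemma linear_below_sublinear:
  assumes p: "sublinear p"
  obtains g where "linear g" "\<And>x. g x \<le> p x"
proof -
  let ?A = "{q. sublinear q \<and> (\<forall>x. q x \<le> p x)}"
  obtain m where m: "m \<in> ?A" "\<And>q. q \<in> ?A \<Longrightarrow> (\<forall>x. q x \<le> m x) \<Longrightarrow> q = m"
  proof (rule Zorn_upper_bounds[of ?A "\<lambda>a b. \<forall>x. b x \<le> a x"])
    show "?A \<noteq> {}" using p by blast
    fix C assume C: "C \<subseteq> ?A" "C \<noteq> {}" and
      ch: "\<And>a b. a \<in> C \<Longrightarrow> b \<in> C \<Longrightarrow> (\<forall>x. b x \<le> a x) \<or> (\<forall>x. a x \<le> b x)"
    define i where "i x = (INF q\<in>C. q x)" for x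
    have low: "- p (- x) \<le> q x" if "q \<in> C" for q x
      using C(1) that sublinear_neg[of q x] by (smt (verit, best) mem_Collect_eq subsetD)
    have bdd: "bdd_below ((\<lambda>q. q x) ` C)" for x using low by (intro bdd_belowI2) auto
    have le: "i x \<le> q x" if "q \<in> C" for q x unfolding i_def by (rule cINF_lower[OF bdd that])
    have ge: "c \<le> i x" if "\<And>q. q \<in> C \<Longrightarrow> c \<le> q x" for c x
      unfolding i_def using that C(2) by (intro cINF_greatest) auto
    have sc: "i (t *\<^sub>R x) \<le> t * i x" if "t > 0" for t x
    proof -
      have "i (t *\<^sub>R x) / t \<le> i x"
      proof (rule ge)
        fix q assume q: "q \<in> C"
        then have "q (t *\<^sub>R x) = t * q x" using C(1) that by (auto intro: sublinear_scale)
        with le[OF q, of "t *\<^sub>R x"] show "i (t *\<^sub>R x) / t \<le> q x" using that by (simp add: field_simps)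
      qed
      then show ?thesis using that by (simp add: field_simps)
    qed
    have "sublinear i" unfolding sublinear_def
    proof (intro conjI allI impI)
      fix x y
      have "i (x + y) - i y \<le> i x"
      proof (rule ge)
        fix q assume q: "q \<in> C"
        have "i (x + y) - q x \<le> i y"
        proof (rule ge)
          fix q' assume q': "q' \<in> C"
          \<comment> \<open>Subadditivity of the infimum needs one functional below both
            \<open>q\<close> and \<open>q'\<close>; the chain provides it.\<close>
          from ch[OF q q'] obtain r where r: "r \<in> C" "\<forall>x. r x \<le> q x" "\<forall>x. r x \<le> q' x"
            using q q' by blast
          have "i (x + y) \<le> r x + r y"
            using le[OF r(1), of "x + y"] C(1) r(1) sublinear_add[of r x y] by force
          also have "\<dots> \<le> q x + q' y" using r by (simp add: add_mono)
          finally show "i (x + y) - q x \<le> q' y" by simp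
        qed
        then show "i (x + y) - i y \<le> q x" by simp
      qed
      then show "i (x + y) \<le> i x + i y" by simp
    next
      fix t :: real and x assume "0 \<le> t"
      show "i (t *\<^sub>R x) = t * i x"
      proof (cases "t = 0")
        case True
        have "q 0 = 0" if "q \<in> C" for q using C(1) that by (auto intro: sublinear_zero)
        then have "i 0 = (INF q\<in>C. 0)" unfolding i_def by (intro INF_cong) auto
        then have "i 0 = 0" using C(2) by simp
        with True show ?thesis by simp
      next
        case False
        with \<open>0 \<le> t\<close> have t: "t > 0" by simp
        have "i ((1/t) *\<^sub>R (t *\<^sub>R x)) \<le> (1/t) * i (t *\<^sub>R x)" using t by (intro sc) simp
        then have "t * i x \<le> i (t *\<^sub>R x)" using t by (simp add: field_simps)
        with sc[OF t, of x] show ?thesis by simp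
      qed
    qed
    moreover have "i x \<le> p x" for x
    proof -
      obtain q where q: "q \<in> C" using C(2) by blast
      with C(1) have "q x \<le> p x" by blast
      with le[OF q, of x] show ?thesis by simp
    qed
    ultimately show "\<exists>u\<in>?A. \<forall>a\<in>C. \<forall>x. u x \<le> a x" using le by blast
  next
    fix a b c assume "\<forall>x. b x \<le> a x" "\<forall>x. c x \<le> (b x :: real)"
    then show "\<forall>x. c x \<le> a x" using order_trans by blast
  next
    fix a b assume "\<forall>x. b x \<le> a x" "\<forall>x. a x \<le> (b x :: real)"
    then show "a = b" by (intro ext antisym) auto
  next
    fix m assume "m \<in> ?A" "\<And>q. q \<in> ?A \<Longrightarrow> (\<forall>x. q x \<le> m x) \<Longrightarrow> q = m"
    then show thesis by (rule that)
  qed simp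
  have sm: "sublinear m" using m(1) by blast
  have odd: "m (- y) = - m y" for y
  proof -
    obtain p' where p': "sublinear p'" "\<And>x. p' x \<le> m x" "p' (- y) \<le> - m y"
      using sublinear_below_ray[OF sm] by blast
    have "p' \<in> ?A" using p' m(1) by (auto intro: order_trans)
    then have "p' = m" using m(2) p'(2) by blast
    with p'(3) sublinear_neg[OF sm, of y] show ?thesis by simp
  qed
  have "linear m"
  proof (rule linearI)
    fix x y
    have "m (- x + - y) \<le> m (- x) + m (- y)" by (rule sublinear_add[OF sm])
    moreover have "m (- x + - y) = - m (x + y)" using odd[of "x + y"] by simp
    ultimately show "m (x + y) = m x + m y" using sublinear_add[OF sm, of x y] by (simp add: odd)
  next
    fix r x
    show "m (r *\<^sub>R x) = r *\<^sub>R m x"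
    proof (cases "0 \<le> r")
      case True
      then show ?thesis using sublinear_scale[OF sm] by simp
    next
      case False
      then have "m ((- r) *\<^sub>R x) = (- r) * m x" by (intro sublinear_scale[OF sm]) simp
      then show ?thesis using odd[of "r *\<^sub>R x"] by simp
    qed
  qed
  with m(1) that show thesis by blast
qed

lemma linear_support_sublinear:
  assumes "sublinear p"
  obtains g where "linear g" "\<And>x. g x \<le> p x" "p y \<le> g y"
proof -
  obtain p' where p': "sublinear p'" "\<And>x. p' x \<le> p x" "p' (- y) \<le> - p y"
    using sublinear_below_ray[OF assms] by blast
  obtain g where g: "linear g" "\<And>x. g x \<le> p' x" using linear_below_sublinear[OF p'(1)] by blast
  have "g y = - g (- y)" using linear_neg[OF g(1), of y] by simp
  with g(2)[of "-y"] p'(3) have "p y \<le> g y" by simp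
  moreover have "g x \<le> p x" for x using g(2)[of x] p'(2)[of x] by simp
  ultimately show thesis using g(1) that by blast
qed

section \<open>Complex functionals and Helly's theorem\<close>

definition complex_linear :: "('b::unital_cstar_algebra \<Rightarrow> complex) \<Rightarrow> bool" where
  "complex_linear f \<longleftrightarrow> (\<forall>x y. f (x + y) = f x + f y) \<and> (\<forall>c x. f (c *\<^sub>C x) = c * f x)"

definition complex_seminorm :: "('b::unital_cstar_algebra \<Rightarrow> real) \<Rightarrow> bool" where
  "complex_seminorm N \<longleftrightarrow> (\<forall>x y. N (x + y) \<le> N x + N y) \<and> (\<forall>c x. N (c *\<^sub>C x) = cmod c * N x)"

lemma complex_seminorm_add: "complex_seminorm N \<Longrightarrow> N (x + y) \<le> N x + N y"
  and complex_seminorm_scale: "complex_seminorm N \<Longrightarrow> N (c *\<^sub>C x) = cmod c * N x"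
  by (auto simp: complex_seminorm_def)

lemma complex_seminorm_norm: "complex_seminorm (norm :: 'b::unital_cstar_algebra \<Rightarrow> real)"
  by (simp add: complex_seminorm_def norm_triangle_ineq norm_scaleC)

lemma complex_seminorm_scale_by: "complex_seminorm N \<Longrightarrow> 0 \<le> K \<Longrightarrow> complex_seminorm (\<lambda>x. K * N x)"
  by (auto simp: complex_seminorm_def simp flip: distrib_left intro: mult_left_mono)

lemma complex_seminorm_sublinear:
  assumes N: "complex_seminorm N" shows "sublinear N"
  using complex_seminorm_add[OF N] complex_seminorm_scale[OF N, of "complex_of_real _"]
  by (auto simp: sublinear_def scaleR_scaleC)

lemma complex_seminorm_nonneg: assumes "complex_seminorm N" shows "0 \<le> N x"
proof -
  have "N (- x) = N x" using complex_seminorm_scale[OF assms, of "-1" x] by (simp add: scaleC_minus_one)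
  then show ?thesis using sublinear_neg[OF complex_seminorm_sublinear[OF assms], of x] by simp
qed

definition complexify :: "('b::unital_cstar_algebra \<Rightarrow> real) \<Rightarrow> 'b \<Rightarrow> complex" where
  "complexify g x = Complex (g x) (- g (\<i> *\<^sub>C x))"

lemma Re_complexify [simp]: "Re (complexify g x) = g x"
  by (simp add: complexify_def)

lemma complex_linear_complexify:
  fixes g :: "'b::unital_cstar_algebra \<Rightarrow> real"
  assumes g: "linear g"
  shows "complex_linear (complexify g)"
  unfolding complex_linear_def
proof (intro conjI allI)
  fix x y show "complexify g (x + y) = complexify g x + complexify g y"
    by (simp add: complexify_def complex_eq_iff scaleC_add_right linear_add[OF g])
next
  fix c and x :: 'b
  have c: "c *\<^sub>C x = Re c *\<^sub>R x + Im c *\<^sub>R (\<i> *\<^sub>C x)" for x :: 'b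
    using complex_eq[of c]
    by (simp add: scaleR_scaleC scaleC_scaleC flip: scaleC_add_left) (simp add: mult.commute)
  have i: "\<i> *\<^sub>C \<i> *\<^sub>C x = - x" by (simp add: scaleC_scaleC scaleC_minus_one)
  have "g (c *\<^sub>C x) = Re c * g x + Im c * g (\<i> *\<^sub>C x)"
    by (subst c) (simp add: linear_add[OF g] linear_scale[OF g])
  moreover have "g (\<i> *\<^sub>C c *\<^sub>C x) = Re c * g (\<i> *\<^sub>C x) - Im c * g x"
    by (subst c) (simp add: scaleC_add_right scaleC_scaleR i linear_add[OF g] linear_diff[OF g] linear_neg[OF g] linear_scale[OF g])
  ultimately show "complexify g (c *\<^sub>C x) = c * complexify g x"
    by (simp add: complexify_def complex_eq_iff)
qed

lemma complex_linear_cmod_le: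
  assumes g: "complex_linear g" and N: "complex_seminorm N" and le: "\<And>x. Re (g x) \<le> N x"
  shows "cmod (g x) \<le> N x"
proof (cases "g x = 0")
  case False
  define c where "c = cnj (g x) / cmod (g x)"
  have nc: "cmod c = 1" using False by (simp add: c_def norm_divide)
  have "g (c *\<^sub>C x) = c * g x" using g by (simp add: complex_linear_def)
  also have "\<dots> = cmod (g x)"
    using False by (simp add: c_def mult.commute complex_norm_square[symmetric] power2_eq_square)
  finally have "cmod (g x) \<le> N (c *\<^sub>C x)" using le[of "c *\<^sub>C x"] by simp
  then show ?thesis using complex_seminorm_scale[OF N, of c x] nc by simp
qed (simp add: complex_seminorm_nonneg[OF N])

text \<open>The functional \<open>p'\<close> lies below the real part of \<open>f\<close> on
  \<open>V\<close>. As \<open>V\<close> is symmetric, a linear functional below \<open>p'\<close>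
  equals that real part there, and complexifying it restores \<open>f\<close>.\<close>

lemma complex_Hahn_Banach:
  fixes V :: "'b::unital_cstar_algebra set"
  assumes N: "complex_seminorm N"
    and V: "0 \<in> V" "\<And>x y. x \<in> V \<Longrightarrow> y \<in> V \<Longrightarrow> x + y \<in> V" "\<And>c x. x \<in> V \<Longrightarrow> c *\<^sub>C x \<in> V"
    and f: "\<And>x y. x \<in> V \<Longrightarrow> y \<in> V \<Longrightarrow> f (x + y) = f x + f y" "\<And>c x. x \<in> V \<Longrightarrow> f (c *\<^sub>C x) = c * f x"
    and le: "\<And>x. x \<in> V \<Longrightarrow> cmod (f x) \<le> N x"
  obtains g where "complex_linear g" "\<And>x. x \<in> V \<Longrightarrow> g x = f x" "\<And>x. cmod (g x) \<le> N x"
proof -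
  have V': "t *\<^sub>R x \<in> V" if "x \<in> V" for t x using V(3)[OF that] by (simp add: scaleR_scaleC)
  have neg: "- x \<in> V" "f (- x) = - f x" if "x \<in> V" for x
    using V(3)[OF that, of "-1"] f(2)[OF that, of "-1"] by (simp_all add: scaleC_minus_one)
  obtain p' where p': "sublinear p'" "\<And>x. p' x \<le> N x" "\<And>v. v \<in> V \<Longrightarrow> p' v \<le> Re (f v)"
  proof (rule sublinear_below_cone[OF complex_seminorm_sublinear[OF N], of V "\<lambda>x. Re (f x)"])
    fix t :: real and v assume "v \<in> V"
    then show "Re (f (t *\<^sub>R v)) = t * Re (f v)" using f(2)[of v "complex_of_real t"] by (simp add: scaleR_scaleC)
  next
    fix v assume v: "v \<in> V"
    show "- N (- v) \<le> Re (f v)" using le[OF neg(1)[OF v]] neg(2)[OF v] abs_Re_le_cmod[of "f v"] by simp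
  qed (use V V' f in auto)
  obtain g where g: "linear g" "\<And>x. g x \<le> p' x" using linear_below_sublinear[OF p'(1)] by blast
  have gf: "g v = Re (f v)" if "v \<in> V" for v
    using g(2)[of v] p'(3)[OF that] g(2)[of "-v"] p'(3)[OF neg(1)[OF that]] neg(2)[OF that]
    by (simp add: linear_neg[OF g(1)])
  have lin: "complex_linear (complexify g)" by (rule complex_linear_complexify[OF g(1)])
  moreover have "complexify g x = f x" if "x \<in> V" for x
    using gf[OF that] gf[OF V(3)[OF that, of \<i>]] f(2)[OF that, of \<i>]
    by (simp add: complexify_def complex_eq_iff)
  moreover have "cmod (complexify g x) \<le> N x" for x
    by (rule complex_linear_cmod_le[OF lin N]) (use order_trans[OF g(2) p'(2)] in simp)
  ultimately show thesis using that by blast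
qed

lemma complex_norming_functional:
  fixes a :: "'b::unital_cstar_algebra"
  obtains g where "complex_linear g" "\<And>x. cmod (g x) \<le> norm x" "g a = norm a"
proof -
  obtain h :: "'b \<Rightarrow> real" where h: "linear h" "\<And>x. h x \<le> norm x" "norm a \<le> h a"
    using linear_support_sublinear[OF complex_seminorm_sublinear[OF complex_seminorm_norm]] by blast
  have lin: "complex_linear (complexify h)" by (rule complex_linear_complexify[OF h(1)])
  have le: "cmod (complexify h x) \<le> norm x" for x
    by (rule complex_linear_cmod_le[OF lin complex_seminorm_norm]) (simp add: h(2))
  have "complexify h a = norm a"
  proof -
    have R: "Re (complexify h a) = norm a" using h(2)[of a] h(3) by simp
    then have "(Im (complexify h a))\<^sup>2 \<le> 0"
      using power_mono[OF le[of a], of 2] by (simp add: cmod_power2)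
    then show ?thesis using R by (simp add: complex_eq_iff)
  qed
  with lin le that show thesis by blast
qed

lemma complex_linear_dual:
  fixes f :: "'b::unital_cstar_algebra \<Rightarrow> complex"
  assumes "complex_linear f" "\<And>x. cmod (f x) \<le> K * norm x"
  shows "f \<in> dual UNIV"
  using assms by (auto simp: dual_def complex_linear_def)

text \<open>The number \<open>m\<close> is the norm of \<open>F\<close> relative to
  \<open>N\<close>. The seminorm may vanish at nonzero vectors, as the distance to a subspace does;
  the bound by \<open>K * N\<close> controls \<open>F\<close> there. The last clause expresses that
  \<open>m\<close> is a supremum over the unit ball, in a form that can be nested.\<close>

lemma bounded_linear_dual_seminorm:
  fixes F :: "'b::unital_cstar_algebra \<Rightarrow> real"
  assumes F: "linear F" and N: "complex_seminorm N" and le: "\<And>y. F y \<le> K * N y" and K: "0 \<le> K"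
  obtains m where "0 \<le> m" "\<And>x. cmod (complexify F x) \<le> m * N x"
    "\<And>c. (\<And>y. N y \<le> 1 \<Longrightarrow> F y \<le> c) \<Longrightarrow> m \<le> c"
proof -
  define m where "m = Sup (F ` {y. N y \<le> 1})"
  have N0: "N 0 = 0" using sublinear_zero[OF complex_seminorm_sublinear[OF N]] .
  have Nn: "0 \<le> N y" for y by (rule complex_seminorm_nonneg[OF N])
  have "F y \<le> K" if "N y \<le> 1" for y
    using le[of y] mult_left_mono[OF that K] by simp
  then have bdd: "bdd_above (F ` {y. N y \<le> 1})" by (intro bdd_aboveI2) auto
  have upper: "F y \<le> m" if "N y \<le> 1" for y unfolding m_def using that by (intro cSUP_upper[OF _ bdd]) auto
  have m0: "0 \<le> m" using upper[of 0] N0 linear_0[OF F] by simp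
  have "F y \<le> m * N y" for y
  proof (cases "N y = 0")
    case True
    with le[of y] show ?thesis by simp
  next
    case False
    with Nn[of y] have p: "N y > 0" by simp
    have "N ((1 / N y) *\<^sub>R y) = 1"
      using sublinear_scale[OF complex_seminorm_sublinear[OF N], of "1 / N y" y] p by simp
    then have "F ((1 / N y) *\<^sub>R y) \<le> m" by (intro upper) simp
    then show ?thesis using p by (simp add: linear_scale[OF F] field_simps)
  qed
  then have "cmod (complexify F x) \<le> m * N x" for x
    using complex_linear_cmod_le[OF complex_linear_complexify[OF F] complex_seminorm_scale_by[OF N m0], of x]
    by simp
  moreover have "m \<le> c" if "\<And>y. N y \<le> 1 \<Longrightarrow> F y \<le> c" for c
    unfolding m_def using that by (intro cSUP_least) (auto intro!: exI[of _ 0] simp: N0)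
  ultimately show thesis using m0 that by blast
qed

text \<open>If no point of \<open>X\<close> were as required, a functional on the threefold product, given by
  functionals \<open>\<phi>\<^sub>j\<close> with \<open>\<phi>\<^sub>1 + \<phi>\<^sub>2 + \<phi>\<^sub>3 = 0\<close> on \<open>X\<close>, would separate the diagonal of \<open>X\<close> from the box
  around \<open>(a\<^sub>1, a\<^sub>2, a\<^sub>3)\<close>, which contradicts the bounds on \<open>z\<close>.\<close>

lemma Helly_three_seminorms:
  fixes X :: "'b::unital_cstar_algebra set"
  assumes X: "0 \<in> X" "\<And>x y. x \<in> X \<Longrightarrow> y \<in> X \<Longrightarrow> x + y \<in> X" "\<And>c x. x \<in> X \<Longrightarrow> c *\<^sub>C x \<in> X"
    and N: "complex_seminorm N1" "complex_seminorm N2" "complex_seminorm N3"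
    and NK: "\<And>x. N1 x \<le> K * norm x" "\<And>x. N2 x \<le> K * norm x" "\<And>x. N3 x \<le> K * norm x"
    and z_bidual: "z \<in> bidual UNIV"
    and z_X: "\<And>\<phi>. \<phi> \<in> dual UNIV \<Longrightarrow> (\<And>x. x \<in> X \<Longrightarrow> \<phi> x = 0) \<Longrightarrow> z \<phi> = 0"
    and z1: "\<And>\<phi> m. \<phi> \<in> dual UNIV \<Longrightarrow> 0 \<le> m \<Longrightarrow> (\<And>x. cmod (\<phi> x) \<le> m * N1 x) \<Longrightarrow> cmod (z \<phi> - \<phi> a1) \<le> m * s1"
    and z2: "\<And>\<phi> m. \<phi> \<in> dual UNIV \<Longrightarrow> 0 \<le> m \<Longrightarrow> (\<And>x. cmod (\<phi> x) \<le> m * N2 x) \<Longrightarrow> cmod (z \<phi> - \<phi> a2) \<le> m * s2"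
    and z3: "\<And>\<phi> m. \<phi> \<in> dual UNIV \<Longrightarrow> 0 \<le> m \<Longrightarrow> (\<And>x. cmod (\<phi> x) \<le> m * N3 x) \<Longrightarrow> cmod (z \<phi> - \<phi> a3) \<le> m * s3"
    and r: "s1 < r1" "s2 < r2" "s3 < r3" "0 < r1" "0 < r2" "0 < r3"
  obtains x where "x \<in> X" "N1 (x - a1) < r1" "N2 (x - a2) < r2" "N3 (x - a3) < r3"
proof (rule ccontr)
  assume "\<not> thesis"
  then have far: "r1 \<le> N1 (x - a1) \<or> r2 \<le> N2 (x - a2) \<or> r3 \<le> N3 (x - a3)" if "x \<in> X" for x
    using that that by (meson linorder_not_le \<open>\<And>x. \<lbrakk>x \<in> X; N1 (x - a1) < r1; N2 (x - a2) < r2; N3 (x - a3) < r3\<rbrakk> \<Longrightarrow> thesis\<close>)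
  note sl = complex_seminorm_sublinear[OF N(1)] complex_seminorm_sublinear[OF N(2)] complex_seminorm_sublinear[OF N(3)]
  define p :: "'b \<times> 'b \<times> 'b \<Rightarrow> real"
    where "p = (\<lambda>(x, y, w). max (N1 x / r1) (max (N2 y / r2) (N3 w / r3)))"
  have p: "sublinear p" unfolding sublinear_def
  proof (intro conjI allI impI)
    fix u v :: "'b \<times> 'b \<times> 'b"
    obtain x y w x' y' w' where uv: "u = (x, y, w)" "v = (x', y', w')" by (metis surj_pair)
    have "N1 (x + x') / r1 \<le> N1 x / r1 + N1 x' / r1" "N2 (y + y') / r2 \<le> N2 y / r2 + N2 y' / r2"
      "N3 (w + w') / r3 \<le> N3 w / r3 + N3 w' / r3"
      using sl[THEN sublinear_add] r(4-6) by (simp_all add: divide_right_mono flip: add_divide_distrib)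
    then show "p (u + v) \<le> p u + p v" unfolding uv p_def by (simp add: max_def)
  next
    fix t :: real and u :: "'b \<times> 'b \<times> 'b" assume t: "0 \<le> t"
    obtain x y w where u: "u = (x, y, w)" by (metis surj_pair)
    have mx: "t * max a b = max (t * a) (t * b)" for a b using t by (simp add: max_mult_distrib_left)
    show "p (t *\<^sub>R u) = t * p u" unfolding u p_def
      by (simp add: sublinear_scale[OF sl(1) t] sublinear_scale[OF sl(2) t] sublinear_scale[OF sl(3) t] mx)
  qed
  let ?D = "(\<lambda>x. (x, x, x)) ` X"
  have pn: "0 \<le> p v" for v
    using complex_seminorm_nonneg[OF N(1), of "fst v"] r(4) by (auto simp: p_def le_max_iff_disj split: prod.splits)
  obtain p' where p': "sublinear p'" "\<And>v. p' v \<le> p v" "\<And>v. v \<in> ?D \<Longrightarrow> p' v \<le> 0"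
    "\<And>v c. (\<And>d. d \<in> ?D \<Longrightarrow> c \<le> p (v - d) + 0) \<Longrightarrow> c \<le> p' v"
  proof (rule sublinear_below_cone[OF p, of ?D "\<lambda>_. 0"])
    show "0 \<in> ?D" using X(1) by (auto simp: zero_prod_def)
    show "u + v \<in> ?D" if "u \<in> ?D" "v \<in> ?D" for u v using that X(2) by auto
    show "t *\<^sub>R v \<in> ?D" if "v \<in> ?D" for t v using that X(3)[of _ "complex_of_real t"] by (auto simp: scaleR_scaleC)
  qed (use pn in auto)
  obtain g where g: "linear g" "\<And>v. g v \<le> p' v" "p' (- (a1, a2, a3)) \<le> g (- (a1, a2, a3))"
    using linear_support_sublinear[OF p'(1)] by blast
  \<comment> \<open>The failure of the conclusion says that the gauge \<open>p\<close> of the box is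
    at least 1 on all differences to the diagonal of \<open>X\<close>; so the infimum
    \<open>p'\<close> is at least 1 as well.\<close>
  have "1 \<le> p' (- (a1, a2, a3))"
  proof (rule p'(4))
    fix d assume "d \<in> ?D"
    then obtain x where x: "x \<in> X" "d = (x, x, x)" by blast
    have mX: "- x \<in> X" using X(3)[OF x(1), of "-1"] by (simp add: scaleC_minus_one)
    have "- (a1, a2, a3) - d = (- x - a1, - x - a2, - x - a3)" by (simp add: x)
    then show "1 \<le> p (- (a1, a2, a3) - d) + 0" using far[OF mX] r(4-6)
      by (auto simp: p_def le_max_iff_disj)
  qed
  then have ga: "g (a1, a2, a3) \<le> - 1" using g(3) linear_neg[OF g(1), of "(a1, a2, a3)"] by simp
  define F1 F2 F3 where "F1 y = g (y, 0, 0)" and "F2 y = g (0, y, 0)" and "F3 y = g (0, 0, y)" for y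
  have gF: "g (x, y, w) = F1 x + F2 y + F3 w" for x y w
    using linear_add[OF g(1), of "(x, 0, 0)" "(0, y, w)"] linear_add[OF g(1), of "(0, y, 0)" "(0, 0, w)"]
    by (simp add: F1_def F2_def F3_def)
  have sc: "g (t *\<^sub>R x, t *\<^sub>R y, t *\<^sub>R w) = t * g (x, y, w)" for t x y w
    using linear_scale[OF g(1), of t "(x, y, w)"] by simp
  have lF: "linear F1" "linear F2" "linear F3"
    unfolding F1_def F2_def F3_def
    using sc[of _ _ 0 0] sc[of _ 0 _ 0] sc[of _ 0 0]
    by (auto intro!: linearI simp flip: linear_add[OF g(1)])
  have gp: "F1 x + F2 y + F3 w \<le> p (x, y, w)" for x y w
    using g(2)[of "(x, y, w)"] p'(2)[of "(x, y, w)"] gF by simp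
  have N0: "N1 0 = 0" "N2 0 = 0" "N3 0 = 0" and F0: "F1 0 = 0" "F2 0 = 0" "F3 0 = 0"
    using sl[THEN sublinear_zero] lF[THEN linear_0] by auto
  have nn: "0 \<le> N1 y / r1" "0 \<le> N2 y / r2" "0 \<le> N3 y / r3" for y
    using r(4-6) N[THEN complex_seminorm_nonneg, of y] by auto
  have b: "F1 y \<le> (1/r1) * N1 y" "F2 y \<le> (1/r2) * N2 y" "F3 y \<le> (1/r3) * N3 y" for y
    using gp[of y 0 0] gp[of 0 y 0] gp[of 0 0 y] nn[of y]
    by (simp_all add: p_def N0 F0 max_absorb1 max_absorb2)
  obtain m1 where m1: "0 \<le> m1" "\<And>x. cmod (complexify F1 x) \<le> m1 * N1 x"
    "\<And>c. (\<And>y. N1 y \<le> 1 \<Longrightarrow> F1 y \<le> c) \<Longrightarrow> m1 \<le> c"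
    using bounded_linear_dual_seminorm[OF lF(1) N(1) b(1)] r(4) by auto
  obtain m2 where m2: "0 \<le> m2" "\<And>x. cmod (complexify F2 x) \<le> m2 * N2 x"
    "\<And>c. (\<And>y. N2 y \<le> 1 \<Longrightarrow> F2 y \<le> c) \<Longrightarrow> m2 \<le> c"
    using bounded_linear_dual_seminorm[OF lF(2) N(2) b(2)] r(5) by auto
  obtain m3 where m3: "0 \<le> m3" "\<And>x. cmod (complexify F3 x) \<le> m3 * N3 x"
    "\<And>c. (\<And>y. N3 y \<le> 1 \<Longrightarrow> F3 y \<le> c) \<Longrightarrow> m3 \<le> c"
    using bounded_linear_dual_seminorm[OF lF(3) N(3) b(3)] r(6) by auto
  have unit: "r1 * F1 x + r2 * F2 y + r3 * F3 w \<le> 1" if "N1 x \<le> 1" "N2 y \<le> 1" "N3 w \<le> 1" for x y w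
  proof -
    have "p (r1 *\<^sub>R x, r2 *\<^sub>R y, r3 *\<^sub>R w) \<le> 1"
      using that r(4-6) by (simp add: p_def sl[THEN sublinear_scale])
    then show ?thesis
      using gp[of "r1 *\<^sub>R x" "r2 *\<^sub>R y" "r3 *\<^sub>R w"] by (simp add: lF[THEN linear_scale])
  qed
  \<comment> \<open>The dual norm of a maximum of seminorms is the sum of the dual norms: the
    arguments of \<open>F1\<close>, \<open>F2\<close> and \<open>F3\<close> vary independently, so
    the three suprema can be taken one inside the other.\<close>
  have "m1 \<le> (1 - r2 * m2 - r3 * m3) / r1"
  proof (rule m1(3))
    fix x assume x: "N1 x \<le> 1"
    have "m2 \<le> (1 - r1 * F1 x - r3 * m3) / r2"
    proof (rule m2(3))
      fix y assume y: "N2 y \<le> 1"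
      have "m3 \<le> (1 - r1 * F1 x - r2 * F2 y) / r3"
        by (rule m3(3)) (use unit[OF x y] r(6) in \<open>simp add: field_simps\<close>)
      then show "F2 y \<le> (1 - r1 * F1 x - r3 * m3) / r2" using r(5,6) by (simp add: field_simps)
    qed
    then show "F1 x \<le> (1 - r2 * m2 - r3 * m3) / r1" using r(4,5) by (simp add: field_simps)
  qed
  then have rm: "m1 * r1 + m2 * r2 + m3 * r3 \<le> 1" using r(4) by (simp add: field_simps)
  have cl: "complex_linear (complexify F1)" "complex_linear (complexify F2)" "complex_linear (complexify F3)"
    using lF[THEN complex_linear_complexify] by auto
  have d1: "complexify F1 \<in> dual UNIV"
    by (rule complex_linear_dual[OF cl(1), of "m1 * K"])
       (use m1(2) mult_left_mono[OF NK(1) m1(1)] order_trans in \<open>fastforce simp: mult.assoc\<close>)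
  have d2: "complexify F2 \<in> dual UNIV"
    by (rule complex_linear_dual[OF cl(2), of "m2 * K"])
       (use m2(2) mult_left_mono[OF NK(2) m2(1)] order_trans in \<open>fastforce simp: mult.assoc\<close>)
  have d3: "complexify F3 \<in> dual UNIV"
    by (rule complex_linear_dual[OF cl(3), of "m3 * K"])
       (use m3(2) mult_left_mono[OF NK(3) m3(1)] order_trans in \<open>fastforce simp: mult.assoc\<close>)
  have sumd: "(\<lambda>x. f x + h x) \<in> dual UNIV" if "f \<in> dual UNIV" "h \<in> dual UNIV" for f h :: "'b \<Rightarrow> complex"
  proof -
    from that obtain A B where "\<And>x. cmod (f x) \<le> A * norm x" "\<And>x. cmod (h x) \<le> B * norm x"
      by (auto simp: dual_def)
    then have "cmod (f x + h x) \<le> (A + B) * norm x" for x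
      by (metis add_mono distrib_right norm_triangle_le)
    then have "\<exists>K. \<forall>x. cmod (f x + h x) \<le> K * norm x" by blast
    then show ?thesis using that by (simp add: dual_def distrib_left)
  qed
  define \<phi> where "\<phi> x = (complexify F1 x + complexify F2 x) + complexify F3 x" for x
  have dphi: "\<phi> \<in> dual UNIV" unfolding \<phi>_def by (intro sumd d1 d2 d3)
  have gX: "g (x, x, x) = 0" if "x \<in> X" for x
  proof -
    have "- x \<in> X" using X(3)[OF that, of "-1"] by (simp add: scaleC_minus_one)
    then have "g (- x, - x, - x) \<le> 0" using g(2)[of "(-x, -x, -x)"] p'(3)[of "(-x, -x, -x)"] by simp
    moreover have "g (- x, - x, - x) = - g (x, x, x)" using linear_neg[OF g(1), of "(x, x, x)"] by simp
    moreover have "g (x, x, x) \<le> 0" using g(2)[of "(x, x, x)"] p'(3)[of "(x, x, x)"] that by simp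
    ultimately show ?thesis by simp
  qed
  have "\<phi> x = 0" if "x \<in> X" for x
    using gX[OF that] gX[OF X(3)[OF that, of \<i>]] by (simp add: \<phi>_def complexify_def complex_eq_iff gF)
  then have "z \<phi> = 0" by (intro z_X dphi)
  moreover have "z \<phi> = z (complexify F1) + z (complexify F2) + z (complexify F3)"
    unfolding \<phi>_def using z_bidual d1 d2 d3 sumd by (simp add: bidual_def)
  moreover have "Re (complexify F1 a1 + complexify F2 a2 + complexify F3 a3) \<le> - 1" using ga by (simp add: gF)
  ultimately have "1 \<le> Re (z (complexify F1) - complexify F1 a1) + Re (z (complexify F2) - complexify F2 a2)
      + Re (z (complexify F3) - complexify F3 a3)"
    by (simp add: complex_eq_iff)
  also have "\<dots> \<le> m1 * s1 + m2 * s2 + m3 * s3"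
    using z1[OF d1 m1(1,2)] z2[OF d2 m2(1,2)] z3[OF d3 m3(1,2)] complex_Re_le_cmod
    by (intro add_mono) (blast intro: order_trans)+
  finally have one: "1 \<le> m1 * s1 + m2 * s2 + m3 * s3" .
  \<comment> \<open>Each \<open>s\<close> is strictly below its \<open>r\<close>. The sums are
    squeezed to equality, which is possible only if all three norms vanish, and then the lower bound
    1 fails.\<close>
  have le: "m1 * s1 \<le> m1 * r1" "m2 * s2 \<le> m2 * r2" "m3 * s3 \<le> m3 * r3"
    using r m1(1) m2(1) m3(1) by (auto intro: mult_left_mono)
  then have "m1 * s1 = m1 * r1" "m2 * s2 = m2 * r2" "m3 * s3 = m3 * r3" using one rm by linarith+
  then have "m1 = 0" "m2 = 0" "m3 = 0" using r by auto
  with one show False by simp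
qed

section \<open>Duals and biduals of C*-subalgebras\<close>

lemma cnj_div_cmod_mult: "z \<noteq> 0 \<Longrightarrow> cnj z / complex_of_real (cmod z) * z = complex_of_real (cmod z)"
proof -
  assume "z \<noteq> 0"
  moreover have "cnj z * z = complex_of_real (cmod z) * complex_of_real (cmod z)"
    using complex_norm_square[of z] by (simp add: power2_eq_square mult.commute)
  ultimately show ?thesis by (simp add: field_simps)
qed

abbreviation (input) functional_scale :: "complex \<Rightarrow> ('b \<Rightarrow> complex) \<Rightarrow> 'b \<Rightarrow> complex"  (infixr "*\<^sub>\<phi>" 75) where
  "c *\<^sub>\<phi> f \<equiv> (\<lambda>x. c * f x)"

notation bidual_star  ("_\<^sup>\<star>" [1000] 1000)

text \<open>The locale is used for the whole algebra, as \<open>U\<close>, and for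
  \<open>B0 q\<close>, as \<open>B\<close>, so that biduals and absolute values of functionals are
  treated once for both.\<close>

locale cstar_subalgebra =
  fixes S :: "'b::unital_cstar_algebra set"
  assumes closed_S: "closed S" and subalgebra: "complex_subalgebra S"
    and one_S [simp]: "1 \<in> S" and star_S [simp]: "x \<in> S \<Longrightarrow> star x \<in> S"
begin

lemma zero_S [simp]: "0 \<in> S"
  and add_S [simp]: "x \<in> S \<Longrightarrow> y \<in> S \<Longrightarrow> x + y \<in> S"
  and scaleC_S [simp]: "x \<in> S \<Longrightarrow> c *\<^sub>C x \<in> S"
  and mult_S [simp]: "x \<in> S \<Longrightarrow> y \<in> S \<Longrightarrow> x * y \<in> S"
  using subalgebra by (auto simp: complex_subalgebra_def)

lemma scaleR_S [simp]: "x \<in> S \<Longrightarrow> r *\<^sub>R x \<in> S"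
  by (simp add: scaleR_scaleC)

lemma minus_S [simp]: "x \<in> S \<Longrightarrow> - x \<in> S"
  using scaleC_S[of x "-1"] by (simp add: scaleC_minus_one)

lemma diff_S [simp]: "x \<in> S \<Longrightarrow> y \<in> S \<Longrightarrow> x - y \<in> S"
  using add_S[of x "-y"] by simp

lemma star_S_iff [simp]: "star x \<in> S \<longleftrightarrow> x \<in> S"
  using star_S[of "star x"] by (auto simp: star_star)

lemma sqrt_S:
  assumes "cpos h" "h \<in> S"
  obtains s where "s \<in> S" "cpos s" "s * s = h"
proof -
  from cpos_sqrt[OF assms(1)] obtain s where s: "cpos s" "s * s = h"
    "\<And>V. closed V \<Longrightarrow> 1 \<in> V \<Longrightarrow> h \<in> V \<Longrightarrow> (\<And>u v. u \<in> V \<Longrightarrow> v \<in> V \<Longrightarrow> u + v \<in> V) \<Longrightarrow>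
       (\<And>r u. u \<in> V \<Longrightarrow> r *\<^sub>R u \<in> V) \<Longrightarrow> (\<And>u. u \<in> V \<Longrightarrow> u * u \<in> V) \<Longrightarrow> s \<in> V" by blast
  have "s \<in> S" by (rule s(3)[OF closed_S]) (auto simp: assms(2))
  with s that show thesis by blast
qed

section \<open>Functionals on a subalgebra\<close>

lemma dual_add: "\<phi> \<in> dual S \<Longrightarrow> x \<in> S \<Longrightarrow> y \<in> S \<Longrightarrow> \<phi> (x + y) = \<phi> x + \<phi> y"
  and dual_scaleC: "\<phi> \<in> dual S \<Longrightarrow> x \<in> S \<Longrightarrow> \<phi> (c *\<^sub>C x) = c * \<phi> x"
  and dual_outside: "\<phi> \<in> dual S \<Longrightarrow> x \<notin> S \<Longrightarrow> \<phi> x = 0"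
  by (auto simp: dual_def)

lemma dual_zero: "\<phi> \<in> dual S \<Longrightarrow> \<phi> 0 = 0"
  using dual_scaleC[of \<phi> 0 0] by simp

lemma dual_minus: "\<phi> \<in> dual S \<Longrightarrow> x \<in> S \<Longrightarrow> \<phi> (- x) = - \<phi> x"
  using dual_scaleC[of \<phi> x "-1"] by (simp add: scaleC_minus_one)

lemma dual_diff: "\<phi> \<in> dual S \<Longrightarrow> x \<in> S \<Longrightarrow> y \<in> S \<Longrightarrow> \<phi> (x - y) = \<phi> x - \<phi> y"
  using dual_add[of \<phi> x "-y"] dual_minus[of \<phi> y] by simp

lemma dual_scaleR: "\<phi> \<in> dual S \<Longrightarrow> x \<in> S \<Longrightarrow> \<phi> (r *\<^sub>R x) = of_real r * \<phi> x"
  by (simp add: scaleR_scaleC dual_scaleC)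

lemmas dual_simps = dual_add dual_scaleC dual_zero dual_minus dual_diff dual_scaleR

lemma dual_norm_ge:
  assumes "\<phi> \<in> dual S" "x \<in> S"
  shows "cmod (\<phi> x) \<le> dual_norm S \<phi> * norm x"
proof (cases "x = 0")
  case False
  obtain K where K: "\<And>x. x \<in> S \<Longrightarrow> cmod (\<phi> x) \<le> K * norm x" using assms(1) unfolding dual_def by blast
  have "cmod (\<phi> x) \<le> \<bar>K\<bar>" if "x \<in> S" "norm x \<le> 1" for x
  proof -
    have "cmod (\<phi> x) \<le> \<bar>K\<bar> * norm x" using K[OF that(1)] by (meson abs_ge_self mult_right_mono norm_ge_zero order_trans)
    also have "\<dots> \<le> \<bar>K\<bar> * 1" by (intro mult_left_mono that(2)) simp
    finally show ?thesis by simp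
  qed
  then have bdd: "bdd_above {cmod (\<phi> x) |x. x \<in> S \<and> norm x \<le> 1}" by (intro bdd_aboveI) blast
  define y where "y = (1 / norm x) *\<^sub>R x"
  have "y \<in> S" "norm y \<le> 1" using assms False by (simp_all add: y_def)
  then have "cmod (\<phi> y) \<le> dual_norm S \<phi>" unfolding dual_norm_def by (intro cSup_upper[OF _ bdd]) blast
  moreover have "cmod (\<phi> y) = cmod (\<phi> x) / norm x" by (simp add: y_def dual_scaleR assms norm_mult norm_divide)
  ultimately show ?thesis using False by (simp add: field_simps)
qed (simp add: dual_zero assms)

lemma dual_norm_le:
  assumes "0 \<le> K" "\<And>x. x \<in> S \<Longrightarrow> cmod (\<phi> x) \<le> K * norm x"
  shows "dual_norm S \<phi> \<le> K"
  unfolding dual_norm_def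
proof (rule cSup_least)
  fix r assume "r \<in> {cmod (\<phi> x) |x. x \<in> S \<and> norm x \<le> 1}"
  then obtain x where x: "x \<in> S" "norm x \<le> 1" "r = cmod (\<phi> x)" by blast
  then show "r \<le> K" using assms(2)[OF x(1)] mult_left_mono[OF x(2) assms(1)] by simp
qed (auto intro!: exI[of _ 0])

lemma dual_norm_nonneg: assumes "\<phi> \<in> dual S" shows "0 \<le> dual_norm S \<phi>"
proof -
  have "0 \<le> dual_norm S \<phi> * norm (1::'b)" by (meson dual_norm_ge[OF assms one_S] norm_ge_zero order_trans)
  then show ?thesis by simp
qed

lemma dual_norm_attained:
  assumes "\<phi> \<in> dual S" "0 < e"
  obtains x where "x \<in> S" "norm x \<le> 1" "dual_norm S \<phi> - e \<le> Re (\<phi> x)"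
proof -
  let ?A = "{cmod (\<phi> x) |x. x \<in> S \<and> norm x \<le> 1}"
  have "cmod (\<phi> 0) \<in> ?A" by (intro CollectI exI[of _ 0] conjI) auto
  then have ne: "?A \<noteq> {}" by blast
  have "dual_norm S \<phi> - e < Sup ?A" using assms(2) unfolding dual_norm_def by simp
  then have "\<exists>r\<in>?A. dual_norm S \<phi> - e < r" using ne by (rule less_cSupD[rotated])
  then obtain x where x: "x \<in> S" "norm x \<le> 1" "dual_norm S \<phi> - e < cmod (\<phi> x)" by blast
  show thesis
  proof (cases "\<phi> x = 0")
    case True
    show ?thesis by (rule that[OF x(1,2)]) (use True x(3) in simp)
  next
    case False
    define c where "c = cnj (\<phi> x) / cmod (\<phi> x)"
    have nc: "cmod c = 1" using False by (simp add: c_def norm_divide)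
    have e: "\<phi> (c *\<^sub>C x) = cmod (\<phi> x)"
      unfolding c_def dual_scaleC[OF assms(1) x(1)] by (rule cnj_div_cmod_mult[OF False])
    show ?thesis by (rule that[of "c *\<^sub>C x"]) (use x nc e in \<open>simp_all add: norm_scaleC\<close>)
  qed
qed

lemma dualI:
  assumes "\<And>x y. x \<in> S \<Longrightarrow> y \<in> S \<Longrightarrow> \<phi> (x + y) = \<phi> x + \<phi> y"
    and "\<And>c x. x \<in> S \<Longrightarrow> \<phi> (c *\<^sub>C x) = c * \<phi> x"
    and "\<And>x. x \<in> S \<Longrightarrow> cmod (\<phi> x) \<le> K * norm x"
    and "\<And>x. x \<notin> S \<Longrightarrow> \<phi> x = 0"
  shows "\<phi> \<in> dual S"
  unfolding dual_def using assms by (intro CollectI conjI) blast+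

lemma dual_eqI: "\<phi> \<in> dual S \<Longrightarrow> \<psi> \<in> dual S \<Longrightarrow> (\<And>x. x \<in> S \<Longrightarrow> \<phi> x = \<psi> x) \<Longrightarrow> \<phi> = \<psi>"
  by (rule ext) (metis dual_outside)

lemma dual_plus [simp]: assumes "\<phi> \<in> dual S" "\<psi> \<in> dual S" shows "(\<lambda>x. \<phi> x + \<psi> x) \<in> dual S"
proof (rule dualI[where K = "dual_norm S \<phi> + dual_norm S \<psi>"])
  fix x assume "x \<in> S"
  then show "cmod (\<phi> x + \<psi> x) \<le> (dual_norm S \<phi> + dual_norm S \<psi>) * norm x"
    using assms by (metis add_mono distrib_right dual_norm_ge norm_triangle_le)
qed (use assms in \<open>auto simp: dual_simps dual_outside algebra_simps\<close>)

lemma dual_cmult [simp]: assumes "\<phi> \<in> dual S" shows "c *\<^sub>\<phi> \<phi> \<in> dual S"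
proof (rule dualI[where K = "cmod c * dual_norm S \<phi>"])
  fix x assume "x \<in> S"
  then show "cmod (c * \<phi> x) \<le> cmod c * dual_norm S \<phi> * norm x"
    using mult_left_mono[OF dual_norm_ge[OF assms], of x "cmod c"] by (simp add: norm_mult mult.assoc)
qed (use assms in \<open>auto simp: dual_simps dual_outside algebra_simps\<close>)

lemma dual_zero_in [simp]: "(\<lambda>_. 0) \<in> dual S"
  by (rule dualI[where K = 0]) auto

lemma dual_minus_in [simp]: assumes "\<phi> \<in> dual S" "\<psi> \<in> dual S" shows "(\<lambda>x. \<phi> x - \<psi> x) \<in> dual S"
  using dual_plus[OF assms(1) dual_cmult[OF assms(2), of "-1"]] by simp

lemma dual_uminus_in [simp]: "\<phi> \<in> dual S \<Longrightarrow> (\<lambda>x. - \<phi> x) \<in> dual S"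
  using dual_cmult[of \<phi> "-1"] by simp

text \<open>\<open>lm a \<phi>\<close> and \<open>rm b \<phi>\<close> are \<open>\<phi> (a \<cdot>)\<close> and \<open>\<phi> (\<cdot> b)\<close>; \<open>bact \<theta> \<phi>\<close> and \<open>lact \<theta> \<phi>\<close> extend these
  module actions to \<open>\<theta>\<close> in the bidual, as \<open>\<phi> (\<cdot> \<theta>)\<close> and \<open>\<phi> (\<theta> \<cdot>)\<close>.\<close>

definition lm :: "'b \<Rightarrow> 'b functional \<Rightarrow> 'b functional" where
  "lm a \<phi> = (\<lambda>x. if x \<in> S then \<phi> (a * x) else 0)"

definition rm :: "'b \<Rightarrow> 'b functional \<Rightarrow> 'b functional" where
  "rm b \<phi> = (\<lambda>x. if x \<in> S then \<phi> (x * b) else 0)"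

definition dstar :: "'b functional \<Rightarrow> 'b functional" where
  "dstar \<phi> = (\<lambda>x. cnj (\<phi> (star x)))"

definition bact :: "'b bifunctional \<Rightarrow> 'b functional \<Rightarrow> 'b functional" where
  "bact \<theta> \<phi> = (\<lambda>a. if a \<in> S then \<theta> (lm a \<phi>) else 0)"

definition lact :: "'b bifunctional \<Rightarrow> 'b functional \<Rightarrow> 'b functional" where
  "lact \<theta> \<phi> = (\<lambda>b. if b \<in> S then \<theta> (rm b \<phi>) else 0)"

lemma lm_apply [simp]: "x \<in> S \<Longrightarrow> lm a \<phi> x = \<phi> (a * x)"
  and rm_apply [simp]: "x \<in> S \<Longrightarrow> rm a \<phi> x = \<phi> (x * a)"
  and bact_apply [simp]: "x \<in> S \<Longrightarrow> bact \<theta> \<phi> x = \<theta> (lm x \<phi>)"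
  and lact_apply [simp]: "x \<in> S \<Longrightarrow> lact \<theta> \<phi> x = \<theta> (rm x \<phi>)"
  by (auto simp: lm_def rm_def bact_def lact_def)

lemma lm_bound:
  assumes "\<phi> \<in> dual S" "a \<in> S" "x \<in> S" shows "cmod (lm a \<phi> x) \<le> norm a * dual_norm S \<phi> * norm x"
proof -
  have "cmod (\<phi> (a * x)) \<le> dual_norm S \<phi> * norm (a * x)" using assms by (intro dual_norm_ge) auto
  also have "\<dots> \<le> dual_norm S \<phi> * (norm a * norm x)"
    by (intro mult_left_mono norm_mult_ineq dual_norm_nonneg assms)
  finally show ?thesis using assms by (simp add: algebra_simps)
qed

lemma rm_bound:
  assumes "\<phi> \<in> dual S" "a \<in> S" "x \<in> S" shows "cmod (rm a \<phi> x) \<le> norm a * dual_norm S \<phi> * norm x"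
proof -
  have "cmod (\<phi> (x * a)) \<le> dual_norm S \<phi> * norm (x * a)" using assms by (intro dual_norm_ge) auto
  also have "\<dots> \<le> dual_norm S \<phi> * (norm x * norm a)"
    by (intro mult_left_mono norm_mult_ineq dual_norm_nonneg assms)
  finally show ?thesis using assms by (simp add: algebra_simps)
qed

lemma lm_dual [simp]: assumes "\<phi> \<in> dual S" "a \<in> S" shows "lm a \<phi> \<in> dual S"
proof (rule dualI[where K = "norm a * dual_norm S \<phi>"])
  fix x assume "x \<in> S"
  then show "cmod (lm a \<phi> x) \<le> norm a * dual_norm S \<phi> * norm x" by (rule lm_bound[OF assms])
qed (use assms in \<open>auto simp: dual_simps algebra_simps mult_scaleC_right, auto simp: lm_def\<close>)

lemma rm_dual [simp]: assumes "\<phi> \<in> dual S" "a \<in> S" shows "rm a \<phi> \<in> dual S"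
proof (rule dualI[where K = "norm a * dual_norm S \<phi>"])
  fix x assume "x \<in> S"
  then show "cmod (rm a \<phi> x) \<le> norm a * dual_norm S \<phi> * norm x" by (rule rm_bound[OF assms])
qed (use assms in \<open>auto simp: dual_simps algebra_simps mult_scaleC_left, auto simp: rm_def\<close>)

lemma lm_norm: "\<phi> \<in> dual S \<Longrightarrow> a \<in> S \<Longrightarrow> dual_norm S (lm a \<phi>) \<le> norm a * dual_norm S \<phi>"
  by (intro dual_norm_le lm_bound mult_nonneg_nonneg dual_norm_nonneg) auto

lemma rm_norm: "\<phi> \<in> dual S \<Longrightarrow> a \<in> S \<Longrightarrow> dual_norm S (rm a \<phi>) \<le> norm a * dual_norm S \<phi>"
  by (intro dual_norm_le rm_bound mult_nonneg_nonneg dual_norm_nonneg) auto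

lemma dstar_dual [simp]: assumes "\<phi> \<in> dual S" shows "dstar \<phi> \<in> dual S"
proof (rule dualI[where K = "dual_norm S \<phi>"])
  fix x assume "x \<in> S"
  then show "cmod (dstar \<phi> x) \<le> dual_norm S \<phi> * norm x"
    using dual_norm_ge[OF assms, of "star x"] by (simp add: dstar_def)
qed (use assms in \<open>auto simp: dstar_def star_add star_scaleC dual_simps dual_outside\<close>)

lemma dstar_norm_le: "\<phi> \<in> dual S \<Longrightarrow> dual_norm S (dstar \<phi>) \<le> dual_norm S \<phi>"
proof (rule dual_norm_le[OF dual_norm_nonneg])
  fix x assume "x \<in> S" "\<phi> \<in> dual S"
  then show "cmod (dstar \<phi> x) \<le> dual_norm S \<phi> * norm x"
    using dual_norm_ge[of \<phi> "star x"] by (simp add: dstar_def)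
qed

lemma dstar_dstar [simp]: "dstar (dstar \<phi>) = \<phi>"
  by (simp add: dstar_def star_star)

lemma lm_lm: "a \<in> S \<Longrightarrow> b \<in> S \<Longrightarrow> lm b (lm a \<phi>) = lm (a * b) \<phi>"
  by (auto simp: lm_def fun_eq_iff mult.assoc)

section \<open>The bidual and its Arens product\<close>

lemma bidual_add: "\<eta> \<in> bidual S \<Longrightarrow> \<phi> \<in> dual S \<Longrightarrow> \<psi> \<in> dual S \<Longrightarrow> \<eta> (\<lambda>x. \<phi> x + \<psi> x) = \<eta> \<phi> + \<eta> \<psi>"
  and bidual_cmult: "\<eta> \<in> bidual S \<Longrightarrow> \<phi> \<in> dual S \<Longrightarrow> \<eta> (c *\<^sub>\<phi> \<phi>) = c * \<eta> \<phi>"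
  and bidual_outside: "\<eta> \<in> bidual S \<Longrightarrow> \<phi> \<notin> dual S \<Longrightarrow> \<eta> \<phi> = 0"
  by (auto simp: bidual_def)

lemma bidual_minus: "\<eta> \<in> bidual S \<Longrightarrow> \<phi> \<in> dual S \<Longrightarrow> \<psi> \<in> dual S \<Longrightarrow> \<eta> (\<lambda>x. \<phi> x - \<psi> x) = \<eta> \<phi> - \<eta> \<psi>"
  using bidual_add[of \<eta> \<phi> "(-1) *\<^sub>\<phi> \<psi>"] bidual_cmult[of \<eta> \<psi> "-1"] by simp

text \<open>This is membership in the ball of radius \<open>K\<close> of the bidual. A predicate
  passes through products and limits more easily than the supremum \<open>bidual_norm\<close>; the
  two are linked by \<open>bidual_norm_ge\<close> and \<open>bidual_norm_le\<close>.\<close>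

definition bbound :: "real \<Rightarrow> 'b bifunctional \<Rightarrow> bool" where
  "bbound K \<eta> \<longleftrightarrow> 0 \<le> K \<and> (\<forall>\<phi>\<in>dual S. cmod (\<eta> \<phi>) \<le> K * dual_norm S \<phi>)"

lemma bidual_bbound: assumes "\<eta> \<in> bidual S" obtains K where "bbound K \<eta>"
proof -
  obtain K where K: "\<And>\<phi>. \<phi> \<in> dual S \<Longrightarrow> cmod (\<eta> \<phi>) \<le> K * dual_norm S \<phi>"
    using assms unfolding bidual_def by blast
  have "bbound \<bar>K\<bar> \<eta>" unfolding bbound_def
    by (meson K abs_ge_self abs_ge_zero dual_norm_nonneg mult_right_mono order_trans)
  then show thesis by (rule that)
qed

lemma bbound_apply: "bbound K \<eta> \<Longrightarrow> \<phi> \<in> dual S \<Longrightarrow> cmod (\<eta> \<phi>) \<le> K * dual_norm S \<phi>"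
  and bbound_nonneg: "bbound K \<eta> \<Longrightarrow> 0 \<le> K"
  by (auto simp: bbound_def)

lemma bbound_le:
  assumes "bbound K \<eta>" "\<phi> \<in> dual S" "0 \<le> c" "\<And>x. x \<in> S \<Longrightarrow> cmod (\<phi> x) \<le> c * norm x"
  shows "cmod (\<eta> \<phi>) \<le> K * c"
  by (rule order_trans[OF bbound_apply[OF assms(1,2)]])
     (intro mult_left_mono dual_norm_le assms bbound_nonneg[OF assms(1)])

lemma bidualI:
  assumes "\<And>\<phi> \<psi>. \<phi> \<in> dual S \<Longrightarrow> \<psi> \<in> dual S \<Longrightarrow> \<eta> (\<lambda>x. \<phi> x + \<psi> x) = \<eta> \<phi> + \<eta> \<psi>"
    and "\<And>c \<phi>. \<phi> \<in> dual S \<Longrightarrow> \<eta> (c *\<^sub>\<phi> \<phi>) = c * \<eta> \<phi>"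
    and "\<And>\<phi>. \<phi> \<in> dual S \<Longrightarrow> cmod (\<eta> \<phi>) \<le> K * dual_norm S \<phi>"
    and "\<And>\<phi>. \<phi> \<notin> dual S \<Longrightarrow> \<eta> \<phi> = 0"
  shows "\<eta> \<in> bidual S"
  unfolding bidual_def using assms by (intro CollectI conjI) blast+

lemma bidual_eqI: "\<eta> \<in> bidual S \<Longrightarrow> \<theta> \<in> bidual S \<Longrightarrow> (\<And>\<phi>. \<phi> \<in> dual S \<Longrightarrow> \<eta> \<phi> = \<theta> \<phi>) \<Longrightarrow> \<eta> = \<theta>"
  by (rule ext) (metis bidual_outside)

lemma bidual_plus [simp]: assumes "\<eta> \<in> bidual S" "\<theta> \<in> bidual S" shows "\<eta> + \<theta> \<in> bidual S"
proof -
  obtain K L where "bbound K \<eta>" "bbound L \<theta>" using assms by (meson bidual_bbound)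
  then have "cmod (\<eta> \<phi> + \<theta> \<phi>) \<le> (K + L) * dual_norm S \<phi>" if "\<phi> \<in> dual S" for \<phi>
    by (metis add_mono bbound_apply distrib_right norm_triangle_le that)
  then show ?thesis
    by (intro bidualI[where K = "K + L"])
       (use assms in \<open>auto simp: bidual_add bidual_cmult bidual_outside algebra_simps\<close>)
qed

lemma bidual_scale [simp]: assumes "\<eta> \<in> bidual S" shows "c *\<^sub>\<phi> \<eta> \<in> bidual S"
proof -
  obtain K where K: "bbound K \<eta>" using assms by (meson bidual_bbound)
  have "cmod (c * \<eta> \<phi>) \<le> cmod c * K * dual_norm S \<phi>" if "\<phi> \<in> dual S" for \<phi>
    using mult_left_mono[OF bbound_apply[OF K that], of "cmod c"] by (simp add: norm_mult mult.assoc)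
  then show ?thesis
    by (intro bidualI[where K = "cmod c * K"])
       (use assms in \<open>auto simp: bidual_add bidual_cmult bidual_outside algebra_simps\<close>)
qed

lemma bidual_diff [simp]: assumes "\<eta> \<in> bidual S" "\<theta> \<in> bidual S" shows "\<eta> - \<theta> \<in> bidual S"
  using bidual_plus[OF assms(1) bidual_scale[OF assms(2), of "-1"]]
  by (simp add: plus_fun_def fun_diff_def)

lemma bidual_zero [simp]: "0 \<in> bidual S"
  by (rule bidualI[where K = 0]) auto

lemma canon_apply [simp]: "\<phi> \<in> dual S \<Longrightarrow> canon S b \<phi> = \<phi> b"
  by (simp add: canon_def)

lemma bbound_canon: "b \<in> S \<Longrightarrow> bbound (norm b) (canon S b)"
  using dual_norm_ge[of _ b] by (auto simp: bbound_def mult.commute)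

lemma canon_bidual [simp]: assumes "b \<in> S" shows "canon S b \<in> bidual S"
  by (rule bidualI[where K = "norm b"]) (use assms bbound_canon[OF assms] in \<open>auto simp: bbound_def canon_def\<close>)

lemma bact_bound:
  assumes "bbound K \<theta>" "\<phi> \<in> dual S" "a \<in> S"
  shows "cmod (bact \<theta> \<phi> a) \<le> K * dual_norm S \<phi> * norm a"
proof -
  have "cmod (\<theta> (lm a \<phi>)) \<le> K * (norm a * dual_norm S \<phi>)"
    using order_trans[OF bbound_apply[OF assms(1) lm_dual[OF assms(2,3)]] mult_left_mono[OF lm_norm[OF assms(2,3)] bbound_nonneg[OF assms(1)]]] .
  then show ?thesis using assms by (simp add: algebra_simps)
qed

lemma lact_bound:
  assumes "bbound K \<theta>" "\<phi> \<in> dual S" "a \<in> S"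
  shows "cmod (lact \<theta> \<phi> a) \<le> K * dual_norm S \<phi> * norm a"
proof -
  have "cmod (\<theta> (rm a \<phi>)) \<le> K * (norm a * dual_norm S \<phi>)"
    using order_trans[OF bbound_apply[OF assms(1) rm_dual[OF assms(2,3)]] mult_left_mono[OF rm_norm[OF assms(2,3)] bbound_nonneg[OF assms(1)]]] .
  then show ?thesis using assms by (simp add: algebra_simps)
qed

lemma lm_linear:
  "\<phi> \<in> dual S \<Longrightarrow> a \<in> S \<Longrightarrow> b \<in> S \<Longrightarrow> lm (a + b) \<phi> = (\<lambda>x. lm a \<phi> x + lm b \<phi> x)"
  "\<phi> \<in> dual S \<Longrightarrow> a \<in> S \<Longrightarrow> lm (c *\<^sub>C a) \<phi> = c *\<^sub>\<phi> lm a \<phi>"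
  "\<phi> \<in> dual S \<Longrightarrow> \<psi> \<in> dual S \<Longrightarrow> lm a (\<lambda>x. \<phi> x + \<psi> x) = (\<lambda>x. lm a \<phi> x + lm a \<psi> x)"
  "\<phi> \<in> dual S \<Longrightarrow> lm a (c *\<^sub>\<phi> \<phi>) = c *\<^sub>\<phi> lm a \<phi>"
  by (auto simp: lm_def fun_eq_iff dual_simps algebra_simps mult_scaleC_left)

lemma rm_linear:
  "\<phi> \<in> dual S \<Longrightarrow> a \<in> S \<Longrightarrow> b \<in> S \<Longrightarrow> rm (a + b) \<phi> = (\<lambda>x. rm a \<phi> x + rm b \<phi> x)"
  "\<phi> \<in> dual S \<Longrightarrow> a \<in> S \<Longrightarrow> rm (c *\<^sub>C a) \<phi> = c *\<^sub>\<phi> rm a \<phi>"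
  "\<phi> \<in> dual S \<Longrightarrow> \<psi> \<in> dual S \<Longrightarrow> rm a (\<lambda>x. \<phi> x + \<psi> x) = (\<lambda>x. rm a \<phi> x + rm a \<psi> x)"
  "\<phi> \<in> dual S \<Longrightarrow> rm a (c *\<^sub>\<phi> \<phi>) = c *\<^sub>\<phi> rm a \<phi>"
  by (auto simp: rm_def fun_eq_iff dual_simps algebra_simps mult_scaleC_right)

lemma bact_dual [simp]: assumes "\<theta> \<in> bidual S" "\<phi> \<in> dual S" shows "bact \<theta> \<phi> \<in> dual S"
proof -
  obtain K where "bbound K \<theta>" using assms bidual_bbound by blast
  then have b: "cmod (bact \<theta> \<phi> x) \<le> K * dual_norm S \<phi> * norm x" if "x \<in> S" for x
    using assms that by (intro bact_bound)
  show ?thesis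
    by (rule dualI[OF _ _ b])
       (use assms in \<open>auto simp: lm_linear bidual_add bidual_cmult, auto simp: bact_def\<close>)
qed

lemma lact_dual [simp]: assumes "\<theta> \<in> bidual S" "\<phi> \<in> dual S" shows "lact \<theta> \<phi> \<in> dual S"
proof -
  obtain K where "bbound K \<theta>" using assms bidual_bbound by blast
  then have b: "cmod (lact \<theta> \<phi> x) \<le> K * dual_norm S \<phi> * norm x" if "x \<in> S" for x
    using assms that by (intro lact_bound)
  show ?thesis
    by (rule dualI[OF _ _ b])
       (use assms in \<open>auto simp: rm_linear bidual_add bidual_cmult, auto simp: lact_def\<close>)
qed

lemma bact_norm: "bbound K \<theta> \<Longrightarrow> \<phi> \<in> dual S \<Longrightarrow> dual_norm S (bact \<theta> \<phi>) \<le> K * dual_norm S \<phi>"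
  by (intro dual_norm_le bact_bound mult_nonneg_nonneg dual_norm_nonneg) (auto simp: bbound_nonneg)

lemma bact_linear:
  "\<theta> \<in> bidual S \<Longrightarrow> \<phi> \<in> dual S \<Longrightarrow> \<psi> \<in> dual S \<Longrightarrow> bact \<theta> (\<lambda>x. \<phi> x + \<psi> x) = (\<lambda>x. bact \<theta> \<phi> x + bact \<theta> \<psi> x)"
  "\<theta> \<in> bidual S \<Longrightarrow> \<phi> \<in> dual S \<Longrightarrow> bact \<theta> (c *\<^sub>\<phi> \<phi>) = c *\<^sub>\<phi> bact \<theta> \<phi>"
  "bact (\<theta> + \<theta>') \<phi> = (\<lambda>x. bact \<theta> \<phi> x + bact \<theta>' \<phi> x)"
  "bact (\<theta> - \<theta>') \<phi> = (\<lambda>x. bact \<theta> \<phi> x - bact \<theta>' \<phi> x)"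
  "bact (c *\<^sub>\<phi> \<theta>) \<phi> = c *\<^sub>\<phi> bact \<theta> \<phi>"
  by (auto simp: bact_def fun_eq_iff lm_linear bidual_add bidual_cmult)

lemma lact_linear:
  "\<theta> \<in> bidual S \<Longrightarrow> \<phi> \<in> dual S \<Longrightarrow> \<psi> \<in> dual S \<Longrightarrow> lact \<theta> (\<lambda>x. \<phi> x + \<psi> x) = (\<lambda>x. lact \<theta> \<phi> x + lact \<theta> \<psi> x)"
  "\<theta> \<in> bidual S \<Longrightarrow> \<phi> \<in> dual S \<Longrightarrow> lact \<theta> (c *\<^sub>\<phi> \<phi>) = c *\<^sub>\<phi> lact \<theta> \<phi>"
  by (auto simp: lact_def fun_eq_iff rm_linear bidual_add bidual_cmult)

abbreviation (input) mul :: "'b bifunctional \<Rightarrow> 'b bifunctional \<Rightarrow> 'b bifunctional"  (infixl "\<otimes>" 70) where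
  "\<eta> \<otimes> \<theta> \<equiv> arens S \<eta> \<theta>"

lemma arens_apply: "\<phi> \<in> dual S \<Longrightarrow> (\<eta> \<otimes> \<theta>) \<phi> = \<eta> (bact \<theta> \<phi>)"
  unfolding arens_def bact_def lm_def by simp

lemma arens_outside: "\<phi> \<notin> dual S \<Longrightarrow> (\<eta> \<otimes> \<theta>) \<phi> = 0"
  by (simp add: arens_def)

lemma bbound_arens:
  assumes "bbound K \<eta>" "bbound L \<theta>" "\<theta> \<in> bidual S" shows "bbound (K * L) (\<eta> \<otimes> \<theta>)"
  unfolding bbound_def
proof (intro conjI ballI)
  fix \<phi> assume p: "\<phi> \<in> dual S"
  have "cmod (\<eta> (bact \<theta> \<phi>)) \<le> K * (L * dual_norm S \<phi>)"
    using order_trans[OF bbound_apply[OF assms(1) bact_dual[OF assms(3) p]] mult_left_mono[OF bact_norm[OF assms(2) p] bbound_nonneg[OF assms(1)]]] .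
  then show "cmod ((\<eta> \<otimes> \<theta>) \<phi>) \<le> K * L * dual_norm S \<phi>" by (simp add: arens_apply p mult.assoc)
qed (use assms bbound_nonneg in auto)

lemma arens_bidual [simp]: assumes "\<eta> \<in> bidual S" "\<theta> \<in> bidual S" shows "\<eta> \<otimes> \<theta> \<in> bidual S"
proof -
  obtain K L where "bbound K \<eta>" "bbound L \<theta>" using assms by (meson bidual_bbound)
  then have "bbound (K * L) (\<eta> \<otimes> \<theta>)" using assms by (intro bbound_arens)
  then show ?thesis
    by (intro bidualI[where K = "K * L"])
       (use assms in \<open>auto simp: arens_apply bact_linear bidual_add bidual_cmult arens_outside bbound_def\<close>)
qed

lemma bact_lm: "\<phi> \<in> dual S \<Longrightarrow> a \<in> S \<Longrightarrow> bact \<theta> (lm a \<phi>) = lm a (bact \<theta> \<phi>)"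
  by (rule ext) (auto simp: bact_def lm_lm, auto simp: lm_def bact_def)

lemma bact_arens:
  "\<theta> \<in> bidual S \<Longrightarrow> \<phi> \<in> dual S \<Longrightarrow> bact (\<eta> \<otimes> \<theta>) \<phi> = bact \<eta> (bact \<theta> \<phi>)"
proof
  fix a assume "\<theta> \<in> bidual S" "\<phi> \<in> dual S"
  then show "bact (\<eta> \<otimes> \<theta>) \<phi> a = bact \<eta> (bact \<theta> \<phi>) a"
    by (cases "a \<in> S") (simp_all add: arens_apply bact_lm, simp add: bact_def)
qed

lemma arens_assoc:
  assumes "\<theta> \<in> bidual S" "\<kappa> \<in> bidual S"
  shows "(\<eta> \<otimes> \<theta>) \<otimes> \<kappa> = \<eta> \<otimes> (\<theta> \<otimes> \<kappa>)"
proof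
  fix \<phi> show "(\<eta> \<otimes> \<theta> \<otimes> \<kappa>) \<phi> = (\<eta> \<otimes> (\<theta> \<otimes> \<kappa>)) \<phi>"
    by (cases "\<phi> \<in> dual S") (use assms in \<open>simp_all add: arens_apply bact_arens arens_outside\<close>)
qed

lemma arens_add_left: "(\<eta> + \<theta>) \<otimes> \<kappa> = \<eta> \<otimes> \<kappa> + \<theta> \<otimes> \<kappa>"
  and arens_diff_left: "(\<eta> - \<theta>) \<otimes> \<kappa> = \<eta> \<otimes> \<kappa> - \<theta> \<otimes> \<kappa>"
  and arens_scale_left: "(c *\<^sub>\<phi> \<eta>) \<otimes> \<kappa> = c *\<^sub>\<phi> (\<eta> \<otimes> \<kappa>)"
  and arens_zero_left: "0 \<otimes> \<kappa> = 0"
  by (auto simp: arens_def fun_eq_iff)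

lemma arens_right:
  assumes "\<kappa> \<in> bidual S" "\<eta> \<in> bidual S" "\<theta> \<in> bidual S"
  shows arens_add_right: "\<kappa> \<otimes> (\<eta> + \<theta>) = \<kappa> \<otimes> \<eta> + \<kappa> \<otimes> \<theta>"
    and arens_diff_right: "\<kappa> \<otimes> (\<eta> - \<theta>) = \<kappa> \<otimes> \<eta> - \<kappa> \<otimes> \<theta>"
proof -
  have "(\<kappa> \<otimes> (\<eta> + \<theta>)) \<phi> = (\<kappa> \<otimes> \<eta> + \<kappa> \<otimes> \<theta>) \<phi> \<and> (\<kappa> \<otimes> (\<eta> - \<theta>)) \<phi> = (\<kappa> \<otimes> \<eta> - \<kappa> \<otimes> \<theta>) \<phi>" for \<phi>
    by (cases "\<phi> \<in> dual S")
       (use assms in \<open>simp_all add: arens_apply bact_linear bidual_add bidual_minus arens_outside\<close>)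
  then show "\<kappa> \<otimes> (\<eta> + \<theta>) = \<kappa> \<otimes> \<eta> + \<kappa> \<otimes> \<theta>" "\<kappa> \<otimes> (\<eta> - \<theta>) = \<kappa> \<otimes> \<eta> - \<kappa> \<otimes> \<theta>" by blast+
qed

lemma arens_scale_right:
  assumes "\<kappa> \<in> bidual S" "\<eta> \<in> bidual S"
  shows "\<kappa> \<otimes> (c *\<^sub>\<phi> \<eta>) = c *\<^sub>\<phi> (\<kappa> \<otimes> \<eta>)"
proof
  fix \<phi> show "(\<kappa> \<otimes> (c *\<^sub>\<phi> \<eta>)) \<phi> = c * (\<kappa> \<otimes> \<eta>) \<phi>"
    by (cases "\<phi> \<in> dual S")
       (use assms in \<open>simp_all add: arens_apply bact_linear bidual_cmult arens_outside\<close>)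
qed

lemma arens_zero_right: "\<kappa> \<in> bidual S \<Longrightarrow> \<kappa> \<otimes> 0 = 0"
  using arens_diff_right[of \<kappa> 0 0] by simp

lemma bact_canon: "\<phi> \<in> dual S \<Longrightarrow> b \<in> S \<Longrightarrow> bact (canon S b) \<phi> = rm b \<phi>"
  by (auto simp: bact_def rm_def fun_eq_iff)

lemma arens_canon: "a \<in> S \<Longrightarrow> b \<in> S \<Longrightarrow> canon S a \<otimes> canon S b = canon S (a * b)"
  by (rule bidual_eqI) (auto simp: arens_apply bact_canon)

lemma arens_one_left [simp]: assumes "\<eta> \<in> bidual S" shows "canon S 1 \<otimes> \<eta> = \<eta>"
proof -
  have "lm 1 \<phi> = \<phi>" if "\<phi> \<in> dual S" for \<phi> using that by (auto simp: lm_def fun_eq_iff dual_outside)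
  then show ?thesis using assms by (intro bidual_eqI) (auto simp: arens_apply)
qed

lemma arens_one_right [simp]: assumes "\<eta> \<in> bidual S" shows "\<eta> \<otimes> canon S 1 = \<eta>"
proof -
  have "rm 1 \<phi> = \<phi>" if "\<phi> \<in> dual S" for \<phi> using that by (auto simp: rm_def fun_eq_iff dual_outside)
  then show ?thesis using assms by (intro bidual_eqI) (auto simp: arens_apply bact_canon)
qed

lemma canon_linear:
  assumes "a \<in> S" "b \<in> S"
  shows "canon S (a + b) = canon S a + canon S b" "canon S (a - b) = canon S a - canon S b"
    "canon S (c *\<^sub>C a) = c *\<^sub>\<phi> canon S a" "canon S (r *\<^sub>R a) = of_real r *\<^sub>\<phi> canon S a"
  using assms by (auto simp: canon_def fun_eq_iff dual_simps)

lemma bstar_apply: "\<eta>\<^sup>\<star> \<phi> = cnj (\<eta> (dstar \<phi>))"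
  by (simp add: bidual_star_def dstar_def)

lemma bbound_bstar: assumes "bbound K \<eta>" shows "bbound K (\<eta>\<^sup>\<star>)"
  unfolding bbound_def
proof (intro conjI ballI)
  fix \<phi> assume p: "\<phi> \<in> dual S"
  show "cmod (\<eta>\<^sup>\<star> \<phi>) \<le> K * dual_norm S \<phi>"
    using order_trans[OF bbound_apply[OF assms dstar_dual[OF p]] mult_left_mono[OF dstar_norm_le[OF p] bbound_nonneg[OF assms]]]
    by (simp add: bstar_apply)
qed (use assms bbound_nonneg in auto)

lemma bstar_bidual [simp]: assumes "\<eta> \<in> bidual S" shows "\<eta>\<^sup>\<star> \<in> bidual S"
proof -
  obtain K where "bbound K \<eta>" using assms by (meson bidual_bbound)
  then have K: "bbound K (\<eta>\<^sup>\<star>)" by (rule bbound_bstar)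
  show ?thesis
  proof (rule bidualI[where K = K])
    fix \<phi> \<psi> assume "\<phi> \<in> dual S" "\<psi> \<in> dual S"
    moreover have "dstar (\<lambda>x. \<phi> x + \<psi> x) = (\<lambda>x. dstar \<phi> x + dstar \<psi> x)" by (simp add: dstar_def)
    ultimately show "\<eta>\<^sup>\<star> (\<lambda>x. \<phi> x + \<psi> x) = \<eta>\<^sup>\<star> \<phi> + \<eta>\<^sup>\<star> \<psi>"
      using assms by (simp add: bstar_apply bidual_add)
  next
    fix c \<phi> assume "\<phi> \<in> dual S"
    moreover have "dstar (c *\<^sub>\<phi> \<phi>) = cnj c *\<^sub>\<phi> dstar \<phi>" by (simp add: dstar_def)
    ultimately show "\<eta>\<^sup>\<star> (c *\<^sub>\<phi> \<phi>) = c * \<eta>\<^sup>\<star> \<phi>"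
      using assms by (simp add: bstar_apply bidual_cmult)
  next
    fix \<phi> assume "\<phi> \<notin> dual S"
    then have "dstar \<phi> \<notin> dual S" using dstar_dual[of "dstar \<phi>"] by auto
    then show "\<eta>\<^sup>\<star> \<phi> = 0" using assms by (simp add: bstar_apply bidual_outside)
  qed (use K in \<open>simp add: bbound_def\<close>)
qed

lemma bstar_bstar [simp]: "\<eta>\<^sup>\<star>\<^sup>\<star> = (\<eta> :: 'b bifunctional)"
  by (auto simp: bstar_apply fun_eq_iff)

lemma bstar_linear:
  fixes \<eta> :: "'b bifunctional"
  shows "(\<eta> + \<theta>)\<^sup>\<star> = \<eta>\<^sup>\<star> + \<theta>\<^sup>\<star>" "(\<eta> - \<theta>)\<^sup>\<star> = \<eta>\<^sup>\<star> - \<theta>\<^sup>\<star>" "(c *\<^sub>\<phi> \<eta>)\<^sup>\<star> = cnj c *\<^sub>\<phi> \<eta>\<^sup>\<star>"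
  by (auto simp: bstar_apply fun_eq_iff)

lemma bstar_canon: assumes "b \<in> S" shows "(canon S b)\<^sup>\<star> = canon S (star b)"
proof (rule bidual_eqI)
  fix \<phi> assume "\<phi> \<in> dual S"
  then show "(canon S b)\<^sup>\<star> \<phi> = canon S (star b) \<phi>" by (simp add: bstar_apply) (simp add: dstar_def)
qed (use assms in auto)

text \<open>Banach-Alaoglu along an ultrafilter: the values at a fixed point stay in a compact disc
  and therefore converge, and linear relations and bounds survive in the limit.
  \<open>bidual_limit\<close> is the same argument one dual higher.\<close>

lemma dual_limit:
  assumes U: "U \<noteq> bot" "\<And>P. eventually P U \<or> eventually (\<lambda>x. \<not> P x) U"
    and f: "\<And>i. f i \<in> dual S" "\<And>i x. x \<in> S \<Longrightarrow> cmod (f i x) \<le> K * norm x"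
  obtains g where "g \<in> dual S" "\<And>x. x \<in> S \<Longrightarrow> ((\<lambda>i. f i x) \<longlongrightarrow> g x) U"
    "\<And>x. x \<in> S \<Longrightarrow> cmod (g x) \<le> K * norm x"
proof -
  have "\<exists>l. ((\<lambda>i. f i x) \<longlongrightarrow> l) U" if "x \<in> S" for x
    using maximal_filter_compact_limit[OF U compact_cball[of 0 "K * norm x"], of "\<lambda>i. f i x"] f(2)[OF that]
    by (auto simp: always_eventually)
  then obtain g0 where g0: "\<And>x. x \<in> S \<Longrightarrow> ((\<lambda>i. f i x) \<longlongrightarrow> g0 x) U" by metis
  define g where "g x = (if x \<in> S then g0 x else 0)" for x
  have g: "((\<lambda>i. f i x) \<longlongrightarrow> g x) U" if "x \<in> S" for x using g0 that by (simp add: g_def)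
  have b: "cmod (g x) \<le> K * norm x" if "x \<in> S" for x
    by (rule tendsto_upperbound[OF tendsto_norm[OF g[OF that]] _ U(1)]) (use f(2) that in auto)
  have "g \<in> dual S"
  proof (rule dualI[OF _ _ b])
    fix x y assume "x \<in> S" "y \<in> S"
    then have "((\<lambda>i. f i x + f i y) \<longlongrightarrow> g (x + y)) U" "((\<lambda>i. f i x + f i y) \<longlongrightarrow> g x + g y) U"
      using g[of "x + y"] by (auto simp: dual_add f intro!: tendsto_add g)
    then show "g (x + y) = g x + g y" using tendsto_unique U(1) by blast
  next
    fix c x assume "x \<in> S"
    then have "((\<lambda>i. c * f i x) \<longlongrightarrow> g (c *\<^sub>C x)) U" "((\<lambda>i. c * f i x) \<longlongrightarrow> c * g x) U"
      using g[of "c *\<^sub>C x"] by (auto simp: dual_scaleC f intro!: tendsto_mult g)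
    then show "g (c *\<^sub>C x) = c * g x" using tendsto_unique U(1) by blast
  qed (auto simp: g_def)
  with g b that show thesis by blast
qed

lemma bidual_limit:
  assumes U: "U \<noteq> bot" "\<And>P. eventually P U \<or> eventually (\<lambda>x. \<not> P x) U"
    and h: "\<And>i. h i \<in> bidual S" "\<And>i. bbound K (h i)"
  obtains k where "k \<in> bidual S" "bbound K k" "\<And>\<phi>. \<phi> \<in> dual S \<Longrightarrow> ((\<lambda>i. h i \<phi>) \<longlongrightarrow> k \<phi>) U"
proof -
  have K: "0 \<le> K" using h(2) bbound_nonneg by blast
  have "\<exists>l. ((\<lambda>i. h i \<phi>) \<longlongrightarrow> l) U" if "\<phi> \<in> dual S" for \<phi>
    using maximal_filter_compact_limit[OF U compact_cball[of 0 "K * dual_norm S \<phi>"], of "\<lambda>i. h i \<phi>"]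
      bbound_apply[OF h(2) that] by (auto simp: always_eventually)
  then obtain g0 where g0: "\<And>\<phi>. \<phi> \<in> dual S \<Longrightarrow> ((\<lambda>i. h i \<phi>) \<longlongrightarrow> g0 \<phi>) U" by metis
  define k where "k \<phi> = (if \<phi> \<in> dual S then g0 \<phi> else 0)" for \<phi>
  have g: "((\<lambda>i. h i \<phi>) \<longlongrightarrow> k \<phi>) U" if "\<phi> \<in> dual S" for \<phi> using g0 that by (simp add: k_def)
  have b: "cmod (k \<phi>) \<le> K * dual_norm S \<phi>" if "\<phi> \<in> dual S" for \<phi>
    by (rule tendsto_upperbound[OF tendsto_norm[OF g[OF that]] _ U(1)]) (use bbound_apply[OF h(2) that] in auto)
  have "k \<in> bidual S"
  proof (rule bidualI[OF _ _ b])
    fix x y assume "x \<in> dual S" "y \<in> dual S"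
    then have "((\<lambda>i. h i x + h i y) \<longlongrightarrow> k (\<lambda>z. x z + y z)) U" "((\<lambda>i. h i x + h i y) \<longlongrightarrow> k x + k y) U"
      using g[of "\<lambda>z. x z + y z"] by (auto simp: bidual_add h intro!: tendsto_add g)
    then show "k (\<lambda>z. x z + y z) = k x + k y" using tendsto_unique U(1) by blast
  next
    fix c x assume "x \<in> dual S"
    then have "((\<lambda>i. c * h i x) \<longlongrightarrow> k (c *\<^sub>\<phi> x)) U" "((\<lambda>i. c * h i x) \<longlongrightarrow> c * k x) U"
      using g[of "c *\<^sub>\<phi> x"] by (auto simp: bidual_cmult h intro!: tendsto_mult g)
    then show "k (c *\<^sub>\<phi> x) = c * k x" using tendsto_unique U(1) by blast
  qed (auto simp: k_def)
  moreover have "bbound K k" using b K by (simp add: bbound_def)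
  ultimately show thesis using g that by blast
qed

end

text \<open>The common core of the Cauchy-Schwarz inequalities for functionals on the algebra and on
  the bidual, and of the estimate for near minimisers in \<open>Riesz_approx\<close>.\<close>

lemma discriminant_le:
  fixes b :: complex
  assumes a: "0 \<le> c" and q: "\<And>t::complex. 0 \<le> a + 2 * Re (t * b) + (cmod t)\<^sup>2 * c"
  shows "(cmod b)\<^sup>2 \<le> a * c"
proof -
  have Re_scaled: "Re (of_real r * cnj b * b) = r * (cmod b)\<^sup>2" for r
    by (simp add: cmod_power2) (simp add: power2_eq_square algebra_simps)
  show ?thesis
  proof (cases "c = 0")
    case True
    have "b = 0"
    proof (rule ccontr)
      assume "b \<noteq> 0"
      then have p: "(cmod b)\<^sup>2 > 0" by simp
      \<comment> \<open>For \<open>c = 0\<close> the expression is affine in \<open>t\<close>, and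
        this \<open>r\<close> would make it negative.\<close>
      define r where "r = - (\<bar>a\<bar> + 1) / (cmod b)\<^sup>2"
      have "r * (cmod b)\<^sup>2 = - (\<bar>a\<bar> + 1)" using p by (simp add: r_def)
      then have "0 \<le> a - 2 * (\<bar>a\<bar> + 1)" using q[of "of_real r * cnj b"] Re_scaled[of r] True by simp
      then show False using abs_ge_self[of a] abs_ge_zero[of a] by argo
    qed
    with True show ?thesis by simp
  next
    case False
    with a have c: "c > 0" by simp
    \<comment> \<open>The quadratic expression is minimal at \<open>t = - cnj b / c\<close>.\<close>
    define r where "r = - 1 / c"
    have "0 \<le> a + 2 * (r * (cmod b)\<^sup>2) + (r * cmod b)\<^sup>2 * c"
      using q[of "of_real r * cnj b"] unfolding Re_scaled by (simp add: norm_mult power_mult_distrib)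
    also have "\<dots> = a - (cmod b)\<^sup>2 / c" using c by (simp add: r_def power2_eq_square)
    finally show ?thesis using c by (simp add: field_simps)
  qed
qed

lemma complex_eq_of_real: "cmod z \<le> K \<Longrightarrow> K \<le> Re z \<Longrightarrow> z = complex_of_real K"
proof -
  assume z: "cmod z \<le> K" "K \<le> Re z"
  then have R: "Re z = K" using complex_Re_le_cmod[of z] by simp
  have "(cmod z)\<^sup>2 \<le> K\<^sup>2" using z by (intro power_mono) auto
  then have "(Im z)\<^sup>2 \<le> 0" using R by (simp add: cmod_power2)
  with R show ?thesis by (simp add: complex_eq_iff)
qed

lemma norm_mult_le_one:
  fixes x y :: "'b::unital_cstar_algebra"
  shows "norm x \<le> 1 \<Longrightarrow> norm y \<le> 1 \<Longrightarrow> norm (x * y) \<le> 1"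
  using norm_mult_ineq[of x y] mult_le_one[of "norm x" "norm y"] by simp

context cstar_subalgebra
begin

section \<open>Positive functionals and functionals that attain their norm\<close>

abbreviation pos :: "'b functional \<Rightarrow> bool" where
  "pos \<psi> \<equiv> positive_functional S \<psi>"

lemma pos_dual [simp]: "pos \<psi> \<Longrightarrow> \<psi> \<in> dual S"
  by (simp add: positive_functional_def)

lemma pos_star_mult: assumes "pos \<psi>" "x \<in> S" shows "0 \<le> Re (\<psi> (star x * x))" "Im (\<psi> (star x * x)) = 0"
  using assms by (auto simp: positive_functional_def complex_nonneg_Reals_iff)

lemma posI: "\<psi> \<in> dual S \<Longrightarrow> (\<And>x. x \<in> S \<Longrightarrow> 0 \<le> Re (\<psi> (star x * x)) \<and> Im (\<psi> (star x * x)) = 0) \<Longrightarrow> pos \<psi>"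
  by (auto simp: positive_functional_def complex_nonneg_Reals_iff)

lemma pos_one: "pos \<psi> \<Longrightarrow> 0 \<le> Re (\<psi> 1)" "pos \<psi> \<Longrightarrow> Im (\<psi> 1) = 0"
  using pos_star_mult[of \<psi> 1] by auto

text \<open>Polarisation: reality of \<psi> at the squares of \<open>x + 1\<close> and
  \<open>x + \<i>\<close> determines the imaginary and the real part of
  \<open>\<psi> (star x)\<close>.\<close>

lemma pos_hermitian: assumes p: "pos \<psi>" and x: "x \<in> S" shows "\<psi> (star x) = cnj (\<psi> x)"
proof -
  note d = pos_dual[OF p]
  have e1: "star (x + 1) * (x + 1) = star x * x + star x + x + 1"
    by (simp add: star_add algebra_simps)
  have e2: "star (x + \<i> *\<^sub>C 1) * (x + \<i> *\<^sub>C 1) = star x * x + \<i> *\<^sub>C star x - \<i> *\<^sub>C x + 1"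
    by (simp add: star_add star_scaleC algebra_simps mult_scaleC_left mult_scaleC_right scaleC_scaleC scaleC_diff_right scaleC_add_right)
  have "Im (\<psi> (star (x + 1) * (x + 1))) = 0" "Im (\<psi> (star (x + \<i> *\<^sub>C 1) * (x + \<i> *\<^sub>C 1))) = 0"
    by (rule pos_star_mult(2)[OF p]; simp add: x)+
  then show ?thesis
    unfolding e1 e2 using x pos_one(2)[OF p] pos_star_mult(2)[OF p x]
    by (simp add: dual_simps d complex_eq_iff)
qed

lemma dstar_pos: assumes "pos \<psi>" shows "dstar \<psi> = \<psi>"
  by (rule dual_eqI) (use assms in auto, simp add: dstar_def pos_hermitian assms)

text \<open>The seminorm of the GNS construction for \<psi>. The space is never completed, so
  representing vectors occur only approximately.\<close>

definition pnorm :: "'b functional \<Rightarrow> 'b \<Rightarrow> real" where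
  "pnorm \<psi> x = sqrt (Re (\<psi> (star x * x)))"

lemma pnorm_nonneg: "pos \<psi> \<Longrightarrow> x \<in> S \<Longrightarrow> 0 \<le> pnorm \<psi> x"
  and pnorm_square: "pos \<psi> \<Longrightarrow> x \<in> S \<Longrightarrow> (pnorm \<psi> x)\<^sup>2 = Re (\<psi> (star x * x))"
  using pos_star_mult(1)[of \<psi> x] by (auto simp: pnorm_def)

lemma pos_expand:
  assumes p: "pos \<psi>" and x: "x \<in> S" and y: "y \<in> S"
  shows "Re (\<psi> (star (x + c *\<^sub>C y) * (x + c *\<^sub>C y)))
    = Re (\<psi> (star x * x)) + 2 * Re (cnj c * \<psi> (star y * x)) + (cmod c)\<^sup>2 * Re (\<psi> (star y * y))"
proof -
  have e: "star (x + c *\<^sub>C y) * (x + c *\<^sub>C y)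
      = star x * x + c *\<^sub>C (star x * y) + cnj c *\<^sub>C (star y * x) + (cnj c * c) *\<^sub>C (star y * y)"
    by (simp add: star_add star_scaleC algebra_simps mult_scaleC_left mult_scaleC_right scaleC_scaleC scaleC_add_right mult.commute)
  have h: "\<psi> (star x * y) = cnj (\<psi> (star y * x))"
    using pos_hermitian[OF p, of "star y * x"] x y by (simp add: star_mult star_star)
  have cc: "cnj c * c = of_real ((cmod c)\<^sup>2)" using complex_norm_square[of c] by (simp add: mult.commute)
  have "Re (c * cnj (\<psi> (star y * x))) = Re (cnj c * \<psi> (star y * x))" by simp
  then show ?thesis unfolding e cc using x y
    by (simp add: dual_simps pos_dual[OF p] h del: complex_norm_square)
qed

lemma pos_CS:
  assumes p: "pos \<psi>" and x: "x \<in> S" and y: "y \<in> S"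
  shows "cmod (\<psi> (star y * x)) \<le> pnorm \<psi> y * pnorm \<psi> x"
proof -
  have "(cmod (\<psi> (star y * x)))\<^sup>2 \<le> Re (\<psi> (star x * x)) * Re (\<psi> (star y * y))"
  proof (rule discriminant_le)
    fix t
    have "0 \<le> Re (\<psi> (star (x + cnj t *\<^sub>C y) * (x + cnj t *\<^sub>C y)))"
      by (rule pos_star_mult[OF p]) (simp add: x y)
    then show "0 \<le> Re (\<psi> (star x * x)) + 2 * Re (t * \<psi> (star y * x)) + (cmod t)\<^sup>2 * Re (\<psi> (star y * y))"
      unfolding pos_expand[OF p x y] by simp
  qed (rule pos_star_mult[OF p y])
  also have "\<dots> = (pnorm \<psi> y * pnorm \<psi> x)\<^sup>2"
    using p x y by (simp add: pnorm_square power_mult_distrib mult.commute)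
  finally show ?thesis
    by (rule power2_le_imp_le) (intro mult_nonneg_nonneg pnorm_nonneg p x y)
qed

lemma pos_cpos: assumes p: "pos \<psi>" and h: "h \<in> S" "cpos h" shows "0 \<le> Re (\<psi> h)"
proof -
  obtain s where s: "s \<in> S" "cpos s" "s * s = h" using sqrt_S h by blast
  then show ?thesis using pos_star_mult(1)[OF p s(1)] cpos_selfadjoint[OF s(2)] by simp
qed

lemma pnorm_le: assumes p: "pos \<psi>" and x: "x \<in> S" shows "pnorm \<psi> x \<le> norm x * sqrt (Re (\<psi> 1))"
proof -
  have "cpos ((norm x)\<^sup>2 *\<^sub>R 1 - star x * x)"
    by (rule cpos_norm_bound) (simp_all add: star_mult star_star cstar_identity)
  then have "0 \<le> Re (\<psi> ((norm x)\<^sup>2 *\<^sub>R 1 - star x * x))" by (intro pos_cpos p) (simp_all add: x)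
  then have "Re (\<psi> (star x * x)) \<le> (norm x)\<^sup>2 * Re (\<psi> 1)" using x by (simp add: dual_simps pos_dual[OF p])
  then have "pnorm \<psi> x \<le> sqrt ((norm x)\<^sup>2 * Re (\<psi> 1))" unfolding pnorm_def by (rule real_sqrt_le_mono)
  then show ?thesis by (simp add: real_sqrt_mult)
qed

lemma pos_bound: assumes p: "pos \<psi>" and x: "x \<in> S" shows "cmod (\<psi> x) \<le> Re (\<psi> 1) * norm x"
proof -
  have "cmod (\<psi> (star 1 * x)) \<le> pnorm \<psi> 1 * pnorm \<psi> x" by (rule pos_CS[OF p x one_S])
  also have "\<dots> \<le> pnorm \<psi> 1 * (norm x * sqrt (Re (\<psi> 1)))"
    by (intro mult_left_mono pnorm_le pnorm_nonneg p x one_S)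
  also have "\<dots> = Re (\<psi> 1) * norm x" using pos_one(1)[OF p] by (simp add: pnorm_def)
  finally show ?thesis by simp
qed

text \<open>A functional that attains its norm at 1 is positive because \<open>1 - h\<close> is a
  contraction for every positive contraction \<open>h\<close>, and \<open>1 + \<i> t h\<close> has
  norm at most \<open>1 + t\<^sup>2 / 2\<close> for every self-adjoint one. Both arguments are
  carried out with an error \<open>e\<close>, since \<open>almost_norming_quadratic\<close> applies
  them to a functional that attains its norm only almost.\<close>

lemma almost_positive:
  assumes f: "f \<in> dual S" "\<And>x. x \<in> S \<Longrightarrow> cmod (f x) \<le> K * norm x" and one: "K - e \<le> Re (f 1)"
    and h: "h \<in> S" "norm h \<le> 1"
  shows "cpos h \<Longrightarrow> - e \<le> Re (f h)"
    and "star h = h \<Longrightarrow> 0 < t \<Longrightarrow> \<bar>Im (f h)\<bar> \<le> (e + K * t\<^sup>2 / 2) / t"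
proof -
  have K: "0 \<le> K" using f(2)[OF one_S] by (metis norm_ge_zero norm_one mult.right_neutral order_trans)
  show "- e \<le> Re (f h)" if "cpos h"
  proof -
    have "Re (f (1 - h)) \<le> cmod (f (1 - h))" by (rule complex_Re_le_cmod)
    also have "\<dots> \<le> K * norm (1 - h)" by (rule f) (simp add: h)
    also have "\<dots> \<le> K" using mult_left_mono[OF norm_one_minus_le[OF that h(2)] K] by simp
    finally show ?thesis using one h by (simp add: dual_simps f(1))
  qed
  show "\<bar>Im (f h)\<bar> \<le> (e + K * t\<^sup>2 / 2) / t" if sh: "star h = h" and t: "0 < t"
  proof -
    have main: "- (t * Im (f g)) \<le> e + K * t\<^sup>2 / 2" if g: "g \<in> S" "star g = g" "norm g \<le> 1" for g
    proof -
      define u where "u = 1 + (\<i> * of_real t) *\<^sub>C g"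
      have "star u * u = 1 + t\<^sup>2 *\<^sub>R (g * g)"
        by (simp add: u_def star_add star_scaleC g algebra_simps mult_scaleC_left mult_scaleC_right
            scaleC_scaleC scaleR_scaleC scaleC_diff_right scaleC_add_right power2_eq_square)
      then have "(norm u)\<^sup>2 \<le> 1 + norm (t\<^sup>2 *\<^sub>R (g * g))" by (metis cstar_identity norm_one norm_triangle_ineq)
      also have "norm (t\<^sup>2 *\<^sub>R (g * g)) \<le> t\<^sup>2 * 1"
        using g by (simp add: norm_selfadjoint_square power_le_one mult_left_le)
      also have "1 + t\<^sup>2 * 1 \<le> (1 + t\<^sup>2 / 2)\<^sup>2" by (simp add: power2_sum)
      finally have "(norm u)\<^sup>2 \<le> (1 + t\<^sup>2 / 2)\<^sup>2" by simp
      moreover have "0 \<le> 1 + t\<^sup>2 / 2" by (intro add_nonneg_nonneg) auto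
      ultimately have nu: "norm u \<le> 1 + t\<^sup>2 / 2" by (rule power2_le_imp_le)
      have "Re (f u) \<le> cmod (f u)" by (rule complex_Re_le_cmod)
      also have "\<dots> \<le> K * norm u" by (rule f) (simp add: u_def g)
      also have "\<dots> \<le> K * (1 + t\<^sup>2 / 2)" by (intro mult_left_mono K nu)
      finally show ?thesis using one g by (simp add: u_def dual_simps f(1) algebra_simps)
    qed
    have "- (t * Im (f h)) \<le> e + K * t\<^sup>2 / 2" by (rule main[OF h(1) sh h(2)])
    moreover have "t * Im (f h) \<le> e + K * t\<^sup>2 / 2"
      using main[of "- h"] h sh by (simp add: dual_simps f(1))
    ultimately have "t * \<bar>Im (f h)\<bar> \<le> e + K * t\<^sup>2 / 2" by (auto simp: abs_if)
    then show ?thesis using t by (simp add: field_simps)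
  qed
qed

lemma pos_if_norm_at_one:
  assumes f: "f \<in> dual S" "\<And>x. x \<in> S \<Longrightarrow> cmod (f x) \<le> K * norm x" and one: "K \<le> Re (f 1)"
  shows "pos f"
proof (rule posI[OF f(1)])
  fix x assume x: "x \<in> S"
  have K: "0 \<le> K" using f(2)[OF one_S] by (metis norm_ge_zero norm_one mult.right_neutral order_trans)
  define M where "M = (norm x)\<^sup>2 + 1"
  have M: "M > 0" by (simp add: M_def add_nonneg_pos)
  define h where "h = (1 / M) *\<^sub>R (star x * x)"
  have h: "h \<in> S" "cpos h" using x M by (auto simp: h_def cpos_scaleR cpos_star_mult)
  have nh: "norm h \<le> 1" using M by (simp add: h_def cstar_identity M_def)
  have fh: "f (star x * x) = of_real M * f h" using M x by (simp add: h_def dual_simps f(1))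
  have "0 \<le> Re (f h)" using almost_positive(1)[OF f, of 0 h] one h nh by simp
  moreover have "\<bar>Im (f h)\<bar> \<le> t" if "t > 0" for t
  proof -
    \<comment> \<open>Without an error the bound on the imaginary part is \<open>K * s / 2\<close>,
      which is at most \<open>t\<close> for this \<open>s\<close>; the summand 1 avoids a division
      by 0.\<close>
    define s where "s = 2 * t / (K + 1)"
    have s: "s > 0" using that K by (simp add: s_def)
    have "\<bar>Im (f h)\<bar> \<le> K * s\<^sup>2 / 2 / s"
      using almost_positive(2)[OF f, of 0 h s] one h nh s cpos_selfadjoint[OF h(2)] by simp
    also have "\<dots> = K * s / 2" using s by (simp add: power2_eq_square)
    also have "\<dots> \<le> t" using K that by (simp add: s_def field_simps)
    finally show ?thesis .
  qed
  then have "\<bar>Im (f h)\<bar> \<le> 0" by (rule field_le_epsilon[of _ 0, simplified])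
  ultimately show "0 \<le> Re (f (star x * x)) \<and> Im (f (star x * x)) = 0" using M by (simp add: fh)
qed

text \<open>If \<open>y\<close> almost attains the norm of \<open>\<phi>\<close> then \<open>\<phi>\<close> is almost concentrated on \<open>y* y\<close>:
  for \<open>b = sqrt (1 - y* y)\<close> the column with entries \<open>y, b\<close> is a contraction,
  hence the norm of \<open>y + t z b\<close> is at most \<open>sqrt (1 + t\<^sup>2)\<close>.\<close>

lemma almost_norming:
  assumes \<phi>: "\<phi> \<in> dual S" and y: "y \<in> S" "norm y \<le> 1" and e: "dual_norm S \<phi> - e \<le> Re (\<phi> y)"
    and x: "x \<in> S" "norm x \<le> 1" and t: "0 < t"
  shows "cmod (\<phi> x - \<phi> (x * star y * y)) \<le> (e + dual_norm S \<phi> * t\<^sup>2 / 2) / t"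
proof -
  let ?K = "dual_norm S \<phi>"
  have ny: "norm (star y * y) \<le> 1" using y(2) by (simp add: cstar_identity power_le_one)
  have "cpos (1 - star y * y)"
    using cpos_norm_bound[of "star y * y" 1] ny by (simp add: star_mult star_star)
  then obtain b where b: "b \<in> S" "cpos b" "b * b = 1 - star y * y"
    using sqrt_S[of "1 - star y * y"] y by auto
  have sb: "star b = b" by (rule cpos_selfadjoint[OF b(2)])
  have "(norm b)\<^sup>2 \<le> 1"
    using norm_selfadjoint_square[OF sb] b(3) norm_one_minus_le[OF cpos_star_mult ny] by simp
  then have nb: "norm b \<le> 1" by (simp add: power_le_one_iff)
  have xb: "x * b \<in> S" "norm (x * b) \<le> 1"
    using x b nb by (auto intro: norm_mult_le_one)
  have xx: "x - x * star y * y = (x * b) * b" using b(3) by (simp add: mult.assoc) (simp add: algebra_simps)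
  define c where "c = (if \<phi> (x * b * b) = 0 then 1 else cnj (\<phi> (x * b * b)) / cmod (\<phi> (x * b * b)))"
  have nc: "cmod c = 1" by (simp add: c_def norm_divide)
  define z where "z = c *\<^sub>C (x * b)"
  have z: "z \<in> S" "norm z \<le> 1" using xb nc by (simp_all add: z_def norm_scaleC)
  have "c * \<phi> (x * b * b) = cmod (\<phi> (x * b * b))"
    unfolding c_def using cnj_div_cmod_mult[of "\<phi> (x * b * b)"] by simp
  then have \<phi>z: "\<phi> (z * b) = cmod (\<phi> (x * b * b))"
    using x b by (simp add: z_def mult_scaleC_left dual_simps \<phi>)
  define v where "v = y + t *\<^sub>R (z * b)"
  have sv: "star v = star y + t *\<^sub>R (b * star z)" by (simp add: v_def star_add star_mult sb)
  have vS: "v \<in> S" using y z b by (simp add: v_def)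
  \<comment> \<open>Let C be the column with entries \<open>y\<close>, \<open>b\<close>, for which
    C* C = 1, and R the row with entries 1, \<open>t z\<close>. Then v = R C, and \<open>?p\<close>,
    \<open>?r\<close> are the entries of R - v C*. The identity below says that R - v C* times its
    adjoint is R R* - v v*.\<close>
  let ?p = "1 - v * star y" and ?r = "t *\<^sub>R z - v * b"
  have "?p * star ?p + ?r * star ?r = 1 + t\<^sup>2 *\<^sub>R (z * star z) - v * star v"
  proof -
    have "?p * star ?p + ?r * star ?r = 1 + t\<^sup>2 *\<^sub>R (z * star z) - v * (star y + t *\<^sub>R (b * star z))
        - (y + t *\<^sub>R (z * b)) * star v + v * (star y * y + b * b) * star v"
      by (simp add: star_diff star_mult star_star sb algebra_simps power2_eq_square)
    also have "\<dots> = 1 + t\<^sup>2 *\<^sub>R (z * star z) - v * star v"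
      unfolding sv[symmetric] v_def[symmetric] b(3) by simp
    finally show ?thesis .
  qed
  moreover have "cpos (?p * star ?p + ?r * star ?r)" by (intro cpos_add cpos_mult_star)
  ultimately have "norm (v * star v) \<le> norm (1 + t\<^sup>2 *\<^sub>R (z * star z))"
    by (intro cpos_norm_mono cpos_mult_star) simp
  also have "\<dots> \<le> 1 + t\<^sup>2 * 1"
  proof (rule norm_triangle_le)
    have "norm (t\<^sup>2 *\<^sub>R (z * star z)) \<le> t\<^sup>2 * 1"
      using z by (simp add: cstar_identity' power_le_one mult_left_le)
    then show "norm (1::'b) + norm (t\<^sup>2 *\<^sub>R (z * star z)) \<le> 1 + t\<^sup>2 * 1" by simp
  qed
  also have "1 + t\<^sup>2 * 1 \<le> (1 + t\<^sup>2 / 2)\<^sup>2" by (simp add: power2_sum)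
  finally have "(norm v)\<^sup>2 \<le> (1 + t\<^sup>2 / 2)\<^sup>2" by (simp add: cstar_identity')
  then have nv: "norm v \<le> 1 + t\<^sup>2 / 2" by (rule power2_le_imp_le) (use zero_le_power2[of t] in linarith)
  have "Re (\<phi> v) \<le> cmod (\<phi> v)" by (rule complex_Re_le_cmod)
  also have "\<dots> \<le> ?K * norm v" by (rule dual_norm_ge[OF \<phi> vS])
  also have "\<dots> \<le> ?K * (1 + t\<^sup>2 / 2)" by (intro mult_left_mono nv dual_norm_nonneg \<phi>)
  finally have "t * cmod (\<phi> (x * b * b)) \<le> e + ?K * t\<^sup>2 / 2"
    using e y(1) z(1) b(1) by (simp add: v_def dual_simps \<phi> \<phi>z distrib_left)
  then have "cmod (\<phi> (x * b * b)) \<le> (e + ?K * t\<^sup>2 / 2) / t" using t by (simp add: field_simps)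
  moreover have "\<phi> (x * b * b) = \<phi> x - \<phi> (x * star y * y)"
    unfolding xx[symmetric] using x y by (simp add: dual_simps \<phi>)
  ultimately show ?thesis by simp
qed

text \<open>The functional \<open>f = \<phi> (\<cdot> y)\<close> is almost positive, and \<phi>
  almost equals \<open>f (\<cdot> (star y))\<close> by \<open>almost_norming\<close>. Expanding the
  almost positive value of \<open>f\<close> at \<open>w * star w\<close> for
  \<open>w = x + \<alpha> y\<close>, where \<open>norm w \<le> 1 + cmod \<alpha>\<close>, gives the
  quadratic expression in \<alpha>. The coefficient 6 consists of 2 for replacing \<open>f g\<close>
  by \<open>\<phi> x\<close> and 4 for replacing \<open>f (star g)\<close> by the conjugate of
  \<open>f g\<close>, with \<open>g = x * star y\<close>.\<close>

lemma almost_norming_quadratic: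
  assumes \<phi>: "\<phi> \<in> dual S" and y: "y \<in> S" "norm y \<le> 1" and e: "dual_norm S \<phi> - e \<le> Re (\<phi> y)" "0 \<le> e"
    and x: "x \<in> S" "norm x \<le> 1" and t: "0 < t"
    and d: "d = (e + dual_norm S \<phi> * t\<^sup>2 / 2) / t"
  shows "- (e * (1 + cmod \<alpha>)\<^sup>2) \<le> Re (\<phi> (x * star x * y)) + 2 * Re (cnj \<alpha> * \<phi> x)
     + (cmod \<alpha>)\<^sup>2 * dual_norm S \<phi> + 6 * cmod \<alpha> * d"
proof -
  let ?K = "dual_norm S \<phi>"
  define f where "f = rm y \<phi>"
  have f: "f \<in> dual S" by (simp add: f_def \<phi> y)
  have K: "0 \<le> ?K" by (rule dual_norm_nonneg[OF \<phi>])
  have fb: "cmod (f z) \<le> ?K * norm z" if "z \<in> S" for z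
  proof -
    have "cmod (rm y \<phi> z) \<le> norm y * (?K * norm z)" using rm_bound[OF \<phi> y(1) that] by (simp add: mult.assoc)
    also have "\<dots> \<le> 1 * (?K * norm z)" by (intro mult_right_mono y) (simp add: K)
    finally show ?thesis by (simp add: f_def)
  qed
  have f1: "?K - e \<le> Re (f 1)" using e by (simp add: f_def)
  define M where "M = 1 + cmod \<alpha>"
  have M: "M > 0" by (simp add: M_def add_pos_nonneg)
  define w where "w = x + \<alpha> *\<^sub>C y"
  have wS: "w \<in> S" by (simp add: w_def x y)
  have "norm w \<le> norm x + cmod \<alpha> * norm y" unfolding w_def using norm_triangle_ineq[of x "\<alpha> *\<^sub>C y"] by (simp add: norm_scaleC)
  also have "\<dots> \<le> M" unfolding M_def using x y by (simp add: add_mono mult_left_le)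
  finally have nw: "norm w \<le> M" .
  have "- e \<le> Re (f ((1 / M\<^sup>2) *\<^sub>R (w * star w)))"
  proof (rule almost_positive(1)[OF f fb f1])
    show "norm ((1 / M\<^sup>2) *\<^sub>R (w * star w)) \<le> 1"
      using nw M by (simp add: cstar_identity' power_mono divide_le_eq)
  qed (auto simp: wS cpos_scaleR cpos_mult_star)
  then have 1: "- (e * M\<^sup>2) \<le> Re (f (w * star w))"
    using M wS by (simp add: dual_simps f field_simps)
  define g where "g = x * star y"
  have g: "g \<in> S" "norm g \<le> 1"
    using x y by (auto simp: g_def intro: norm_mult_le_one)
  define a where "a = (1/2) *\<^sub>R (g + star g)"
  define b where "b = (1/2) *\<^sub>R (\<i> *\<^sub>C (star g - g))"
  have sab: "star a = a" "star b = b"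
    by (simp_all add: a_def b_def star_add star_diff star_scaleC star_star add.commute flip: scaleC_minus_right)
  have nab: "norm a \<le> 1" "norm b \<le> 1"
    using norm_triangle_ineq[of g "star g"] norm_triangle_ineq4[of "star g" g] g(2)
    by (simp_all add: a_def b_def norm_scaleC)
  have abS: "a \<in> S" "b \<in> S" using g by (simp_all add: a_def b_def)
  have "g = a + \<i> *\<^sub>C b"
  proof -
    have "\<i> *\<^sub>C b = (1/2) *\<^sub>R (g - star g)" by (simp add: b_def scaleC_scaleR scaleC_scaleC scaleC_minus_one)
    then show ?thesis unfolding a_def by (simp flip: scaleR_add_right)
  qed
  then have fg: "f g = f a + \<i> * f b" "f (star g) = f a - \<i> * f b"
    using abS by (simp_all add: star_add star_scaleC sab dual_simps f)
  have im: "\<bar>Im (f a)\<bar> \<le> d" "\<bar>Im (f b)\<bar> \<le> d"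
    unfolding d using almost_positive(2)[OF f fb f1 abS(1) nab(1) sab(1) t]
      almost_positive(2)[OF f fb f1 abS(2) nab(2) sab(2) t] by auto
  have "f (star g) - cnj (f g) = of_real (2 * Im (f b)) + of_real (2 * Im (f a)) * \<i>"
    by (simp add: fg complex_eq_iff)
  then have "cmod (f (star g) - cnj (f g)) \<le> cmod (of_real (2 * Im (f b))) + cmod (of_real (2 * Im (f a)) * \<i>)"
    by (metis norm_triangle_ineq)
  also have "\<dots> \<le> 4 * d" using im by (simp add: norm_mult)
  finally have 2: "cmod (f (star g) - cnj (f g)) \<le> 4 * d" .
  have 3: "cmod (\<phi> x - f g) \<le> d"
    using almost_norming[OF \<phi> y e(1) x t] g by (simp add: d f_def g_def)
  have 4: "Re (f (y * star y)) \<le> ?K"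
  proof -
    have "norm (y * star y) \<le> 1" using y(2) by (simp add: cstar_identity' power_le_one)
    then have "?K * norm (y * star y) \<le> ?K" using K by (simp add: mult_left_le)
    then show ?thesis using fb[of "y * star y"] y complex_Re_le_cmod[of "f (y * star y)"] by simp
  qed
  have "w * star w = x * star x + cnj \<alpha> *\<^sub>C g + \<alpha> *\<^sub>C star g + (cnj \<alpha> * \<alpha>) *\<^sub>C (y * star y)"
    by (simp add: w_def g_def star_add star_scaleC star_mult star_star algebra_simps mult_scaleC_left mult_scaleC_right scaleC_scaleC scaleC_add_right)
  then have "f (w * star w) = f (x * star x) + cnj \<alpha> * f g + \<alpha> * f (star g) + (cnj \<alpha> * \<alpha>) * f (y * star y)"
    using x y g by (simp add: dual_simps f)
  also have "cnj \<alpha> * \<alpha> = of_real ((cmod \<alpha>)\<^sup>2)" using complex_norm_square[of \<alpha>] by (simp add: mult.commute)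
  also have "f (x * star x) + cnj \<alpha> * f g + \<alpha> * f (star g) + of_real ((cmod \<alpha>)\<^sup>2) * f (y * star y)
    = f (x * star x) + (cnj \<alpha> * \<phi> x + \<alpha> * cnj (\<phi> x)) - (cnj \<alpha> * (\<phi> x - f g) + \<alpha> * cnj (\<phi> x - f g))
      + \<alpha> * (f (star g) - cnj (f g)) + of_real ((cmod \<alpha>)\<^sup>2) * f (y * star y)"
    by (simp add: algebra_simps)
  finally have 5: "Re (f (w * star w)) = Re (f (x * star x)) + 2 * Re (cnj \<alpha> * \<phi> x)
      - 2 * Re (cnj \<alpha> * (\<phi> x - f g)) + Re (\<alpha> * (f (star g) - cnj (f g))) + (cmod \<alpha>)\<^sup>2 * Re (f (y * star y))"
    by (simp add: algebra_simps)
  have "- Re (cnj \<alpha> * (\<phi> x - f g)) \<le> cmod (cnj \<alpha> * (\<phi> x - f g))"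
    using abs_Re_le_cmod[of "cnj \<alpha> * (\<phi> x - f g)"] by linarith
  also have "\<dots> \<le> cmod \<alpha> * d" using 3 by (simp add: norm_mult mult_left_mono)
  finally have 6: "- Re (cnj \<alpha> * (\<phi> x - f g)) \<le> cmod \<alpha> * d" .
  have "Re (\<alpha> * (f (star g) - cnj (f g))) \<le> cmod (\<alpha> * (f (star g) - cnj (f g)))" by (rule complex_Re_le_cmod)
  also have "\<dots> \<le> cmod \<alpha> * (4 * d)" unfolding norm_mult by (intro mult_left_mono 2) simp
  finally have 7: "Re (\<alpha> * (f (star g) - cnj (f g))) \<le> cmod \<alpha> * (4 * d)" .
  have 8: "(cmod \<alpha>)\<^sup>2 * Re (f (y * star y)) \<le> (cmod \<alpha>)\<^sup>2 * ?K" by (intro mult_left_mono 4) simp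
  have 9: "f (x * star x) = \<phi> (x * star x * y)" using x by (simp add: f_def)
  show ?thesis using 1 5 6 7 8 unfolding 9 M_def by linarith
qed

lemma bbound_mono: "bbound K \<eta> \<Longrightarrow> K \<le> L \<Longrightarrow> bbound L \<eta>"
  unfolding bbound_def by (meson dual_norm_nonneg mult_right_mono order_trans)

text \<open>\<eta> is a weak* limit of elements of the unit ball at which \<phi> approaches its
  norm. The functional \<open>\<phi> (\<cdot> \<eta>)\<close> attains its norm at 1 and is therefore
  positive. The last clause is the discriminant of the limit of
  \<open>almost_norming_quadratic\<close>; it makes \<phi> bounded in the GNS seminorm of this
  positive functional.\<close>

lemma norming_bidual:
  assumes \<phi>: "\<phi> \<in> dual S"
  obtains \<eta> where "\<eta> \<in> bidual S" "bbound 1 \<eta>" "pos (bact \<eta> \<phi>)" "bact \<eta> \<phi> 1 = of_real (dual_norm S \<phi>)"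
    "\<eta> \<phi> = of_real (dual_norm S \<phi>)"
    "\<And>x. x \<in> S \<Longrightarrow> (cmod (\<phi> x))\<^sup>2 \<le> dual_norm S \<phi> * Re (bact \<eta> \<phi> (x * star x))"
proof -
  let ?K = "dual_norm S \<phi>"
  have K: "0 \<le> ?K" by (rule dual_norm_nonneg[OF \<phi>])
  \<comment> \<open>The defect is a square so that the choice \<open>t = 1 / (n + 1)\<close> makes
    the error \<open>(e + K t\<^sup>2 / 2) / t\<close> tend to 0.\<close>
  define e :: "nat \<Rightarrow> real" where "e n = (1 / (real n + 1))\<^sup>2" for n
  have e: "0 < e n" for n by (simp add: e_def)
  have "\<forall>n. \<exists>y. y \<in> S \<and> norm y \<le> 1 \<and> ?K - e n \<le> Re (\<phi> y)"
    using dual_norm_attained[OF \<phi> e] by metis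
  then obtain y where y: "\<And>n. y n \<in> S" "\<And>n. norm (y n) \<le> 1" "\<And>n. ?K - e n \<le> Re (\<phi> (y n))"
    by metis
  obtain U :: "nat filter" where U: "U \<noteq> bot" "U \<le> sequentially" "\<And>P. eventually P U \<or> eventually (\<lambda>x. \<not> P x) U"
    using maximal_filter[of sequentially] by (metis sequentially_bot)
  have "bbound 1 (canon S (y n))" for n by (rule bbound_mono[OF bbound_canon]) (use y in auto)
  then obtain \<eta> where \<eta>: "\<eta> \<in> bidual S" "bbound 1 \<eta>" "\<And>\<xi>. \<xi> \<in> dual S \<Longrightarrow> ((\<lambda>n. canon S (y n) \<xi>) \<longlongrightarrow> \<eta> \<xi>) U"
    using bidual_limit[OF U(1,3), of "\<lambda>n. canon S (y n)" 1] y(1) by (metis canon_bidual)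
  have lim: "((\<lambda>n. \<xi> (y n)) \<longlongrightarrow> \<eta> \<xi>) U" if "\<xi> \<in> dual S" for \<xi>
    using \<eta>(3)[OF that] that by simp
  define \<psi> where "\<psi> = bact \<eta> \<phi>"
  have \<psi>lim: "((\<lambda>n. \<phi> (x * y n)) \<longlongrightarrow> \<psi> x) U" if "x \<in> S" for x
    using lim[OF lm_dual[OF \<phi> that]] y(1) that by (simp add: \<psi>_def)
  have inv: "(\<lambda>n. 1 / (real n + 1)) \<longlonglongrightarrow> 0" using LIMSEQ_inverse_real_of_nat by (simp add: inverse_eq_divide add.commute)
  have "e \<longlonglongrightarrow> 0\<^sup>2" unfolding e_def by (intro tendsto_power inv)
  then have e0: "(e \<longlongrightarrow> 0) U" using tendsto_mono[OF U(2)] by simp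
  have "((\<lambda>n. ?K - e n) \<longlongrightarrow> ?K - 0) U" by (intro tendsto_diff tendsto_const e0)
  then have "?K \<le> Re (\<eta> \<phi>)"
    using tendsto_le[OF U(1) tendsto_Re[OF lim[OF \<phi>]]] y(3) by (simp add: always_eventually)
  then have \<eta>\<phi>: "\<eta> \<phi> = of_real ?K" using bbound_apply[OF \<eta>(2) \<phi>] by (intro complex_eq_of_real) auto
  have "lm 1 \<phi> = \<phi>" by (rule dual_eqI) (use \<phi> in auto)
  then have \<psi>1: "\<psi> 1 = of_real ?K" by (simp add: \<psi>_def \<eta>\<phi>)
  have "\<psi> \<in> dual S" by (simp add: \<psi>_def \<phi> \<eta>)
  then have p: "pos \<psi>"
    by (rule pos_if_norm_at_one[where K = ?K]) (use bact_bound[OF \<eta>(2) \<phi>] \<psi>1 in \<open>auto simp: \<psi>_def\<close>)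
  define d where "d n = (1 + ?K / 2) * (1 / (real n + 1))" for n :: nat
  have "d \<longlonglongrightarrow> (1 + ?K / 2) * 0" unfolding d_def by (intro tendsto_mult tendsto_const inv)
  then have d0: "(d \<longlongrightarrow> 0) U" using tendsto_mono[OF U(2)] by simp
  have unit: "(cmod (\<phi> x))\<^sup>2 \<le> Re (\<psi> (x * star x)) * ?K" if x: "x \<in> S" "norm x \<le> 1" for x
  proof (rule discriminant_le[OF K])
    fix t
    have n: "- (e n * (1 + cmod t)\<^sup>2) \<le> Re (\<phi> (x * star x * y n)) + 2 * Re (t * \<phi> x) + (cmod t)\<^sup>2 * ?K + 6 * cmod t * d n" for n
    proof -
      have q: "a\<^sup>2 + k * a\<^sup>2 / 2 = (1 + k / 2) * a * a" for a k :: real by (simp add: power2_eq_square algebra_simps)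
      have "d n = (e n + ?K * (1 / (real n + 1))\<^sup>2 / 2) / (1 / (real n + 1))"
        unfolding d_def e_def q by simp
      from almost_norming_quadratic[OF \<phi> y(1,2,3) less_imp_le[OF e] x _ this, of "cnj t"] show ?thesis by simp
    qed
    have lim1: "((\<lambda>n. - (e n * (1 + cmod t)\<^sup>2)) \<longlongrightarrow> - (0 * (1 + cmod t)\<^sup>2)) U"
      by (intro tendsto_intros e0)
    moreover have lim2: "((\<lambda>n. Re (\<phi> (x * star x * y n)) + 2 * Re (t * \<phi> x) + (cmod t)\<^sup>2 * ?K + 6 * cmod t * d n)
       \<longlongrightarrow> Re (\<psi> (x * star x)) + 2 * Re (t * \<phi> x) + (cmod t)\<^sup>2 * ?K + 6 * cmod t * 0) U"
      by (intro tendsto_intros d0 \<psi>lim) (simp add: x)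
    ultimately have "- (0 * (1 + cmod t)\<^sup>2) \<le> Re (\<psi> (x * star x)) + 2 * Re (t * \<phi> x) + (cmod t)\<^sup>2 * ?K + 6 * cmod t * 0"
      by (intro tendsto_le[OF U(1) lim2 lim1]) (use n in \<open>simp add: always_eventually\<close>)
    then show "0 \<le> Re (\<psi> (x * star x)) + 2 * Re (t * \<phi> x) + (cmod t)\<^sup>2 * ?K" by simp
  qed
  have "(cmod (\<phi> x))\<^sup>2 \<le> ?K * Re (\<psi> (x * star x))" if x: "x \<in> S" for x
  proof (cases "x = 0")
    case False
    define z where "z = (1 / norm x) *\<^sub>R x"
    have z: "z \<in> S" "norm z \<le> 1" using x False by (simp_all add: z_def)
    have "\<phi> x = of_real (norm x) * \<phi> z" using x False by (simp add: z_def dual_simps \<phi>)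
    moreover have "\<psi> (x * star x) = of_real ((norm x)\<^sup>2) * \<psi> (z * star z)"
      using x False by (simp add: z_def dual_simps \<open>\<psi> \<in> dual S\<close> power2_eq_square)
    ultimately show ?thesis using mult_left_mono[OF unit[OF z], of "(norm x)\<^sup>2"]
      by (simp add: norm_mult power_mult_distrib mult.commute mult.left_commute del: of_real_power)
  qed (simp add: dual_zero \<phi> \<open>\<psi> \<in> dual S\<close>)
  then show thesis using that \<eta>(1,2) p \<psi>1 \<eta>\<phi> unfolding \<psi>_def by blast
qed

end

text \<open>The restriction to \<open>e \<le> 1\<close> lets error estimates absorb squares of
  \<open>e\<close>.\<close>

lemma le_if_le_plus_small:
  fixes a b D :: real
  assumes "\<And>e. 0 < e \<Longrightarrow> e \<le> 1 \<Longrightarrow> a \<le> b + e * D"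
  shows "a \<le> b"
proof (rule field_le_epsilon)
  fix r :: real assume r: "0 < r"
  define e where "e = min 1 (r / (\<bar>D\<bar> + 1))"
  have D: "\<bar>D\<bar> + 1 > 0" by (simp add: add_nonneg_pos)
  have "e \<le> r / (\<bar>D\<bar> + 1)" by (simp add: e_def)
  then have e: "0 < e" "e \<le> 1" "e * (\<bar>D\<bar> + 1) \<le> r" using r D unfolding pos_le_divide_eq[OF D] by (auto simp: e_def)
  have "e * D \<le> e * (\<bar>D\<bar> + 1)" using e(1) by (intro mult_left_mono) auto
  with assms[OF e(1,2)] e(3) show "a \<le> b + r" by linarith
qed

context cstar_subalgebra
begin

text \<open>A version of the Riesz representation theorem that avoids completing the semi-inner
  product space of \<open>\<psi>\<close>: almost minimisers of the usual quadratic functional almost represent \<open>F\<close>.\<close>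

lemma Riesz_approx:
  assumes p: "pos \<psi>" and F: "F \<in> dual S" and M: "0 \<le> M" "\<And>y. y \<in> S \<Longrightarrow> cmod (F (star y)) \<le> M * pnorm \<psi> y"
    and e: "0 < e"
  obtains x where "x \<in> S" "\<And>y. y \<in> S \<Longrightarrow> cmod (F (star y) - \<psi> (star y * x)) \<le> e * pnorm \<psi> y"
    "pnorm \<psi> x \<le> M + e"
proof -
  define J where "J x = Re (\<psi> (star x * x)) - 2 * Re (F (star x))" for x
  have low: "- M\<^sup>2 \<le> J x" if "x \<in> S" for x
  proof -
    have "Re (F (star x)) \<le> M * pnorm \<psi> x" using M(2)[OF that] complex_Re_le_cmod order_trans by blast
    then have "J x \<ge> (pnorm \<psi> x)\<^sup>2 - 2 * (M * pnorm \<psi> x)" by (simp add: J_def pnorm_square p that)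
    moreover have "0 \<le> (pnorm \<psi> x - M)\<^sup>2" by simp
    ultimately show ?thesis by (simp add: power2_diff mult.commute)
  qed
  have bdd: "bdd_below (J ` S)" using low by (intro bdd_belowI2) auto
  obtain x where x: "x \<in> S" "J x < Inf (J ` S) + e\<^sup>2"
  proof (rule ccontr)
    assume "\<not> thesis"
    then have "Inf (J ` S) + e\<^sup>2 \<le> J x" if "x \<in> S" for x using that \<open>\<And>x. \<lbrakk>x \<in> S; J x < Inf (J ` S) + e\<^sup>2\<rbrakk> \<Longrightarrow> thesis\<close> by force
    moreover have "S \<noteq> {}" using zero_S by blast
    ultimately have "Inf (J ` S) + e\<^sup>2 \<le> Inf (J ` S)" by (intro cINF_greatest) auto
    with e show False by simp
  qed
  have D: "cmod (F (star y) - \<psi> (star y * x)) \<le> e * pnorm \<psi> y" if y: "y \<in> S" for y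
  proof -
    have "(cmod (\<psi> (star y * x) - F (star y)))\<^sup>2 \<le> e\<^sup>2 * Re (\<psi> (star y * y))"
    proof (rule discriminant_le)
      fix t
      have "Inf (J ` S) \<le> J (x + cnj t *\<^sub>C y)" using x y by (intro cINF_lower[OF bdd]) auto
      then have "J x - e\<^sup>2 \<le> J (x + cnj t *\<^sub>C y)" using x(2) by simp
      moreover have "J (x + cnj t *\<^sub>C y) = J x + 2 * Re (t * (\<psi> (star y * x) - F (star y))) + (cmod t)\<^sup>2 * Re (\<psi> (star y * y))"
        unfolding J_def pos_expand[OF p x(1) y] using x(1) y
        by (simp add: star_add star_scaleC dual_simps F algebra_simps)
      ultimately show "0 \<le> e\<^sup>2 + 2 * Re (t * (\<psi> (star y * x) - F (star y))) + (cmod t)\<^sup>2 * Re (\<psi> (star y * y))"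
        by simp
    qed (rule pos_star_mult[OF p y])
    also have "\<dots> = (e * pnorm \<psi> y)\<^sup>2" by (simp add: power_mult_distrib pnorm_square p y)
    finally have "cmod (\<psi> (star y * x) - F (star y)) \<le> e * pnorm \<psi> y"
      by (rule power2_le_imp_le) (use e pnorm_nonneg[OF p y] in simp)
    then show ?thesis by (simp add: norm_minus_commute)
  qed
  moreover have "pnorm \<psi> x \<le> M + e"
  proof (cases "pnorm \<psi> x = 0")
    case True
    with M(1) e show ?thesis by simp
  next
    case False
    then have N: "pnorm \<psi> x > 0" using pnorm_nonneg[OF p x(1)] by simp
    have "(pnorm \<psi> x)\<^sup>2 \<le> cmod (\<psi> (star x * x))" using complex_Re_le_cmod by (simp add: pnorm_square p x(1))
    also have "\<dots> \<le> cmod (F (star x)) + cmod (F (star x) - \<psi> (star x * x))"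
      using norm_triangle_ineq4[of "F (star x)" "F (star x) - \<psi> (star x * x)"] by simp
    also have "\<dots> \<le> M * pnorm \<psi> x + e * pnorm \<psi> x" by (intro add_mono M D x)
    finally have "pnorm \<psi> x * pnorm \<psi> x \<le> (M + e) * pnorm \<psi> x" by (simp add: power2_eq_square algebra_simps)
    then show ?thesis using N by simp
  qed
  ultimately show thesis using that x(1) by blast
qed

section \<open>Positive functionals span the dual\<close>

lemma pos_conjugate: assumes p: "pos \<psi>" and v: "v \<in> S" shows "pos (lm (star v) (rm v \<psi>))"
proof (rule posI)
  fix w assume w: "w \<in> S"
  have "lm (star v) (rm v \<psi>) (star w * w) = \<psi> (star (w * v) * (w * v))"
    using v w by (simp add: star_mult mult.assoc)
  then show "0 \<le> Re (lm (star v) (rm v \<psi>) (star w * w)) \<and> Im (lm (star v) (rm v \<psi>) (star w * w)) = 0"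
    using pos_star_mult[OF p mult_S[OF w v]] by simp
qed (use assms in simp)

text \<open>By \<open>Riesz_approx\<close>, \<open>\<phi> z\<close> is the limit of
  \<open>\<psi> (z * x n)\<close>. Polarisation writes this as a combination of the values
  \<open>\<psi> (star (x n + c) * z * (x n + c))\<close> with \<open>c\<close> running through the
  fourth roots of unity. Each of these four functionals is positive and bounded uniformly in
  \<open>n\<close>, so they have limits along an ultrafilter.\<close>

lemma dual_decompose:
  assumes \<phi>: "\<phi> \<in> dual S"
  obtains g1 g2 g3 g4 where "pos g1" "pos g2" "pos g3" "pos g4"
    "\<phi> = (\<lambda>z. (1/4) * (g1 z + (\<i> * g2 z + ((-1) * g3 z + (-\<i>) * g4 z))))"
proof -
  obtain \<eta> where \<eta>: "pos (bact \<eta> \<phi>)"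
    "\<And>x. x \<in> S \<Longrightarrow> (cmod (\<phi> x))\<^sup>2 \<le> dual_norm S \<phi> * Re (bact \<eta> \<phi> (x * star x))"
    using norming_bidual[OF \<phi>] by metis
  define \<psi> where "\<psi> = bact \<eta> \<phi>"
  have p: "pos \<psi>" using \<eta>(1) by (simp add: \<psi>_def)
  define M where "M = sqrt (dual_norm S \<phi>)"
  have M: "0 \<le> M" by (simp add: M_def dual_norm_nonneg \<phi>)
  have b: "cmod (\<phi> (star y)) \<le> M * pnorm \<psi> y" if "y \<in> S" for y
  proof -
    have "(cmod (\<phi> (star y)))\<^sup>2 \<le> dual_norm S \<phi> * Re (\<psi> (star y * y))"
      using \<eta>(2)[of "star y"] that by (simp add: \<psi>_def star_star)
    then have "cmod (\<phi> (star y)) \<le> sqrt (dual_norm S \<phi> * Re (\<psi> (star y * y)))" by (rule real_le_rsqrt)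
    then show ?thesis by (simp add: M_def pnorm_def real_sqrt_mult)
  qed
  have "\<forall>n. \<exists>x. x \<in> S \<and> (\<forall>y\<in>S. cmod (\<phi> (star y) - \<psi> (star y * x)) \<le> 1 / (real n + 1) * pnorm \<psi> y)
      \<and> pnorm \<psi> x \<le> M + 1 / (real n + 1)"
  proof
    fix n
    have "0 < 1 / (real n + 1)" by (simp add: add_nonneg_pos)
    from Riesz_approx[OF p \<phi> M b this]
    show "\<exists>x. x \<in> S \<and> (\<forall>y\<in>S. cmod (\<phi> (star y) - \<psi> (star y * x)) \<le> 1 / (real n + 1) * pnorm \<psi> y)
      \<and> pnorm \<psi> x \<le> M + 1 / (real n + 1)" by metis
  qed
  from choice[OF this] obtain x where x0: "\<forall>n. x n \<in> S \<and> (\<forall>y\<in>S. cmod (\<phi> (star y) - \<psi> (star y * x n)) \<le> 1 / (real n + 1) * pnorm \<psi> y)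
      \<and> pnorm \<psi> (x n) \<le> M + 1 / (real n + 1)" by blast
  then have x: "\<And>n. x n \<in> S" "\<And>n y. y \<in> S \<Longrightarrow> cmod (\<phi> (star y) - \<psi> (star y * x n)) \<le> 1 / (real n + 1) * pnorm \<psi> y"
    "\<And>n. pnorm \<psi> (x n) \<le> M + 1 / (real n + 1)" by auto
  have nx: "pnorm \<psi> (x n) \<le> M + 1" for n
    using x(3)[of n] by (rule order_trans) (simp add: divide_le_eq)
  define \<xi> where "\<xi> c n = lm (star (x n + c *\<^sub>C 1)) (rm (x n + c *\<^sub>C 1) \<psi>)" for c n
  have \<xi>: "pos (\<xi> c n)" for c n unfolding \<xi>_def by (intro pos_conjugate p) (simp add: x(1))
  define B where "B = (M + 1)\<^sup>2 + 2 * (pnorm \<psi> 1 * (M + 1)) + Re (\<psi> 1)"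
  have \<xi>b: "cmod (\<xi> c n z) \<le> B * norm z" if c: "cmod c = 1" and z: "z \<in> S" for c n z
  proof -
    have "Re (\<xi> c n 1) = Re (\<psi> (star (x n + c *\<^sub>C 1) * (x n + c *\<^sub>C 1)))" by (simp add: \<xi>_def x(1))
    also have "\<dots> = (pnorm \<psi> (x n))\<^sup>2 + 2 * Re (cnj c * \<psi> (star 1 * x n)) + Re (\<psi> 1)"
      unfolding pos_expand[OF p x(1) one_S] by (simp add: pnorm_square p x(1) c)
    also have "\<dots> \<le> B" unfolding B_def
    proof (intro add_mono mult_left_mono)
      show "(pnorm \<psi> (x n))\<^sup>2 \<le> (M + 1)\<^sup>2" by (intro power_mono nx pnorm_nonneg p x(1))
      have "Re (cnj c * \<psi> (star 1 * x n)) \<le> cmod (cnj c * \<psi> (star 1 * x n))" by (rule complex_Re_le_cmod)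
      also have "\<dots> \<le> pnorm \<psi> 1 * pnorm \<psi> (x n)" unfolding norm_mult complex_mod_cnj c
        using pos_CS[OF p x(1) one_S] by simp
      also have "\<dots> \<le> pnorm \<psi> 1 * (M + 1)" by (intro mult_left_mono nx pnorm_nonneg p one_S)
      finally show "Re (cnj c * \<psi> (star 1 * x n)) \<le> pnorm \<psi> 1 * (M + 1)" .
    qed auto
    finally have "Re (\<xi> c n 1) * norm z \<le> B * norm z" by (rule mult_right_mono) simp
    then show ?thesis using pos_bound[OF \<xi> z, of c n] by (rule order_trans[rotated])
  qed
  obtain U :: "nat filter" where U: "U \<noteq> bot" "U \<le> sequentially" "\<And>P. eventually P U \<or> eventually (\<lambda>x. \<not> P x) U"
    using maximal_filter[of sequentially] by (metis sequentially_bot)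
  have ex: "\<exists>g. pos g \<and> (\<forall>z\<in>S. ((\<lambda>n. \<xi> c n z) \<longlongrightarrow> g z) U)" if c: "cmod c = 1" for c
  proof -
    obtain g where g: "g \<in> dual S" "\<And>z. z \<in> S \<Longrightarrow> ((\<lambda>n. \<xi> c n z) \<longlongrightarrow> g z) U"
    proof (rule dual_limit[OF U(1,3), of "\<xi> c" B])
      show "\<xi> c n \<in> dual S" for n by (intro pos_dual \<xi>)
      show "cmod (\<xi> c n z) \<le> B * norm z" if "z \<in> S" for n z by (rule \<xi>b[OF c that])
    qed blast
    have "pos g"
    proof (rule posI[OF g(1)])
      fix w assume w: "w \<in> S"
      then have l: "((\<lambda>n. \<xi> c n (star w * w)) \<longlongrightarrow> g (star w * w)) U" by (intro g) simp
      have "0 \<le> Re (g (star w * w))"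
        by (rule tendsto_lowerbound[OF tendsto_Re[OF l] _ U(1)]) (simp add: pos_star_mult[OF \<xi> w] always_eventually)
      moreover have "((\<lambda>n. 0) \<longlongrightarrow> Im (g (star w * w))) U"
        using tendsto_Im[OF l] by (simp add: pos_star_mult(2)[OF \<xi> w])
      then have "Im (g (star w * w)) = 0" using tendsto_unique[OF U(1) _ tendsto_const] by metis
      ultimately show "0 \<le> Re (g (star w * w)) \<and> Im (g (star w * w)) = 0" by blast
    qed
    with g show ?thesis by blast
  qed
  obtain g1 where g1: "pos g1" "\<And>z. z \<in> S \<Longrightarrow> ((\<lambda>n. \<xi> 1 n z) \<longlongrightarrow> g1 z) U" using ex[of 1] by auto
  obtain g2 where g2: "pos g2" "\<And>z. z \<in> S \<Longrightarrow> ((\<lambda>n. \<xi> \<i> n z) \<longlongrightarrow> g2 z) U" using ex[of \<i>] by auto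
  obtain g3 where g3: "pos g3" "\<And>z. z \<in> S \<Longrightarrow> ((\<lambda>n. \<xi> (-1) n z) \<longlongrightarrow> g3 z) U" using ex[of "-1"] by auto
  obtain g4 where g4: "pos g4" "\<And>z. z \<in> S \<Longrightarrow> ((\<lambda>n. \<xi> (-\<i>) n z) \<longlongrightarrow> g4 z) U" using ex[of "-\<i>"] by auto
  have inv: "(\<lambda>n. 1 / (real n + 1)) \<longlonglongrightarrow> 0" using LIMSEQ_inverse_real_of_nat by (simp add: inverse_eq_divide add.commute)
  have "\<phi> z = (1/4) * (g1 z + (\<i> * g2 z + ((-1) * g3 z + (-\<i>) * g4 z)))" if z: "z \<in> S" for z
  proof -
    have e: "\<psi> (z * x n) = (1/4) * (\<xi> 1 n z + (\<i> * \<xi> \<i> n z + ((-1) * \<xi> (-1) n z + (-\<i>) * \<xi> (-\<i>) n z)))" for n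
    proof -
      have c: "\<xi> c n z = \<psi> (star (x n) * z * x n) + c * \<psi> (star (x n) * z) + cnj c * \<psi> (z * x n) + cnj c * c * \<psi> z" for c
        using z x(1)[of n] by (simp add: \<xi>_def star_add star_scaleC algebra_simps mult_scaleC_left mult_scaleC_right
            dual_simps pos_dual[OF p] scaleC_add_right)
      show ?thesis unfolding c by (simp add: algebra_simps)
    qed
    have "((\<lambda>n. (1/4) * (\<xi> 1 n z + (\<i> * \<xi> \<i> n z + ((-1) * \<xi> (-1) n z + (-\<i>) * \<xi> (-\<i>) n z))))
      \<longlongrightarrow> (1/4) * (g1 z + (\<i> * g2 z + ((-1) * g3 z + (-\<i>) * g4 z)))) U"
      by (intro tendsto_intros g1 g2 g3 g4 z)
    then have l1: "((\<lambda>n. \<psi> (z * x n)) \<longlongrightarrow> (1/4) * (g1 z + (\<i> * g2 z + ((-1) * g3 z + (-\<i>) * g4 z)))) U"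
      unfolding e .
    have "(\<lambda>n. 1 / (real n + 1) * pnorm \<psi> (star z)) \<longlonglongrightarrow> 0 * pnorm \<psi> (star z)"
      by (intro tendsto_mult inv tendsto_const)
    then have l0: "(\<lambda>n. 1 / (real n + 1) * pnorm \<psi> (star z)) \<longlonglongrightarrow> 0" by simp
    have "(\<lambda>n. \<phi> z - \<psi> (z * x n)) \<longlonglongrightarrow> 0"
      by (rule Lim_null_comparison[OF _ l0]) (use x(2)[of "star z"] z in \<open>simp add: star_star always_eventually\<close>)
    then have "(\<lambda>n. \<phi> z - (\<phi> z - \<psi> (z * x n))) \<longlonglongrightarrow> \<phi> z - 0" by (intro tendsto_diff tendsto_const)
    then have "((\<lambda>n. \<psi> (z * x n)) \<longlongrightarrow> \<phi> z) U" using tendsto_mono[OF U(2)] by simp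
    then show ?thesis using l1 tendsto_unique[OF U(1)] by blast
  qed
  then have "\<phi> = (\<lambda>z. (1/4) * (g1 z + (\<i> * g2 z + ((-1) * g3 z + (-\<i>) * g4 z))))"
    by (intro dual_eqI \<phi> dual_cmult dual_plus pos_dual g1 g2 g3 g4)
  with g1(1) g2(1) g3(1) g4(1) that show thesis by blast
qed

lemma dual_pos_induct [consumes 1, case_names pos add scale]:
  assumes "\<phi> \<in> dual S" "\<And>\<psi>. pos \<psi> \<Longrightarrow> P \<psi>"
    "\<And>f g. f \<in> dual S \<Longrightarrow> g \<in> dual S \<Longrightarrow> P f \<Longrightarrow> P g \<Longrightarrow> P (\<lambda>x. f x + g x)"
    "\<And>c f. f \<in> dual S \<Longrightarrow> P f \<Longrightarrow> P (c *\<^sub>\<phi> f)"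
  shows "P \<phi>"
proof -
  from dual_decompose[OF assms(1)] obtain g1 g2 g3 g4
    where g: "pos g1" "pos g2" "pos g3" "pos g4"
    and e: "\<phi> = (\<lambda>z. (1/4) * (g1 z + (\<i> * g2 z + ((-1) * g3 z + (-\<i>) * g4 z))))" .
  note d = g[THEN pos_dual] and Pg = g[THEN assms(2)]
  have P34: "P (\<lambda>z. (-1) * g3 z + (-\<i>) * g4 z)"
    by (rule assms(3)[OF dual_cmult[OF d(3)] dual_cmult[OF d(4)] assms(4)[OF d(3) Pg(3)] assms(4)[OF d(4) Pg(4)]])
  have d34: "(\<lambda>z. (-1) * g3 z + (-\<i>) * g4 z) \<in> dual S" by (rule dual_plus[OF dual_cmult[OF d(3)] dual_cmult[OF d(4)]])
  have P234: "P (\<lambda>z. \<i> * g2 z + ((-1) * g3 z + (-\<i>) * g4 z))"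
    by (rule assms(3)[OF dual_cmult[OF d(2)] d34 assms(4)[OF d(2) Pg(2)] P34])
  have d234: "(\<lambda>z. \<i> * g2 z + ((-1) * g3 z + (-\<i>) * g4 z)) \<in> dual S" by (rule dual_plus[OF dual_cmult[OF d(2)] d34])
  show ?thesis unfolding e
    by (rule assms(4)[OF dual_plus[OF d(1) d234] assms(3)[OF d(1) d234 Pg(1) P234]])
qed

lemma bidual_eq_pos:
  assumes "\<eta> \<in> bidual S" "\<theta> \<in> bidual S" "\<And>\<psi>. pos \<psi> \<Longrightarrow> \<eta> \<psi> = \<theta> \<psi>"
  shows "\<eta> = \<theta>"
proof (rule bidual_eqI[OF assms(1,2)])
  fix \<phi> assume "\<phi> \<in> dual S"
  then show "\<eta> \<phi> = \<theta> \<phi>" by (induction rule: dual_pos_induct) (simp_all add: assms bidual_add bidual_cmult)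
qed

section \<open>Regularity of the Arens product and positivity in the bidual\<close>

lemma bidual_diff_le:
  assumes "bbound K \<eta>" "\<eta> \<in> bidual S" "f \<in> dual S" "g \<in> dual S" "0 \<le> c" "\<And>x. x \<in> S \<Longrightarrow> cmod (f x - g x) \<le> c * norm x"
  shows "cmod (\<eta> f - \<eta> g) \<le> K * c"
  using bbound_le[OF assms(1), of "\<lambda>x. f x - g x" c] assms bidual_minus[OF assms(2-4)] by simp

lemma bact_pos_bound:
  assumes p: "pos \<psi>" and K: "bbound K \<eta>" and y: "y \<in> S"
  shows "cmod (bact \<eta> \<psi> (star y)) \<le> K * sqrt (Re (\<psi> 1)) * pnorm \<psi> y"
proof -
  have "cmod (\<eta> (lm (star y) \<psi>)) \<le> K * (sqrt (Re (\<psi> 1)) * pnorm \<psi> y)"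
  proof (rule bbound_le[OF K])
    show "0 \<le> sqrt (Re (\<psi> 1)) * pnorm \<psi> y" by (simp add: pos_one p y pnorm_nonneg)
    fix x assume x: "x \<in> S"
    have "cmod (\<psi> (star y * x)) \<le> pnorm \<psi> y * (norm x * sqrt (Re (\<psi> 1)))"
      by (rule order_trans[OF pos_CS[OF p x y] mult_left_mono[OF pnorm_le[OF p x] pnorm_nonneg[OF p y]]])
    then show "cmod (lm (star y) \<psi> x) \<le> sqrt (Re (\<psi> 1)) * pnorm \<psi> y * norm x" using x by (simp add: algebra_simps)
  qed (simp add: p y)
  then show ?thesis using y by (simp add: mult.assoc)
qed

text \<open>\<open>x\<close> stands for the image under \<eta> of the cyclic vector of the GNS space
  of \<psi>. The first error is measured in the GNS seminorm; the second is measured in the norm, so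
  that another element of the bidual can be applied to the difference.\<close>

lemma bact_approx:
  assumes p: "pos \<psi>" and \<eta>: "\<eta> \<in> bidual S" and K: "bbound K \<eta>" and e: "0 < e"
  obtains x where "x \<in> S" "\<And>y. y \<in> S \<Longrightarrow> cmod (bact \<eta> \<psi> (star y) - \<psi> (star y * x)) \<le> e * pnorm \<psi> y"
    "\<And>y. y \<in> S \<Longrightarrow> cmod (bact \<eta> \<psi> y - \<psi> (y * x)) \<le> e * sqrt (Re (\<psi> 1)) * norm y"
    "pnorm \<psi> x \<le> K * sqrt (Re (\<psi> 1)) + e"
proof -
  have M: "0 \<le> K * sqrt (Re (\<psi> 1))" using bbound_nonneg[OF K] pos_one(1)[OF p] by simp
  obtain x where x: "x \<in> S" "\<And>y. y \<in> S \<Longrightarrow> cmod (bact \<eta> \<psi> (star y) - \<psi> (star y * x)) \<le> e * pnorm \<psi> y"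
    "pnorm \<psi> x \<le> K * sqrt (Re (\<psi> 1)) + e"
    using Riesz_approx[OF p bact_dual[OF \<eta> pos_dual[OF p]] M bact_pos_bound[OF p K] e] by metis
  have "cmod (bact \<eta> \<psi> y - \<psi> (y * x)) \<le> e * sqrt (Re (\<psi> 1)) * norm y" if y: "y \<in> S" for y
  proof -
    have "cmod (bact \<eta> \<psi> y - \<psi> (y * x)) \<le> e * pnorm \<psi> (star y)" using x(2)[OF star_S[OF y]] by (simp add: star_star)
    also have "\<dots> \<le> e * (norm (star y) * sqrt (Re (\<psi> 1)))" using e by (intro mult_left_mono pnorm_le p) (simp_all add: y)
    finally show ?thesis by (simp add: algebra_simps)
  qed
  with x that show thesis by blast
qed

lemma lact_pos: assumes "pos \<psi>" "x \<in> S" shows "lact \<eta> \<psi> x = cnj (bact (\<eta>\<^sup>\<star>) \<psi> (star x))"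
proof -
  have "dstar (lm (star x) \<psi>) = rm x \<psi>"
  proof (rule dual_eqI)
    fix z assume z: "z \<in> S"
    have "cnj (\<psi> (star x * star z)) = \<psi> (z * x)"
      using pos_hermitian[OF assms(1), of "z * x"] z assms(2) by (simp add: star_mult)
    then show "dstar (lm (star x) \<psi>) z = rm x \<psi> z" using z assms by (simp add: dstar_def)
  qed (use assms in auto)
  then show ?thesis using assms by (simp add: bstar_apply)
qed

text \<open>The two Arens products coincide. For a positive functional both are approximated by the inner
  product of the representing vectors; positive functionals span the dual.\<close>

lemma arens_lact_pos:
  assumes p: "pos \<psi>" and \<eta>: "\<eta> \<in> bidual S" and \<theta>: "\<theta> \<in> bidual S"
  shows "\<eta> (bact \<theta> \<psi>) = \<theta> (lact \<eta> \<psi>)"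
proof -
  obtain K where K: "bbound K \<eta>" using bidual_bbound[OF \<eta>] .
  obtain L where L: "bbound L \<theta>" using bidual_bbound[OF \<theta>] .
  define C where "C = sqrt (Re (\<psi> 1))"
  have C: "0 \<le> C" by (simp add: C_def pos_one p)
  have "cmod (\<eta> (bact \<theta> \<psi>) - \<theta> (lact \<eta> \<psi>)) \<le> 0 + e * (2 * K * C + 2 * L * C + 2)" if e: "0 < e" "e \<le> 1" for e
  proof -
    obtain x where x: "x \<in> S" "\<And>y. y \<in> S \<Longrightarrow> cmod (bact \<theta> \<psi> (star y) - \<psi> (star y * x)) \<le> e * pnorm \<psi> y"
      "\<And>y. y \<in> S \<Longrightarrow> cmod (bact \<theta> \<psi> y - \<psi> (y * x)) \<le> e * C * norm y" "pnorm \<psi> x \<le> L * C + e"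
      using bact_approx[OF p \<theta> L e(1)] unfolding C_def by metis
    obtain w where w: "w \<in> S" "\<And>y. y \<in> S \<Longrightarrow> cmod (bact (\<eta>\<^sup>\<star>) \<psi> (star y) - \<psi> (star y * w)) \<le> e * pnorm \<psi> y"
      "pnorm \<psi> w \<le> K * C + e"
      using bact_approx[OF p bstar_bidual[OF \<eta>] bbound_bstar[OF K] e(1)] unfolding C_def by metis
    have l: "cmod (lact \<eta> \<psi> y - \<psi> (star w * y)) \<le> e * pnorm \<psi> y" if "y \<in> S" for y
    proof -
      have "\<psi> (star w * y) = cnj (\<psi> (star y * w))"
        using pos_hermitian[OF p, of "star y * w"] that w(1) by (simp add: star_mult star_star)
      then have "lact \<eta> \<psi> y - \<psi> (star w * y) = cnj (bact (\<eta>\<^sup>\<star>) \<psi> (star y) - \<psi> (star y * w))"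
        using lact_pos[OF p that] by simp
      then show ?thesis using w(2)[OF that] by (metis complex_mod_cnj)
    qed
    have "cmod (\<eta> (bact \<theta> \<psi>) - \<eta> (rm x \<psi>)) \<le> K * (e * C)"
      by (rule bidual_diff_le[OF K \<eta>]) (use p \<theta> x e C in auto)
    moreover have "cmod (\<eta> (rm x \<psi>) - \<psi> (star w * x)) \<le> e * pnorm \<psi> x" using l[OF x(1)] x(1) by simp
    moreover have "cmod (\<theta> (lm (star w) \<psi>) - \<psi> (star w * x)) \<le> e * pnorm \<psi> w" using x(2)[OF w(1)] w(1) by simp
    moreover have "cmod (\<theta> (lact \<eta> \<psi>) - \<theta> (lm (star w) \<psi>)) \<le> L * (e * C)"
    proof (rule bidual_diff_le[OF L \<theta>])
      fix y assume y: "y \<in> S"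
      have "e * pnorm \<psi> y \<le> e * (norm y * C)" using e pnorm_le[OF p y] by (simp add: C_def)
      then show "cmod (lact \<eta> \<psi> y - lm (star w) \<psi> y) \<le> e * C * norm y" using l[OF y] y by (simp add: algebra_simps)
    qed (use p \<eta> w e C in auto)
    ultimately have "cmod (\<eta> (bact \<theta> \<psi>) - \<theta> (lact \<eta> \<psi>)) \<le> K * (e * C) + e * pnorm \<psi> x + e * pnorm \<psi> w + L * (e * C)"
      using norm_triangle_ineq4[of "\<eta> (bact \<theta> \<psi>) - \<psi> (star w * x)" "\<theta> (lact \<eta> \<psi>) - \<psi> (star w * x)"]
        norm_triangle_ineq[of "\<eta> (bact \<theta> \<psi>) - \<eta> (rm x \<psi>)" "\<eta> (rm x \<psi>) - \<psi> (star w * x)"]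
        norm_triangle_ineq[of "\<theta> (lact \<eta> \<psi>) - \<theta> (lm (star w) \<psi>)" "\<theta> (lm (star w) \<psi>) - \<psi> (star w * x)"]
      by simp
    also have "\<dots> \<le> K * (e * C) + e * (L * C + 1) + e * (K * C + 1) + L * (e * C)"
      using x(4) w(3) e by (intro add_mono mult_left_mono order_refl) auto
    finally show ?thesis by (simp add: algebra_simps)
  qed
  then have "cmod (\<eta> (bact \<theta> \<psi>) - \<theta> (lact \<eta> \<psi>)) \<le> 0" by (rule le_if_le_plus_small)
  then show ?thesis by simp
qed

lemma arens_lact:
  assumes \<phi>: "\<phi> \<in> dual S" and \<eta>: "\<eta> \<in> bidual S" and \<theta>: "\<theta> \<in> bidual S"
  shows "(\<eta> \<otimes> \<theta>) \<phi> = \<theta> (lact \<eta> \<phi>)"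
proof -
  have "\<eta> (bact \<theta> \<phi>) = \<theta> (lact \<eta> \<phi>)" using \<phi>
  proof (induction rule: dual_pos_induct)
    case (pos \<psi>)
    then show ?case by (rule arens_lact_pos[OF _ \<eta> \<theta>])
  qed (simp_all add: \<eta> \<theta> bact_linear lact_linear bidual_add bidual_cmult)
  then show ?thesis using \<phi> by (simp add: arens_apply)
qed

text \<open>Taking adjoints exchanges the first Arens product with the second one, so
  antimultiplicativity is an expression of their coincidence.\<close>

lemma bstar_arens:
  assumes \<eta>: "\<eta> \<in> bidual S" and \<theta>: "\<theta> \<in> bidual S"
  shows "(\<eta> \<otimes> \<theta>)\<^sup>\<star> = \<theta>\<^sup>\<star> \<otimes> \<eta>\<^sup>\<star>"
proof (rule bidual_eq_pos)
  fix \<psi> assume p: "pos \<psi>"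
  have "bact (\<eta>\<^sup>\<star>) \<psi> = dstar (lact \<eta> \<psi>)"
  proof (rule dual_eqI)
    fix x assume "x \<in> S"
    then show "bact (\<eta>\<^sup>\<star>) \<psi> x = dstar (lact \<eta> \<psi>) x"
      using lact_pos[OF p, of "star x" \<eta>] by (simp add: dstar_def[of "lact \<eta> \<psi>"] star_star)
  qed (use p \<eta> in auto)
  then have "(\<theta>\<^sup>\<star> \<otimes> \<eta>\<^sup>\<star>) \<psi> = cnj (\<theta> (lact \<eta> \<psi>))"
    using p by (simp add: arens_apply bstar_apply[of \<theta>])
  also have "\<dots> = (\<eta> \<otimes> \<theta>)\<^sup>\<star> \<psi>"
    using p by (simp add: bstar_apply[of "\<eta> \<otimes> \<theta>"] dstar_pos arens_lact \<eta> \<theta>)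
  finally show "(\<eta> \<otimes> \<theta>)\<^sup>\<star> \<psi> = (\<theta>\<^sup>\<star> \<otimes> \<eta>\<^sup>\<star>) \<psi>" by simp
qed (use assms in auto)

text \<open>For the approximating vector \<open>x\<close> of \<eta>, the value is close to
  \<open>\<psi> (star x * x)\<close>, a number between 0 and the square of
  \<open>K * C + e\<close>.\<close>

lemma bstar_arens_pos:
  assumes p: "pos \<psi>" and \<eta>: "\<eta> \<in> bidual S"
  shows "0 \<le> Re ((\<eta>\<^sup>\<star> \<otimes> \<eta>) \<psi>)" "Im ((\<eta>\<^sup>\<star> \<otimes> \<eta>) \<psi>) = 0"
    and "bbound K \<eta> \<Longrightarrow> Re ((\<eta>\<^sup>\<star> \<otimes> \<eta>) \<psi>) \<le> K\<^sup>2 * Re (\<psi> 1)"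
proof -
  define C where "C = sqrt (Re (\<psi> 1))"
  have C: "0 \<le> C" "C\<^sup>2 = Re (\<psi> 1)" by (simp_all add: C_def pos_one p)
  let ?z = "(\<eta>\<^sup>\<star> \<otimes> \<eta>) \<psi>"
  have ex: "\<exists>r. 0 \<le> r \<and> r \<le> (K * C + e)\<^sup>2 \<and> cmod (?z - of_real r) \<le> e * (2 * K * C + 1)"
    if K: "bbound K \<eta>" and e: "0 < e" "e \<le> 1" for K e
  proof -
    obtain x where x: "x \<in> S" "\<And>y. y \<in> S \<Longrightarrow> cmod (bact \<eta> \<psi> (star y) - \<psi> (star y * x)) \<le> e * pnorm \<psi> y"
      "\<And>y. y \<in> S \<Longrightarrow> cmod (bact \<eta> \<psi> y - \<psi> (y * x)) \<le> e * C * norm y" "pnorm \<psi> x \<le> K * C + e"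
      using bact_approx[OF p \<eta> K e(1)] unfolding C_def by metis
    define r where "r = Re (\<psi> (star x * x))"
    have r: "\<psi> (star x * x) = of_real r" using pos_star_mult[OF p x(1)] by (simp add: r_def complex_eq_iff)
    have "0 \<le> r" using pos_star_mult[OF p x(1)] by (simp add: r_def)
    moreover have "r \<le> (K * C + e)\<^sup>2"
      unfolding r_def pnorm_square[OF p x(1), symmetric] by (intro power_mono x pnorm_nonneg p)
    moreover have "cmod (?z - of_real r) \<le> e * (2 * K * C + 1)"
    proof -
      have z: "?z = \<eta>\<^sup>\<star> (bact \<eta> \<psi>)" by (simp add: arens_apply p)
      have "cmod (?z - \<eta>\<^sup>\<star> (rm x \<psi>)) \<le> K * (e * C)" unfolding z
        by (rule bidual_diff_le[OF bbound_bstar[OF K]]) (use p \<eta> x e C in auto)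
      moreover have "\<eta>\<^sup>\<star> (rm x \<psi>) = cnj (bact \<eta> \<psi> (star x))"
        using lact_pos[OF p x(1), of "\<eta>\<^sup>\<star>"] x(1) by simp
      then have "\<eta>\<^sup>\<star> (rm x \<psi>) - of_real r = cnj (bact \<eta> \<psi> (star x) - \<psi> (star x * x))" by (simp add: r)
      then have "cmod (\<eta>\<^sup>\<star> (rm x \<psi>) - of_real r) \<le> e * pnorm \<psi> x" using x(2)[OF x(1)] by (metis complex_mod_cnj)
      moreover have "e * pnorm \<psi> x \<le> e * (K * C + 1)" using x(4) e by (intro mult_left_mono) auto
      ultimately show ?thesis
        using norm_triangle_ineq[of "?z - \<eta>\<^sup>\<star> (rm x \<psi>)" "\<eta>\<^sup>\<star> (rm x \<psi>) - of_real r"] by (simp add: algebra_simps)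
    qed
    ultimately show ?thesis by blast
  qed
  obtain L where L: "bbound L \<eta>" using bidual_bbound[OF \<eta>] .
  have "- Re ?z \<le> 0"
  proof (rule le_if_le_plus_small)
    fix e :: real assume e: "0 < e" "e \<le> 1"
    obtain r where "0 \<le> r" "cmod (?z - of_real r) \<le> e * (2 * L * C + 1)" using ex[OF L e] by blast
    then show "- Re ?z \<le> 0 + e * (2 * L * C + 1)" using abs_Re_le_cmod[of "?z - of_real r"] by simp
  qed
  then show "0 \<le> Re ?z" by simp
  have "\<bar>Im ?z\<bar> \<le> 0"
  proof (rule le_if_le_plus_small)
    fix e :: real assume e: "0 < e" "e \<le> 1"
    obtain r where "cmod (?z - of_real r) \<le> e * (2 * L * C + 1)" using ex[OF L e] by blast
    then show "\<bar>Im ?z\<bar> \<le> 0 + e * (2 * L * C + 1)" using abs_Im_le_cmod[of "?z - of_real r"] by simp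
  qed
  then show "Im ?z = 0" by simp
  assume K: "bbound K \<eta>"
  note K0 = bbound_nonneg[OF K]
  show "Re ?z \<le> K\<^sup>2 * Re (\<psi> 1)"
  proof (rule le_if_le_plus_small)
    fix e :: real assume e: "0 < e" "e \<le> 1"
    obtain r where r: "r \<le> (K * C + e)\<^sup>2" "cmod (?z - of_real r) \<le> e * (2 * K * C + 1)" using ex[OF K e] by blast
    have "e * e \<le> e * 1" using e by (intro mult_left_mono) auto
    then have "(K * C + e)\<^sup>2 \<le> K\<^sup>2 * C\<^sup>2 + e * (2 * K * C + 1)" by (simp add: power2_eq_square algebra_simps)
    moreover have "Re ?z - r \<le> e * (2 * K * C + 1)" using abs_Re_le_cmod[of "?z - of_real r"] r(2) by simp
    ultimately show "Re ?z \<le> K\<^sup>2 * Re (\<psi> 1) + e * (2 * (2 * K * C + 1))" using r(1) C(2) by (simp add: algebra_simps)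
  qed
qed

lemma bstar_pos: "pos \<psi> \<Longrightarrow> \<eta>\<^sup>\<star> \<psi> = cnj (\<eta> \<psi>)"
  by (simp add: bstar_apply dstar_pos)

lemma bidual_CS:
  assumes p: "pos \<psi>" and \<eta>: "\<eta> \<in> bidual S" and \<theta>: "\<theta> \<in> bidual S"
  shows "(cmod ((\<eta>\<^sup>\<star> \<otimes> \<theta>) \<psi>))\<^sup>2 \<le> Re ((\<eta>\<^sup>\<star> \<otimes> \<eta>) \<psi>) * Re ((\<theta>\<^sup>\<star> \<otimes> \<theta>) \<psi>)"
proof -
  have h: "(\<theta>\<^sup>\<star> \<otimes> \<eta>) \<psi> = cnj ((\<eta>\<^sup>\<star> \<otimes> \<theta>) \<psi>)"
    using bstar_pos[OF p, of "\<eta>\<^sup>\<star> \<otimes> \<theta>"] by (simp add: bstar_arens \<eta> \<theta>)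
  have "(cmod ((\<eta>\<^sup>\<star> \<otimes> \<theta>) \<psi>))\<^sup>2 \<le> Re ((\<theta>\<^sup>\<star> \<otimes> \<theta>) \<psi>) * Re ((\<eta>\<^sup>\<star> \<otimes> \<eta>) \<psi>)"
  proof (rule discriminant_le)
    fix t
    define \<kappa> where "\<kappa> = \<theta> + cnj t *\<^sub>\<phi> \<eta>"
    have \<kappa>: "\<kappa> \<in> bidual S" by (simp add: \<kappa>_def \<eta> \<theta>)
    have "\<kappa>\<^sup>\<star> \<otimes> \<kappa> = \<theta>\<^sup>\<star> \<otimes> \<theta> + cnj t *\<^sub>\<phi> (\<theta>\<^sup>\<star> \<otimes> \<eta>) + t *\<^sub>\<phi> (\<eta>\<^sup>\<star> \<otimes> \<theta>) + t *\<^sub>\<phi> (cnj t *\<^sub>\<phi> (\<eta>\<^sup>\<star> \<otimes> \<eta>))"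
      by (simp add: \<kappa>_def bstar_linear arens_add_left arens_scale_left arens_add_right arens_scale_right \<eta> \<theta> fun_eq_iff algebra_simps)
    then have e: "(\<kappa>\<^sup>\<star> \<otimes> \<kappa>) \<psi> = (\<theta>\<^sup>\<star> \<otimes> \<theta>) \<psi> + cnj (t * (\<eta>\<^sup>\<star> \<otimes> \<theta>) \<psi>) + t * (\<eta>\<^sup>\<star> \<otimes> \<theta>) \<psi> + (t * cnj t) * (\<eta>\<^sup>\<star> \<otimes> \<eta>) \<psi>"
      by (simp add: h)
    have "0 \<le> Re ((\<kappa>\<^sup>\<star> \<otimes> \<kappa>) \<psi>)" by (rule bstar_arens_pos(1)[OF p \<kappa>])
    then show "0 \<le> Re ((\<theta>\<^sup>\<star> \<otimes> \<theta>) \<psi>) + 2 * Re (t * (\<eta>\<^sup>\<star> \<otimes> \<theta>) \<psi>) + (cmod t)\<^sup>2 * Re ((\<eta>\<^sup>\<star> \<otimes> \<eta>) \<psi>)"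
      unfolding e complex_norm_square[symmetric] by (simp del: of_real_power)
  qed (rule bstar_arens_pos(1)[OF p \<eta>])
  then show ?thesis by (simp add: mult.commute)
qed

lemma bstar_one [simp]: "(canon S 1)\<^sup>\<star> = canon S 1"
  by (simp add: bstar_canon)

lemma bidual_CS_one:
  assumes p: "pos \<psi>" and \<theta>: "\<theta> \<in> bidual S"
  shows "(cmod (\<theta> \<psi>))\<^sup>2 \<le> Re (\<psi> 1) * Re ((\<theta>\<^sup>\<star> \<otimes> \<theta>) \<psi>)"
  using bidual_CS[OF p canon_bidual[OF one_S] \<theta>] p \<theta> by simp

lemma bstar_arens_eq_0: assumes "\<eta> \<in> bidual S" "\<eta>\<^sup>\<star> \<otimes> \<eta> = 0" shows "\<eta> = 0"
proof (rule bidual_eq_pos)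
  fix \<psi> assume "pos \<psi>"
  from bidual_CS_one[OF this assms(1)] assms(2) show "\<eta> \<psi> = 0 \<psi>" by simp
qed (use assms in auto)

text \<open>This is \<xi> composed with the compression \<open>\<zeta> \<mapsto>
  \<kappa>\<^sup>\<star> \<otimes> \<zeta> \<otimes> \<kappa>\<close>. It inherits positivity from
  \<xi>, so order relations that are tested on positive functionals can be compressed by
  \<kappa>.\<close>

definition sandwich :: "'b bifunctional \<Rightarrow> 'b functional \<Rightarrow> 'b functional" where
  "sandwich \<kappa> \<xi> = bact \<kappa> (lact (\<kappa>\<^sup>\<star>) \<xi>)"

lemma sandwich_apply:
  assumes "\<xi> \<in> dual S" "\<kappa> \<in> bidual S" "\<zeta> \<in> bidual S"
  shows "\<zeta> (sandwich \<kappa> \<xi>) = (\<kappa>\<^sup>\<star> \<otimes> (\<zeta> \<otimes> \<kappa>)) \<xi>"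
  unfolding sandwich_def using assms
  by (subst arens_lact) (simp_all add: arens_apply[of "lact (\<kappa>\<^sup>\<star>) \<xi>"])

lemma sandwich_dual [simp]: "\<xi> \<in> dual S \<Longrightarrow> \<kappa> \<in> bidual S \<Longrightarrow> sandwich \<kappa> \<xi> \<in> dual S"
  by (simp add: sandwich_def)

lemma sandwich_pos:
  assumes p: "pos \<xi>" and \<kappa>: "\<kappa> \<in> bidual S" shows "pos (sandwich \<kappa> \<xi>)"
proof (rule posI)
  fix x assume x: "x \<in> S"
  have "sandwich \<kappa> \<xi> (star x * x) = canon S (star x * x) (sandwich \<kappa> \<xi>)" using p \<kappa> by simp
  also have "\<dots> = (\<kappa>\<^sup>\<star> \<otimes> (canon S (star x * x) \<otimes> \<kappa>)) \<xi>" by (intro sandwich_apply) (use p \<kappa> x in auto)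
  also have "\<kappa>\<^sup>\<star> \<otimes> (canon S (star x * x) \<otimes> \<kappa>) = (canon S x \<otimes> \<kappa>)\<^sup>\<star> \<otimes> (canon S x \<otimes> \<kappa>)"
    using x \<kappa> by (simp add: bstar_arens bstar_canon arens_assoc flip: arens_canon)
  finally show "0 \<le> Re (sandwich \<kappa> \<xi> (star x * x)) \<and> Im (sandwich \<kappa> \<xi> (star x * x)) = 0"
    using bstar_arens_pos(1,2)[OF p] x \<kappa> by simp
qed (use assms in simp)

section \<open>Polar decomposition of functionals\<close>

lemma bact_apply_arens: "\<phi> \<in> dual S \<Longrightarrow> \<theta> \<in> bidual S \<Longrightarrow> x \<in> S \<Longrightarrow> bact \<theta> \<phi> x = (canon S x \<otimes> \<theta>) \<phi>"
  by (simp add: arens_apply del: bact_apply)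

text \<open>Let \<open>\<psi> = \<phi> (\<cdot> \<eta>)\<close>, and let K be the norm of \<phi>.
  For a nearly representing vector \<open>y\<close> of \<phi>, the squared GNS norm of the
  difference between \<open>y\<close> and \<open>\<eta>\<^sup>\<star>\<close> has three
  contributions: the square of \<open>y\<close>, at most about K; twice the real part of
  \<open>\<eta> \<phi> = K\<close>, up to an error, which is subtracted; and
  \<open>\<eta> \<otimes> \<eta>\<^sup>\<star>\<close> at \<psi>, at most K. So \<open>y\<close>
  approaches \<open>\<eta>\<^sup>\<star>\<close>, which gives
  \<open>\<phi> = \<psi> (\<cdot> \<eta>\<^sup>\<star>)\<close>.\<close>

lemma polar_contraction:
  assumes \<phi>: "\<phi> \<in> dual S"
  obtains \<psi> \<eta> where "pos \<psi>" "\<eta> \<in> bidual S" "bbound 1 \<eta>" "Re (\<psi> 1) = dual_norm S \<phi>"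
    "\<eta> \<phi> = of_real (dual_norm S \<phi>)" "\<phi> = bact (\<eta>\<^sup>\<star>) \<psi>"
proof -
  let ?K = "dual_norm S \<phi>"
  obtain \<eta> where \<eta>: "\<eta> \<in> bidual S" "bbound 1 \<eta>" "pos (bact \<eta> \<phi>)" "bact \<eta> \<phi> 1 = of_real ?K" "\<eta> \<phi> = of_real ?K"
    and CI: "\<And>x. x \<in> S \<Longrightarrow> (cmod (\<phi> x))\<^sup>2 \<le> ?K * Re (bact \<eta> \<phi> (x * star x))"
    using norming_bidual[OF \<phi>] by metis
  define \<psi> where "\<psi> = bact \<eta> \<phi>"
  have p: "pos \<psi>" and \<psi>1: "Re (\<psi> 1) = ?K" using \<eta>(3,4) by (simp_all add: \<psi>_def)
  define M where "M = sqrt ?K"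
  have M: "0 \<le> M" "M\<^sup>2 = ?K" by (simp_all add: M_def dual_norm_nonneg \<phi>)
  have b: "cmod (\<phi> (star y)) \<le> M * pnorm \<psi> y" if "y \<in> S" for y
  proof -
    have "(cmod (\<phi> (star y)))\<^sup>2 \<le> ?K * Re (\<psi> (star y * y))"
      using CI[of "star y"] that by (simp add: \<psi>_def star_star)
    then have "cmod (\<phi> (star y)) \<le> sqrt (?K * Re (\<psi> (star y * y)))" by (rule real_le_rsqrt)
    then show ?thesis by (simp add: M_def pnorm_def real_sqrt_mult)
  qed
  note star_bound = bstar_arens_pos(3)[OF p bstar_bidual[OF \<eta>(1)] bbound_bstar[OF \<eta>(2)]]
  have "\<phi> = bact (\<eta>\<^sup>\<star>) \<psi>"
  proof (rule dual_eqI)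
    fix x assume x: "x \<in> S"
    have "cmod (\<phi> x - bact (\<eta>\<^sup>\<star>) \<psi> x) \<le> 0 + s * (norm x * M + norm x * M * sqrt (4 * M + 1))"
      if s: "0 < s" "s \<le> 1" for s
    proof -
      \<comment> \<open>The bound on \<delta> is for a squared seminorm; starting from a square
        leaves an error linear in \<open>s\<close>.\<close>
      define e where "e = s\<^sup>2"
      have e: "0 < e" "e \<le> s" "e \<le> 1" using s by (auto simp: e_def power2_eq_square mult_left_le mult_le_one)
      obtain y where y: "y \<in> S" "\<And>z. z \<in> S \<Longrightarrow> cmod (\<phi> (star z) - \<psi> (star z * y)) \<le> e * pnorm \<psi> z"
        "pnorm \<psi> y \<le> M + e"
        using Riesz_approx[OF p \<phi> M(1) b e(1)] by metis
      have y': "cmod (\<phi> z - \<psi> (z * y)) \<le> e * M * norm z" if z: "z \<in> S" for z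
      proof -
        have "cmod (\<phi> z - \<psi> (z * y)) \<le> e * pnorm \<psi> (star z)" using y(2)[OF star_S[OF z]] by (simp add: star_star)
        also have "\<dots> \<le> e * (norm (star z) * M)" using e pnorm_le[OF p star_S[OF z]] by (simp add: M_def \<psi>1)
        finally show ?thesis by (simp add: algebra_simps)
      qed
      define \<delta> where "\<delta> = canon S y - \<eta>\<^sup>\<star>"
      have \<delta>: "\<delta> \<in> bidual S" using y(1) \<eta>(1) by (simp add: \<delta>_def)
      have "\<delta>\<^sup>\<star> \<otimes> \<delta> = canon S (star y * y) - canon S (star y) \<otimes> \<eta>\<^sup>\<star> - (\<eta> \<otimes> canon S y - \<eta> \<otimes> \<eta>\<^sup>\<star>)"
        using y(1) \<eta>(1) by (simp add: \<delta>_def bstar_linear bstar_canon arens_diff_left arens_diff_right arens_canon)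
      then have "(\<delta>\<^sup>\<star> \<otimes> \<delta>) \<psi> = \<psi> (star y * y) - (canon S (star y) \<otimes> \<eta>\<^sup>\<star>) \<psi> - ((\<eta> \<otimes> canon S y) \<psi> - (\<eta> \<otimes> \<eta>\<^sup>\<star>) \<psi>)"
        using p by simp
      also have "(canon S (star y) \<otimes> \<eta>\<^sup>\<star>) \<psi> = cnj ((\<eta> \<otimes> canon S y) \<psi>)"
        using bstar_pos[OF p, of "\<eta> \<otimes> canon S y"] y(1) \<eta>(1) by (simp add: bstar_arens bstar_canon)
      finally have "Re ((\<delta>\<^sup>\<star> \<otimes> \<delta>) \<psi>) = (pnorm \<psi> y)\<^sup>2 - 2 * Re ((\<eta> \<otimes> canon S y) \<psi>) + Re ((\<eta> \<otimes> \<eta>\<^sup>\<star>) \<psi>)"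
        using p y(1) by (simp add: pnorm_square)
      moreover have "Re ((\<eta> \<otimes> \<eta>\<^sup>\<star>) \<psi>) \<le> ?K" using star_bound by (simp add: \<psi>1)
      moreover have "?K - e * M \<le> Re ((\<eta> \<otimes> canon S y) \<psi>)"
      proof -
        have "cmod (\<eta> \<phi> - \<eta> (rm y \<psi>)) \<le> 1 * (e * M)"
          by (rule bidual_diff_le[OF \<eta>(2,1) \<phi>]) (use p y y' e M in auto)
        then have "\<bar>Re (\<eta> \<phi> - \<eta> (rm y \<psi>))\<bar> \<le> e * M" using abs_Re_le_cmod order_trans by fastforce
        then show ?thesis using \<eta>(5) p y(1) by (simp add: arens_apply bact_canon)
      qed
      moreover have "(pnorm \<psi> y)\<^sup>2 \<le> (M + e)\<^sup>2" by (intro power_mono y pnorm_nonneg p)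
      moreover have "(M + e)\<^sup>2 \<le> ?K + 2 * (M * e) + e"
      proof -
        have "e * e \<le> e * 1" using e by (intro mult_left_mono) auto
        then show ?thesis using M(2) by (simp add: power2_eq_square algebra_simps)
      qed
      ultimately have "Re ((\<delta>\<^sup>\<star> \<otimes> \<delta>) \<psi>) \<le> e * (4 * M + 1)" by (simp add: algebra_simps)
      then have \<delta>\<psi>: "Re ((\<delta>\<^sup>\<star> \<otimes> \<delta>) \<psi>) \<le> s\<^sup>2 * (4 * M + 1)" by (simp add: e_def)
      have "(cmod (((canon S (star x))\<^sup>\<star> \<otimes> \<delta>) \<psi>))\<^sup>2 \<le> Re (((canon S (star x))\<^sup>\<star> \<otimes> canon S (star x)) \<psi>) * Re ((\<delta>\<^sup>\<star> \<otimes> \<delta>) \<psi>)"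
        by (rule bidual_CS[OF p _ \<delta>]) (simp add: x)
      also have "(canon S (star x))\<^sup>\<star> = canon S x" using x by (simp add: bstar_canon star_star)
      also have "Re ((canon S x \<otimes> canon S (star x)) \<psi>) = (pnorm \<psi> (star x))\<^sup>2"
        using x p by (simp add: arens_canon pnorm_square star_star)
      also have "(pnorm \<psi> (star x))\<^sup>2 * Re ((\<delta>\<^sup>\<star> \<otimes> \<delta>) \<psi>) \<le> (norm x * M)\<^sup>2 * (s\<^sup>2 * (4 * M + 1))"
        using pnorm_le[OF p star_S[OF x]] by (intro mult_mono power_mono \<delta>\<psi> bstar_arens_pos(1)[OF p \<delta>] pnorm_nonneg p)
           (simp_all add: x M_def \<psi>1)
      also have "\<dots> = (norm x * M * (s * sqrt (4 * M + 1)))\<^sup>2"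
        using M by (simp add: power_mult_distrib)
      finally have "cmod ((canon S x \<otimes> \<delta>) \<psi>) \<le> norm x * M * (s * sqrt (4 * M + 1))"
        by (rule power2_le_imp_le) (use M s in \<open>simp add: mult_nonneg_nonneg\<close>)
      moreover have "(canon S x \<otimes> \<delta>) \<psi> = \<psi> (x * y) - bact (\<eta>\<^sup>\<star>) \<psi> x"
        unfolding bact_apply_arens[OF pos_dual[OF p] bstar_bidual[OF \<eta>(1)] x]
        using x y(1) \<eta>(1) p by (simp add: \<delta>_def arens_diff_right arens_canon)
      moreover have "cmod (\<phi> x - \<psi> (x * y)) \<le> s * (norm x * M)"
        using order_trans[OF y'[OF x], of "s * (norm x * M)"] e(2) M by (simp add: mult.assoc mult_right_mono mult.commute[of M])
      ultimately show ?thesis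
        using norm_triangle_ineq[of "\<phi> x - \<psi> (x * y)" "\<psi> (x * y) - bact (\<eta>\<^sup>\<star>) \<psi> x"]
        by (simp add: algebra_simps del: bact_apply)
    qed
    then have "cmod (\<phi> x - bact (\<eta>\<^sup>\<star>) \<psi> x) \<le> 0" by (rule le_if_le_plus_small)
    then show "\<phi> x = bact (\<eta>\<^sup>\<star>) \<psi> x" by (simp del: bact_apply)
  qed (use \<phi> p \<eta> in auto)
  with p \<psi>1 \<eta> that show thesis by blast
qed

text \<open>\<open>\<kappa> \<phi>\<close> is an inner product over \<psi> of
  \<open>\<kappa>\<^sup>\<star>\<close> with a contraction. The inequality reduces norm bounds in
  the bidual to values of \<open>\<kappa> \<otimes> \<kappa>\<^sup>\<star>\<close> at positive
  functionals; \<open>left_polar\<close> does the same with the factors exchanged.\<close>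

lemma right_polar:
  assumes \<phi>: "\<phi> \<in> dual S"
  obtains \<psi> where "pos \<psi>" "Re (\<psi> 1) = dual_norm S \<phi>"
    "\<And>\<kappa>. \<kappa> \<in> bidual S \<Longrightarrow> (cmod (\<kappa> \<phi>))\<^sup>2 \<le> dual_norm S \<phi> * Re ((\<kappa> \<otimes> \<kappa>\<^sup>\<star>) \<psi>)"
proof -
  obtain \<psi> \<eta> where p: "pos \<psi>" and \<eta>: "\<eta> \<in> bidual S" "bbound 1 \<eta>" and \<psi>1: "Re (\<psi> 1) = dual_norm S \<phi>"
    and e: "\<phi> = bact (\<eta>\<^sup>\<star>) \<psi>" using polar_contraction[OF \<phi>] by metis
  have "(cmod (\<kappa> \<phi>))\<^sup>2 \<le> dual_norm S \<phi> * Re ((\<kappa> \<otimes> \<kappa>\<^sup>\<star>) \<psi>)" if \<kappa>: "\<kappa> \<in> bidual S" for \<kappa>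
  proof -
    have "\<kappa> \<phi> = (\<kappa> \<otimes> \<eta>\<^sup>\<star>) \<psi>" unfolding e using p by (simp add: arens_apply)
    then have "(cmod (\<kappa> \<phi>))\<^sup>2 \<le> Re ((\<kappa> \<otimes> \<kappa>\<^sup>\<star>) \<psi>) * Re ((\<eta> \<otimes> \<eta>\<^sup>\<star>) \<psi>)"
      using bidual_CS[OF p bstar_bidual[OF \<kappa>] bstar_bidual[OF \<eta>(1)]] by simp
    also have "\<dots> \<le> Re ((\<kappa> \<otimes> \<kappa>\<^sup>\<star>) \<psi>) * dual_norm S \<phi>"
      using bstar_arens_pos(3)[OF p bstar_bidual[OF \<eta>(1)] bbound_bstar[OF \<eta>(2)]]
        bstar_arens_pos(1)[OF p bstar_bidual[OF \<kappa>]] by (intro mult_left_mono) (simp_all add: \<psi>1)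
    finally show ?thesis by (simp add: mult.commute)
  qed
  with p \<psi>1 that show thesis by blast
qed

lemma left_polar:
  assumes \<phi>: "\<phi> \<in> dual S"
  obtains \<psi> where "pos \<psi>" "Re (\<psi> 1) = dual_norm S \<phi>"
    "\<And>\<kappa>. \<kappa> \<in> bidual S \<Longrightarrow> (cmod (\<kappa> \<phi>))\<^sup>2 \<le> dual_norm S \<phi> * Re ((\<kappa>\<^sup>\<star> \<otimes> \<kappa>) \<psi>)"
proof -
  obtain \<psi> where \<psi>: "pos \<psi>" "Re (\<psi> 1) = dual_norm S (dstar \<phi>)"
    "\<And>\<kappa>. \<kappa> \<in> bidual S \<Longrightarrow> (cmod (\<kappa> (dstar \<phi>)))\<^sup>2 \<le> dual_norm S (dstar \<phi>) * Re ((\<kappa> \<otimes> \<kappa>\<^sup>\<star>) \<psi>)"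
    using right_polar[OF dstar_dual[OF \<phi>]] by metis
  have n: "dual_norm S (dstar \<phi>) = dual_norm S \<phi>"
    using dstar_norm_le[OF \<phi>] dstar_norm_le[OF dstar_dual[OF \<phi>]] by simp
  have "(cmod (\<kappa> \<phi>))\<^sup>2 \<le> dual_norm S \<phi> * Re ((\<kappa>\<^sup>\<star> \<otimes> \<kappa>) \<psi>)" if "\<kappa> \<in> bidual S" for \<kappa>
    using \<psi>(3)[OF bstar_bidual[OF that]] by (simp add: n bstar_apply[of \<kappa> "dstar \<phi>"])
  with \<psi>(1,2) n that show thesis by metis
qed

text \<open>The positive part of the unit ball of the bidual. The description by values at positive
  functionals is stable under weak* limits.\<close>

definition effect :: "'b bifunctional \<Rightarrow> bool" where
  "effect h \<longleftrightarrow> h \<in> bidual S \<and> (\<forall>\<xi>. pos \<xi> \<longrightarrow> 0 \<le> Re (h \<xi>) \<and> Re (h \<xi>) \<le> Re (\<xi> 1) \<and> Im (h \<xi>) = 0)"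

lemma effectD: assumes "effect h" shows "h \<in> bidual S" "pos \<xi> \<Longrightarrow> 0 \<le> Re (h \<xi>)"
    "pos \<xi> \<Longrightarrow> Re (h \<xi>) \<le> Re (\<xi> 1)" "pos \<xi> \<Longrightarrow> Im (h \<xi>) = 0"
  using assms by (auto simp: effect_def)

lemma effect_bstar: assumes "effect h" shows "h\<^sup>\<star> = h"
  by (rule bidual_eq_pos) (use effectD[OF assms] in \<open>auto simp: bstar_pos complex_eq_iff\<close>)

text \<open>The inequality \<open>h \<otimes> h \<le> h\<close> is obtained without a square root of
  \<open>h\<close>: the difference is the sum of (1 - h) h (1 - h) and h (1 - h) h.\<close>

lemma effect_square:
  assumes h: "effect h" and p: "pos \<xi>"
  shows "0 \<le> Re ((h \<otimes> h) \<xi>)" "Im ((h \<otimes> h) \<xi>) = 0" "Re ((h \<otimes> h) \<xi>) \<le> Re (h \<xi>)"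
proof -
  note hb = effectD(1)[OF h] and sh = effect_bstar[OF h]
  show "0 \<le> Re ((h \<otimes> h) \<xi>)" "Im ((h \<otimes> h) \<xi>) = 0"
    using bstar_arens_pos(1,2)[OF p hb] by (simp_all add: sh)
  have "0 \<le> Re (h (sandwich (canon S 1 - h) \<xi>))" by (intro effectD(2)[OF h] sandwich_pos p) (simp add: hb)
  also have "h (sandwich (canon S 1 - h) \<xi>) = (h - h \<otimes> h - (h \<otimes> h - h \<otimes> (h \<otimes> h))) \<xi>"
    by (subst sandwich_apply) (use p hb in \<open>simp_all add: bstar_linear sh arens_diff_left arens_diff_right\<close>)
  finally have 1: "0 \<le> Re (h \<xi>) - 2 * Re ((h \<otimes> h) \<xi>) + Re ((h \<otimes> (h \<otimes> h)) \<xi>)" by simp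
  have "Re (h (sandwich h \<xi>)) \<le> Re (sandwich h \<xi> 1)" by (intro effectD(3)[OF h] sandwich_pos p hb)
  also have "sandwich h \<xi> 1 = canon S 1 (sandwich h \<xi>)" using p hb by simp
  also have "\<dots> = (h \<otimes> h) \<xi>" by (subst sandwich_apply) (use p hb in \<open>simp_all add: sh\<close>)
  also have "h (sandwich h \<xi>) = (h \<otimes> (h \<otimes> h)) \<xi>" by (subst sandwich_apply) (use p hb in \<open>simp_all add: sh\<close>)
  finally show "Re ((h \<otimes> h) \<xi>) \<le> Re (h \<xi>)" using 1 by simp
qed

text \<open>\<open>right_polar\<close> bounds the value at \<phi> by that of
  \<open>h \<otimes> h\<close> at a positive functional, and \<open>effect_square\<close> leads back
  to \<open>h\<close>.\<close>

lemma effect_bbound: assumes h: "effect h" shows "bbound 1 h"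
  unfolding bbound_def
proof (intro conjI ballI)
  fix \<phi> assume \<phi>: "\<phi> \<in> dual S"
  obtain \<psi> where \<psi>: "pos \<psi>" "Re (\<psi> 1) = dual_norm S \<phi>"
    "(cmod (h \<phi>))\<^sup>2 \<le> dual_norm S \<phi> * Re ((h \<otimes> h\<^sup>\<star>) \<psi>)"
    using right_polar[OF \<phi>] effectD(1)[OF h] by metis
  have "Re ((h \<otimes> h\<^sup>\<star>) \<psi>) \<le> dual_norm S \<phi>"
    using effect_square(3)[OF h \<psi>(1)] effectD(3)[OF h \<psi>(1)] by (simp add: effect_bstar[OF h] \<psi>(2))
  then have "(cmod (h \<phi>))\<^sup>2 \<le> (dual_norm S \<phi>)\<^sup>2"
    using \<psi>(3) mult_left_mono[OF _ dual_norm_nonneg[OF \<phi>]] by (fastforce simp: power2_eq_square)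
  then have "cmod (h \<phi>) \<le> dual_norm S \<phi>" by (rule power2_le_imp_le[OF _ dual_norm_nonneg[OF \<phi>]])
  then show "cmod (h \<phi>) \<le> 1 * dual_norm S \<phi>" by simp
qed simp

section \<open>Projections of the bidual and supports of positive functionals\<close>

lemma bidual_projectionD:
  assumes "bidual_projection S p"
  shows "p \<in> bidual S" "p \<otimes> p = p" "p\<^sup>\<star> = p"
  using assms by (auto simp: bidual_projection_def)

lemma projection_complement:
  assumes "bidual_projection S p" shows "bidual_projection S (canon S 1 - p)"
  using bidual_projectionD[OF assms] unfolding bidual_projection_def
  by (simp add: arens_diff_left arens_diff_right bstar_linear)

lemma effect_projection: assumes e: "bidual_projection S e" shows "effect e"
  unfolding effect_def
proof (intro conjI allI impI)
  fix \<xi> assume p: "pos \<xi>"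
  note E = bidual_projectionD[OF e] and F = bidual_projectionD[OF projection_complement[OF e]]
  show "0 \<le> Re (e \<xi>)" "Im (e \<xi>) = 0" using bstar_arens_pos(1,2)[OF p E(1)] by (simp_all add: E)
  show "Re (e \<xi>) \<le> Re (\<xi> 1)" using bstar_arens_pos(1)[OF p F(1)] p unfolding F by simp
qed (use bidual_projectionD[OF e] in simp)

lemma null_projection_right:
  assumes n: "bidual_projection S n" and p: "pos \<psi>" and z: "n \<psi> = 0" and \<kappa>: "\<kappa> \<in> bidual S"
  shows "(\<kappa> \<otimes> n) \<psi> = 0" "(n \<otimes> \<kappa>) \<psi> = 0"
proof -
  note N = bidual_projectionD[OF n]
  have *: "(\<theta> \<otimes> n) \<psi> = 0" if "\<theta> \<in> bidual S" for \<theta>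
    using bidual_CS[OF p bstar_bidual[OF that] N(1)] z by (simp add: N)
  show "(\<kappa> \<otimes> n) \<psi> = 0" by (rule *[OF \<kappa>])
  have "(n \<otimes> \<kappa>) \<psi> = cnj ((n \<otimes> \<kappa>)\<^sup>\<star> \<psi>)" by (simp add: bstar_pos[OF p])
  also have "(n \<otimes> \<kappa>)\<^sup>\<star> = \<kappa>\<^sup>\<star> \<otimes> n" by (simp add: bstar_arens N \<kappa>)
  finally show "(n \<otimes> \<kappa>) \<psi> = 0" using * \<kappa> by simp
qed

text \<open>The complement of the support projection is a maximal element of the positive part of the unit
  ball on which \<open>\<psi>\<close> vanishes: \<open>f \<le> 2 f - f\<^sup>2\<close> forces a maximal \<open>f\<close> to be a projection.\<close>

lemma maximal_null_projection:
  assumes p: "pos \<psi>"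
  obtains f where "bidual_projection S f" "f \<psi> = 0"
    "\<And>h. h \<in> bidual S \<Longrightarrow> (\<And>\<xi>. pos \<xi> \<Longrightarrow> 0 \<le> Re (h \<xi>) \<and> Re (h \<xi>) + Re (f \<xi>) \<le> Re (\<xi> 1) \<and> Im (h \<xi>) = 0) \<Longrightarrow>
       h \<psi> = 0 \<Longrightarrow> h = 0"
proof -
  let ?P = "{h. effect h \<and> h \<psi> = 0}"
  let ?le = "\<lambda>h k. \<forall>\<xi>. pos \<xi> \<longrightarrow> Re (h \<xi>) \<le> Re (k \<xi>)"
  have e0: "effect 0" by (simp add: effect_def pos_one)
  have "\<exists>f\<in>?P. \<forall>k\<in>?P. ?le f k \<longrightarrow> k = f"
  proof (rule Zorn_upper_bounds[of ?P ?le])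
    show "?P \<noteq> {}" using e0 by (auto intro!: exI[of _ 0])
  next
    fix a b c :: "'b bifunctional" assume "?le a b" "?le b c"
    then show "?le a c" using order_trans by blast
  next
    fix a b assume ab: "a \<in> ?P" "b \<in> ?P" "?le a b" "?le b a"
    show "a = b"
    proof (rule bidual_eq_pos)
      fix \<xi> assume "pos \<xi>"
      then show "a \<xi> = b \<xi>" using ab effectD(4)[of a \<xi>] effectD(4)[of b \<xi>] by (auto simp: complex_eq_iff intro!: antisym)
    qed (use ab effectD(1) in auto)
  next
    fix C assume C: "C \<subseteq> ?P" "C \<noteq> {}" and ch: "\<And>a b. a \<in> C \<Longrightarrow> b \<in> C \<Longrightarrow> ?le a b \<or> ?le b a"
    define F where "F = (INF h\<in>C. principal {k\<in>C. ?le h k})"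
    have ev: "eventually Q F \<longleftrightarrow> (\<exists>h\<in>C. eventually Q (principal {k\<in>C. ?le h k}))" for Q
      unfolding F_def
    proof (rule eventually_INF_base[OF C(2)])
      fix a b assume ab: "a \<in> C" "b \<in> C"
      have sub: "principal {k\<in>C. ?le y k} \<le> principal {k\<in>C. ?le x k}" if "?le x y" for x y
      proof -
        have "{k\<in>C. ?le y k} \<subseteq> {k\<in>C. ?le x k}" using that order_trans by blast
        then show ?thesis unfolding principal_le_iff .
      qed
      show "\<exists>x\<in>C. principal {k\<in>C. ?le x k} \<le> inf (principal {k\<in>C. ?le a k}) (principal {k\<in>C. ?le b k})"
        using ch[OF ab]
      proof
        assume "?le a b" then show ?thesis using sub[of a b] ab by (intro bexI[of _ b] inf_greatest) auto
      next
        assume "?le b a" then show ?thesis using sub[of b a] ab by (intro bexI[of _ a] inf_greatest) auto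
      qed
    qed
    have "\<not> eventually (\<lambda>_. False) F" unfolding ev by (auto simp: eventually_principal)
    then have "F \<noteq> bot" by (simp add: trivial_limit_def)
    then obtain U where U: "U \<noteq> bot" "U \<le> F" "\<And>P. eventually P U \<or> eventually (\<lambda>x. \<not> P x) U"
      using maximal_filter by metis
    \<comment> \<open>\<open>bidual_limit\<close> asks for bounds at every index. The default 0 is
      an effect that vanishes at \<psi>, and the filter \<open>U\<close> is concentrated on
      \<open>C\<close>.\<close>
    define H where "H i = (if i \<in> C then i else 0)" for i :: "'b bifunctional"
    have H: "effect (H i)" "H i \<psi> = 0" for i using C(1) e0 by (auto simp: H_def)
    obtain k where k: "k \<in> bidual S" "\<And>\<phi>. \<phi> \<in> dual S \<Longrightarrow> ((\<lambda>i. H i \<phi>) \<longlongrightarrow> k \<phi>) U"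
    proof (rule bidual_limit[OF U(1,3), of H 1])
      show "H i \<in> bidual S" for i by (rule effectD(1)[OF H(1)])
      show "bbound 1 (H i)" for i by (rule effect_bbound[OF H(1)])
    qed blast
    have "effect k" unfolding effect_def
    proof (intro conjI allI impI k(1))
      fix \<xi> assume x: "pos \<xi>"
      note l = k(2)[OF pos_dual[OF x]]
      show "0 \<le> Re (k \<xi>)"
        by (rule tendsto_lowerbound[OF tendsto_Re[OF l] _ U(1)]) (simp add: effectD(2)[OF H(1) x] always_eventually)
      show "Re (k \<xi>) \<le> Re (\<xi> 1)"
        by (rule tendsto_upperbound[OF tendsto_Re[OF l] _ U(1)]) (simp add: effectD(3)[OF H(1) x] always_eventually)
      have "((\<lambda>n. 0) \<longlongrightarrow> Im (k \<xi>)) U" using tendsto_Im[OF l] by (simp add: effectD(4)[OF H(1) x])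
      then show "Im (k \<xi>) = 0" using tendsto_unique[OF U(1) _ tendsto_const] by metis
    qed
    moreover have "((\<lambda>n. 0) \<longlongrightarrow> k \<psi>) U" using k(2)[OF pos_dual[OF p]] by (simp add: H(2))
    then have "k \<psi> = 0" using tendsto_unique[OF U(1) _ tendsto_const] by metis
    moreover have "?le h k" if h: "h \<in> C" for h
    proof (intro allI impI)
      fix \<xi> assume x: "pos \<xi>"
      have "eventually (\<lambda>i. i \<in> C \<and> ?le h i) F" unfolding ev using h by (auto simp: eventually_principal)
      then have "eventually (\<lambda>i. i \<in> C \<and> ?le h i) U" using U(2) by (rule filter_leD[rotated])
      then have "eventually (\<lambda>i. Re (h \<xi>) \<le> Re (H i \<xi>)) U"
        by (rule eventually_mono) (use x in \<open>auto simp: H_def\<close>)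
      then show "Re (h \<xi>) \<le> Re (k \<xi>)" by (rule tendsto_lowerbound[OF tendsto_Re[OF k(2)[OF pos_dual[OF x]]] _ U(1)])
    qed
    ultimately show "\<exists>u\<in>?P. \<forall>a\<in>C. ?le a u" by blast
  next
    fix m assume "m \<in> ?P" "\<And>k. k \<in> ?P \<Longrightarrow> ?le m k \<Longrightarrow> k = m"
    then show "\<exists>f\<in>?P. \<forall>k\<in>?P. ?le f k \<longrightarrow> k = f" by blast
  qed simp
  then obtain f where f: "effect f" "f \<psi> = 0" and max: "\<And>k. effect k \<Longrightarrow> k \<psi> = 0 \<Longrightarrow> ?le f k \<Longrightarrow> k = f"
    by blast
  note fb = effectD(1)[OF f(1)] and sf = effect_bstar[OF f(1)]
  let ?g = "f + (f - f \<otimes> f)"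
  have "?g = f"
  proof (rule max)
    show "effect ?g" unfolding effect_def
    proof (intro conjI allI impI)
      fix \<xi> assume x: "pos \<xi>"
      note q = effect_square[OF f(1) x]
      show "0 \<le> Re (?g \<xi>)" using q(3) effectD(2)[OF f(1) x] by simp
      show "Im (?g \<xi>) = 0" using q(2) effectD(4)[OF f(1) x] by simp
      \<comment> \<open>The complement of \<open>?g\<close> is the square of
        \<open>1 - f\<close>.\<close>
      have "0 \<le> Re (((canon S 1 - f)\<^sup>\<star> \<otimes> (canon S 1 - f)) \<xi>)" by (rule bstar_arens_pos(1)[OF x]) (simp add: fb)
      also have "(canon S 1 - f)\<^sup>\<star> \<otimes> (canon S 1 - f) = canon S 1 - f - (f - f \<otimes> f)"
        using fb by (simp add: bstar_linear sf arens_diff_left arens_diff_right)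
      finally show "Re (?g \<xi>) \<le> Re (\<xi> 1)" using x by simp
    qed (intro bidual_plus bidual_diff arens_bidual fb)
    have "(f \<otimes> f) \<psi> = 0" using effect_square[OF f(1) p] f(2) by (simp add: complex_eq_iff)
    then show "?g \<psi> = 0" using f(2) by simp
    show "?le f ?g" using effect_square(3)[OF f(1)] by simp
  qed
  then have ff: "f \<otimes> f = f" by simp
  have "bidual_projection S f" by (simp add: bidual_projection_def fb ff sf)
  moreover have "h = 0" if h: "h \<in> bidual S" "h \<psi> = 0"
    and hx: "\<And>\<xi>. pos \<xi> \<Longrightarrow> 0 \<le> Re (h \<xi>) \<and> Re (h \<xi>) + Re (f \<xi>) \<le> Re (\<xi> 1) \<and> Im (h \<xi>) = 0" for h
  proof -
    have "f + h = f"
    proof (rule max)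
      show "effect (f + h)" unfolding effect_def
        using hx effectD(2,4)[OF f(1)] by (auto simp: fb h add.commute)
      show "(f + h) \<psi> = 0" by (simp add: f h)
      show "?le f (f + h)" using hx by simp
    qed
    then show ?thesis by simp
  qed
  ultimately show thesis using that[of f] f(2) by blast
qed

text \<open>If \<psi> has its full mass on \<open>e\<close>, then \<open>g = 1 - e\<close> vanishes
  at \<psi>, and so does its compression by \<open>1 - f\<close>. This compression can be added to
  \<open>f\<close> within the unit ball, so maximality makes it 0. Hence \<open>g\<close> is below
  \<open>f\<close>, which is the required inequality for the complements.\<close>

lemma support_projection_complement:
  assumes p: "pos \<psi>" and f: "bidual_projection S f" "f \<psi> = 0"
    and max: "\<And>h. h \<in> bidual S \<Longrightarrow> (\<And>\<xi>. pos \<xi> \<Longrightarrow> 0 \<le> Re (h \<xi>) \<and> Re (h \<xi>) + Re (f \<xi>) \<le> Re (\<xi> 1) \<and> Im (h \<xi>) = 0) \<Longrightarrow>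
       h \<psi> = 0 \<Longrightarrow> h = 0"
  shows "support_projection S \<psi> (canon S 1 - f)"
  unfolding support_projection_def
proof (intro conjI allI impI)
  define \<theta> where "\<theta> = canon S 1 - f"
  have P: "bidual_projection S \<theta>" unfolding \<theta>_def by (rule projection_complement[OF f(1)])
  then show "bidual_projection S (canon S 1 - f)" by (simp add: \<theta>_def)
  note T = bidual_projectionD[OF P] and F = bidual_projectionD[OF f(1)]
  show "(canon S 1 - f) \<psi> = canon S 1 \<psi>" by (simp add: f(2))
  fix e assume e: "bidual_projection S e \<and> e \<psi> = canon S 1 \<psi>"
  define g where "g = canon S 1 - e"
  have gP: "bidual_projection S g" and g\<psi>: "g \<psi> = 0" using e projection_complement[of e] by (simp_all add: g_def)
  note G = bidual_projectionD[OF gP]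
  let ?k = "\<theta> \<otimes> (g \<otimes> \<theta>)"
  have kx: "?k \<xi> = g (sandwich \<theta> \<xi>)" if "pos \<xi>" for \<xi>
    by (subst sandwich_apply) (use that T G in simp_all)
  have "?k = 0"
  proof (rule max)
    show "?k \<in> bidual S" using T G by simp
    show "?k \<psi> = 0"
    proof -
      have "g \<otimes> \<theta> = g - g \<otimes> f" using F(1) G(1) by (simp add: \<theta>_def arens_diff_right)
      then have "?k = \<theta> \<otimes> g - (\<theta> \<otimes> g) \<otimes> f" using T(1) F(1) G(1) by (simp add: arens_diff_right arens_assoc)
      then show ?thesis using null_projection_right(1)[OF gP p g\<psi> T(1)]
          null_projection_right(1)[OF f(1) p f(2), of "\<theta> \<otimes> g"] T(1) G(1) by simp
    qed
    fix \<xi> assume x: "pos \<xi>"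
    have sp: "pos (sandwich \<theta> \<xi>)" by (rule sandwich_pos[OF x T(1)])
    have "sandwich \<theta> \<xi> 1 = canon S 1 (sandwich \<theta> \<xi>)" using sp by simp
    also have "\<dots> = \<theta> \<xi>" by (subst sandwich_apply) (use x T in simp_all)
    finally have "Re (sandwich \<theta> \<xi> 1) = Re (\<xi> 1) - Re (f \<xi>)" using x by (simp add: \<theta>_def)
    then show "0 \<le> Re (?k \<xi>) \<and> Re (?k \<xi>) + Re (f \<xi>) \<le> Re (\<xi> 1) \<and> Im (?k \<xi>) = 0"
      using effectD(2-4)[OF effect_projection[OF gP]] sp unfolding kx[OF x] by fastforce
  qed
  then have "(g \<otimes> \<theta>)\<^sup>\<star> \<otimes> (g \<otimes> \<theta>) = 0"
    using T G arens_assoc[of g "g \<otimes> \<theta>" \<theta>] arens_assoc[of g \<theta> g] by (simp add: bstar_arens)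
  then have "g \<otimes> \<theta> = 0" by (rule bstar_arens_eq_0[rotated]) (use T G in simp)
  then have gf: "g \<otimes> f = g" using F(1) G(1) by (simp add: \<theta>_def arens_diff_right)
  have fg: "f \<otimes> g = g" using bstar_arens[OF G(1) F(1)] by (simp add: gf F G)
  show "bidual_le S (canon S 1 - f) e" unfolding bidual_le_def bidual_positive_def
  proof (intro bexI)
    have "(\<lambda>\<phi>. e \<phi> - (canon S 1 - f) \<phi>) = f - g" by (auto simp: g_def fun_eq_iff)
    also have "\<dots> = (f - g)\<^sup>\<star> \<otimes> (f - g)"
      using F G by (simp add: bstar_linear arens_diff_left arens_diff_right gf fg)
    finally show "(\<lambda>\<phi>. e \<phi> - (canon S 1 - f) \<phi>) = (f - g)\<^sup>\<star> \<otimes> (f - g)" .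
  qed (use F G in simp)
qed

text \<open>\<open>polar_contraction\<close> yields only a contraction. It becomes a partial
  isometry when cut down by the support projection \<open>e\<close>:
  \<open>1 - \<eta> \<otimes> \<eta>\<^sup>\<star>\<close> vanishes at \<psi>, so its compression by
  \<open>e\<close> vanishes at \<psi> as well and is 0 by maximality of \<open>f\<close>. Thus
  \<open>u = \<eta>\<^sup>\<star> \<otimes> e\<close> satisfies
  \<open>u\<^sup>\<star> \<otimes> u = e\<close>.\<close>

lemma is_abs_functional_exists:
  assumes \<phi>: "\<phi> \<in> dual S" shows "\<exists>\<psi>. is_abs_functional S \<phi> \<psi>"
proof -
  obtain \<psi> \<eta> where p: "pos \<psi>" and \<eta>: "\<eta> \<in> bidual S" "bbound 1 \<eta>" and \<psi>1: "Re (\<psi> 1) = dual_norm S \<phi>"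
    and \<eta>\<phi>: "\<eta> \<phi> = of_real (dual_norm S \<phi>)" and e\<phi>: "\<phi> = bact (\<eta>\<^sup>\<star>) \<psi>"
    using polar_contraction[OF \<phi>] by metis
  obtain f where f: "bidual_projection S f" "f \<psi> = 0"
    and max: "\<And>h. h \<in> bidual S \<Longrightarrow> (\<And>\<xi>. pos \<xi> \<Longrightarrow> 0 \<le> Re (h \<xi>) \<and> Re (h \<xi>) + Re (f \<xi>) \<le> Re (\<xi> 1) \<and> Im (h \<xi>) = 0) \<Longrightarrow>
       h \<psi> = 0 \<Longrightarrow> h = 0"
    using maximal_null_projection[OF p] by blast
  define e where "e = canon S 1 - f"
  have sup: "support_projection S \<psi> e" unfolding e_def by (rule support_projection_complement[OF p f max])
  have eP: "bidual_projection S e" unfolding e_def by (rule projection_complement[OF f(1)])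
  note E = bidual_projectionD[OF eP] and F = bidual_projectionD[OF f(1)]
  have \<kappa>e: "(\<kappa> \<otimes> e) \<psi> = \<kappa> \<psi>" "(e \<otimes> \<kappa>) \<psi> = \<kappa> \<psi>" if "\<kappa> \<in> bidual S" for \<kappa>
    using null_projection_right[OF f(1) p f(2) that] that F(1) by (simp_all add: e_def arens_diff_left arens_diff_right)
  have \<kappa>\<phi>: "\<kappa> \<phi> = (\<kappa> \<otimes> \<eta>\<^sup>\<star>) \<psi>" for \<kappa> by (subst e\<phi>) (simp add: arens_apply p)
  define \<kappa> where "\<kappa> = canon S 1 - \<eta> \<otimes> \<eta>\<^sup>\<star>"
  have \<kappa>: "\<kappa> \<in> bidual S" using \<eta>(1) by (simp add: \<kappa>_def)
  have "e \<otimes> (\<kappa> \<otimes> e) = 0"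
  proof (rule max)
    show "e \<otimes> (\<kappa> \<otimes> e) \<in> bidual S" using E \<kappa> by simp
    have "(e \<otimes> (\<kappa> \<otimes> e)) \<psi> = \<kappa> \<psi>" using E(1) \<kappa> by (simp add: \<kappa>e)
    also have "\<dots> = 0" using p \<kappa>\<phi>[of \<eta>] \<eta>\<phi> \<psi>1 pos_one(2)[OF p] by (simp add: \<kappa>_def complex_eq_iff)
    finally show "(e \<otimes> (\<kappa> \<otimes> e)) \<psi> = 0" .
    fix \<xi> assume x: "pos \<xi>"
    have sp: "pos (sandwich e \<xi>)" by (rule sandwich_pos[OF x E(1)])
    have 1: "(e \<otimes> (\<kappa> \<otimes> e)) \<xi> = \<kappa> (sandwich e \<xi>)" by (subst sandwich_apply) (use x E \<kappa> in simp_all)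
    have "sandwich e \<xi> 1 = canon S 1 (sandwich e \<xi>)" using sp by simp
    also have "\<dots> = e \<xi>" by (subst sandwich_apply) (use x E in simp_all)
    finally have 2: "Re (sandwich e \<xi> 1) = Re (\<xi> 1) - Re (f \<xi>)" using x by (simp add: e_def)
    note b = bstar_arens_pos[OF sp bstar_bidual[OF \<eta>(1)]] bbound_bstar[OF \<eta>(2)]
    have 3: "0 \<le> Re ((\<eta> \<otimes> \<eta>\<^sup>\<star>) (sandwich e \<xi>))" "Im ((\<eta> \<otimes> \<eta>\<^sup>\<star>) (sandwich e \<xi>)) = 0"
      "Re ((\<eta> \<otimes> \<eta>\<^sup>\<star>) (sandwich e \<xi>)) \<le> Re (sandwich e \<xi> 1)"
      using b(1,2) b(3)[OF b(4)] by simp_all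
    have 4: "\<kappa> (sandwich e \<xi>) = sandwich e \<xi> 1 - (\<eta> \<otimes> \<eta>\<^sup>\<star>) (sandwich e \<xi>)" using sp by (simp add: \<kappa>_def)
    show "0 \<le> Re ((e \<otimes> (\<kappa> \<otimes> e)) \<xi>) \<and> Re ((e \<otimes> (\<kappa> \<otimes> e)) \<xi>) + Re (f \<xi>) \<le> Re (\<xi> 1) \<and> Im ((e \<otimes> (\<kappa> \<otimes> e)) \<xi>) = 0"
      unfolding 1 4 using 2 3 pos_one(2)[OF sp] by simp
  qed
  then have ee: "e \<otimes> ((\<eta> \<otimes> \<eta>\<^sup>\<star>) \<otimes> e) = e"
    using E \<eta>(1) by (simp add: \<kappa>_def arens_diff_left arens_diff_right)
  define u where "u = \<eta>\<^sup>\<star> \<otimes> e"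
  have u: "u \<in> bidual S" using \<eta>(1) E(1) by (simp add: u_def)
  have su: "u\<^sup>\<star> = e \<otimes> \<eta>" using \<eta>(1) E by (simp add: u_def bstar_arens)
  have uu: "u\<^sup>\<star> \<otimes> u = e" unfolding su unfolding u_def using ee \<eta>(1) E(1) by (simp add: arens_assoc)
  have "(u \<otimes> u\<^sup>\<star>) \<otimes> u = u" using u uu \<eta>(1) E by (simp add: arens_assoc) (simp add: u_def arens_assoc E \<eta>)
  moreover have x\<phi>: "x \<phi> = (x \<otimes> u) \<psi>" if "x \<in> bidual S" for x
    unfolding u_def \<kappa>\<phi> using that \<eta>(1) E(1) \<kappa>e(1)[of "x \<otimes> \<eta>\<^sup>\<star>"] by (simp add: arens_assoc)
  moreover have "x \<psi> = (x \<otimes> u\<^sup>\<star>) \<phi>" if "x \<in> bidual S" for x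
    using x\<phi>[of "x \<otimes> u\<^sup>\<star>"] that u uu \<kappa>e(1)[OF that] by (simp add: arens_assoc)
  ultimately have "is_abs_functional S \<phi> \<psi>"
    unfolding is_abs_functional_def using p u uu sup by blast
  then show ?thesis by blast
qed

text \<open>Take \<open>w = u1\<^sup>\<star> \<otimes> u2\<close> for the two partial isometries.
  Since \<open>u1 \<otimes> u1\<^sup>\<star>\<close> is a projection,
  \<open>w\<^sup>\<star> \<otimes> w\<close> is below
  \<open>u2\<^sup>\<star> \<otimes> u2\<close>.\<close>

lemma is_abs_functional_unique_aux:
  assumes 1: "is_abs_functional S \<phi> \<psi>1" and 2: "is_abs_functional S \<phi> \<psi>2"
  obtains w where "w \<in> bidual S" "\<And>x. x \<in> bidual S \<Longrightarrow> x \<psi>1 = (x \<otimes> w) \<psi>2" "Re ((w\<^sup>\<star> \<otimes> w) \<psi>2) \<le> Re (\<psi>2 1)"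
proof -
  from 1 obtain u1 where u1: "u1 \<in> bidual S" "(u1 \<otimes> u1\<^sup>\<star>) \<otimes> u1 = u1" "\<And>x. x \<in> bidual S \<Longrightarrow> x \<psi>1 = (x \<otimes> u1\<^sup>\<star>) \<phi>"
    unfolding is_abs_functional_def by blast
  from 2 obtain u2 where u2: "u2 \<in> bidual S" "support_projection S \<psi>2 (u2\<^sup>\<star> \<otimes> u2)" "\<And>x. x \<in> bidual S \<Longrightarrow> x \<phi> = (x \<otimes> u2) \<psi>2"
    unfolding is_abs_functional_def by blast
  have p: "pos \<psi>2" using 2 by (simp add: is_abs_functional_def)
  define w where "w = u1\<^sup>\<star> \<otimes> u2"
  have w: "w \<in> bidual S" using u1(1) u2(1) by (simp add: w_def)
  have x: "x \<psi>1 = (x \<otimes> w) \<psi>2" if "x \<in> bidual S" for x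
    using u1(3)[OF that] u2(3)[of "x \<otimes> u1\<^sup>\<star>"] that u1(1) u2(1) by (simp add: w_def arens_assoc)
  let ?q = "u1 \<otimes> u1\<^sup>\<star>"
  have qP: "bidual_projection S ?q"
    unfolding bidual_projection_def using u1(1,2) by (simp add: bstar_arens flip: arens_assoc)
  have sp: "pos (sandwich u2 \<psi>2)" by (rule sandwich_pos[OF p u2(1)])
  have "(w\<^sup>\<star> \<otimes> w) = u2\<^sup>\<star> \<otimes> (?q \<otimes> u2)" using u1(1) u2(1) by (simp add: w_def bstar_arens arens_assoc)
  then have "(w\<^sup>\<star> \<otimes> w) \<psi>2 = ?q (sandwich u2 \<psi>2)" by (subst sandwich_apply) (use p u1(1) u2(1) in simp_all)
  then have "Re ((w\<^sup>\<star> \<otimes> w) \<psi>2) \<le> Re (sandwich u2 \<psi>2 1)" using effectD(3)[OF effect_projection[OF qP] sp] by simp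
  also have "sandwich u2 \<psi>2 1 = canon S 1 (sandwich u2 \<psi>2)" using sp by simp
  also have "\<dots> = (u2\<^sup>\<star> \<otimes> u2) \<psi>2" by (subst sandwich_apply) (use p u2(1) in simp_all)
  also have "Re \<dots> \<le> Re (\<psi>2 1)"
    using u2(2) by (intro effectD(3)[OF effect_projection _] p) (simp add: support_projection_def)
  finally show thesis using that w x by blast
qed

text \<open>Exchanging the two candidates shows that they have the same value at 1. Then
  \<open>1 - w\<close> has GNS seminorm 0 over \<psi>2: its square is at most twice the difference
  of these values. So \<open>w\<close> acts on \<psi>2 as 1 does.\<close>

lemma is_abs_functional_unique:
  assumes 1: "is_abs_functional S \<phi> \<psi>1" and 2: "is_abs_functional S \<phi> \<psi>2"
  shows "\<psi>1 = \<psi>2"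
proof -
  have le: "Re (\<xi>1 1) \<le> Re (\<xi>2 1)" if a: "is_abs_functional S \<phi> \<xi>1" "is_abs_functional S \<phi> \<xi>2" for \<xi>1 \<xi>2
  proof -
    obtain w where w: "w \<in> bidual S" "\<And>x. x \<in> bidual S \<Longrightarrow> x \<xi>1 = (x \<otimes> w) \<xi>2" "Re ((w\<^sup>\<star> \<otimes> w) \<xi>2) \<le> Re (\<xi>2 1)"
      using is_abs_functional_unique_aux[OF a] by metis
    have p: "pos \<xi>1" "pos \<xi>2" using a by (simp_all add: is_abs_functional_def)
    have e: "\<xi>1 1 = w \<xi>2" using w(2)[of "canon S 1"] w(1) p by simp
    have "(cmod (w \<xi>2))\<^sup>2 \<le> (Re (\<xi>2 1))\<^sup>2"
      unfolding power2_eq_square[of "Re (\<xi>2 1)"] by (rule order_trans[OF bidual_CS_one[OF p(2) w(1)] mult_left_mono[OF w(3) pos_one(1)[OF p(2)]]])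
    then have "cmod (w \<xi>2) \<le> Re (\<xi>2 1)" by (rule power2_le_imp_le[OF _ pos_one(1)[OF p(2)]])
    then show ?thesis using complex_Re_le_cmod[of "\<xi>1 1"] by (simp add: e)
  qed
  have eq: "Re (\<psi>1 1) = Re (\<psi>2 1)" using le[OF 1 2] le[OF 2 1] by simp
  have p: "pos \<psi>1" "pos \<psi>2" using 1 2 by (simp_all add: is_abs_functional_def)
  obtain w where w: "w \<in> bidual S" "\<And>x. x \<in> bidual S \<Longrightarrow> x \<psi>1 = (x \<otimes> w) \<psi>2" "Re ((w\<^sup>\<star> \<otimes> w) \<psi>2) \<le> Re (\<psi>2 1)"
    using is_abs_functional_unique_aux[OF 1 2] by metis
  have e: "w \<psi>2 = \<psi>1 1" using w(2)[of "canon S 1"] w(1) p by simp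
  let ?d = "canon S 1 - w"
  have d: "?d \<in> bidual S" using w(1) by simp
  have "?d\<^sup>\<star> \<otimes> ?d = canon S 1 - w - (w\<^sup>\<star> - w\<^sup>\<star> \<otimes> w)"
    using w(1) by (simp add: bstar_linear arens_diff_left arens_diff_right)
  then have "Re ((?d\<^sup>\<star> \<otimes> ?d) \<psi>2) \<le> 0" using w(3) eq p e bstar_pos[OF p(2), of w] by simp
  then have z: "Re ((?d\<^sup>\<star> \<otimes> ?d) \<psi>2) = 0" using bstar_arens_pos(1)[OF p(2) d] by simp
  show ?thesis
  proof (rule dual_eqI)
    fix x assume x: "x \<in> S"
    have "(((canon S (star x))\<^sup>\<star> \<otimes> ?d) \<psi>2) = 0"
      using bidual_CS[OF p(2) canon_bidual[OF star_S[OF x]] d] by (simp add: z)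
    then have "(canon S x \<otimes> ?d) \<psi>2 = 0" using x by (simp add: bstar_canon star_star)
    then have "canon S x \<psi>2 = (canon S x \<otimes> w) \<psi>2" using x w(1) by (simp add: arens_diff_right)
    then show "\<psi>1 x = \<psi>2 x" using w(2)[of "canon S x"] x p by simp
  qed (use p in auto)
qed

lemma abs_functional: assumes "\<phi> \<in> dual S" shows "is_abs_functional S \<phi> (abs_functional S \<phi>)"
  unfolding abs_functional_def
  by (rule theI'[of "is_abs_functional S \<phi>"]) (use is_abs_functional_exists[OF assms] is_abs_functional_unique in blast)

end

section \<open>The bidual of a subalgebra inside the bidual of the algebra\<close>

interpretation U: cstar_subalgebra UNIV
  by standard (auto simp: complex_subalgebra_def)

context cstar_subalgebra
begin

lemma dual_tendsto:
  assumes \<phi>: "\<phi> \<in> dual S" and x: "\<And>n. x n \<in> S" "y \<in> S" "(x \<longlongrightarrow> y) F"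
  shows "((\<lambda>n. \<phi> (x n)) \<longlongrightarrow> \<phi> y) F"
proof -
  have "((\<lambda>n. dual_norm S \<phi> * norm (x n - y)) \<longlongrightarrow> dual_norm S \<phi> * norm (y - y)) F"
    by (intro tendsto_intros x)
  then have l: "((\<lambda>n. dual_norm S \<phi> * norm (x n - y)) \<longlongrightarrow> 0) F" by simp
  have "((\<lambda>n. \<phi> (x n) - \<phi> y) \<longlongrightarrow> 0) F"
  proof (rule Lim_null_comparison[OF always_eventually l], rule allI)
    fix n show "norm (\<phi> (x n) - \<phi> y) \<le> dual_norm S \<phi> * norm (x n - y)"
      using dual_norm_ge[OF \<phi> diff_S[OF x(1,2)]] x by (simp add: dual_diff \<phi>)
  qed
  then show ?thesis by (simp add: LIM_zero_iff)
qed

lemma restrict_apply [simp]: "x \<in> S \<Longrightarrow> restrict_functional S \<phi> x = \<phi> x"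
  by (simp add: restrict_functional_def)

lemma restrict_dual [simp]: assumes "\<phi> \<in> dual UNIV" shows "restrict_functional S \<phi> \<in> dual S"
proof (rule dualI[where K = "dual_norm UNIV \<phi>"])
  fix x assume "x \<in> S"
  then show "cmod (restrict_functional S \<phi> x) \<le> dual_norm UNIV \<phi> * norm x"
    using U.dual_norm_ge[OF assms, of x] by simp
qed (use assms in \<open>auto simp: U.dual_simps, simp add: restrict_functional_def\<close>)

lemma restrict_norm: "\<phi> \<in> dual UNIV \<Longrightarrow> dual_norm S (restrict_functional S \<phi>) \<le> dual_norm UNIV \<phi>"
proof (rule dual_norm_le[OF U.dual_norm_nonneg])
  fix x assume "\<phi> \<in> dual UNIV" "x \<in> S"
  then show "cmod (restrict_functional S \<phi> x) \<le> dual_norm UNIV \<phi> * norm x"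
    using U.dual_norm_ge[of \<phi> x] by simp
qed

lemma dual_extend:
  assumes \<phi>: "\<phi> \<in> dual S"
  shows "\<exists>\<phi>'. \<phi>' \<in> dual UNIV \<and> restrict_functional S \<phi>' = \<phi> \<and> dual_norm UNIV \<phi>' \<le> dual_norm S \<phi>"
proof -
  obtain g where g: "complex_linear g" "\<And>x. x \<in> S \<Longrightarrow> g x = \<phi> x" "\<And>x. cmod (g x) \<le> dual_norm S \<phi> * norm x"
  proof (rule complex_Hahn_Banach[OF complex_seminorm_scale_by[OF complex_seminorm_norm dual_norm_nonneg[OF \<phi>]], of S \<phi>])
    show "cmod (\<phi> x) \<le> dual_norm S \<phi> * norm x" if "x \<in> S" for x by (rule dual_norm_ge[OF \<phi> that])
  qed (use \<phi> in \<open>auto simp: dual_add dual_scaleC\<close>)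
  have d: "g \<in> dual UNIV" by (rule complex_linear_dual[OF g(1,3)])
  have "restrict_functional S g = \<phi>"
    using g(2) dual_outside[OF \<phi>] by (auto simp: restrict_functional_def fun_eq_iff)
  moreover have "dual_norm UNIV g \<le> dual_norm S \<phi>" by (rule U.dual_norm_le[OF dual_norm_nonneg[OF \<phi>] g(3)])
  ultimately show ?thesis using d by blast
qed

lemma incl_apply: "\<phi> \<in> dual UNIV \<Longrightarrow> bidual_incl S \<eta> \<phi> = \<eta> (restrict_functional S \<phi>)"
  by (simp add: bidual_incl_def)

lemma incl_bidual [simp]: assumes "\<eta> \<in> bidual S" shows "bidual_incl S \<eta> \<in> bidual UNIV"
proof -
  obtain K where K: "bbound K \<eta>" using bidual_bbound[OF assms] .
  show ?thesis
  proof (rule U.bidualI[where K = K])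
    fix \<phi> \<psi> :: "'b functional" assume "\<phi> \<in> dual UNIV" "\<psi> \<in> dual UNIV"
    moreover have "restrict_functional S (\<lambda>x. \<phi> x + \<psi> x) = (\<lambda>x. restrict_functional S \<phi> x + restrict_functional S \<psi> x)"
      by (auto simp: restrict_functional_def)
    ultimately show "bidual_incl S \<eta> (\<lambda>x. \<phi> x + \<psi> x) = bidual_incl S \<eta> \<phi> + bidual_incl S \<eta> \<psi>"
      by (simp add: incl_apply bidual_add assms)
  next
    fix c and \<phi> :: "'b functional" assume "\<phi> \<in> dual UNIV"
    moreover have "restrict_functional S (c *\<^sub>\<phi> \<phi>) = c *\<^sub>\<phi> restrict_functional S \<phi>"
      by (auto simp: restrict_functional_def)
    ultimately show "bidual_incl S \<eta> (c *\<^sub>\<phi> \<phi>) = c * bidual_incl S \<eta> \<phi>"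
      by (simp add: incl_apply bidual_cmult assms)
  next
    fix \<phi> :: "'b functional" assume \<phi>: "\<phi> \<in> dual UNIV"
    show "cmod (bidual_incl S \<eta> \<phi>) \<le> K * dual_norm UNIV \<phi>"
      using order_trans[OF bbound_apply[OF K restrict_dual[OF \<phi>]] mult_left_mono[OF restrict_norm[OF \<phi>] bbound_nonneg[OF K]]]
      by (simp add: incl_apply \<phi>)
  qed (simp add: bidual_incl_def)
qed

lemma incl_inj:
  assumes "\<eta> \<in> bidual S" "\<theta> \<in> bidual S" "bidual_incl S \<eta> = bidual_incl S \<theta>"
  shows "\<eta> = \<theta>"
proof (rule bidual_eqI[OF assms(1,2)])
  fix \<phi> assume "\<phi> \<in> dual S"
  then obtain \<phi>' where "\<phi>' \<in> dual UNIV" "restrict_functional S \<phi>' = \<phi>" using dual_extend by blast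
  then show "\<eta> \<phi> = \<theta> \<phi>" using incl_apply[of \<phi>' \<eta>] incl_apply[of \<phi>' \<theta>] assms(3) by simp
qed

text \<open>The preimage evaluates \<eta> at an extension of the given functional. Vanishing on the
  annihilator of \<open>S\<close> makes the choice of the extension immaterial, and norm-preserving
  extensions give the bound.\<close>

lemma incl_surj:
  assumes \<eta>: "\<eta> \<in> biannihilator UNIV S"
  shows "\<exists>\<theta>\<in>bidual S. bidual_incl S \<theta> = \<eta>"
proof -
  have \<eta>b: "\<eta> \<in> bidual UNIV" and \<eta>0: "\<And>\<phi>. \<phi> \<in> dual UNIV \<Longrightarrow> (\<And>x. x \<in> S \<Longrightarrow> \<phi> x = 0) \<Longrightarrow> \<eta> \<phi> = 0"
    using \<eta> by (auto simp: biannihilator_def annihilator_def)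
  obtain K where K: "U.bbound K \<eta>" using U.bidual_bbound[OF \<eta>b] .
  obtain X where X: "\<And>\<phi>. \<phi> \<in> dual S \<Longrightarrow> X \<phi> \<in> dual UNIV \<and> restrict_functional S (X \<phi>) = \<phi> \<and> dual_norm UNIV (X \<phi>) \<le> dual_norm S \<phi>"
    using dual_extend by metis
  have eq: "\<eta> \<phi> = \<eta> \<psi>" if "\<phi> \<in> dual UNIV" "\<psi> \<in> dual UNIV" "restrict_functional S \<phi> = restrict_functional S \<psi>" for \<phi> \<psi>
  proof -
    have "\<eta> (\<lambda>x. \<phi> x - \<psi> x) = 0"
    proof (rule \<eta>0)
      fix x assume "x \<in> S"
      then show "\<phi> x - \<psi> x = 0" using fun_cong[OF that(3), of x] by simp
    qed (use that in simp)
    then show ?thesis using U.bidual_minus[OF \<eta>b that(1,2)] by simp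
  qed
  define \<theta> where "\<theta> \<phi> = (if \<phi> \<in> dual S then \<eta> (X \<phi>) else 0)" for \<phi>
  have \<theta>: "\<theta> (restrict_functional S \<phi>) = \<eta> \<phi>" if "\<phi> \<in> dual UNIV" for \<phi>
    using X[OF restrict_dual[OF that]] that by (auto simp: \<theta>_def intro: eq)
  have "\<theta> \<in> bidual S"
  proof (rule bidualI[where K = K])
    fix \<phi> \<psi> assume a: "\<phi> \<in> dual S" "\<psi> \<in> dual S"
    have "restrict_functional S (\<lambda>x. X \<phi> x + X \<psi> x) = (\<lambda>x. restrict_functional S (X \<phi>) x + restrict_functional S (X \<psi>) x)"
      by (auto simp: restrict_functional_def)
    also have "\<dots> = (\<lambda>x. \<phi> x + \<psi> x)" using X a by simp
    finally have "\<theta> (\<lambda>x. \<phi> x + \<psi> x) = \<eta> (\<lambda>x. X \<phi> x + X \<psi> x)" using \<theta>[of "\<lambda>x. X \<phi> x + X \<psi> x"] X a by simp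
    then show "\<theta> (\<lambda>x. \<phi> x + \<psi> x) = \<theta> \<phi> + \<theta> \<psi>" using X a by (simp add: \<theta>_def U.bidual_add \<eta>b)
  next
    fix c \<phi> assume a: "\<phi> \<in> dual S"
    have "restrict_functional S (c *\<^sub>\<phi> X \<phi>) = c *\<^sub>\<phi> restrict_functional S (X \<phi>)"
      by (auto simp: restrict_functional_def)
    also have "\<dots> = c *\<^sub>\<phi> \<phi>" using X a by simp
    finally have "\<theta> (c *\<^sub>\<phi> \<phi>) = \<eta> (c *\<^sub>\<phi> X \<phi>)" using \<theta>[of "c *\<^sub>\<phi> X \<phi>"] X a by simp
    then show "\<theta> (c *\<^sub>\<phi> \<phi>) = c * \<theta> \<phi>" using X a by (simp add: \<theta>_def U.bidual_cmult \<eta>b)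
  next
    fix \<phi> assume a: "\<phi> \<in> dual S"
    have "cmod (\<eta> (X \<phi>)) \<le> K * dual_norm UNIV (X \<phi>)" using U.bbound_apply[OF K] X[OF a] by blast
    also have "\<dots> \<le> K * dual_norm S \<phi>" using X[OF a] U.bbound_nonneg[OF K] by (intro mult_left_mono) auto
    finally show "cmod (\<theta> \<phi>) \<le> K * dual_norm S \<phi>" using a by (simp add: \<theta>_def)
  qed (simp add: \<theta>_def)
  moreover have "bidual_incl S \<theta> = \<eta>"
    by (rule U.bidual_eqI) (use \<open>\<theta> \<in> bidual S\<close> \<eta>b \<theta> in \<open>auto simp: incl_apply\<close>)
  ultimately show ?thesis by blast
qed

lemma incl_arens:
  assumes "\<eta> \<in> bidual S" "\<theta> \<in> bidual S"
  shows "bidual_incl S (\<eta> \<otimes> \<theta>) = bidual_incl S \<eta> \<odot> bidual_incl S \<theta>"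
proof (rule U.bidual_eqI)
  fix \<phi> :: "'b functional" assume \<phi>: "\<phi> \<in> dual UNIV"
  have "restrict_functional S (U.bact (bidual_incl S \<theta>) \<phi>) = bact \<theta> (restrict_functional S \<phi>)"
  proof (rule dual_eqI)
    fix a assume a: "a \<in> S"
    have "restrict_functional S (U.lm a \<phi>) = lm a (restrict_functional S \<phi>)"
      by (rule dual_eqI) (use \<phi> a in auto)
    then show "restrict_functional S (U.bact (bidual_incl S \<theta>) \<phi>) a = bact \<theta> (restrict_functional S \<phi>) a"
      using a \<phi> by (simp add: incl_apply)
  qed (use \<phi> assms in auto)
  then show "bidual_incl S (\<eta> \<otimes> \<theta>) \<phi> = (bidual_incl S \<eta> \<odot> bidual_incl S \<theta>) \<phi>"
    using \<phi> assms by (simp add: incl_apply arens_apply U.arens_apply)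
qed (use assms in auto)

lemma incl_bstar:
  assumes "\<eta> \<in> bidual S"
  shows "bidual_incl S (\<eta>\<^sup>\<star>) = (bidual_incl S \<eta>)\<^sup>\<star>"
proof (rule U.bidual_eqI)
  fix \<phi> :: "'b functional" assume \<phi>: "\<phi> \<in> dual UNIV"
  have "restrict_functional S (U.dstar \<phi>) = dstar (restrict_functional S \<phi>)"
    by (rule dual_eqI) (use \<phi> in auto, simp add: dstar_def U.dstar_def)
  then show "bidual_incl S (\<eta>\<^sup>\<star>) \<phi> = (bidual_incl S \<eta>)\<^sup>\<star> \<phi>"
    using \<phi> by (simp add: incl_apply bstar_apply U.bstar_apply)
qed (use assms in auto)

lemma incl_canon: "b \<in> S \<Longrightarrow> bidual_incl S (canon S b) = \<iota> b"
  by (rule U.bidual_eqI) (auto simp: incl_apply)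

end

section \<open>Closed projections\<close>

lemma eventually_net_filter:
  assumes "directed_index I r"
  shows "eventually P (net_filter I r) \<longleftrightarrow> (\<exists>i\<in>I. \<forall>j\<in>I. r i j \<longrightarrow> P j)"
proof -
  have "eventually P (net_filter I r) \<longleftrightarrow> (\<exists>i\<in>I. eventually P (principal {j \<in> I. r i j}))"
    unfolding net_filter_def
  proof (rule eventually_INF_base)
    show "I \<noteq> {}" using assms by (simp add: directed_index_def)
    fix a b assume ab: "a \<in> I" "b \<in> I"
    then obtain k where k: "k \<in> I" "r a k" "r b k" using assms by (auto simp: directed_index_def)
    have "transp_on I r" using assms by (simp add: directed_index_def)
    then have "{j \<in> I. r k j} \<subseteq> {j \<in> I. r a j}" "{j \<in> I. r k j} \<subseteq> {j \<in> I. r b j}"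
      using k ab unfolding transp_on_def by blast+
    then show "\<exists>x\<in>I. principal {j \<in> I. r x j} \<le> inf (principal {j \<in> I. r a j}) (principal {j \<in> I. r b j})"
      using k(1) by (intro bexI[of _ k]) (simp_all only: le_inf_iff principal_le_iff)
  qed
  then show ?thesis by (auto simp: eventually_principal)
qed

lemma net_filter_not_bot: assumes "directed_index I r" shows "net_filter I r \<noteq> bot"
proof -
  have "\<not> eventually (\<lambda>_. False) (net_filter I r)"
    unfolding eventually_net_filter[OF assms] using assms unfolding directed_index_def reflp_on_def by blast
  then show ?thesis by (simp add: trivial_limit_def)
qed

locale closed_proj =
  fixes q :: "'b::unital_cstar_algebra bifunctional"
  assumes closed_q: "closed_projection q"
begin

definition qc :: "'b bifunctional" where
  "qc = \<iota> 1 - q"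

lemma q_projection: "bidual_projection UNIV q"
  using closed_q by (simp add: closed_projection_def)

lemma q_simps [simp]: "q \<in> bidual UNIV" "q \<odot> q = q" "q\<^sup>\<star> = q"
  using U.bidual_projectionD[OF q_projection] by auto

lemma qc_projection: "bidual_projection UNIV qc"
  unfolding qc_def by (rule U.projection_complement[OF q_projection])

lemma qc_simps [simp]: "qc \<in> bidual UNIV" "qc \<odot> qc = qc" "qc\<^sup>\<star> = qc" "q \<odot> qc = 0" "qc \<odot> q = 0"
  using U.bidual_projectionD[OF qc_projection] by (auto simp: qc_def U.arens_diff_left U.arens_diff_right)

lemma q_absorb [simp]:
  "\<theta> \<in> bidual UNIV \<Longrightarrow> q \<odot> (q \<odot> \<theta>) = q \<odot> \<theta>" "\<theta> \<in> bidual UNIV \<Longrightarrow> qc \<odot> (qc \<odot> \<theta>) = qc \<odot> \<theta>"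
  "\<theta> \<in> bidual UNIV \<Longrightarrow> q \<odot> (qc \<odot> \<theta>) = 0" "\<theta> \<in> bidual UNIV \<Longrightarrow> qc \<odot> (q \<odot> \<theta>) = 0"
  by (simp_all flip: U.arens_assoc add: U.arens_zero_left)

lemma q_plus_qc: "\<phi> \<in> dual UNIV \<Longrightarrow> q \<phi> + qc \<phi> = \<phi> 1"
  by (simp add: qc_def)

definition J :: "'b set" where
  "J = {b. \<iota> b \<odot> q = 0 \<and> q \<odot> \<iota> b = 0}"

text \<open>An increasing net lies below its limit \<open>qc\<close>. Compressing by
  \<open>q\<close> gives \<open>q x q \<le> q qc q = 0\<close>, so its members lie in
  \<open>J\<close>; and \<open>qc \<le> 1\<close> makes them effects, hence contractions.\<close>

lemma approximate_unit:
  obtains F :: "'b filter" and x where "F \<noteq> bot" "\<And>i. x i \<in> J" "\<And>i. cpos (x i)" "\<And>i. norm (x i) \<le> 1"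
    "\<And>\<phi>. \<phi> \<in> dual UNIV \<Longrightarrow> ((\<lambda>i. \<phi> (x i)) \<longlongrightarrow> qc \<phi>) F"
proof -
  have "open_projection qc" using closed_q by (simp add: closed_projection_def qc_def fun_diff_def)
  then obtain I :: "'b set" and r and x :: "'b \<Rightarrow> 'b" where dir: "directed_index I r"
    and pos: "\<And>i. i \<in> I \<Longrightarrow> cpos (x i)"
    and inc: "\<And>i j. i \<in> I \<Longrightarrow> j \<in> I \<Longrightarrow> r i j \<Longrightarrow> cpos (x j - x i)"
    and lim: "weakstar_limit I r x qc"
    unfolding open_projection_def cstar_le_def cstar_positive_iff_cpos by blast
  let ?F = "net_filter I r"
  have F: "?F \<noteq> bot" by (rule net_filter_not_bot[OF dir])
  have lim: "((\<lambda>i. \<phi> (x i)) \<longlongrightarrow> qc \<phi>) ?F" if "\<phi> \<in> dual UNIV" for \<phi>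
    using lim that by (simp add: weakstar_limit_def)
  have below: "Re (\<xi> (x i)) \<le> Re (qc \<xi>)" if \<xi>: "U.pos \<xi>" and i: "i \<in> I" for \<xi> :: "'b functional" and i
  proof -
    have "eventually (\<lambda>j. Re (\<xi> (x i)) \<le> Re (\<xi> (x j))) ?F"
      unfolding eventually_net_filter[OF dir]
    proof (intro bexI[OF _ i] ballI impI)
      fix j assume "j \<in> I" "r i j"
      then have "0 \<le> Re (\<xi> (x j - x i))" using U.pos_cpos[OF \<xi> UNIV_I inc[OF i]] by blast
      then show "Re (\<xi> (x i)) \<le> Re (\<xi> (x j))" by (simp add: U.dual_diff U.pos_dual[OF \<xi>])
    qed
    then show ?thesis by (rule tendsto_lowerbound[OF tendsto_Re[OF lim[OF U.pos_dual[OF \<xi>]]] _ F])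
  qed
  have im: "Im (\<xi> h) = 0" if "U.pos \<xi>" "cpos h" for \<xi> :: "'b functional" and h
    using U.pos_hermitian[OF that(1), of h] cpos_selfadjoint[OF that(2)] by (simp add: complex_eq_iff)
  have xJ: "x i \<in> J" if i: "i \<in> I" for i
  proof -
    from cpos_sqrt_commute[OF pos[OF i]] obtain s where s: "cpos s" "s * s = x i" by blast
    have ss: "(\<iota> s)\<^sup>\<star> = \<iota> s" by (simp add: U.bstar_canon cpos_selfadjoint[OF s(1)])
    define \<kappa> where "\<kappa> = \<iota> s \<odot> q"
    have \<kappa>: "\<kappa> \<in> bidual UNIV" by (simp add: \<kappa>_def)
    have e: "\<kappa>\<^sup>\<star> \<odot> \<kappa> = q \<odot> (\<iota> (x i) \<odot> q)"
      unfolding \<kappa>_def by (simp add: U.bstar_arens ss U.arens_assoc flip: s(2) U.arens_canon)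
    have "\<kappa>\<^sup>\<star> \<odot> \<kappa> = 0"
    proof (rule U.bidual_eq_pos)
      fix \<xi> :: "'b functional" assume \<xi>: "U.pos \<xi>"
      have sp: "U.pos (U.sandwich q \<xi>)" by (rule U.sandwich_pos[OF \<xi>]) simp
      have "(\<kappa>\<^sup>\<star> \<odot> \<kappa>) \<xi> = \<iota> (x i) (U.sandwich q \<xi>)"
        unfolding e by (subst U.sandwich_apply) (use \<xi> in simp_all)
      also have "\<dots> = U.sandwich q \<xi> (x i)" using sp by simp
      finally have "Re ((\<kappa>\<^sup>\<star> \<odot> \<kappa>) \<xi>) \<le> Re (qc (U.sandwich q \<xi>))" using below[OF sp i] by simp
      also have "qc (U.sandwich q \<xi>) = 0" by (subst U.sandwich_apply) (use \<xi> in \<open>simp_all add: U.arens_zero_right\<close>)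
      finally have "Re ((\<kappa>\<^sup>\<star> \<odot> \<kappa>) \<xi>) = 0" using U.bstar_arens_pos(1)[OF \<xi> \<kappa>] by simp
      then show "(\<kappa>\<^sup>\<star> \<odot> \<kappa>) \<xi> = 0 \<xi>" using U.bstar_arens_pos(2)[OF \<xi> \<kappa>] by (simp add: complex_eq_iff)
    qed (use \<kappa> in auto)
    then have "\<kappa> = 0" using U.bstar_arens_eq_0[OF \<kappa>] by simp
    then have "\<iota> (x i) \<odot> q = 0"
      by (simp add: \<kappa>_def U.arens_assoc U.arens_zero_right flip: s(2) U.arens_canon)
    moreover from this have "(\<iota> (x i) \<odot> q)\<^sup>\<star> = 0\<^sup>\<star>" by simp
    then have "q \<odot> \<iota> (x i) = 0"
      by (simp add: U.bstar_arens U.bstar_canon cpos_selfadjoint[OF pos[OF i]] fun_eq_iff U.bstar_apply)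
    ultimately show ?thesis by (simp add: J_def)
  qed
  have nx: "norm (x i) \<le> 1" if i: "i \<in> I" for i
  proof -
    have "U.effect (\<iota> (x i))" unfolding U.effect_def
    proof (intro conjI allI impI)
      fix \<xi> :: "'b functional" assume \<xi>: "U.pos \<xi>"
      show "0 \<le> Re (\<iota> (x i) \<xi>)" "Im (\<iota> (x i) \<xi>) = 0"
        using U.pos_cpos[OF \<xi> UNIV_I pos[OF i]] im[OF \<xi> pos[OF i]] \<xi> by simp_all
      show "Re (\<iota> (x i) \<xi>) \<le> Re (\<xi> 1)"
        using below[OF \<xi> i] U.effectD(3)[OF U.effect_projection[OF qc_projection] \<xi>] \<xi> by simp
    qed simp
    then have b: "U.bbound 1 (\<iota> (x i))" by (rule U.effect_bbound)
    obtain g where g: "complex_linear g" "\<And>y. cmod (g y) \<le> norm y" "g (x i) = norm (x i)"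
      using complex_norming_functional by blast
    have d: "g \<in> dual UNIV" by (rule complex_linear_dual[OF g(1), of 1]) (simp add: g(2))
    have "cmod (\<iota> (x i) g) \<le> 1 * 1" by (rule U.bbound_le[OF b d]) (simp_all add: g(2))
    then show ?thesis using d by (simp add: g(3))
  qed
  \<comment> \<open>Outside the index set the net is continued by 0, an element of \<open>J\<close>,
    so that its properties hold at all indices and not just eventually.\<close>
  define y where "y i = (if i \<in> I then x i else 0)" for i
  have ev: "eventually (\<lambda>i. y i = x i) ?F"
    unfolding eventually_net_filter[OF dir] using dir by (auto simp: y_def directed_index_def)
  have i0: "\<iota> 0 = (0 :: 'b bifunctional)" by (auto simp: canon_def fun_eq_iff U.dual_zero)
  show thesis
  proof (rule that[OF F, of y])
    show "y i \<in> J" for i using xJ by (auto simp: y_def J_def i0 U.arens_zero_left U.arens_zero_right)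
    show "cpos (y i)" for i using pos cpos_one[of 0] by (auto simp: y_def)
    show "norm (y i) \<le> 1" for i using nx by (auto simp: y_def)
    show "((\<lambda>i. \<phi> (y i)) \<longlongrightarrow> qc \<phi>) ?F" if "\<phi> \<in> dual UNIV" for \<phi>
      using tendsto_cong[of "\<lambda>i. \<phi> (y i)" "\<lambda>i. \<phi> (x i)" ?F] lim[OF that] ev by (simp add: eventually_mono)
  qed
qed

lemma mem_B0: "b \<in> B0 q \<longleftrightarrow> \<iota> b \<odot> q = q \<odot> \<iota> b"
  by (simp add: B0_def)

lemma canon_q_apply: "\<phi> \<in> dual UNIV \<Longrightarrow> (\<iota> b \<odot> q) \<phi> = U.bact q \<phi> b" "\<phi> \<in> dual UNIV \<Longrightarrow> (q \<odot> \<iota> b) \<phi> = U.lact q \<phi> b"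
  by (simp_all add: U.arens_apply U.bact_canon)

lemma canon_linear: "\<iota> (a + b) = \<iota> a + \<iota> b" "\<iota> (a - b) = \<iota> a - \<iota> b" "\<iota> (c *\<^sub>C a) = c *\<^sub>\<phi> \<iota> a" "\<iota> 0 = 0"
  by (auto simp: canon_def fun_eq_iff U.dual_simps)

lemma canon_mult: "\<iota> (a * b) = \<iota> a \<odot> \<iota> b"
  by (simp add: U.arens_canon)

lemma closed_B0: "closed (B0 q)"
proof (subst closed_sequential_limits, intro allI impI, elim conjE)
  fix x and b :: 'b assume x: "\<forall>n::nat. x n \<in> B0 q" "x \<longlonglongrightarrow> b"
  show "b \<in> B0 q" unfolding mem_B0
  proof (rule U.bidual_eqI)
    fix \<phi> :: "'b functional" assume \<phi>: "\<phi> \<in> dual UNIV"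
    have 1: "(\<lambda>n. U.bact q \<phi> (x n)) \<longlonglongrightarrow> U.bact q \<phi> b" "(\<lambda>n. U.lact q \<phi> (x n)) \<longlonglongrightarrow> U.lact q \<phi> b"
      by (rule U.dual_tendsto[OF U.bact_dual[OF q_simps(1) \<phi>] _ _ x(2)] U.dual_tendsto[OF U.lact_dual[OF q_simps(1) \<phi>] _ _ x(2)]; simp)+
    have "U.bact q \<phi> (x n) = U.lact q \<phi> (x n)" for n
      using x(1) canon_q_apply[OF \<phi>, of "x n"] unfolding mem_B0 by metis
    then have "(\<lambda>n. U.bact q \<phi> (x n)) \<longlonglongrightarrow> U.lact q \<phi> b" using 1(2) by simp
    then show "(\<iota> b \<odot> q) \<phi> = (q \<odot> \<iota> b) \<phi>" unfolding canon_q_apply[OF \<phi>] using 1(1) LIMSEQ_unique by blast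
  qed simp_all
qed

sublocale B: cstar_subalgebra "B0 q"
proof
  show "closed (B0 q)" by (rule closed_B0)
  show "complex_subalgebra (B0 q)" unfolding complex_subalgebra_def
  proof (intro conjI ballI allI)
    show "0 \<in> B0 q" by (simp add: mem_B0 canon_linear U.arens_zero_left U.arens_zero_right)
    fix x y assume x: "x \<in> B0 q" and y: "y \<in> B0 q"
    show "x + y \<in> B0 q" using x y by (simp add: mem_B0 canon_linear U.arens_add_left U.arens_add_right)
    have "\<iota> x \<odot> \<iota> y \<odot> q = \<iota> x \<odot> (q \<odot> \<iota> y)" using y by (simp add: mem_B0 U.arens_assoc)
    also have "\<dots> = q \<odot> \<iota> x \<odot> \<iota> y" using x by (simp add: mem_B0 flip: U.arens_assoc)
    finally show "x * y \<in> B0 q" by (simp add: mem_B0 canon_mult U.arens_assoc)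
  next
    fix c x assume "x \<in> B0 q"
    then show "c *\<^sub>C x \<in> B0 q" by (simp add: mem_B0 canon_linear U.arens_scale_left U.arens_scale_right)
  qed
  show "1 \<in> B0 q" by (simp add: mem_B0)
  fix x assume "x \<in> B0 q"
  then have "(\<iota> x \<odot> q)\<^sup>\<star> = (q \<odot> \<iota> x)\<^sup>\<star>" by (simp add: mem_B0)
  then show "star x \<in> B0 q" by (simp add: mem_B0 U.bstar_arens U.bstar_canon)
qed

lemma qc_commute: "b \<in> B0 q \<Longrightarrow> \<iota> b \<odot> qc = qc \<odot> \<iota> b"
  by (simp add: qc_def mem_B0 U.arens_diff_left U.arens_diff_right)

lemma J_B0: "j \<in> J \<Longrightarrow> j \<in> B0 q"
  by (simp add: J_def mem_B0)

lemma J_zero: "0 \<in> J"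
  by (simp add: J_def canon_linear U.arens_zero_left U.arens_zero_right)

lemma J_add: "a \<in> J \<Longrightarrow> b \<in> J \<Longrightarrow> a + b \<in> J"
  by (simp add: J_def canon_linear U.arens_add_left U.arens_add_right)

lemma J_scaleC: "a \<in> J \<Longrightarrow> c *\<^sub>C a \<in> J"
  by (simp add: J_def canon_linear U.arens_scale_left U.arens_scale_right) (simp add: fun_eq_iff)

lemma J_mult_right: "j \<in> J \<Longrightarrow> b \<in> B0 q \<Longrightarrow> j * b \<in> J"
proof -
  assume j: "j \<in> J" and b: "b \<in> B0 q"
  have "\<iota> (j * b) \<odot> q = \<iota> j \<odot> (\<iota> b \<odot> q)" by (simp add: canon_mult U.arens_assoc)
  also have "\<dots> = (\<iota> j \<odot> q) \<odot> \<iota> b" using b by (simp add: mem_B0 U.arens_assoc)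
  also have "\<dots> = 0" using j by (simp add: J_def U.arens_zero_left)
  finally have 1: "\<iota> (j * b) \<odot> q = 0" .
  have "q \<odot> \<iota> (j * b) = (q \<odot> \<iota> j) \<odot> \<iota> b" by (simp add: canon_mult U.arens_assoc)
  also have "\<dots> = 0" using j by (simp add: J_def U.arens_zero_left)
  finally show "j * b \<in> J" using 1 by (simp add: J_def)
qed

lemma J_hereditary: "j \<in> J \<Longrightarrow> k \<in> J \<Longrightarrow> j * b * k \<in> J"
proof -
  assume j: "j \<in> J" and k: "k \<in> J"
  have "\<iota> (j * b * k) \<odot> q = \<iota> j \<odot> (\<iota> b \<odot> (\<iota> k \<odot> q))" by (simp add: canon_mult U.arens_assoc)
  moreover have "q \<odot> \<iota> (j * b * k) = (q \<odot> \<iota> j) \<odot> (\<iota> b \<odot> \<iota> k)" by (simp add: canon_mult U.arens_assoc)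
  ultimately show ?thesis using j k by (simp add: J_def U.arens_zero_left U.arens_zero_right)
qed

lemma qc_J: "j \<in> J \<Longrightarrow> qc \<odot> \<iota> j = \<iota> j" "j \<in> J \<Longrightarrow> \<iota> j \<odot> qc = \<iota> j"
  by (simp_all add: J_def qc_def U.arens_diff_left U.arens_diff_right)

lemma closed_J: "closed J"
proof (subst closed_sequential_limits, intro allI impI, elim conjE)
  fix x and b :: 'b assume x: "\<forall>n::nat. x n \<in> J" "x \<longlonglongrightarrow> b"
  have z: "U.bact q \<phi> (x n) = 0" "U.lact q \<phi> (x n) = 0" if \<phi>: "\<phi> \<in> dual UNIV" for n \<phi>
    using x(1) canon_q_apply[OF \<phi>, of "x n"] by (simp_all add: J_def del: U.bact_apply U.lact_apply)
  have "(\<iota> b \<odot> q) \<phi> = 0 \<and> (q \<odot> \<iota> b) \<phi> = 0" if \<phi>: "\<phi> \<in> dual UNIV" for \<phi>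
  proof -
    have "(\<lambda>n. U.bact q \<phi> (x n)) \<longlonglongrightarrow> U.bact q \<phi> b" "(\<lambda>n. U.lact q \<phi> (x n)) \<longlonglongrightarrow> U.lact q \<phi> b"
      by (rule U.dual_tendsto[OF U.bact_dual[OF q_simps(1) \<phi>] _ _ x(2)] U.dual_tendsto[OF U.lact_dual[OF q_simps(1) \<phi>] _ _ x(2)]; simp)+
    then have "U.bact q \<phi> b = 0" "U.lact q \<phi> b = 0" unfolding z[OF \<phi>] by (simp_all add: LIMSEQ_const_iff)
    then show ?thesis using canon_q_apply[OF \<phi>, of b] by simp
  qed
  then have "\<iota> b \<odot> q = 0" "q \<odot> \<iota> b = 0" by (auto intro!: U.bidual_eqI)
  then show "b \<in> J" by (simp add: J_def)
qed

lemma qc_vanish: assumes \<phi>: "\<phi> \<in> dual UNIV" and 0: "\<And>j. j \<in> J \<Longrightarrow> \<phi> j = 0" shows "qc \<phi> = 0"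
proof -
  obtain F :: "'b filter" and x where F: "F \<noteq> bot" "\<And>i. x i \<in> J" "\<And>\<phi>. \<phi> \<in> dual UNIV \<Longrightarrow> ((\<lambda>i. \<phi> (x i)) \<longlongrightarrow> qc \<phi>) F"
    using approximate_unit by metis
  have "((\<lambda>i. 0) \<longlongrightarrow> qc \<phi>) F" using F(3)[OF \<phi>] by (simp add: 0 F(2))
  then show ?thesis using tendsto_unique[OF F(1) _ tendsto_const] by metis
qed

lemma qc_canon_vanish:
  assumes \<phi>: "\<phi> \<in> dual UNIV" and 0: "\<And>j. j \<in> J \<Longrightarrow> \<phi> j = 0" and b: "b \<in> B0 q"
  shows "(qc \<odot> \<iota> b) \<phi> = 0"
proof -
  have "qc (U.rm b \<phi>) = 0" by (rule qc_vanish) (use \<phi> 0 J_mult_right[OF _ b] in auto)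
  then show ?thesis using \<phi> by (simp add: U.arens_apply U.bact_canon)
qed

text \<open>The approximate unit is inserted on both sides of \<open>b\<close>, and
  \<open>J_hereditary\<close> keeps the products in \<open>J\<close>. This works for
  \<open>b\<close> that do not commute with \<open>q\<close>, as happens for elements of
  \<open>A\<close> in \<open>approach_J\<close>.\<close>

lemma qc_compress_vanish:
  assumes \<phi>: "\<phi> \<in> dual UNIV" and 0: "\<And>j. j \<in> J \<Longrightarrow> \<phi> j = 0"
  shows "(qc \<odot> (\<iota> b \<odot> qc)) \<phi> = 0"
proof -
  have "qc (U.bact (\<iota> b \<odot> qc) \<phi>) = 0"
  proof (rule qc_vanish)
    fix j assume j: "j \<in> J"
    have "U.bact (\<iota> b \<odot> qc) \<phi> j = (\<iota> j \<odot> (\<iota> b \<odot> qc)) \<phi>" by (subst U.bact_apply_arens) (use \<phi> in simp_all)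
    also have "\<dots> = (\<iota> (j * b) \<odot> qc) \<phi>" by (simp add: canon_mult U.arens_assoc)
    also have "\<dots> = qc (U.lm (j * b) \<phi>)"
      using \<phi> by (simp add: U.arens_apply)
    also have "\<dots> = 0" by (rule qc_vanish) (use \<phi> 0 J_hereditary[OF j] in auto)
    finally show "U.bact (\<iota> b \<odot> qc) \<phi> j = 0" .
  qed (use \<phi> in simp)
  then show ?thesis using \<phi> by (simp add: U.arens_apply)
qed

lemma q_biannihilator_B0: "q \<in> biannihilator UNIV (B0 q)"
  unfolding biannihilator_def annihilator_def
proof (intro CollectI conjI ballI, simp)
  fix \<phi> assume "\<phi> \<in> {\<phi> \<in> dual UNIV. \<forall>x\<in>B0 q. \<phi> x = 0}"
  then have \<phi>: "\<phi> \<in> dual UNIV" "\<And>x. x \<in> B0 q \<Longrightarrow> \<phi> x = 0" by auto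
  then have "qc \<phi> = 0" by (intro qc_vanish) (auto intro: J_B0)
  then show "q \<phi> = 0" using q_plus_qc[OF \<phi>(1)] \<phi>(2)[OF B.one_S] by simp
qed

lemma q0: "q0 q \<in> bidual (B0 q)" "bidual_incl (B0 q) (q0 q) = q"
proof -
  have "q \<in> bidual_incl (B0 q) ` bidual (B0 q)" using B.incl_surj[OF q_biannihilator_B0] by force
  then show "q0 q \<in> bidual (B0 q)" "bidual_incl (B0 q) (q0 q) = q"
    unfolding q0_def bidual_pull_def by (rule inv_into_into, rule f_inv_into_f)
qed

lemma q0_projection: "bidual_projection (B0 q) (q0 q)"
proof -
  have "arens (B0 q) (q0 q) (q0 q) = q0 q"
    by (rule B.incl_inj) (simp_all add: q0 B.incl_arens)
  moreover have "(q0 q)\<^sup>\<star> = q0 q"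
    by (rule B.incl_inj) (simp_all add: q0 B.incl_bstar)
  ultimately show ?thesis using q0(1) by (simp add: bidual_projection_def)
qed

text \<open>This is \<open>E\<close>. It speaks of functionals on the whole algebra and of
  \<open>q\<close> itself, so that Helly's theorem applies to it directly; the passage to the dual
  of \<open>B0 q\<close> and to \<open>q0 q\<close> is confined to the lemmas that follow.\<close>

definition A0_interpolates :: "'b set \<Rightarrow> bool" where
  "A0_interpolates A \<longleftrightarrow> (\<forall>\<phi>\<in>dual UNIV. (\<forall>a\<in>A0 A q. \<phi> a = 0) \<longrightarrow> (\<forall>b\<in>B0 q. (q \<odot> \<iota> b) \<phi> = 0))"

section \<open>Conditions (i), (ii) and (iv) as statements about functionals\<close>

lemma A0_B0: "a \<in> A0 A q \<Longrightarrow> a \<in> B0 q"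
  by (simp add: A0_def)

lemma q0_canon_apply:
  "\<phi> \<in> dual UNIV \<Longrightarrow> b \<in> B0 q \<Longrightarrow>
    arens (B0 q) (q0 q) (canon (B0 q) b) (restrict_functional (B0 q) \<phi>) = (q \<odot> \<iota> b) \<phi>"
  using B.incl_apply[of \<phi> "arens (B0 q) (q0 q) (canon (B0 q) b)"] by (simp add: B.incl_arens q0 B.incl_canon)

lemma cond_ii_iff: "cond_ii A q \<longleftrightarrow> A0_interpolates A"
proof
  assume c: "cond_ii A q"
  show "A0_interpolates A" unfolding A0_interpolates_def
  proof (intro ballI impI)
    fix \<phi> b assume \<phi>: "\<phi> \<in> dual UNIV" and z: "\<forall>a\<in>A0 A q. \<phi> a = 0" and b: "b \<in> B0 q"
    have "restrict_functional (B0 q) \<phi> \<in> annihilator (B0 q) (A0 A q)"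
      using \<phi> z by (auto simp: annihilator_def A0_B0)
    then have "arens (B0 q) (q0 q) (canon (B0 q) b) (restrict_functional (B0 q) \<phi>) = 0"
      using c b unfolding cond_ii_def preannihilator_def by blast
    then show "(q \<odot> \<iota> b) \<phi> = 0" using q0_canon_apply[OF \<phi> b] by simp
  qed
next
  assume c: "A0_interpolates A"
  show "cond_ii A q" unfolding cond_ii_def
  proof
    fix \<phi> assume a: "\<phi> \<in> annihilator (B0 q) (A0 A q)"
    then have \<phi>: "\<phi> \<in> dual (B0 q)" "\<And>a. a \<in> A0 A q \<Longrightarrow> \<phi> a = 0" by (auto simp: annihilator_def)
    obtain \<phi>' where \<phi>': "\<phi>' \<in> dual UNIV" "restrict_functional (B0 q) \<phi>' = \<phi>" using B.dual_extend[OF \<phi>(1)] by blast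
    have "\<phi>' a = 0" if "a \<in> A0 A q" for a
      using \<phi>(2)[OF that] A0_B0[OF that] by (simp flip: \<phi>'(2))
    then have "(q \<odot> \<iota> b) \<phi>' = 0" if "b \<in> B0 q" for b using c \<phi>'(1) that unfolding A0_interpolates_def by blast
    then have "arens (B0 q) (q0 q) (canon (B0 q) b) \<phi> = 0" if "b \<in> B0 q" for b
      using q0_canon_apply[OF \<phi>'(1) that] that by (simp add: \<phi>'(2))
    then show "\<phi> \<in> preannihilator (B0 q) {arens (B0 q) (q0 q) (canon (B0 q) b) |b. b \<in> B0 q}"
      using \<phi>(1) by (auto simp: preannihilator_def)
  qed
qed

lemma cond_i_iff: "cond_i A q \<longleftrightarrow> cond_ii A q"
proof
  assume c: "cond_i A q"
  show "cond_ii A q" unfolding cond_ii_iff A0_interpolates_def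
  proof (intro ballI impI)
    fix \<phi> b assume \<phi>: "\<phi> \<in> dual UNIV" and z: "\<forall>a\<in>A0 A q. \<phi> a = 0" and b: "b \<in> B0 q"
    obtain \<eta> where \<eta>: "\<eta> \<in> biannihilator (B0 q) (A0 A q)" "q \<odot> \<iota> b = bidual_incl (B0 q) \<eta>"
      using c b unfolding cond_i_def by blast
    have "restrict_functional (B0 q) \<phi> \<in> annihilator (B0 q) (A0 A q)"
      using \<phi> z by (auto simp: annihilator_def A0_B0)
    then show "(q \<odot> \<iota> b) \<phi> = 0" using \<eta> by (simp add: B.incl_apply \<phi> biannihilator_def)
  qed
next
  assume c: "cond_ii A q"
  show "cond_i A q" unfolding cond_i_def
  proof
    fix \<eta> assume "\<eta> \<in> {q \<odot> \<iota> b |b. b \<in> B0 q}"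
    then obtain b where b: "b \<in> B0 q" "\<eta> = q \<odot> \<iota> b" by blast
    let ?\<theta> = "arens (B0 q) (q0 q) (canon (B0 q) b)"
    have "?\<theta> \<in> biannihilator (B0 q) (A0 A q)"
      using c b q0 unfolding biannihilator_def cond_ii_def preannihilator_def by auto
    moreover have "\<eta> = bidual_incl (B0 q) ?\<theta>" using b by (simp add: B.incl_arens q0 B.incl_canon)
    ultimately show "\<eta> \<in> bidual_incl (B0 q) ` biannihilator (B0 q) (A0 A q)" by blast
  qed
qed

text \<open>By the other description of the product, \<open>q \<eta>\<close> at \<phi> is \<eta> at
  the functional \<open>\<phi> (q \<cdot>)\<close>. Condition (ii) says that this functional is 0,
  which any \<eta> respects.\<close>

lemma cond_ii'_iff: "cond_ii A q \<longleftrightarrow> cond_ii' A q"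
proof
  assume c: "cond_ii A q"
  show "cond_ii' A q" unfolding cond_ii'_def
  proof
    fix \<phi> assume a: "\<phi> \<in> annihilator (B0 q) (A0 A q)"
    then have \<phi>: "\<phi> \<in> dual (B0 q)" by (auto simp: annihilator_def)
    have z: "B.lact (q0 q) \<phi> = (\<lambda>_. 0)"
    proof (rule B.dual_eqI)
      fix b assume b: "b \<in> B0 q"
      have "arens (B0 q) (q0 q) (canon (B0 q) b) \<phi> = 0" using c a b unfolding cond_ii_def preannihilator_def by blast
      then show "B.lact (q0 q) \<phi> b = 0" using b \<phi> q0(1) by (simp add: B.arens_lact)
    qed (use \<phi> q0 in auto)
    have "\<eta> (\<lambda>_. 0) = 0" if "\<eta> \<in> bidual (B0 q)" for \<eta>
      using B.bidual_cmult[OF that B.dual_zero_in, of 0] by simp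
    then have "arens (B0 q) (q0 q) \<eta> \<phi> = 0" if "\<eta> \<in> bidual (B0 q)" for \<eta>
      using that \<phi> q0(1) by (simp add: B.arens_lact z)
    then show "\<phi> \<in> preannihilator (B0 q) {arens (B0 q) (q0 q) \<eta> |\<eta>. \<eta> \<in> bidual (B0 q)}"
      using \<phi> by (auto simp: preannihilator_def)
  qed
next
  assume "cond_ii' A q"
  then show "cond_ii A q" unfolding cond_ii_def cond_ii'_def preannihilator_def using B.canon_bidual by blast
qed

text \<open>One direction is \<open>|\<phi>| q = \<phi> (q u\<^sup>\<star>)\<close>, an instance of
  the second form of (ii). Conversely, \<open>\<phi> (q b) = |\<phi>| (q b u)\<close> vanishes by
  the Cauchy-Schwarz inequality if \<open>|\<phi>| q = 0\<close>.\<close>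

lemma cond_iv_iff: "cond_iv A q \<longleftrightarrow> cond_ii A q"
proof
  assume c: "cond_ii A q"
  show "cond_iv A q" unfolding cond_iv_def
  proof
    fix \<phi> assume a: "\<phi> \<in> annihilator (B0 q) (A0 A q)"
    then have \<phi>: "\<phi> \<in> dual (B0 q)" by (auto simp: annihilator_def)
    obtain u where u: "u \<in> bidual (B0 q)"
      "\<And>x. x \<in> bidual (B0 q) \<Longrightarrow> x (abs_functional (B0 q) \<phi>) = arens (B0 q) x (u\<^sup>\<star>) \<phi>"
      using B.abs_functional[OF \<phi>] unfolding is_abs_functional_def by blast
    have "arens (B0 q) (q0 q) (u\<^sup>\<star>) \<phi> = 0"
      using c[unfolded cond_ii'_iff] a B.bstar_bidual[OF u(1)] unfolding cond_ii'_def preannihilator_def by blast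
    then show "q0 q (abs_functional (B0 q) \<phi>) = 0" using u(2)[OF q0(1)] by simp
  qed
next
  assume c: "cond_iv A q"
  show "cond_ii A q" unfolding cond_ii_def
  proof
    fix \<phi> assume a: "\<phi> \<in> annihilator (B0 q) (A0 A q)"
    then have \<phi>: "\<phi> \<in> dual (B0 q)" by (auto simp: annihilator_def)
    have p: "B.pos (abs_functional (B0 q) \<phi>)" using B.abs_functional[OF \<phi>] by (simp add: is_abs_functional_def)
    obtain u where u: "u \<in> bidual (B0 q)"
      "\<And>x. x \<in> bidual (B0 q) \<Longrightarrow> x \<phi> = arens (B0 q) x u (abs_functional (B0 q) \<phi>)"
      using B.abs_functional[OF \<phi>] unfolding is_abs_functional_def by blast
    have z: "q0 q (abs_functional (B0 q) \<phi>) = 0" using c a by (simp add: cond_iv_def)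
    have "arens (B0 q) (q0 q) (canon (B0 q) b) \<phi> = 0" if b: "b \<in> B0 q" for b
    proof -
      have "arens (B0 q) (q0 q) (canon (B0 q) b) \<phi>
          = arens (B0 q) (q0 q) (arens (B0 q) (canon (B0 q) b) u) (abs_functional (B0 q) \<phi>)"
        using u(2)[of "arens (B0 q) (q0 q) (canon (B0 q) b)"] b q0(1) u(1) by (simp add: B.arens_assoc)
      also have "\<dots> = 0"
        by (rule B.null_projection_right(2)[OF q0_projection p z]) (use b u in simp)
      finally show ?thesis .
    qed
    then show "\<phi> \<in> preannihilator (B0 q) {arens (B0 q) (q0 q) (canon (B0 q) b) |b. b \<in> B0 q}"
      using \<phi> by (auto simp: preannihilator_def)
  qed
qed

end

section \<open>Interpolation\<close>

lemma geometric_increments_converge: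
  fixes x :: "nat \<Rightarrow> 'a::banach"
  assumes "\<And>n. norm (x (Suc n) - x n) \<le> C / 2 ^ n"
  obtains l where "x \<longlonglongrightarrow> l" "norm (l - x 0) \<le> 2 * C"
proof -
  have s: "(\<lambda>n. C / 2 ^ n) sums (C * 2)"
    using sums_mult[OF geometric_sums[of "1/2 :: real"], of C] by (simp add: power_divide)
  have sm: "summable (\<lambda>n. norm (x (Suc n) - x n))"
    by (rule summable_comparison_test'[OF sums_summable[OF s], of 0]) (use assms in simp)
  have t: "(\<lambda>n. x 0 + (\<Sum>k<n. x (Suc k) - x k)) = x"
    by (simp add: sum_lessThan_telescope)
  have "(\<lambda>n. x 0 + (\<Sum>k<n. x (Suc k) - x k)) \<longlonglongrightarrow> x 0 + (\<Sum>k. x (Suc k) - x k)"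
    by (intro tendsto_add tendsto_const summable_LIMSEQ summable_norm_cancel[OF sm])
  then have "x \<longlonglongrightarrow> x 0 + (\<Sum>k. x (Suc k) - x k)" unfolding t .
  moreover have "norm (\<Sum>k. x (Suc k) - x k) \<le> 2 * C"
    by (rule order_trans[OF summable_norm[OF sm]])
       (use suminf_le[OF assms sm sums_summable[OF s]] sums_unique[OF s] in \<open>simp add: mult.commute\<close>)
  ultimately show thesis using that by fastforce
qed

context cstar_subalgebra
begin

lemma bidual_norm_ge:
  assumes \<eta>: "\<eta> \<in> bidual S" and \<phi>: "\<phi> \<in> dual S"
  shows "cmod (\<eta> \<phi>) \<le> bidual_norm S \<eta> * dual_norm S \<phi>"
proof -
  obtain K where K: "bbound K \<eta>" using bidual_bbound[OF \<eta>] .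
  show ?thesis
  proof (cases "dual_norm S \<phi> = 0")
    case True
    then show ?thesis using bbound_apply[OF K \<phi>] by simp
  next
    case False
    then have n: "dual_norm S \<phi> > 0" using dual_norm_nonneg[OF \<phi>] by simp
    define \<psi> where "\<psi> = of_real (1 / dual_norm S \<phi>) *\<^sub>\<phi> \<phi>"
    have \<psi>: "\<psi> \<in> dual S" unfolding \<psi>_def by (rule dual_cmult[OF \<phi>])
    have "dual_norm S \<psi> \<le> 1"
    proof (rule dual_norm_le)
      fix x assume "x \<in> S"
      then show "cmod (\<psi> x) \<le> 1 * norm x"
        using dual_norm_ge[OF \<phi>, of x] n by (simp add: \<psi>_def norm_mult norm_divide field_simps)
    qed simp
    moreover have "bdd_above {cmod (\<eta> \<phi>) |\<phi>. \<phi> \<in> dual S \<and> dual_norm S \<phi> \<le> 1}"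
    proof (rule bdd_aboveI)
      fix r assume "r \<in> {cmod (\<eta> \<phi>) |\<phi>. \<phi> \<in> dual S \<and> dual_norm S \<phi> \<le> 1}"
      then obtain \<xi> where "\<xi> \<in> dual S" "dual_norm S \<xi> \<le> 1" "r = cmod (\<eta> \<xi>)" by blast
      then show "r \<le> K * 1"
        using order_trans[OF bbound_apply[OF K, of \<xi>] mult_left_mono[OF _ bbound_nonneg[OF K]]] by blast
    qed
    ultimately have "cmod (\<eta> \<psi>) \<le> bidual_norm S \<eta>"
      unfolding bidual_norm_def using \<psi> by (intro cSup_upper) blast+
    moreover have "cmod (\<eta> \<psi>) = cmod (\<eta> \<phi>) / dual_norm S \<phi>"
      using n by (simp add: \<psi>_def bidual_cmult[OF \<eta> \<phi>] norm_mult norm_divide del: of_real_divide)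
    ultimately show ?thesis using n by (simp add: field_simps)
  qed
qed

lemma bidual_norm_le: assumes "bbound K \<eta>" shows "bidual_norm S \<eta> \<le> K"
  unfolding bidual_norm_def
proof (rule cSup_least)
  have "cmod (\<eta> (\<lambda>_. 0)) \<in> {cmod (\<eta> \<phi>) |\<phi>. \<phi> \<in> dual S \<and> dual_norm S \<phi> \<le> 1}"
    by (intro CollectI exI[of _ "\<lambda>_. 0"] conjI refl dual_zero_in dual_norm_le) auto
  then show "{cmod (\<eta> \<phi>) |\<phi>. \<phi> \<in> dual S \<and> dual_norm S \<phi> \<le> 1} \<noteq> {}" by blast
  fix r assume "r \<in> {cmod (\<eta> \<phi>) |\<phi>. \<phi> \<in> dual S \<and> dual_norm S \<phi> \<le> 1}"
  then obtain \<xi> where "\<xi> \<in> dual S" "dual_norm S \<xi> \<le> 1" "r = cmod (\<eta> \<xi>)" by blast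
  then have "r \<le> K * 1"
    using order_trans[OF bbound_apply[OF assms, of \<xi>] mult_left_mono[OF _ bbound_nonneg[OF assms]]] by blast
  then show "r \<le> K" by simp
qed

end

text \<open>No norm bound is required, so linear algebra suffices. One functional \<psi> is split
  off by an element of \<open>Y\<close> at which it is 1; the others are treated in the kernel of
  \<psi> in \<open>Y\<close>, with \<open>z\<close> corrected so that it vanishes at \<psi>.\<close>

lemma finite_interpolation:
  fixes Y :: "'b::unital_cstar_algebra set"
  assumes "finite F" "F \<subseteq> dual UNIV" "z \<in> bidual UNIV"
    and "0 \<in> Y" "\<And>x y. x \<in> Y \<Longrightarrow> y \<in> Y \<Longrightarrow> x + y \<in> Y" "\<And>c x. x \<in> Y \<Longrightarrow> c *\<^sub>C x \<in> Y"
    and "\<And>\<phi>. \<phi> \<in> dual UNIV \<Longrightarrow> (\<And>y. y \<in> Y \<Longrightarrow> \<phi> y = 0) \<Longrightarrow> z \<phi> = 0"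
  shows "\<exists>x\<in>Y. \<forall>\<phi>\<in>F. \<phi> x = z \<phi>"
  using assms
proof (induction F arbitrary: Y z rule: finite_induct)
  case empty
  then show ?case by blast
next
  case (insert \<psi> F)
  note Y = insert.prems(3-5)
  have \<psi>: "\<psi> \<in> dual UNIV" and F: "F \<subseteq> dual UNIV" using insert.prems(1) by auto
  show ?case
  proof (cases "\<forall>y\<in>Y. \<psi> y = 0")
    case True
    then have "z \<psi> = 0" using insert.prems(6) \<psi> by blast
    moreover obtain x where "x \<in> Y" "\<forall>\<phi>\<in>F. \<phi> x = z \<phi>"
      using insert.IH[OF F insert.prems(2) Y insert.prems(6)] by blast
    ultimately show ?thesis using True by auto
  next
    case False
    then obtain y1 where y1: "y1 \<in> Y" "\<psi> y1 \<noteq> 0" by blast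
    define y0 where "y0 = (1 / \<psi> y1) *\<^sub>C y1"
    have y0: "y0 \<in> Y" "\<psi> y0 = 1" using y1 Y(3) by (simp_all add: y0_def U.dual_scaleC \<psi>)
    define z' where "z' = z - z \<psi> *\<^sub>\<phi> \<iota> y0"
    have z': "z' \<phi> = z \<phi> - z \<psi> * \<phi> y0" if "\<phi> \<in> dual UNIV" for \<phi> using that by (simp add: z'_def)
    have "\<exists>x\<in>{y \<in> Y. \<psi> y = 0}. \<forall>\<phi>\<in>F. \<phi> x = z' \<phi>"
    proof (rule insert.IH[OF F])
      show "z' \<in> bidual UNIV" using insert.prems(2) by (simp add: z'_def)
      show "0 \<in> {y \<in> Y. \<psi> y = 0}" using Y \<psi> by (simp add: U.dual_zero)
      show "x + y \<in> {y \<in> Y. \<psi> y = 0}" if "x \<in> {y \<in> Y. \<psi> y = 0}" "y \<in> {y \<in> Y. \<psi> y = 0}" for x y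
        using that Y \<psi> by (simp add: U.dual_add)
      show "c *\<^sub>C x \<in> {y \<in> Y. \<psi> y = 0}" if "x \<in> {y \<in> Y. \<psi> y = 0}" for c x
        using that Y \<psi> by (simp add: U.dual_scaleC)
      fix \<phi> assume \<phi>: "\<phi> \<in> dual UNIV" and k: "\<And>y. y \<in> {y \<in> Y. \<psi> y = 0} \<Longrightarrow> \<phi> y = 0"
      have "z (\<lambda>x. \<phi> x - \<phi> y0 * \<psi> x) = 0"
      proof (rule insert.prems(6))
        fix y assume y: "y \<in> Y"
        have "y + (- \<psi> y) *\<^sub>C y0 \<in> Y" using Y(2)[OF y Y(3)[OF y0(1), of "- \<psi> y"]] .
        moreover have "\<psi> (y + (- \<psi> y) *\<^sub>C y0) = 0" using y0(2) by (simp add: U.dual_simps \<psi> del: scaleC_minus_left)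
        ultimately have "\<phi> (y + (- \<psi> y) *\<^sub>C y0) = 0" by (intro k) blast
        then show "\<phi> y - \<phi> y0 * \<psi> y = 0" by (simp add: U.dual_simps \<phi> mult.commute del: scaleC_minus_left)
      qed (use \<phi> \<psi> in simp)
      then have "z \<phi> = \<phi> y0 * z \<psi>"
        using U.bidual_minus[OF insert.prems(2) \<phi> U.dual_cmult[OF \<psi>, of "\<phi> y0"]]
        by (simp add: U.bidual_cmult[OF insert.prems(2) \<psi>])
      then show "z' \<phi> = 0" using z'[OF \<phi>] by (simp add: mult.commute)
    qed
    then obtain x where x: "x \<in> Y" "\<psi> x = 0" "\<forall>\<phi>\<in>F. \<phi> x = z' \<phi>" by blast
    have "x + z \<psi> *\<^sub>C y0 \<in> Y" by (intro Y x y0)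
    moreover have "\<psi> (x + z \<psi> *\<^sub>C y0) = z \<psi>" using x(2) y0(2) by (simp add: U.dual_simps \<psi>)
    moreover have "\<phi> (x + z \<psi> *\<^sub>C y0) = z \<phi>" if "\<phi> \<in> F" for \<phi>
      using x(3) that F z'[of \<phi>] by (auto simp: U.dual_simps subset_iff)
    ultimately show ?thesis by auto
  qed
qed

context closed_proj
begin

text \<open>The quotient seminorm modulo \<open>J\<close>. It dominates the norm of
  \<open>q \<odot> \<iota> b\<close> and, unlike the latter, is a seminorm of the kind to which
  Helly's theorem and limits in the closed set \<open>J\<close> apply directly.\<close>

definition dJ :: "'b \<Rightarrow> real" where
  "dJ y = infdist y J"

lemma J_ne: "J \<noteq> {}"
  using J_zero by blast

lemma dJ_near: assumes "dJ y < r" obtains j where "j \<in> J" "norm (y - j) < r"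
proof -
  have "\<exists>j\<in>J. dist y j < r" using assms J_ne unfolding dJ_def infdist_def by (simp add: cINF_less_iff)
  with that show thesis by (auto simp: dist_norm)
qed

lemma dJ_le: "j \<in> J \<Longrightarrow> dJ y \<le> norm (y - j)"
  unfolding dJ_def dist_norm[symmetric] by (rule infdist_le)

lemma dJ_seminorm: "complex_seminorm dJ"
  unfolding complex_seminorm_def
proof (intro conjI allI)
  fix x y
  show "dJ (x + y) \<le> dJ x + dJ y"
  proof (rule field_le_epsilon)
    fix e :: real assume e: "0 < e"
    obtain j where j: "j \<in> J" "norm (x - j) < dJ x + e / 2" using dJ_near[of x "dJ x + e / 2"] e by auto
    obtain k where k: "k \<in> J" "norm (y - k) < dJ y + e / 2" using dJ_near[of y "dJ y + e / 2"] e by auto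
    have "dJ (x + y) \<le> norm ((x - j) + (y - k))" using dJ_le[OF J_add[OF j(1) k(1)], of "x + y"] by (simp add: algebra_simps)
    also have "\<dots> \<le> norm (x - j) + norm (y - k)" by (rule norm_triangle_ineq)
    finally show "dJ (x + y) \<le> dJ x + dJ y + e" using j k by simp
  qed
next
  fix c x
  have le: "dJ (c *\<^sub>C x) \<le> cmod c * dJ x" for c x
  proof (rule field_le_epsilon)
    fix e :: real assume e: "0 < e"
    have p: "cmod c + 1 > 0" by (simp add: add_nonneg_pos)
    then obtain j where j: "j \<in> J" "norm (x - j) < dJ x + e / (cmod c + 1)" using dJ_near[of x "dJ x + e / (cmod c + 1)"] e by auto
    have "dJ (c *\<^sub>C x) \<le> norm (c *\<^sub>C (x - j))" using dJ_le[OF J_scaleC[OF j(1)], of "c *\<^sub>C x" c] by (simp add: scaleC_diff_right)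
    also have "\<dots> \<le> cmod c * (dJ x + e / (cmod c + 1))" unfolding norm_scaleC using j by (intro mult_left_mono) auto
    also have "\<dots> \<le> cmod c * dJ x + e" using e p by (simp add: field_simps)
    finally show "dJ (c *\<^sub>C x) \<le> cmod c * dJ x + e" .
  qed
  show "dJ (c *\<^sub>C x) = cmod c * dJ x"
  proof (cases "c = 0")
    case True
    then show ?thesis using le[of 0 x] infdist_nonneg[of "0::'b" J] by (simp add: dJ_def)
  next
    case False
    then have "dJ x \<le> cmod (1 / c) * dJ (c *\<^sub>C x)" using le[of "1 / c" "c *\<^sub>C x"] by (simp add: scaleC_scaleC)
    then have "cmod c * dJ x \<le> dJ (c *\<^sub>C x)" using False by (simp add: norm_divide field_simps)
    with le[of c x] show ?thesis by simp
  qed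
qed

lemma dJ_le_norm: "dJ y \<le> 1 * norm y"
  using dJ_le[OF J_zero, of y] by simp

lemma dJ_eq_0: "dJ y = 0 \<longleftrightarrow> y \<in> J"
  unfolding dJ_def using in_closed_iff_infdist_zero[OF closed_J J_ne] by simp

lemma dJ_minus: "dJ (y - x) = dJ (x - y)"
  using complex_seminorm_scale[OF dJ_seminorm, of "-1" "x - y"] by (simp add: scaleC_minus_one)

lemma dJ_dominated: assumes "\<And>x. cmod (\<phi> x) \<le> m * dJ x" "j \<in> J" shows "\<phi> j = 0"
  using assms(1)[of j] dJ_eq_0[of j] assms(2) by simp

lemma q_bbound: "U.bbound 1 q" "U.bbound 1 qc"
  by (intro U.effect_bbound U.effect_projection q_projection qc_projection)+

lemma q_canon_bbound: "U.bbound (norm b) (q \<odot> \<iota> b)" "U.bbound (norm b) (qc \<odot> \<iota> b)" "U.bbound (norm b) (\<iota> b \<odot> q)"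
  using U.bbound_arens[OF q_bbound(1) U.bbound_canon[OF UNIV_I]] U.bbound_arens[OF q_bbound(2) U.bbound_canon[OF UNIV_I]]
    U.bbound_arens[OF U.bbound_canon[OF UNIV_I] q_bbound(1)] by auto

lemma q_canon_bbound_dJ: assumes "dJ b < r" shows "U.bbound r (q \<odot> \<iota> b)"
proof -
  obtain j where j: "j \<in> J" "norm (b - j) < r" using dJ_near[OF assms] .
  have "q \<odot> \<iota> b = q \<odot> \<iota> (b - j)" using j(1) by (simp add: canon_linear U.arens_diff_right J_def)
  then show ?thesis using U.bbound_mono[OF q_canon_bbound(1)] j(2) by simp
qed

text \<open>The summands of \<open>B\<^sub>0\<close>'s bidual cut out by \<open>q\<close> and its complement are combined with the maximum norm.\<close>

lemma q_sum_bbound: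
  assumes c: "c \<in> B0 q" and y: "y \<in> B0 q" and mc: "U.bbound m (q \<odot> \<iota> c)" and my: "norm y \<le> m"
  shows "U.bbound m (q \<odot> \<iota> c + qc \<odot> \<iota> y)"
  unfolding U.bbound_def
proof (intro conjI ballI)
  show m: "0 \<le> m" by (rule U.bbound_nonneg[OF mc])
  fix \<phi> :: "'b functional" assume \<phi>: "\<phi> \<in> dual UNIV"
  define \<kappa> where "\<kappa> = q \<odot> \<iota> c"
  define \<theta> where "\<theta> = qc \<odot> \<iota> y"
  have \<kappa>: "\<kappa> \<in> bidual UNIV" and \<theta>: "\<theta> \<in> bidual UNIV" by (simp_all add: \<kappa>_def \<theta>_def)
  have s\<kappa>: "\<kappa>\<^sup>\<star> = \<iota> (star c) \<odot> q" and s\<theta>: "\<theta>\<^sup>\<star> = \<iota> (star y) \<odot> qc"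
    by (simp_all add: \<kappa>_def \<theta>_def U.bstar_arens U.bstar_canon)
  have k1: "\<kappa> \<odot> \<theta>\<^sup>\<star> = 0"
  proof -
    have "\<kappa> \<odot> \<theta>\<^sup>\<star> = q \<odot> (\<iota> (c * star y) \<odot> qc)" unfolding s\<theta> by (simp add: \<kappa>_def canon_mult U.arens_assoc)
    also have "\<dots> = 0" using qc_commute[of "c * star y"] c y by simp
    finally show ?thesis .
  qed
  have k2: "\<theta> \<odot> \<kappa>\<^sup>\<star> = 0"
  proof -
    have "\<theta> \<odot> \<kappa>\<^sup>\<star> = qc \<odot> (\<iota> (y * star c) \<odot> q)" unfolding s\<kappa> by (simp add: \<theta>_def canon_mult U.arens_assoc)
    also have "\<dots> = 0" using c y B.mult_S[OF y B.star_S[OF c]] by (simp add: mem_B0)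
    finally show ?thesis .
  qed
  obtain \<psi> where \<psi>: "U.pos \<psi>" "Re (\<psi> 1) = dual_norm UNIV \<phi>"
    "(cmod ((\<kappa> + \<theta>) \<phi>))\<^sup>2 \<le> dual_norm UNIV \<phi> * Re (((\<kappa> + \<theta>) \<odot> (\<kappa> + \<theta>)\<^sup>\<star>) \<psi>)"
    using U.right_polar[OF \<phi>] U.bidual_plus[OF \<kappa> \<theta>] by metis
  have "(\<kappa> + \<theta>) \<odot> (\<kappa> + \<theta>)\<^sup>\<star> = \<kappa> \<odot> \<kappa>\<^sup>\<star> + \<theta> \<odot> \<theta>\<^sup>\<star>"
    using \<kappa> \<theta> by (simp add: U.bstar_linear U.arens_add_left U.arens_add_right k1 k2)
  then have e: "Re (((\<kappa> + \<theta>) \<odot> (\<kappa> + \<theta>)\<^sup>\<star>) \<psi>) = Re ((\<kappa> \<odot> \<kappa>\<^sup>\<star>) \<psi>) + Re ((\<theta> \<odot> \<theta>\<^sup>\<star>) \<psi>)" by simp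
  have sp: "U.pos (U.sandwich q \<psi>)" "U.pos (U.sandwich qc \<psi>)" by (rule U.sandwich_pos[OF \<psi>(1)]; simp)+
  have one: "U.sandwich r \<psi> 1 = (r\<^sup>\<star> \<odot> r) \<psi>" if "r \<in> bidual UNIV" for r
  proof -
    have "U.sandwich r \<psi> 1 = \<iota> 1 (U.sandwich r \<psi>)" using that \<psi>(1) by simp
    also have "\<dots> = (r\<^sup>\<star> \<odot> r) \<psi>" by (subst U.sandwich_apply) (use that \<psi>(1) in simp_all)
    finally show ?thesis .
  qed
  \<comment> \<open>The mixed products vanish, so the two squares are estimated separately, each on
    the compression of \<psi> to its own summand. The masses \<open>q \<psi>\<close> and
    \<open>qc \<psi>\<close> add up to the norm of \<phi>.\<close>
  have "Re ((\<kappa> \<odot> \<kappa>\<^sup>\<star>) \<psi>) \<le> m\<^sup>2 * Re (q \<psi>)"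
  proof -
    have "\<kappa> \<odot> \<kappa>\<^sup>\<star> = q \<odot> (\<iota> c \<odot> (\<iota> (star c) \<odot> q))" unfolding s\<kappa> by (simp add: \<kappa>_def U.arens_assoc)
    then have "(\<kappa> \<odot> \<kappa>\<^sup>\<star>) (U.sandwich q \<psi>) = (\<kappa> \<odot> \<kappa>\<^sup>\<star>) \<psi>"
      by (subst U.sandwich_apply) (use \<psi>(1) \<kappa> in \<open>simp_all add: U.arens_assoc\<close>)
    moreover have "Re ((\<kappa> \<odot> \<kappa>\<^sup>\<star>) (U.sandwich q \<psi>)) \<le> m\<^sup>2 * Re (U.sandwich q \<psi> 1)"
      using U.bstar_arens_pos(3)[OF sp(1) U.bstar_bidual[OF \<kappa>] U.bbound_bstar[OF mc[folded \<kappa>_def]]] by simp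
    ultimately show ?thesis by (simp add: one)
  qed
  moreover have "Re ((\<theta> \<odot> \<theta>\<^sup>\<star>) \<psi>) \<le> m\<^sup>2 * Re (qc \<psi>)"
  proof -
    have "\<theta> \<odot> \<theta>\<^sup>\<star> = qc \<odot> (\<iota> y \<odot> (\<iota> (star y) \<odot> qc))" unfolding s\<theta> by (simp add: \<theta>_def U.arens_assoc)
    then have "\<iota> (y * star y) (U.sandwich qc \<psi>) = (\<theta> \<odot> \<theta>\<^sup>\<star>) \<psi>"
      by (subst U.sandwich_apply) (use \<psi>(1) in \<open>simp_all add: canon_mult U.arens_assoc\<close>)
    then have "Re ((\<theta> \<odot> \<theta>\<^sup>\<star>) \<psi>) = Re (U.sandwich qc \<psi> (y * star y))" using sp(2) by simp
    also have "\<dots> \<le> Re (U.sandwich qc \<psi> 1) * norm (y * star y)"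
      using U.pos_bound[OF sp(2), of "y * star y"] complex_Re_le_cmod order_trans by (metis UNIV_I)
    also have "\<dots> \<le> Re (U.sandwich qc \<psi> 1) * m\<^sup>2"
      using my U.pos_one(1)[OF sp(2)] by (intro mult_left_mono) (simp_all add: cstar_identity' power_mono)
    finally show ?thesis by (simp add: one mult.commute)
  qed
  moreover have "Re (q \<psi>) + Re (qc \<psi>) = dual_norm UNIV \<phi>" using q_plus_qc[OF U.pos_dual[OF \<psi>(1)]] \<psi>(2) by (metis plus_complex.sel(1))
  ultimately have "Re (((\<kappa> + \<theta>) \<odot> (\<kappa> + \<theta>)\<^sup>\<star>) \<psi>) \<le> m\<^sup>2 * dual_norm UNIV \<phi>"
    unfolding e by (metis (no_types) add_mono distrib_left)
  then have "(cmod ((\<kappa> + \<theta>) \<phi>))\<^sup>2 \<le> dual_norm UNIV \<phi> * (m\<^sup>2 * dual_norm UNIV \<phi>)"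
    using \<psi>(3) mult_left_mono[OF _ U.dual_norm_nonneg[OF \<phi>]] order_trans by blast
  also have "\<dots> = (m * dual_norm UNIV \<phi>)\<^sup>2" by (simp add: power2_eq_square)
  finally show "cmod ((q \<odot> \<iota> c + qc \<odot> \<iota> y) \<phi>) \<le> m * dual_norm UNIV \<phi>"
    unfolding \<kappa>_def[symmetric] \<theta>_def[symmetric]
    by (rule power2_le_imp_le) (intro mult_nonneg_nonneg m U.dual_norm_nonneg[OF \<phi>])
qed

text \<open>The element \<open>z\<close> has norm at most 1. It is within \<delta> of
  \<open>x\<close>, because \<open>z - x = q (c - x) + qc (w - x)\<close> with
  \<open>q (c - x)\<close> controlled by \<open>dJ\<close> and \<open>w - x = - \<delta> w\<close>.
  It agrees with \<open>c\<close> modulo \<open>J\<close>. Helly's theorem relaxes the bounds 1,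
  \<delta>, 0 to 1 + \<delta> / 2, 2 \<delta>, \<delta> / 2. The subspace \<open>X\<close> is kept
  abstract because \<open>cond_iii_if\<close> applies the result to a translate of
  \<open>A0 A q\<close>.\<close>

lemma interpolation_step:
  assumes X: "0 \<in> X" "\<And>x y. x \<in> X \<Longrightarrow> y \<in> X \<Longrightarrow> x + y \<in> X" "\<And>c x. x \<in> X \<Longrightarrow> c *\<^sub>C x \<in> X" "X \<subseteq> B0 q"
    and XE: "\<And>\<phi> b. \<phi> \<in> dual UNIV \<Longrightarrow> (\<And>x. x \<in> X \<Longrightarrow> \<phi> x = 0) \<Longrightarrow> b \<in> B0 q \<Longrightarrow> (q \<odot> \<iota> b) \<phi> = 0"
    and c: "c \<in> B0 q" "U.bbound 1 (q \<odot> \<iota> c)"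
    and x: "x \<in> X" "norm x < 1 + \<delta>" "dJ (x - c) < \<delta>"
  obtains y where "y \<in> X" "norm y < 1 + \<delta> / 2" "norm (y - x) < 2 * \<delta>" "dJ (y - c) < \<delta> / 2"
proof -
  have d: "\<delta> > 0" using x(3) infdist_nonneg[of "x - c" J] by (simp add: dJ_def)
  define w where "w = (1 / (1 + \<delta>)) *\<^sub>R x"
  have w: "w \<in> X" unfolding w_def scaleR_scaleC by (rule X(3)[OF x(1)])
  have xB: "x \<in> B0 q" "w \<in> B0 q" using X(4) x(1) w by auto
  have nw: "norm w \<le> 1" using x(2) d by (simp add: w_def field_simps)
  have nwx: "norm (w - x) \<le> \<delta>"
  proof -
    have "w - x = (- \<delta>) *\<^sub>R w" using d by (simp add: w_def field_simps flip: scaleR_left.diff scaleR_left_diff_distrib)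
      (simp add: scaleR_left_diff_distrib diff_divide_distrib algebra_simps flip: scaleR_left_distrib add_divide_distrib)
    then show ?thesis using nw d by (simp add: mult_left_le)
  qed
  define z where "z = q \<odot> \<iota> c + qc \<odot> \<iota> w"
  have z: "z \<in> bidual UNIV" by (simp add: z_def)
  have qcw: "(qc \<odot> \<iota> b) \<phi> = \<phi> b - (q \<odot> \<iota> b) \<phi>" if "\<phi> \<in> dual UNIV" for \<phi> b
    using that by (simp add: qc_def U.arens_diff_left)
  have dn: "dual_norm UNIV \<phi> \<le> m" if "0 \<le> m" "\<And>x. cmod (\<phi> x) \<le> m * norm x" for \<phi> :: "'b functional" and m
    by (rule U.dual_norm_le) (use that in auto)
  show thesis
  proof (rule Helly_three_seminorms[OF X(1-3) complex_seminorm_norm complex_seminorm_norm dJ_seminorm _ _ _ z,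
      of 1 0 1 x \<delta> c 0 "1 + \<delta> / 2" "2 * \<delta>" "\<delta> / 2"])
    fix \<phi> :: "'b functional" assume \<phi>: "\<phi> \<in> dual UNIV" and 0: "\<And>x. x \<in> X \<Longrightarrow> \<phi> x = 0"
    show "z \<phi> = 0" using XE[OF \<phi> 0 c(1)] XE[OF \<phi> 0 xB(2)] 0[OF w] by (simp add: z_def qcw[OF \<phi>])
  next
    fix \<phi> :: "'b functional" and m assume \<phi>: "\<phi> \<in> dual UNIV" and m: "0 \<le> m" "\<And>x. cmod (\<phi> x) \<le> m * norm x"
    have "cmod (z \<phi>) \<le> 1 * dual_norm UNIV \<phi>"
      unfolding z_def by (rule U.bbound_apply[OF q_sum_bbound[OF c(1) xB(2) c(2) nw] \<phi>])
    then show "cmod (z \<phi> - \<phi> 0) \<le> m * 1" using dn[OF m] by (simp add: U.dual_zero \<phi>)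
  next
    fix \<phi> :: "'b functional" and m assume \<phi>: "\<phi> \<in> dual UNIV" and m: "0 \<le> m" "\<And>x. cmod (\<phi> x) \<le> m * norm x"
    have "U.bbound \<delta> (q \<odot> \<iota> (c - x) + qc \<odot> \<iota> (w - x))"
      by (intro q_sum_bbound q_canon_bbound_dJ) (use c xB nwx x(3) in \<open>simp_all add: dJ_minus[of c]\<close>)
    then have "cmod ((q \<odot> \<iota> (c - x) + qc \<odot> \<iota> (w - x)) \<phi>) \<le> \<delta> * dual_norm UNIV \<phi>" by (rule U.bbound_apply[OF _ \<phi>])
    also have "\<dots> \<le> m * \<delta>" using dn[OF m] d by (simp add: mult.commute)
    also have "(q \<odot> \<iota> (c - x) + qc \<odot> \<iota> (w - x)) \<phi> = z \<phi> - \<phi> x"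
      using \<phi> by (simp add: z_def canon_linear U.arens_diff_right qcw)
    finally show "cmod (z \<phi> - \<phi> x) \<le> m * \<delta>" .
  next
    fix \<phi> :: "'b functional" and m assume \<phi>: "\<phi> \<in> dual UNIV" and m: "0 \<le> m" "\<And>x. cmod (\<phi> x) \<le> m * dJ x"
    have "(qc \<odot> \<iota> (w - c)) \<phi> = 0"
      by (rule qc_canon_vanish[OF \<phi> dJ_dominated[OF m(2)]]) (use c xB in auto)
    then have "z \<phi> = \<phi> c" using \<phi> by (simp add: z_def canon_linear U.arens_diff_right qcw)
    then show "cmod (z \<phi> - \<phi> c) \<le> m * 0" by simp
  next
    fix y assume "y \<in> X" "norm (y - 0) < 1 + \<delta> / 2" "norm (y - x) < 2 * \<delta>" "dJ (y - c) < \<delta> / 2"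
    then show thesis by (intro that) auto
  qed (use d dJ_le_norm in auto)
qed

text \<open>The interpolating element is the limit of elements which almost interpolate and whose norms
  are almost at most 1; passing from one to the next costs as much as the error of the former.\<close>

lemma interpolation:
  assumes X: "0 \<in> X" "\<And>x y. x \<in> X \<Longrightarrow> y \<in> X \<Longrightarrow> x + y \<in> X" "\<And>c x. x \<in> X \<Longrightarrow> c *\<^sub>C x \<in> X" "X \<subseteq> B0 q" "closed X"
    and XE: "\<And>\<phi> b. \<phi> \<in> dual UNIV \<Longrightarrow> (\<And>x. x \<in> X \<Longrightarrow> \<phi> x = 0) \<Longrightarrow> b \<in> B0 q \<Longrightarrow> (q \<odot> \<iota> b) \<phi> = 0"
    and c: "c \<in> B0 q" "U.bbound 1 (q \<odot> \<iota> c)"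
  obtains x where "x \<in> X" "norm x \<le> 1" "q \<odot> \<iota> x = q \<odot> \<iota> c"
proof -
  \<comment> \<open>The initial value exceeds \<open>norm c\<close>, so the iteration can start at
    0.\<close>
  define \<delta> where "\<delta> n = (norm c + 1) / 2 ^ n" for n :: nat
  have \<delta>0: "\<delta> \<longlonglongrightarrow> 0"
    unfolding \<delta>_def using tendsto_mult[OF tendsto_const LIMSEQ_realpow_zero[of "1/2"], of "norm c + 1"]
    by (simp add: power_divide)
  have "\<exists>x. \<forall>n. (x n \<in> X \<and> norm (x n) < 1 + \<delta> n \<and> dJ (x n - c) < \<delta> n) \<and> norm (x (Suc n) - x n) < 2 * \<delta> n"
  proof (rule dependent_nat_choice)
    have "dJ (0 - c) < \<delta> 0" using dJ_le_norm[of "0 - c"] by (simp add: \<delta>_def)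
    then show "\<exists>x. x \<in> X \<and> norm x < 1 + \<delta> 0 \<and> dJ (x - c) < \<delta> 0"
      using X(1) by (intro exI[of _ 0]) (simp add: \<delta>_def add_pos_nonneg)
    fix x n assume x: "x \<in> X \<and> norm x < 1 + \<delta> n \<and> dJ (x - c) < \<delta> n"
    have h: "\<delta> n / 2 = \<delta> (Suc n)" by (simp add: \<delta>_def)
    show "\<exists>y. (y \<in> X \<and> norm y < 1 + \<delta> (Suc n) \<and> dJ (y - c) < \<delta> (Suc n)) \<and> norm (y - x) < 2 * \<delta> n"
    proof (rule interpolation_step[of X c x "\<delta> n"])
      show "0 \<in> X" "\<And>x y. x \<in> X \<Longrightarrow> y \<in> X \<Longrightarrow> x + y \<in> X" "\<And>c x. x \<in> X \<Longrightarrow> c *\<^sub>C x \<in> X" "X \<subseteq> B0 q"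
        by (fact X)+
      show "(q \<odot> \<iota> b) \<phi> = 0" if "\<phi> \<in> dual UNIV" "\<And>x. x \<in> X \<Longrightarrow> \<phi> x = 0" "b \<in> B0 q" for \<phi> b
        by (rule XE[OF that])
      show "c \<in> B0 q" "U.bbound 1 (q \<odot> \<iota> c)" by (fact c)+
      show "x \<in> X" "norm x < 1 + \<delta> n" "dJ (x - c) < \<delta> n" using x by auto
      fix y assume "y \<in> X" "norm y < 1 + \<delta> n / 2" "norm (y - x) < 2 * \<delta> n" "dJ (y - c) < \<delta> n / 2"
      then show ?thesis unfolding h by blast
    qed
  qed
  then obtain x where x: "\<And>n. x n \<in> X" "\<And>n. norm (x n) < 1 + \<delta> n" "\<And>n. dJ (x n - c) < \<delta> n"
    "\<And>n. norm (x (Suc n) - x n) < 2 * \<delta> n" by blast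
  have "norm (x (Suc n) - x n) \<le> (2 * (norm c + 1)) / 2 ^ n" for n
    using x(4)[of n] by (simp add: \<delta>_def)
  then obtain l where l: "x \<longlonglongrightarrow> l" using geometric_increments_converge by metis
  have "l \<in> X" using X(5) x(1) l closed_sequentially by blast
  moreover have "norm l \<le> 1"
  proof (rule LIMSEQ_le[OF tendsto_norm[OF l]])
    show "(\<lambda>n. 1 + \<delta> n) \<longlonglongrightarrow> 1" using tendsto_add[OF tendsto_const \<delta>0, of 1] by simp
    show "\<exists>N. \<forall>n\<ge>N. norm (x n) \<le> 1 + \<delta> n" using x(2) less_imp_le by blast
  qed
  moreover have "l - c \<in> J"
  proof -
    have "(\<lambda>n. dJ (x n - c)) \<longlonglongrightarrow> dJ (l - c)" unfolding dJ_def by (intro tendsto_infdist tendsto_diff l tendsto_const)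
    then have "dJ (l - c) \<le> 0" by (rule LIMSEQ_le[OF _ \<delta>0]) (use x(3) less_imp_le in blast)
    then show ?thesis using infdist_nonneg[of "l - c" J] dJ_eq_0 by (simp add: dJ_def)
  qed
  then have "q \<odot> \<iota> (l - c) = 0" by (simp add: J_def)
  then have "q \<odot> \<iota> l = q \<odot> \<iota> c" by (simp add: canon_linear U.arens_diff_right)
  ultimately show thesis using that by blast
qed

end

section \<open>The conditions\<close>

locale closed_proj_subalgebra = closed_proj q
  for q :: "'b::unital_cstar_algebra bifunctional" +
  fixes A :: "'b set"
  assumes closed_A: "closed A" and subalgebra_A: "complex_subalgebra A" and one_A: "1 \<in> A"
begin

lemma A_simps: "0 \<in> A" "x \<in> A \<Longrightarrow> y \<in> A \<Longrightarrow> x + y \<in> A" "x \<in> A \<Longrightarrow> c *\<^sub>C x \<in> A" "x \<in> A \<Longrightarrow> y \<in> A \<Longrightarrow> x * y \<in> A"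
  using subalgebra_A by (auto simp: complex_subalgebra_def)

lemma A0_iff: "a \<in> A0 A q \<longleftrightarrow> a \<in> A \<and> a \<in> B0 q"
  by (simp add: A0_def)

lemma A0_simps: "0 \<in> A0 A q" "1 \<in> A0 A q" "x \<in> A0 A q \<Longrightarrow> y \<in> A0 A q \<Longrightarrow> x + y \<in> A0 A q"
  "x \<in> A0 A q \<Longrightarrow> c *\<^sub>C x \<in> A0 A q" "x \<in> A0 A q \<Longrightarrow> y \<in> A0 A q \<Longrightarrow> x * y \<in> A0 A q"
  by (simp_all add: A0_iff A_simps one_A B.scaleC_S B.mult_S)

lemma closed_A0: "closed (A0 A q)"
  unfolding A0_def by (intro closed_Int closed_A closed_B0)

lemma A0_interpolatesD:
  "A0_interpolates A \<Longrightarrow> \<phi> \<in> dual UNIV \<Longrightarrow> (\<And>a. a \<in> A0 A q \<Longrightarrow> \<phi> a = 0) \<Longrightarrow> b \<in> B0 q \<Longrightarrow> (q \<odot> \<iota> b) \<phi> = 0"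
  unfolding A0_interpolates_def by blast

lemma q_canon_scale: "q \<odot> \<iota> (c *\<^sub>C b) = c *\<^sub>\<phi> (q \<odot> \<iota> b)"
  by (simp add: canon_linear U.arens_scale_right)

lemma q_canon_mult: "q \<odot> \<iota> (b * c) = (q \<odot> \<iota> b) \<odot> \<iota> c"
  by (simp add: canon_mult U.arens_assoc)

text \<open>The norm control on the preimage is what later turns a Cauchy sequence in
  \<open>q A0\<close> into one in \<open>A0 A q\<close>.\<close>

lemma lift:
  assumes E: "A0_interpolates A" and b: "b \<in> B0 q" and t: "U.bbound t (q \<odot> \<iota> b)" "0 < t"
  obtains a where "a \<in> A0 A q" "norm a \<le> t" "q \<odot> \<iota> a = q \<odot> \<iota> b"
proof (rule interpolation[of "A0 A q" "of_real (1 / t) *\<^sub>C b"])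
  show "U.bbound 1 (q \<odot> \<iota> (of_real (1 / t) *\<^sub>C b))" unfolding U.bbound_def
  proof (intro conjI ballI)
    fix \<phi> :: "'b functional" assume \<phi>: "\<phi> \<in> dual UNIV"
    have "cmod ((q \<odot> \<iota> (of_real (1 / t) *\<^sub>C b)) \<phi>) = cmod ((q \<odot> \<iota> b) \<phi>) / t"
      unfolding q_canon_scale using t(2) by (simp add: norm_mult norm_divide)
    also have "\<dots> \<le> 1 * dual_norm UNIV \<phi>" using U.bbound_apply[OF t(1) \<phi>] t(2) by (simp add: field_simps)
    finally show "cmod ((q \<odot> \<iota> (of_real (1 / t) *\<^sub>C b)) \<phi>) \<le> 1 * dual_norm UNIV \<phi>" .
  qed simp
  show "(q \<odot> \<iota> b) \<phi> = 0" if "\<phi> \<in> dual UNIV" "\<And>x. x \<in> A0 A q \<Longrightarrow> \<phi> x = 0" "b \<in> B0 q" for \<phi> b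
    by (rule A0_interpolatesD[OF E that])
  fix x assume x: "x \<in> A0 A q" "norm x \<le> 1" "q \<odot> \<iota> x = q \<odot> \<iota> (of_real (1 / t) *\<^sub>C b)"
  show thesis
  proof (rule that)
    show "of_real t *\<^sub>C x \<in> A0 A q" by (intro A0_simps x)
    show "norm (complex_of_real t *\<^sub>C x) \<le> t" using x(2) t(2) by (simp add: norm_scaleC mult_left_le)
    show "q \<odot> \<iota> (of_real t *\<^sub>C x) = q \<odot> \<iota> b"
      unfolding q_canon_scale x(3) using t(2) by (simp add: fun_eq_iff)
  qed
qed (use b in \<open>auto simp: A0_iff A_simps B.scaleC_S closed_A0\<close>)

lemma cond_vi_if: assumes E: "A0_interpolates A" shows "cond_vi A q"
  unfolding cond_vi_def
proof (intro ballI impI)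
  fix b assume b: "b \<in> B0 q" and n: "bidual_norm UNIV (\<iota> b \<odot> q) \<le> 1"
  have "U.bbound 1 (q \<odot> \<iota> b)" unfolding U.bbound_def
  proof (intro conjI ballI)
    fix \<phi> :: "'b functional" assume \<phi>: "\<phi> \<in> dual UNIV"
    have "cmod ((\<iota> b \<odot> q) \<phi>) \<le> bidual_norm UNIV (\<iota> b \<odot> q) * dual_norm UNIV \<phi>"
      by (rule U.bidual_norm_ge) (use \<phi> in simp_all)
    also have "\<dots> \<le> 1 * dual_norm UNIV \<phi>" by (intro mult_right_mono n U.dual_norm_nonneg \<phi>)
    finally show "cmod ((q \<odot> \<iota> b) \<phi>) \<le> 1 * dual_norm UNIV \<phi>" using b by (simp add: mem_B0)
  qed simp
  then obtain a where a: "a \<in> A0 A q" "norm a \<le> 1" "q \<odot> \<iota> a = q \<odot> \<iota> b" using lift[OF E b] zero_less_one by metis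
  then show "\<exists>a\<in>A. norm a \<le> 1 \<and> \<iota> a \<odot> q = q \<odot> \<iota> a \<and> q \<odot> \<iota> a = \<iota> b \<odot> q"
    using b by (intro bexI[of _ a]) (auto simp: A0_iff mem_B0)
qed

lemma cond_v_if: assumes vi: "cond_vi A q" shows "cond_v A q"
proof -
  have "\<exists>a\<in>A0 A q. q \<odot> \<iota> a = q \<odot> \<iota> b" if b: "b \<in> B0 q" for b
  proof -
    define t where "t = norm b + 1"
    have t: "t > 0" by (simp add: t_def add_nonneg_pos)
    let ?b = "of_real (1 / t) *\<^sub>C b"
    have "bidual_norm UNIV (\<iota> ?b \<odot> q) \<le> norm ?b" by (rule U.bidual_norm_le[OF q_canon_bbound(3)])
    also have "\<dots> \<le> 1" using t by (simp add: norm_scaleC norm_divide t_def)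
    finally obtain a where a: "a \<in> A" "\<iota> a \<odot> q = q \<odot> \<iota> a" "q \<odot> \<iota> a = \<iota> ?b \<odot> q"
      using vi B.scaleC_S[OF b] unfolding cond_vi_def by blast
    have "of_real t *\<^sub>C a \<in> A0 A q" using a by (intro A0_simps) (simp add: A0_iff mem_B0)
    moreover have "q \<odot> \<iota> a = q \<odot> \<iota> ?b" using a(3) B.scaleC_S[OF b] by (simp add: mem_B0)
    then have "q \<odot> \<iota> (of_real t *\<^sub>C a) = q \<odot> \<iota> b"
      unfolding q_canon_scale using t by (simp add: fun_eq_iff)
    ultimately show ?thesis by blast
  qed
  then show ?thesis unfolding cond_v_def by (blast intro: A0_B0 dest: sym)
qed

lemma B0_inverse: assumes d: "d \<in> B0 q" "d * e = 1" "e * d = 1" shows "e \<in> B0 q"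
proof -
  have "\<iota> e \<odot> q = \<iota> e \<odot> (q \<odot> (\<iota> d \<odot> \<iota> e))" using d(2) by (simp flip: canon_mult)
  also have "\<dots> = \<iota> e \<odot> ((q \<odot> \<iota> d) \<odot> \<iota> e)" by (simp add: U.arens_assoc)
  also have "\<dots> = \<iota> e \<odot> ((\<iota> d \<odot> q) \<odot> \<iota> e)" using d(1) by (simp add: mem_B0)
  also have "\<dots> = (\<iota> e \<odot> \<iota> d) \<odot> (q \<odot> \<iota> e)" by (simp add: U.arens_assoc)
  also have "\<dots> = q \<odot> \<iota> e" using d(3) by (simp flip: canon_mult)
  finally show ?thesis by (simp add: mem_B0)
qed

text \<open>Condition (iii) is interpolation of \<open>b d\<^sup>-\<^sup>1\<^sup>/\<^sup>2\<close> by elements of \<open>A\<^sub>0 d\<^sup>-\<^sup>1\<^sup>/\<^sup>2\<close>.\<close>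

lemma cond_iii_if: assumes E: "A0_interpolates A" shows "cond_iii A q"
  unfolding cond_iii_def
proof (intro allI impI, elim conjE)
  fix b d assume b: "b \<in> B0 q" and inv: "cstar_invertible d" and pos: "cstar_positive d"
    and comm: "\<iota> d \<odot> q = q \<odot> \<iota> d" and le: "bidual_le UNIV (q \<odot> \<iota> (star b) \<odot> \<iota> b \<odot> q) (q \<odot> \<iota> d)"
  have d: "d \<in> B0 q" using comm by (simp add: mem_B0)
  have cd: "cpos d" using pos by (simp add: cstar_positive_iff_cpos)
  obtain s where s: "s \<in> B0 q" "cpos s" "s * s = d" using B.sqrt_S[OF cd d] .
  obtain e where e: "d * e = 1" "e * d = 1" using inv by (auto simp: cstar_invertible_def)
  have eB: "e \<in> B0 q" by (rule B0_inverse[OF d e])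
  have ss: "star s = s" by (rule cpos_selfadjoint[OF s(2)])
  have sd: "star d = d" by (rule cpos_selfadjoint[OF cd])
  have "star e = star e * (d * e)" using e by simp
  also have "\<dots> = star (d * e) * e" by (simp add: star_mult sd mult.assoc)
  finally have se: "star e = e" using e by simp
  have "e * s = e * s * (d * e)" using e by simp
  also have "\<dots> = e * (s * (s * s)) * e" by (simp add: mult.assoc flip: s(3))
  also have "\<dots> = (e * d) * s * e" by (simp add: mult.assoc flip: s(3))
  finally have es: "e * s = s * e" using e by simp
  \<comment> \<open>\<open>r\<close> is the inverse square root of \<open>d\<close>.\<close>
  define r where "r = s * e"
  have rB: "r \<in> B0 q" using s eB by (simp add: r_def B.mult_S)
  have sr: "star r = r" by (simp add: r_def star_mult ss se es)
  have sr1: "s * r = 1" using e by (simp add: r_def s(3) flip: mult.assoc)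
  have rs1: "r * s = 1"
  proof -
    have "r * s = s * (e * s)" by (simp add: r_def mult.assoc)
    then show ?thesis using sr1 by (simp add: es r_def)
  qed
  have rsx: "r * (s * x) = x" "s * (r * x) = x" for x using rs1 sr1 by (simp_all flip: mult.assoc)
  define X where "X = {x. x * s \<in> A0 A q}"
  have XA: "a * r \<in> X" if "a \<in> A0 A q" for a using that by (simp add: X_def mult.assoc rs1)
  have XB: "x \<in> B0 q" if "x \<in> X" for x
  proof -
    have "(x * s) * r \<in> B0 q" by (rule B.mult_S[OF A0_B0[of _ A] rB]) (use that in \<open>simp add: X_def\<close>)
    then show ?thesis by (simp add: mult.assoc sr1)
  qed
  obtain x where x: "x \<in> X" "norm x \<le> 1" "q \<odot> \<iota> x = q \<odot> \<iota> (b * r)"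
  proof (rule interpolation[of X "b * r"])
    show "0 \<in> X" by (simp add: X_def A0_simps)
    show "x + y \<in> X" if "x \<in> X" "y \<in> X" for x y using that by (simp add: X_def A0_simps distrib_right)
    show "c *\<^sub>C x \<in> X" if "x \<in> X" for c x using that by (simp add: X_def A0_simps mult_scaleC_left)
    show "X \<subseteq> B0 q" using XB by blast
    show "closed X" 
      using closed_vimage[OF closed_A0, of "\<lambda>x. x * s"] by (simp add: X_def vimage_def continuous_intros)
    show "b * r \<in> B0 q" by (intro B.mult_S b rB)
    fix \<phi> c assume \<phi>: "\<phi> \<in> dual UNIV" and z: "\<And>x. x \<in> X \<Longrightarrow> \<phi> x = 0" and c: "c \<in> B0 q"
    have "(q \<odot> \<iota> (c * s)) (U.rm r \<phi>) = 0"
    proof (rule A0_interpolatesD[OF E])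
      show "U.rm r \<phi> a = 0" if "a \<in> A0 A q" for a using z[OF XA[OF that]] by simp
    qed (use \<phi> c s in \<open>auto intro: B.mult_S\<close>)
    moreover have "(q \<odot> \<iota> (c * s)) (U.rm r \<phi>) = ((q \<odot> \<iota> (c * s)) \<odot> \<iota> r) \<phi>"
      using \<phi> by (simp add: U.arens_apply U.bact_canon)
    ultimately show "(q \<odot> \<iota> c) \<phi> = 0" by (simp flip: q_canon_mult add: mult.assoc sr1)
  next
    show "U.bbound 1 (q \<odot> \<iota> (b * r))" unfolding U.bbound_def
    proof (intro conjI ballI)
      fix \<phi> :: "'b functional" assume \<phi>: "\<phi> \<in> dual UNIV"
      \<comment> \<open>It remains to compare squares at a positive functional: the square of
        \<open>q b r\<close> is \<open>r H r\<close>, which by hypothesis is at most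
        \<open>r (q d) r = q\<close>.\<close>
      obtain \<psi> where \<psi>: "U.pos \<psi>" "Re (\<psi> 1) = dual_norm UNIV \<phi>"
        "(cmod ((q \<odot> \<iota> (b * r)) \<phi>))\<^sup>2 \<le> dual_norm UNIV \<phi> * Re (((q \<odot> \<iota> (b * r))\<^sup>\<star> \<odot> (q \<odot> \<iota> (b * r))) \<psi>)"
        using U.left_polar[OF \<phi>] U.arens_bidual[OF q_simps(1) U.canon_bidual[OF UNIV_I]] by metis
      define H where "H = q \<odot> \<iota> (star b) \<odot> \<iota> b \<odot> q"
      have H: "H \<in> bidual UNIV" by (simp add: H_def)
      define \<xi> where "\<xi> = U.sandwich (\<iota> r) \<psi>"
      have \<xi>: "U.pos \<xi>" unfolding \<xi>_def by (rule U.sandwich_pos[OF \<psi>(1)]) simp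
      have sw: "\<zeta> \<xi> = (\<iota> r \<odot> (\<zeta> \<odot> \<iota> r)) \<psi>" if "\<zeta> \<in> bidual UNIV" for \<zeta>
        unfolding \<xi>_def using that \<psi>(1) by (subst U.sandwich_apply) (simp_all add: U.bstar_canon sr)
      have qb: "q \<odot> \<iota> b = \<iota> b \<odot> q" using b by (simp add: mem_B0)
      have "(q \<odot> \<iota> (b * r))\<^sup>\<star> \<odot> (q \<odot> \<iota> (b * r)) = (\<iota> r \<odot> (\<iota> (star b) \<odot> q)) \<odot> (q \<odot> (\<iota> b \<odot> \<iota> r))"
        by (simp add: U.bstar_arens U.bstar_canon star_mult sr canon_mult U.arens_assoc)
      also have "\<dots> = \<iota> r \<odot> (\<iota> (star b) \<odot> ((q \<odot> \<iota> b) \<odot> \<iota> r))" by (simp add: U.arens_assoc)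
      also have "\<dots> = \<iota> r \<odot> ((\<iota> (star b) \<odot> q) \<odot> ((q \<odot> \<iota> b) \<odot> \<iota> r))" by (simp add: U.arens_assoc)
      also have "\<dots> = \<iota> r \<odot> (H \<odot> \<iota> r)"
        unfolding qb H_def using B.star_S[OF b] by (simp add: mem_B0 U.arens_assoc)
      finally have "((q \<odot> \<iota> (b * r))\<^sup>\<star> \<odot> (q \<odot> \<iota> (b * r))) \<psi> = H \<xi>" using sw[OF H] by simp
      moreover have "Re (H \<xi>) \<le> Re ((q \<odot> \<iota> d) \<xi>)"
      proof -
        obtain \<theta> where "\<theta> \<in> bidual UNIV" "(\<lambda>\<phi>. (q \<odot> \<iota> d) \<phi> - H \<phi>) = \<theta>\<^sup>\<star> \<odot> \<theta>"
          using le unfolding bidual_le_def bidual_positive_def H_def by blast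
        then show ?thesis using U.bstar_arens_pos(1)[OF \<xi>, of \<theta>] fun_cong[of _ _ \<xi>] by (metis diff_ge_0_iff_ge minus_complex.sel(1))
      qed
      moreover have "(q \<odot> \<iota> d) \<xi> = q \<psi>"
      proof -
        have "\<iota> r \<odot> ((q \<odot> \<iota> d) \<odot> \<iota> r) = (\<iota> r \<odot> q) \<odot> (\<iota> d \<odot> \<iota> r)" by (simp add: U.arens_assoc)
        also have "\<dots> = q \<odot> (\<iota> r \<odot> (\<iota> d \<odot> \<iota> r))" using rB by (simp add: mem_B0 U.arens_assoc)
        also have "\<iota> r \<odot> (\<iota> d \<odot> \<iota> r) = \<iota> (r * (d * r))" by (simp add: canon_mult)
        also have "r * (d * r) = 1" by (simp add: s(3)[symmetric] mult.assoc sr1 rs1)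
        finally show ?thesis using sw[of "q \<odot> \<iota> d"] by simp
      qed
      moreover have "Re (q \<psi>) \<le> dual_norm UNIV \<phi>"
        using U.effectD(3)[OF U.effect_projection[OF q_projection] \<psi>(1)] \<psi>(2) by simp
      ultimately have "Re (((q \<odot> \<iota> (b * r))\<^sup>\<star> \<odot> (q \<odot> \<iota> (b * r))) \<psi>) \<le> dual_norm UNIV \<phi>" by simp
      then have "(cmod ((q \<odot> \<iota> (b * r)) \<phi>))\<^sup>2 \<le> dual_norm UNIV \<phi> * dual_norm UNIV \<phi>"
        using \<psi>(3) mult_left_mono[OF _ U.dual_norm_nonneg[OF \<phi>]] order_trans by blast
      then have "(cmod ((q \<odot> \<iota> (b * r)) \<phi>))\<^sup>2 \<le> (1 * dual_norm UNIV \<phi>)\<^sup>2" by (simp add: power2_eq_square)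
      then show "cmod ((q \<odot> \<iota> (b * r)) \<phi>) \<le> 1 * dual_norm UNIV \<phi>"
        by (rule power2_le_imp_le) (use U.dual_norm_nonneg[OF \<phi>] in simp)
    qed simp
  qed
  define a where "a = x * s"
  have a: "a \<in> A0 A q" using x(1) by (simp add: a_def X_def)
  have "q \<odot> \<iota> a = q \<odot> \<iota> (b * r * s)" unfolding a_def by (subst (1 2) q_canon_mult) (simp add: x(3))
  then have qa: "q \<odot> \<iota> a = \<iota> b \<odot> q" using b by (simp add: mult.assoc rs1 mem_B0)
  have "cpos (1 *\<^sub>R 1 - star x * x)"
    by (rule cpos_norm_bound) (use x(2) in \<open>simp_all add: star_mult star_star cstar_identity power_le_one\<close>)
  from cpos_sqrt_commute[OF this] obtain w where w: "cpos w" "w * w = 1 - star x * x" unfolding scaleR_one by blast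
  have "d - star a * a = s * (1 - star x * x) * s"
    by (simp add: a_def star_mult ss s(3)[symmetric] algebra_simps)
  also have "\<dots> = star (w * s) * (w * s)"
    unfolding w(2)[symmetric] by (simp add: star_mult ss cpos_selfadjoint[OF w(1)] mult.assoc)
  finally have "cstar_le (star a * a) d" unfolding cstar_le_def cstar_positive_def by blast
  with a qa show "\<exists>a\<in>A. \<iota> a \<odot> q = q \<odot> \<iota> a \<and> q \<odot> \<iota> a = \<iota> b \<odot> q \<and> cstar_le (star a * a) d"
    by (intro bexI[of _ a]) (auto simp: A0_iff mem_B0)
qed

text \<open>Interpolating \<open>b\<close> below \<open>d = \<parallel>b\<parallel>\<^sup>2 (1 - e) + \<epsilon>\<close>, with \<open>e\<close> running through an approximate unit for
  the complement of \<open>q\<close>, makes the part of the interpolating element off \<open>q\<close> negligible.\<close>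

lemma A0_interpolates_if_cond_iii: assumes iii: "cond_iii A q" shows "A0_interpolates A"
  unfolding A0_interpolates_def
proof (intro ballI impI)
  fix \<phi> b assume \<phi>: "\<phi> \<in> dual UNIV" and z: "\<forall>a\<in>A0 A q. \<phi> a = 0" and b: "b \<in> B0 q"
  obtain F :: "'b filter" and x where F: "F \<noteq> bot" "\<And>i. x i \<in> J" "\<And>i. cpos (x i)" "\<And>i. norm (x i) \<le> 1"
    "\<And>\<phi>. \<phi> \<in> dual UNIV \<Longrightarrow> ((\<lambda>i. \<phi> (x i)) \<longlongrightarrow> qc \<phi>) F"
    using approximate_unit by metis
  obtain \<psi> where \<psi>: "U.pos \<psi>"
    "\<And>\<kappa>. \<kappa> \<in> bidual UNIV \<Longrightarrow> (cmod (\<kappa> \<phi>))\<^sup>2 \<le> dual_norm UNIV \<phi> * Re ((\<kappa>\<^sup>\<star> \<odot> \<kappa>) \<psi>)"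
    using U.left_polar[OF \<phi>] by metis
  define n where "n = dual_norm UNIV \<phi>"
  have n: "0 \<le> n" unfolding n_def by (rule U.dual_norm_nonneg[OF \<phi>])
  define N where "N = (norm b)\<^sup>2"
  have N: "0 \<le> N" by (simp add: N_def)
  define \<xi> where "\<xi> = U.sandwich qc \<psi>"
  have \<xi>: "U.pos \<xi>" unfolding \<xi>_def by (rule U.sandwich_pos[OF \<psi>(1)]) simp
  have sw: "\<zeta> \<xi> = (qc \<odot> (\<zeta> \<odot> qc)) \<psi>" if "\<zeta> \<in> bidual UNIV" for \<zeta>
    unfolding \<xi>_def using that \<psi>(1) by (subst U.sandwich_apply) simp_all
  \<comment> \<open>The compressed functional has all its mass off \<open>q\<close>, so the
    approximate unit exhausts it in the limit.\<close>
  have \<xi>1: "qc \<xi> = \<xi> 1"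
  proof -
    have "qc \<xi> = \<iota> 1 \<xi>" using sw[of qc] sw[of "\<iota> 1"] by simp
    then show ?thesis using \<xi> by simp
  qed
  define v where "v = (cmod ((q \<odot> \<iota> b) \<phi>))\<^sup>2"
  have est: "v \<le> n * (N * (Re (\<xi> 1) - Re (\<xi> (x i))) + e * Re (\<xi> 1))" if e: "0 < e" for i and e :: real
  proof -
    define d where "d = N *\<^sub>R (1 - x i) + e *\<^sub>R 1"
    have dB: "d \<in> B0 q" using J_B0[OF F(2)] by (simp add: d_def)
    have c1: "cpos (1 *\<^sub>R 1 - x i)" by (rule cpos_norm_bound[OF cpos_selfadjoint[OF F(3)] F(4)])
    have "cpos d" unfolding d_def using c1 e N by (intro cpos_add cpos_scaleR cpos_one) auto
    have "cstar_invertible d"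
    proof -
      have Ne: "N + e > 0" using N e by simp
      have "1 - (1 / (N + e)) *\<^sub>R d = (1 / (N + e)) *\<^sub>R ((N + e) *\<^sub>R 1 - d)"
        using Ne by (simp add: scaleR_diff_right)
      also have "(N + e) *\<^sub>R 1 - d = N *\<^sub>R x i" by (simp add: d_def algebra_simps)
      finally have "norm (1 - (1 / (N + e)) *\<^sub>R d) = N * norm (x i) / (N + e)" using Ne N by simp
      also have "\<dots> < 1" using mult_left_mono[OF F(4)[of i] N] e Ne by simp
      finally obtain y where "((1 / (N + e)) *\<^sub>R d) * y = 1" "y * ((1 / (N + e)) *\<^sub>R d) = 1"
        using cstar_invertible_near_one unfolding cstar_invertible_def by blast
      then show ?thesis unfolding cstar_invertible_def by (intro exI[of _ "(1 / (N + e)) *\<^sub>R y"]) simp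
    qed
    have "cpos (N *\<^sub>R 1 - star b * b)"
      by (rule cpos_norm_bound) (simp_all add: star_mult star_star cstar_identity N_def)
    then have "cpos (N *\<^sub>R 1 - star b * b + e *\<^sub>R 1)" using e by (intro cpos_add cpos_one) auto
    then obtain s where s: "s \<in> B0 q" "cpos s" "s * s = N *\<^sub>R 1 - star b * b + e *\<^sub>R 1"
      by (rule B.sqrt_S) (use b in simp)
    have "q \<odot> \<iota> d - q \<odot> \<iota> (star b) \<odot> \<iota> b \<odot> q = (\<iota> s \<odot> q)\<^sup>\<star> \<odot> (\<iota> s \<odot> q)"
    proof -
      have qb: "q \<odot> \<iota> (star b * b) = (q \<odot> \<iota> (star b) \<odot> \<iota> b) \<odot> q"
      proof -
        have "(q \<odot> \<iota> (star b) \<odot> \<iota> b) \<odot> q = q \<odot> (\<iota> (star b * b) \<odot> q)" by (simp add: canon_mult U.arens_assoc)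
        also have "\<iota> (star b * b) \<odot> q = q \<odot> \<iota> (star b * b)"
          using B.mult_S[OF B.star_S[OF b] b] by (simp add: mem_B0)
        finally show ?thesis by simp
      qed
      have "(\<iota> s \<odot> q)\<^sup>\<star> \<odot> (\<iota> s \<odot> q) = q \<odot> (\<iota> (s * s) \<odot> q)"
        by (simp add: U.bstar_arens U.bstar_canon cpos_selfadjoint[OF s(2)] canon_mult U.arens_assoc)
      also have "\<iota> (s * s) \<odot> q = q \<odot> \<iota> (s * s)" using B.mult_S[OF s(1) s(1)] by (simp add: mem_B0)
      also have "q \<odot> (q \<odot> \<iota> (s * s)) = q \<odot> \<iota> (s * s)" by simp
      also have "s * s = d + N *\<^sub>R x i - star b * b" by (simp add: s(3) d_def algebra_simps)
      also have "q \<odot> \<iota> (d + N *\<^sub>R x i - star b * b) = q \<odot> \<iota> d - q \<odot> \<iota> (star b * b)"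
        using F(2)[of i] by (simp add: canon_linear scaleR_scaleC U.arens_diff_right U.arens_add_right U.arens_scale_right J_def)
          (simp add: fun_eq_iff)
      finally show ?thesis unfolding qb by simp
    qed
    then have "bidual_le UNIV (q \<odot> \<iota> (star b) \<odot> \<iota> b \<odot> q) (q \<odot> \<iota> d)"
      unfolding bidual_le_def bidual_positive_def by (intro bexI[of _ "\<iota> s \<odot> q"]) (simp_all add: fun_diff_def)
    then obtain a where a: "a \<in> A" "\<iota> a \<odot> q = q \<odot> \<iota> a" "q \<odot> \<iota> a = \<iota> b \<odot> q" "cstar_le (star a * a) d"
      using iii b dB \<open>cpos d\<close> \<open>cstar_invertible d\<close> unfolding cond_iii_def cstar_positive_iff_cpos mem_B0 by blast
    have aB: "a \<in> B0 q" using a(2) by (simp add: mem_B0)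
    have "\<phi> a = 0" using z a(1) aB by (simp add: A0_iff)
    \<comment> \<open>Since \<phi> vanishes at \<open>a\<close>, its values at
      \<open>q a = q b\<close> and at \<open>qc a\<close> cancel. The square of the latter is
      bounded by \<xi> at \<open>star a * a\<close>, hence by \<xi> at \<open>d\<close>.\<close>
    then have "(q \<odot> \<iota> b) \<phi> = - (qc \<odot> \<iota> a) \<phi>"
      using b a(3) \<phi> by (simp add: mem_B0 qc_def U.arens_diff_left)
    then have "v \<le> n * Re (((qc \<odot> \<iota> a)\<^sup>\<star> \<odot> (qc \<odot> \<iota> a)) \<psi>)"
      using \<psi>(2)[of "qc \<odot> \<iota> a"] by (simp add: v_def n_def)
    also have "(qc \<odot> \<iota> a)\<^sup>\<star> \<odot> (qc \<odot> \<iota> a) = qc \<odot> (\<iota> (star a * a) \<odot> qc)"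
    proof -
      have "(qc \<odot> \<iota> a)\<^sup>\<star> = qc \<odot> \<iota> (star a)"
        using qc_commute[OF B.star_S[OF aB]] by (simp add: U.bstar_arens U.bstar_canon)
      moreover have "qc \<odot> \<iota> a = \<iota> a \<odot> qc" using qc_commute[OF aB] by simp
      ultimately show ?thesis by (simp add: canon_mult U.arens_assoc)
    qed
    also have "(qc \<odot> (\<iota> (star a * a) \<odot> qc)) \<psi> = \<xi> (star a * a)" using sw[of "\<iota> (star a * a)"] \<xi> by simp
    also have "n * Re (\<xi> (star a * a)) \<le> n * Re (\<xi> d)"
    proof (intro mult_left_mono n)
      have "0 \<le> Re (\<xi> (d - star a * a))"
        using a(4) by (intro U.pos_cpos[OF \<xi>]) (simp_all add: cstar_le_def cstar_positive_iff_cpos)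
      then show "Re (\<xi> (star a * a)) \<le> Re (\<xi> d)" using \<xi> by (simp add: U.dual_diff)
    qed
    also have "Re (\<xi> d) = N * (Re (\<xi> 1) - Re (\<xi> (x i))) + e * Re (\<xi> 1)"
      using \<xi> by (simp add: d_def U.dual_simps)
    finally show ?thesis .
  qed
  have "v \<le> 0"
  proof (rule le_if_le_plus_small)
    fix e :: real assume e: "0 < e"
    have "((\<lambda>i. n * (N * (Re (\<xi> 1) - Re (\<xi> (x i))) + e * Re (\<xi> 1))) \<longlongrightarrow> n * (N * (Re (\<xi> 1) - Re (qc \<xi>)) + e * Re (\<xi> 1))) F"
      using \<xi> by (intro tendsto_intros F(5)) simp
    then have "v \<le> n * (N * (Re (\<xi> 1) - Re (qc \<xi>)) + e * Re (\<xi> 1))"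
      by (rule tendsto_lowerbound[OF _ always_eventually F(1)]) (use est[OF e] in blast)
    then show "v \<le> 0 + e * (n * Re (\<xi> 1))" by (simp add: \<xi>1 mult.left_commute)
  qed
  then show "(q \<odot> \<iota> b) \<phi> = 0" by (simp add: v_def)
qed

section \<open>Projections in the weak* closure of the subalgebra\<close>

lemma arens_biannihilator:
  assumes "\<eta> \<in> biannihilator UNIV A" "\<theta> \<in> biannihilator UNIV A"
  shows "\<eta> \<odot> \<theta> \<in> biannihilator UNIV A"
proof -
  have \<eta>: "\<eta> \<in> bidual UNIV" "\<And>\<phi>. \<phi> \<in> dual UNIV \<Longrightarrow> (\<And>a. a \<in> A \<Longrightarrow> \<phi> a = 0) \<Longrightarrow> \<eta> \<phi> = 0"
    and \<theta>: "\<theta> \<in> bidual UNIV" "\<And>\<phi>. \<phi> \<in> dual UNIV \<Longrightarrow> (\<And>a. a \<in> A \<Longrightarrow> \<phi> a = 0) \<Longrightarrow> \<theta> \<phi> = 0"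
    using assms by (auto simp: biannihilator_def annihilator_def)
  have "(\<eta> \<odot> \<theta>) \<phi> = 0" if \<phi>: "\<phi> \<in> dual UNIV" and z: "\<And>a. a \<in> A \<Longrightarrow> \<phi> a = 0" for \<phi>
  proof -
    have "\<theta> (U.lm a \<phi>) = 0" if a: "a \<in> A" for a
      by (rule \<theta>(2)) (use \<phi> z A_simps(4)[OF a] in auto)
    then have "\<eta> (U.bact \<theta> \<phi>) = 0" using \<phi> \<theta>(1) by (intro \<eta>(2)) auto
    then show ?thesis by (simp add: U.arens_apply \<phi>)
  qed
  then show ?thesis using \<eta>(1) \<theta>(1) by (auto simp: biannihilator_def annihilator_def)
qed

lemma canon_biannihilator: "a \<in> A \<Longrightarrow> \<iota> a \<in> biannihilator UNIV A"
  by (auto simp: biannihilator_def annihilator_def)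

lemma qc_biannihilator: "q \<in> biannihilator UNIV A \<Longrightarrow> qc \<in> biannihilator UNIV A"
  using one_A by (auto simp: biannihilator_def annihilator_def qc_def)

text \<open>The compression of \<open>x\<close> to \<open>1 - q\<close> is in the weak* closure of \<open>A\<close>, close to \<open>x\<close>, and zero modulo \<open>J\<close>.\<close>

lemma approach_J:
  assumes qA: "q \<in> biannihilator UNIV A" and x: "x \<in> A" "dJ x < \<delta>"
  obtains y where "y \<in> A" "norm (y - x) < 3 * \<delta>" "dJ y < \<delta> / 2"
proof -
  have d: "\<delta> > 0" using x(2) infdist_nonneg[of x J] by (simp add: dJ_def)
  define z where "z = qc \<odot> (\<iota> x \<odot> qc)"
  have zA: "z \<in> biannihilator UNIV A"
    unfolding z_def by (intro arens_biannihilator qc_biannihilator qA canon_biannihilator x)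
  obtain j where j: "j \<in> J" "norm (x - j) < \<delta>" using dJ_near[OF x(2)] .
  show thesis
  \<comment> \<open>Two constraints suffice here, so the one for the norm fills two slots.\<close>
  proof (rule Helly_three_seminorms[of A norm norm dJ 1 z x "2 * \<delta>" x "2 * \<delta>" 0 0 "3 * \<delta>" "3 * \<delta>" "\<delta> / 2"])
    show "z \<in> bidual UNIV" by (simp add: z_def)
    show "z \<phi> = 0" if "\<phi> \<in> dual UNIV" "\<And>x. x \<in> A \<Longrightarrow> \<phi> x = 0" for \<phi>
      using zA that by (auto simp: biannihilator_def annihilator_def)
    have 1: "cmod (z \<phi> - \<phi> x) \<le> m * (2 * \<delta>)"
      if \<phi>: "\<phi> \<in> dual UNIV" and m: "0 \<le> m" "\<And>x. cmod (\<phi> x) \<le> m * norm x" for \<phi> :: "'b functional" and m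
    proof -
      \<comment> \<open>Compression fixes \<open>j\<close>, so \<open>z - x\<close> is the
        compression of \<open>x - j\<close> minus \<open>x - j\<close>, of norm at most 2
        \<delta>.\<close>
      have "z = \<iota> j + qc \<odot> (\<iota> (x - j) \<odot> qc)"
        using qc_J[OF j(1)] by (simp add: z_def canon_linear U.arens_diff_left U.arens_diff_right)
      then have "z \<phi> - \<phi> x = (qc \<odot> (\<iota> (x - j) \<odot> qc)) \<phi> - \<phi> (x - j)" using \<phi> by (simp add: U.dual_diff)
      moreover have "cmod ((qc \<odot> (\<iota> (x - j) \<odot> qc)) \<phi>) \<le> 1 * (norm (x - j) * 1) * m"
        by (rule U.bbound_le[OF U.bbound_arens[OF q_bbound(2) U.bbound_arens[OF U.bbound_canon[OF UNIV_I] q_bbound(2)]] \<phi> m(1)])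
          (use m(2) in simp_all)
      moreover have "cmod (\<phi> (x - j)) \<le> m * norm (x - j)" by (rule m)
      moreover have "m * norm (x - j) \<le> m * \<delta>" using j(2) m(1) by (intro mult_left_mono) auto
      ultimately have "cmod (z \<phi> - \<phi> x) \<le> m * \<delta> + m * \<delta>"
        using norm_triangle_ineq4[of "(qc \<odot> (\<iota> (x - j) \<odot> qc)) \<phi>" "\<phi> (x - j)"]
        by (simp only: mult_1_left mult_1_right mult.commute[of _ m])
      then show ?thesis by (simp only: mult_2 distrib_left)
    qed
    show "cmod (z \<phi> - \<phi> x) \<le> m * (2 * \<delta>)" "cmod (z \<phi> - \<phi> x) \<le> m * (2 * \<delta>)"
      if "\<phi> \<in> dual UNIV" "0 \<le> m" "\<And>x. cmod (\<phi> x) \<le> m * norm x" for \<phi> :: "'b functional" and m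
      by (rule 1[OF that])+
    fix \<phi> :: "'b functional" and m assume \<phi>: "\<phi> \<in> dual UNIV" and m: "0 \<le> m" "\<And>x. cmod (\<phi> x) \<le> m * dJ x"
    have "z \<phi> = 0" unfolding z_def by (rule qc_compress_vanish[OF \<phi> dJ_dominated[OF m(2)]])
    then show "cmod (z \<phi> - \<phi> 0) \<le> m * 0" by (simp add: U.dual_zero \<phi>)
  next
    fix y assume "y \<in> A" "norm (y - x) < 3 * \<delta>" "dJ (y - 0) < \<delta> / 2"
    then show thesis by (intro that) auto
  qed (use d dJ_le_norm dJ_seminorm complex_seminorm_norm A_simps in auto)
qed

text \<open>An element of \<open>A\<close> near \<open>J\<close> is near the intersection
  \<open>A \<inter> J\<close>, with a constant independent of the element: the steps of size 3
  \<delta> / 2^n add up to 6 \<delta>.\<close>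

lemma approach_J_limit:
  assumes qA: "q \<in> biannihilator UNIV A" and x: "x \<in> A" "dJ x < \<delta>"
  obtains y where "y \<in> A \<inter> J" "norm (y - x) \<le> 6 * \<delta>"
proof -
  define \<epsilon> where "\<epsilon> n = \<delta> / 2 ^ n" for n :: nat
  have \<epsilon>0: "\<epsilon> \<longlonglongrightarrow> 0"
    unfolding \<epsilon>_def using tendsto_mult[OF tendsto_const LIMSEQ_realpow_zero[of "1/2"], of \<delta>]
    by (simp add: power_divide)
  have "\<exists>f. \<forall>n. (f n \<in> A \<and> dJ (f n) < \<epsilon> n \<and> (n = 0 \<longrightarrow> f n = x)) \<and> norm (f (Suc n) - f n) < 3 * \<epsilon> n"
  proof (rule dependent_nat_choice)
    show "\<exists>y. y \<in> A \<and> dJ y < \<epsilon> 0 \<and> ((0::nat) = 0 \<longrightarrow> y = x)" using x by (intro exI[of _ x]) (simp add: \<epsilon>_def)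
    fix y and n :: nat assume y: "y \<in> A \<and> dJ y < \<epsilon> n \<and> (n = 0 \<longrightarrow> y = x)"
    then have "y \<in> A" "dJ y < \<epsilon> n" by auto
    then obtain w where "w \<in> A" "norm (w - y) < 3 * \<epsilon> n" "dJ w < \<epsilon> n / 2" using approach_J[OF qA] by metis
    then show "\<exists>w. (w \<in> A \<and> dJ w < \<epsilon> (Suc n) \<and> (Suc n = 0 \<longrightarrow> w = x)) \<and> norm (w - y) < 3 * \<epsilon> n"
      by (intro exI[of _ w]) (simp add: \<epsilon>_def)
  qed
  then obtain f where f: "\<And>n. f n \<in> A" "\<And>n. dJ (f n) < \<epsilon> n" "f 0 = x" "\<And>n. norm (f (Suc n) - f n) < 3 * \<epsilon> n" by blast
  have "norm (f (Suc n) - f n) \<le> (3 * \<delta>) / 2 ^ n" for n using f(4)[of n] by (simp add: \<epsilon>_def)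
  then obtain l where l: "f \<longlonglongrightarrow> l" "norm (l - f 0) \<le> 2 * (3 * \<delta>)" using geometric_increments_converge by metis
  have "(\<lambda>n. dJ (f n)) \<longlonglongrightarrow> dJ l" unfolding dJ_def by (intro tendsto_infdist l)
  then have "dJ l \<le> 0" by (rule LIMSEQ_le[OF _ \<epsilon>0]) (use f(2) less_imp_le in blast)
  then have "l \<in> J" using infdist_nonneg[of l J] dJ_eq_0 by (simp add: dJ_def)
  moreover have "l \<in> A" using closed_A f(1) l(1) closed_sequentially by blast
  ultimately show thesis using that l(2) f(3) by simp
qed

text \<open>\<open>qc\<close> lies in the weak* closures of \<open>A\<close> and of
  \<open>J\<close>, but this does not by itself place it in that of \<open>A \<inter> J\<close>.
  Helly's theorem provides an \<open>x\<close> in \<open>A\<close> that is close to \<open>J\<close>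
  and at which \<phi> is close to \<open>qc \<phi>\<close>; by \<open>approach_J_limit\<close> it
  can be moved into \<open>A \<inter> J\<close>, where \<phi> vanishes, at a cost proportional to
  its distance from \<open>J\<close>.\<close>

lemma A_J_vanish:
  assumes qA: "q \<in> biannihilator UNIV A" and \<phi>: "\<phi> \<in> dual UNIV" and 0: "\<And>a. a \<in> A \<inter> J \<Longrightarrow> \<phi> a = 0"
  shows "qc \<phi> = 0"
proof (rule ccontr)
  assume nz: "qc \<phi> \<noteq> 0"
  then have "\<phi> \<noteq> (\<lambda>_. 0)" using U.bidual_cmult[OF qc_simps(1) \<phi>, of 0] by auto
  then obtain u0 where u0: "\<phi> u0 \<noteq> 0" by auto
  define u where "u = (1 / \<phi> u0) *\<^sub>C u0"
  have u: "\<phi> u = 1" using u0 by (simp add: u_def U.dual_scaleC \<phi>)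
  \<comment> \<open>Any point at which \<phi> takes the value \<open>qc \<phi>\<close> serves as the
    centre for the seminorm given by \<phi>.\<close>
  define a where "a = qc \<phi> *\<^sub>C u"
  have a: "\<phi> a = qc \<phi>" by (simp add: a_def U.dual_scaleC \<phi> u)
  define n where "n = dual_norm UNIV \<phi>"
  have n: "0 \<le> n" unfolding n_def by (rule U.dual_norm_nonneg[OF \<phi>])
  have "cmod (qc \<phi>) \<le> 0"
  proof (rule le_if_le_plus_small)
    fix e :: real assume e: "0 < e"
    obtain x where x: "x \<in> A" "dJ (x - 0) < e" "cmod (\<phi> (x - a)) < e"
    proof (rule Helly_three_seminorms[of A dJ dJ "\<lambda>x. cmod (\<phi> x)" "max 1 n" qc 0 0 0 0 a 0 e e e])
      show "complex_seminorm (\<lambda>x. cmod (\<phi> x))"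
        using \<phi> by (auto simp: complex_seminorm_def U.dual_simps norm_mult norm_triangle_ineq)
      show "dJ x \<le> max 1 n * norm x" "dJ x \<le> max 1 n * norm x" for x
        using dJ_le_norm[of x] mult_right_mono[of 1 "max 1 n" "norm x"] by auto
      show "cmod (\<phi> x) \<le> max 1 n * norm x" for x
        using U.dual_norm_ge[OF \<phi>, of x] mult_right_mono[of n "max 1 n" "norm x"] by (simp add: n_def)
      show "qc \<xi> = 0" if "\<xi> \<in> dual UNIV" "\<And>x. x \<in> A \<Longrightarrow> \<xi> x = 0" for \<xi>
        using qc_biannihilator[OF qA] that by (auto simp: biannihilator_def annihilator_def)
      have 1: "cmod (qc \<xi> - \<xi> 0) \<le> m * 0"
        if \<xi>: "\<xi> \<in> dual UNIV" and m: "\<And>x. cmod (\<xi> x) \<le> m * dJ x" for \<xi> :: "'b functional" and m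
        using qc_vanish[OF \<xi> dJ_dominated[OF m]] by (simp add: U.dual_zero \<xi>)
      show "cmod (qc \<xi> - \<xi> 0) \<le> m * 0" "cmod (qc \<xi> - \<xi> 0) \<le> m * 0"
        if "\<xi> \<in> dual UNIV" "\<And>x. cmod (\<xi> x) \<le> m * dJ x" for \<xi> :: "'b functional" and m
        by (rule 1[OF that])+
      fix \<xi> :: "'b functional" and m assume \<xi>: "\<xi> \<in> dual UNIV" and m: "\<And>x. cmod (\<xi> x) \<le> m * cmod (\<phi> x)"
      \<comment> \<open>A functional dominated by the modulus of \<phi> vanishes on the kernel of
        \<phi> and is therefore a multiple of \<phi>.\<close>
      have "\<xi> = \<xi> u *\<^sub>\<phi> \<phi>"
      proof (rule U.dual_eqI)
        fix x
        have "\<phi> (x - \<phi> x *\<^sub>C u) = 0" by (simp add: U.dual_simps \<phi> u)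
        then have "\<xi> (x - \<phi> x *\<^sub>C u) = 0" using m[of "x - \<phi> x *\<^sub>C u"] by simp
        then show "\<xi> x = \<xi> u * \<phi> x" by (simp add: U.dual_simps \<xi> mult.commute)
      qed (use \<phi> \<xi> in simp_all)
      then have "qc \<xi> = \<xi> u * qc \<phi>" using U.bidual_cmult[OF qc_simps(1) \<phi>, of "\<xi> u"] by simp
      also have "\<dots> = \<xi> a" by (simp add: a_def U.dual_scaleC \<xi> mult.commute)
      finally show "cmod (qc \<xi> - \<xi> a) \<le> m * 0" by simp
    qed (use e dJ_seminorm A_simps in auto)
    obtain y where y: "y \<in> A \<inter> J" "norm (y - x) \<le> 6 * e" using approach_J_limit[OF qA x(1), of e] x(2) by auto
    have "cmod (\<phi> (y - x)) \<le> n * (6 * e)"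
      using U.dual_norm_ge[OF \<phi>, of "y - x"] mult_left_mono[OF y(2) n] by (simp add: n_def)
    then have "cmod (\<phi> x) \<le> n * (6 * e)" using 0[OF y(1)] by (simp add: U.dual_diff \<phi>)
    moreover have "cmod (qc \<phi>) \<le> cmod (\<phi> x) + cmod (\<phi> (x - a))"
      using norm_triangle_ineq4[of "\<phi> x" "\<phi> (x - a)"] by (simp add: U.dual_diff \<phi> a)
    ultimately show "cmod (qc \<phi>) \<le> 0 + e * (6 * n + 1)" using x(3) by (simp add: algebra_simps)
  qed
  with nz show False by simp
qed

lemma A_closed_iff: "A_closed A q \<longleftrightarrow> q \<in> biannihilator UNIV A"
proof
  assume qA: "q \<in> biannihilator UNIV A"
  have ex: "\<exists>x. x \<in> A \<inter> J \<and> (\<forall>\<phi>\<in>F. \<phi> x = qc \<phi>)" if "finite F" "F \<subseteq> dual UNIV" for F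
    using finite_interpolation[OF that qc_simps(1), of "A \<inter> J"] A_J_vanish[OF qA]
    by (auto simp: A_simps J_zero J_add J_scaleC)
  then obtain x where x: "\<And>F. finite F \<Longrightarrow> F \<subseteq> dual UNIV \<Longrightarrow> x F \<in> A \<inter> J \<and> (\<forall>\<phi>\<in>F. \<phi> (x F) = qc \<phi>)" by metis
  \<comment> \<open>The net is indexed by finite sets of functionals, at which \<open>x\<close>
    takes exactly the values of \<open>qc\<close>; the numerical component of the index is
    constant.\<close>
  define I :: "('b functional set \<times> nat) set" where "I = {F. finite F \<and> F \<subseteq> dual UNIV} \<times> {0}"
  define r :: "'b functional set \<times> nat \<Rightarrow> 'b functional set \<times> nat \<Rightarrow> bool" where "r i k \<longleftrightarrow> fst i \<subseteq> fst k" for i k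
  have dir: "directed_index I r" unfolding directed_index_def
  proof (intro conjI ballI)
    show "I \<noteq> {}" by (auto simp: I_def)
    show "reflp_on I r" "transp_on I r" by (auto simp: r_def reflp_on_def transp_on_def)
    fix i k assume "i \<in> I" "k \<in> I"
    then show "\<exists>l\<in>I. r i l \<and> r k l" by (intro bexI[of _ "(fst i \<union> fst k, 0)"]) (auto simp: I_def r_def)
  qed
  have "weakstar_limit I r (\<lambda>i. x (fst i)) qc" unfolding weakstar_limit_def
  proof (intro ballI tendsto_eventually)
    fix \<phi> :: "'b functional" assume \<phi>: "\<phi> \<in> dual UNIV"
    show "eventually (\<lambda>i. \<phi> (x (fst i)) = qc \<phi>) (net_filter I r)"
      unfolding eventually_net_filter[OF dir]
    proof (intro bexI[of _ "({\<phi>}, 0)"] ballI impI)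
      fix k assume "k \<in> I" "r ({\<phi>}, 0) k"
      then show "\<phi> (x (fst k)) = qc \<phi>" using x[of "fst k"] by (auto simp: I_def r_def)
    qed (use \<phi> in \<open>simp add: I_def\<close>)
  qed
  moreover have "x (fst i) \<in> A \<and> (\<exists>\<eta>\<in>biannihilator UNIV A. \<iota> (x (fst i)) = (qc \<odot> \<eta>) \<odot> qc)" if "i \<in> I" for i
  proof -
    have "x (fst i) \<in> A \<inter> J" using x that by (auto simp: I_def)
    then show ?thesis using canon_biannihilator qc_J by (intro conjI bexI[of _ "\<iota> (x (fst i))"]) auto
  qed
  ultimately have "A_open A qc"
    unfolding A_open_def
    by (intro conjI qc_projection qc_biannihilator[OF qA] exI[of _ I] exI[of _ r] exI[of _ "\<lambda>i. x (fst i)"] dir) blast+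
  then show "A_closed A q"
    using qA q_projection by (simp add: A_closed_def qc_def fun_diff_def)
qed (simp add: A_closed_def)

lemma p_projection_iff: "p_projection A q \<longleftrightarrow> q \<in> biannihilator UNIV A"
  by (simp add: p_projection_def closed_q)

text \<open>A functional vanishing on \<open>A\<close> vanishes on \<open>A0 A q\<close>, and
  \<open>E\<close> is used with \<open>b = 1\<close>.\<close>

lemma p_projection_if: assumes E: "A0_interpolates A" shows "p_projection A q"
proof -
  have "q \<phi> = 0" if \<phi>: "\<phi> \<in> dual UNIV" "\<And>a. a \<in> A \<Longrightarrow> \<phi> a = 0" for \<phi>
    using A0_interpolatesD[OF E \<phi>(1) _ B.one_S] \<phi>(2) by (simp add: A0_iff)
  then show ?thesis unfolding p_projection_iff by (auto simp: biannihilator_def annihilator_def)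
qed

text \<open>Both 1 and \<open>A \<inter> J\<close> lie in \<open>A0 A q\<close>, which gives
  \<open>E\<close> for \<open>b = 1\<close>. For general \<open>b\<close> write
  \<open>q b = q a\<close> with \<open>a\<close> in \<open>A0 A q\<close>: as this is an algebra,
  \<open>\<phi> (\<cdot> a)\<close> vanishes on it together with \<phi>, and \<open>q b\<close> at
  \<phi> is \<open>q\<close> at \<open>\<phi> (\<cdot> a)\<close>.\<close>

lemma A0_interpolates_if_cond_v:
  assumes p: "p_projection A q" and v: "cond_v A q"
  shows "A0_interpolates A"
proof -
  have qA: "q \<in> biannihilator UNIV A" using p by (simp add: p_projection_iff)
  have q0: "q \<phi> = 0" if \<phi>: "\<phi> \<in> dual UNIV" and z: "\<And>a. a \<in> A0 A q \<Longrightarrow> \<phi> a = 0" for \<phi>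
  proof -
    have "qc \<phi> = 0" by (rule A_J_vanish[OF qA \<phi>]) (use z J_B0 in \<open>auto simp: A0_iff\<close>)
    then show ?thesis using q_plus_qc[OF \<phi>] z[OF A0_simps(2)] by simp
  qed
  show ?thesis unfolding A0_interpolates_def
  proof (intro ballI impI)
    fix \<phi> b assume \<phi>: "\<phi> \<in> dual UNIV" and z: "\<forall>a\<in>A0 A q. \<phi> a = 0" and b: "b \<in> B0 q"
    obtain a where a: "a \<in> A0 A q" "q \<odot> \<iota> b = q \<odot> \<iota> a" using v b unfolding cond_v_def by blast
    have "q (U.rm a \<phi>) = 0" by (rule q0) (use \<phi> z A0_simps(5)[OF _ a(1)] in auto)
    then show "(q \<odot> \<iota> b) \<phi> = 0" using a(2) \<phi> by (simp add: U.arens_apply U.bact_canon)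
  qed
qed

text \<open>Differences of successive approximations in \<open>q A0\<close> have norm at most 1 /
  2^n + 1 / 2^(n + 1) and are lifted by \<open>lift\<close> without increasing the bound 2 / 2^n.
  The partial sums of the lifts converge in the closed set \<open>A0 A q\<close>, and multiplication
  by \<open>q\<close> carries their limit to \<eta>.\<close>

lemma closed_quotient:
  assumes E: "A0_interpolates A" and \<eta>: "\<eta> \<in> bidual UNIV"
    and \<zeta>: "\<And>n::nat. \<zeta> n \<in> {q \<odot> \<iota> a |a. a \<in> A0 A q}" "(\<lambda>n. bidual_norm UNIV (\<zeta> n - \<eta>)) \<longlonglongrightarrow> 0"
  shows "\<eta> \<in> {q \<odot> \<iota> a |a. a \<in> A0 A q}"
proof -
  define D where "D a = bidual_norm UNIV (q \<odot> \<iota> a - \<eta>)" for a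
  have D: "cmod ((q \<odot> \<iota> a) \<phi> - \<eta> \<phi>) \<le> D a * dual_norm UNIV \<phi>" if "\<phi> \<in> dual UNIV" for a \<phi>
    using U.bidual_norm_ge[OF _ that, of "q \<odot> \<iota> a - \<eta>"] \<eta> by (simp add: D_def)
  have near: "\<exists>a\<in>A0 A q. D a < e" if "0 < e" for e
  proof -
    have "eventually (\<lambda>n. bidual_norm UNIV (\<zeta> n - \<eta>) < e) sequentially"
      by (rule order_tendstoD(2)[OF \<zeta>(2) that])
    then obtain n where n: "bidual_norm UNIV (\<zeta> n - \<eta>) < e" by (auto simp: eventually_sequentially)
    moreover obtain a where "a \<in> A0 A q" "\<zeta> n = q \<odot> \<iota> a" using \<zeta>(1)[of n] by blast
    ultimately show ?thesis unfolding D_def by auto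
  qed
  have "\<exists>f. \<forall>n. (f n \<in> A0 A q \<and> D (f n) < 1 / 2 ^ n) \<and> norm (f (Suc n) - f n) \<le> 2 / 2 ^ n"
  proof (rule dependent_nat_choice)
    show "\<exists>a. a \<in> A0 A q \<and> D a < 1 / 2 ^ 0" using near[of 1] by auto
    fix a n assume a: "a \<in> A0 A q \<and> D a < 1 / 2 ^ n"
    obtain c where c: "c \<in> A0 A q" "D c < 1 / 2 ^ Suc n" using near[of "1 / 2 ^ Suc n"] by auto
    have bb: "U.bbound (2 / 2 ^ n) (q \<odot> \<iota> (c - a))" unfolding U.bbound_def
    proof (intro conjI ballI)
      fix \<phi> :: "'b functional" assume \<phi>: "\<phi> \<in> dual UNIV"
      have "(q \<odot> \<iota> (c - a)) \<phi> = ((q \<odot> \<iota> c) \<phi> - \<eta> \<phi>) - ((q \<odot> \<iota> a) \<phi> - \<eta> \<phi>)"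
        by (simp add: canon_linear U.arens_diff_right)
      also have "cmod \<dots> \<le> D c * dual_norm UNIV \<phi> + D a * dual_norm UNIV \<phi>"
        by (rule order_trans[OF norm_triangle_ineq4 add_mono[OF D[OF \<phi>] D[OF \<phi>]]])
      also have "\<dots> = (D c + D a) * dual_norm UNIV \<phi>" by (simp add: distrib_right)
      also have "\<dots> \<le> (2 / 2 ^ n) * dual_norm UNIV \<phi>"
      proof (intro mult_right_mono U.dual_norm_nonneg \<phi>)
        have "1 / 2 ^ Suc n \<le> 1 / (2 ^ n :: real)" by (simp add: field_simps)
        then show "D c + D a \<le> 2 / 2 ^ n" using a c(2) by simp
      qed
      finally show "cmod ((q \<odot> \<iota> (c - a)) \<phi>) \<le> (2 / 2 ^ n) * dual_norm UNIV \<phi>" .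
    qed simp
    have "c - a \<in> B0 q" using A0_B0[OF c(1)] A0_B0[of a A] a by (intro B.diff_S) simp_all
    then obtain y where y: "y \<in> A0 A q" "norm y \<le> 2 / 2 ^ n" "q \<odot> \<iota> y = q \<odot> \<iota> (c - a)"
      using lift[OF E _ bb] by auto
    have "q \<odot> \<iota> (a + y) = q \<odot> \<iota> c" using y(3) by (simp add: canon_linear U.arens_diff_right U.arens_add_right)
    then have "D (a + y) < 1 / 2 ^ Suc n" using c(2) by (simp add: D_def)
    then show "\<exists>w. (w \<in> A0 A q \<and> D w < 1 / 2 ^ Suc n) \<and> norm (w - a) \<le> 2 / 2 ^ n"
      using a y by (intro exI[of _ "a + y"]) (simp add: A0_simps)
  qed
  then obtain f where f: "\<And>n. f n \<in> A0 A q" "\<And>n. D (f n) < 1 / 2 ^ n" "\<And>n. norm (f (Suc n) - f n) \<le> 2 / 2 ^ n" by blast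
  obtain l where l: "f \<longlonglongrightarrow> l" using geometric_increments_converge[OF f(3)] .
  have "\<eta> = q \<odot> \<iota> l"
  proof (rule U.bidual_eqI[OF \<eta>])
    fix \<phi> :: "'b functional" assume \<phi>: "\<phi> \<in> dual UNIV"
    have "(\<lambda>n. (1 / 2) ^ n * dual_norm UNIV \<phi>) \<longlonglongrightarrow> 0 * dual_norm UNIV \<phi>"
      by (intro tendsto_intros LIMSEQ_realpow_zero) auto
    then have z: "(\<lambda>n. (1 / 2) ^ n * dual_norm UNIV \<phi>) \<longlonglongrightarrow> 0" by simp
    have "(\<lambda>n. (q \<odot> \<iota> (f n)) \<phi> - \<eta> \<phi>) \<longlonglongrightarrow> 0"
    proof (rule Lim_null_comparison[OF always_eventually z], rule allI)
      fix n
      have "D (f n) * dual_norm UNIV \<phi> \<le> (1 / 2) ^ n * dual_norm UNIV \<phi>"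
        using f(2)[of n] by (intro mult_right_mono U.dual_norm_nonneg \<phi>) (simp add: power_divide)
      then show "norm ((q \<odot> \<iota> (f n)) \<phi> - \<eta> \<phi>) \<le> (1 / 2) ^ n * dual_norm UNIV \<phi>" using D[OF \<phi>, of "f n"] by simp
    qed
    then have "(\<lambda>n. U.lact q \<phi> (f n)) \<longlonglongrightarrow> \<eta> \<phi>" unfolding canon_q_apply[OF \<phi>] by (simp add: LIM_zero_iff)
    moreover have "(\<lambda>n. U.lact q \<phi> (f n)) \<longlonglongrightarrow> U.lact q \<phi> l"
      by (rule U.dual_tendsto[OF U.lact_dual[OF q_simps(1) \<phi>] _ _ l]) simp_all
    ultimately have "\<eta> \<phi> = U.lact q \<phi> l" by (rule LIMSEQ_unique)
    then show "\<eta> \<phi> = (q \<odot> \<iota> l) \<phi>" unfolding canon_q_apply[OF \<phi>] .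
  qed simp
  moreover have "l \<in> A0 A q" using closed_A0 f(1) l closed_sequentially by blast
  ultimately show ?thesis by blast
qed

lemma quotient_cstar_subalgebra:
  assumes E: "A0_interpolates A"
  shows "bidual_cstar_subalgebra {q \<odot> \<iota> a |a. a \<in> A0 A q}"
proof -
  define Z where "Z = {q \<odot> \<iota> a |a. a \<in> A0 A q}"
  have Z: "Z = {q \<odot> \<iota> b |b. b \<in> B0 q}"
    using cond_v_if[OF cond_vi_if[OF E]] by (simp add: Z_def cond_v_def)
  have I: "q \<odot> \<iota> b \<in> Z" if "b \<in> B0 q" for b unfolding Z using that by blast
  have cases: thesis if "\<eta> \<in> Z" "\<And>b. b \<in> B0 q \<Longrightarrow> \<eta> = q \<odot> \<iota> b \<Longrightarrow> thesis" for \<eta> thesis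
    using that unfolding Z by blast
  have "bidual_cstar_subalgebra Z" unfolding bidual_cstar_subalgebra_def
  proof (intro conjI ballI allI impI)
    show "Z \<subseteq> bidual UNIV" by (auto simp: Z)
    have "q \<odot> \<iota> 0 = 0" by (simp add: canon_linear U.arens_zero_right)
    then show "(\<lambda>_. 0) \<in> Z" using I[OF B.zero_S] by (simp only: zero_fun_def)
    fix \<eta> assume "\<eta> \<in> Z"
    then obtain b where b: "b \<in> B0 q" "\<eta> = q \<odot> \<iota> b" by (rule cases)
    show "(\<lambda>\<phi>. c * \<eta> \<phi>) \<in> Z" for c
      using I[OF B.scaleC_S[OF b(1), of c]] by (simp only: b(2) q_canon_scale)
    show "\<eta>\<^sup>\<star> \<in> Z"
      using I[OF B.star_S[OF b(1)]] B.star_S[OF b(1)] by (simp add: b(2) U.bstar_arens U.bstar_canon mem_B0)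
    fix \<theta> assume "\<theta> \<in> Z"
    then obtain c where c: "c \<in> B0 q" "\<theta> = q \<odot> \<iota> c" by (rule cases)
    have "q \<odot> \<iota> (b + c) = (\<lambda>\<phi>. \<eta> \<phi> + \<theta> \<phi>)"
      by (simp add: b(2) c(2) canon_linear U.arens_add_right fun_eq_iff)
    then show "(\<lambda>\<phi>. \<eta> \<phi> + \<theta> \<phi>) \<in> Z" using I[OF B.add_S[OF b(1) c(1)]] by simp
    have "\<eta> \<odot> \<theta> = q \<odot> ((\<iota> b \<odot> q) \<odot> \<iota> c)" by (simp add: b(2) c(2) U.arens_assoc)
    also have "\<dots> = q \<odot> \<iota> (b * c)" using b(1) by (simp add: mem_B0 U.arens_assoc canon_mult)
    finally show "\<eta> \<odot> \<theta> \<in> Z" using I[OF B.mult_S[OF b(1) c(1)]] by simp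
  next
    fix \<zeta> \<eta> assume "(\<forall>n::nat. \<zeta> n \<in> Z) \<and> \<eta> \<in> bidual UNIV \<and> (\<lambda>n. bidual_norm UNIV (\<lambda>\<phi>. \<zeta> n \<phi> - \<eta> \<phi>)) \<longlonglongrightarrow> 0"
    then show "\<eta> \<in> Z" using closed_quotient[OF E, of \<eta> \<zeta>] by (simp add: Z_def fun_diff_def)
  qed
  then show ?thesis by (simp add: Z_def)
qed

end

theorem theorem2p2:
  fixes A :: "'b::unital_cstar_algebra set" and q :: "'b bifunctional"
  assumes "closed A" and "complex_subalgebra A" and "1 \<in> A"
    and "closed_projection q"
  shows "(cond_i A q \<longleftrightarrow> cond_ii A q) \<and> (cond_ii A q \<longleftrightarrow> cond_ii' A q) \<and>
         (cond_i A q \<longleftrightarrow> cond_iii A q) \<and> (cond_i A q \<longleftrightarrow> cond_iv A q) \<and>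
         (p_projection A q \<longleftrightarrow> q \<in> biannihilator UNIV A) \<and>
         (p_projection A q \<longleftrightarrow> A_closed A q) \<and>
         (cond_i A q \<longrightarrow>
            p_projection A q \<and>
            bidual_cstar_subalgebra {q \<odot> \<iota> a | a. a \<in> A0 A q} \<and>
            cond_v A q \<and> cond_vi A q) \<and>
         (cond_vi A q \<longrightarrow> cond_v A q) \<and>
         (p_projection A q \<longrightarrow>
            (cond_i A q \<longleftrightarrow> cond_v A q) \<and> (cond_i A q \<longleftrightarrow> cond_vi A q))"
proof -
  interpret closed_proj_subalgebra q A
    by standard (fact assms)+
  have i: "cond_i A q \<longleftrightarrow> A0_interpolates A" by (simp add: cond_i_iff cond_ii_iff)
  have iii: "A0_interpolates A \<longleftrightarrow> cond_iii A q" using cond_iii_if A0_interpolates_if_cond_iii by blast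
  have iv: "A0_interpolates A \<longleftrightarrow> cond_iv A q" by (simp add: cond_iv_iff cond_ii_iff)
  show ?thesis
    using i iii iv cond_i_iff cond_ii'_iff p_projection_iff A_closed_iff p_projection_if quotient_cstar_subalgebra
      cond_vi_if cond_v_if A0_interpolates_if_cond_v by blast
qed

end
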